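(* Let $\theta,\theta_0\in\Theta$ and assume that the functions $$y\mapsto \frac{q^{\theta}_{ij}(y)}{q^{\theta_0}_{ij}(y)},\qquad y\mapsto \frac{q^{\theta_0}_{ij}(y)}{q^{\theta}_{ij}(y)}$$ are bounded on $\mathbb{R}^d$ for each $(i,j)$, where $0/0=1$. Then $P^\theta$ is equivalent to $P^{\theta_0}$, and the log likelihood $$L_T(\theta,\theta_0):=\log\frac{\mathrm{d}P^\theta}{\mathrm{d}P^{\theta_0}}(\{Z_t\}_{t\in[0,T]})$$ is given by $$\begin{aligned} L_T(\theta,\theta_0)=&\ \sum_{i\neq j}\left\{\int_0^T\log\frac{q^\theta_{ji}(Y_t)}{q^{\theta_0}_{ji}(Y_t)}\,\mathrm{d}N^{ji}_t-\int_0^T\bigl(q^\theta_{ji}(Y_t)-q^{\theta_0}_{ji}(Y_t)\bigr)\langle X_t,e_i\rangle\,\mathrm{d}t\right\}\\ &+\frac{1}{\epsilon^2}\int_0^T\langle\mu^\theta(Z_t)-\mu^{\theta_0}(Z_t),\mathrm{d}Y_t\rangle-\frac{1}{2\epsilon^2}\int_0^T\bigl(|\mu^\theta(Z_t)|^2-|\mu^{\theta_0}(Z_t)|^2\bigr)\mathrm{d}t,\end{aligned}$$ where $N^{ji}$ is the counting process of the transitions from $e_i$ to $e_j$: $$N^{ji}_t=\int_0^t\langle X_{s-},e_i\rangle\langle e_j,\mathrm{d}X_s\rangle .$$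
   Context: Fix integers $k,d\ge1$, a horizon $T>0$ and a known constant $\epsilon>0$. Let $e_1,\dots,e_k$ be the standard basis of $\mathbb{R}^k$, $\langle\cdot,\cdot\rangle$ the Euclidean inner product (of $\mathbb{R}^k$ or $\mathbb{R}^d$), and $S=\{e_1,\dots,e_k\}\times\mathbb{R}^d$. $D([0,T];S)$ is the space of càdlàg paths in $S$ and $Z=(X,Y)$ is the canonical process on it, $X$ being the discrete part and $Y$ the continuous part. $\Theta$ is a parameter set. For each $\theta\in\Theta$, $\mu^\theta:S\to\mathbb{R}^d$ is a bounded Borel function and $Q^\theta=[q^\theta_{ij}]$ is a bounded continuous function on $\mathbb{R}^d$ whose values are $k\times k$ Q-matrices, with the convention that $q^\theta_{ji}$ is the rate from $e_i$ to $e_j$: $q^\theta_{ji}(y)\ge0$ for $j\ne i$ and $\sum_{j\ne i}q^\theta_{ji}(y)=-q^\theta_{ii}(y)$ for all $y$. Put $$\mathcal{L}^\theta f(e_i,y)=\langle\mu^\theta,\nabla_yf\rangle(e_i,y)+\tfrac12\epsilon^2\Delta_yf(e_i,y)+\sum_{j=1}^k(f(e_j,y)-f(e_i,y))\langle e_j,Q^\theta(y)e_i\rangle.$$ $P^\theta$ is the law on $D([0,T];S)$ of the Markov process with generator $\mathcal{L}^\theta$, i.e. the unique probability measure under which $Z_0$ has the prescribed initial distribution and $f(Z_t)-\int_0^t\mathcal{L}^\theta f(Z_s)\,\mathrm{d}s$ is a martingale for every $f$ such that each $f(e_i,\cdot)$ is $C^\infty$ with compact support (existence and uniqueness hold under the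 stated boundedness and continuity conditions). The initial distribution $P^\theta\circ Z_0^{-1}$ is assumed known and not to depend on $\theta$. *)

theory Defs
  imports "HOL-Probability.Probability"
begin

section \<open>Path space\<close>

text \<open>The state space is realised inside \<^typ>\<open>(real^'k) \<times> (real^'d)\<close>, its discrete coordinate
  ranging over the standard basis vectors \<^term>\<open>axis i 1\<close>.\<close>

definition state_space :: "((real^'k) \<times> (real^'d)) set" where
  "state_space = range (\<lambda>i. axis i 1) \<times> UNIV"

text \<open>Paths are functions on the closed interval from 0 to \<open>T\<close>, set to \<^const>\<open>undefined\<close> elsewhere.
  As the state space is closed, left limits are automatically in it.\<close>

definition cadlag_paths :: "real \<Rightarrow> (real \<Rightarrow> (real^'k) \<times> (real^'d)) set" where
  "cadlag_paths T = {\<omega> \<in> extensional {0..T}.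
     (\<forall>t\<in>{0..T}. \<omega> t \<in> state_space) \<and>
     (\<forall>t\<in>{0..<T}. (\<omega> \<longlongrightarrow> \<omega> t) (at_right t)) \<and>
     (\<forall>t\<in>{0<..T}. \<exists>l. (\<omega> \<longlongrightarrow> l) (at_left t))}"

text \<open>The sigma-algebra generated by the coordinate maps is the Borel sigma-algebra of the Skorokhod
  topology. Only the sigma-algebras of \<open>path_space\<close> and \<open>canonical_filtration\<close> matter, not their
  measures.\<close>

definition path_space :: "real \<Rightarrow> (real \<Rightarrow> (real^'k) \<times> (real^'d)) measure" where
  "path_space T = restrict_space (\<Pi>\<^sub>M t\<in>{0..T}. borel) (cadlag_paths T)"

definition canonical_filtration ::
  "real \<Rightarrow> real \<Rightarrow> (real \<Rightarrow> (real^'k) \<times> (real^'d)) measure" where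
  "canonical_filtration T t =
     sigma (cadlag_paths T)
       (\<Union>s\<in>{0..t}. {(\<lambda>\<omega>. \<omega> s) -` B \<inter> cadlag_paths T | B. B \<in> sets borel})"


section \<open>The martingale problem\<close>

definition martingale_on ::
  "'w measure \<Rightarrow> (real \<Rightarrow> 'w measure) \<Rightarrow> real \<Rightarrow> (real \<Rightarrow> 'w \<Rightarrow> real) \<Rightarrow> bool" where
  "martingale_on P F T M \<longleftrightarrow>
     (\<forall>t\<in>{0..T}. M t \<in> borel_measurable (F t) \<and> integrable P (M t)) \<and>
     (\<forall>s t. 0 \<le> s \<and> s \<le> t \<and> t \<le> T \<longrightarrow>
        (AE \<omega> in P. real_cond_exp P (F s) (M t) \<omega> = M s \<omega>))"

definition partial_deriv :: "'a \<Rightarrow> ('a::euclidean_space \<Rightarrow> real) \<Rightarrow> 'a \<Rightarrow> real" where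
  "partial_deriv b f y = frechet_derivative f (at y) b"

definition gradient :: "('a::euclidean_space \<Rightarrow> real) \<Rightarrow> 'a \<Rightarrow> 'a" where
  "gradient f y = (\<Sum>b\<in>Basis. partial_deriv b f y *\<^sub>R b)"

definition laplacian :: "('a::euclidean_space \<Rightarrow> real) \<Rightarrow> 'a \<Rightarrow> real" where
  "laplacian f y = (\<Sum>b\<in>Basis. partial_deriv b (partial_deriv b f) y)"

fun C_k :: "nat \<Rightarrow> ('a::euclidean_space \<Rightarrow> real) \<Rightarrow> bool" where
  "C_k 0 f \<longleftrightarrow> continuous_on UNIV f"
| "C_k (Suc n) f \<longleftrightarrow> (\<forall>y. f differentiable (at y)) \<and> (\<forall>b\<in>Basis. C_k n (partial_deriv b f))"

definition test_function :: "((real^'k) \<times> (real^'d) \<Rightarrow> real) \<Rightarrow> bool" where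
  "test_function f \<longleftrightarrow>
     (\<forall>i. (\<forall>n. C_k n (\<lambda>y. f (axis i 1, y))) \<and> compact (closure {y. f (axis i 1, y) \<noteq> 0}))"

text \<open>In row-column notation the entry \<open>Q y $ j $ i\<close> is the rate from state \<open>i\<close> to state \<open>j\<close>,
  so that the columns of a Q-matrix sum to zero.\<close>

definition Q_matrix :: "real^'k^'k \<Rightarrow> bool" where
  "Q_matrix A \<longleftrightarrow>
     (\<forall>i j. j \<noteq> i \<longrightarrow> 0 \<le> A $ j $ i) \<and> (\<forall>i. (\<Sum>j\<in>UNIV - {i}. A $ j $ i) = - (A $ i $ i))"

definition generator ::
  "real \<Rightarrow> ((real^'k) \<times> (real^'d) \<Rightarrow> real^'d) \<Rightarrow> (real^'d \<Rightarrow> real^'k^'k) \<Rightarrow>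
   ((real^'k) \<times> (real^'d) \<Rightarrow> real) \<Rightarrow> (real^'k) \<times> (real^'d) \<Rightarrow> real" where
  "generator \<epsilon> \<mu> Q f = (\<lambda>(x, y).
     \<mu> (x, y) \<bullet> gradient (\<lambda>y'. f (x, y')) y
     + 1 / 2 * \<epsilon>\<^sup>2 * laplacian (\<lambda>y'. f (x, y')) y
     + (\<Sum>j\<in>UNIV. (f (axis j 1, y) - f (x, y)) * (axis j 1 \<bullet> (Q y *v x))))"

definition solves_martingale_problem ::
  "real \<Rightarrow> real \<Rightarrow> ((real^'k) \<times> (real^'d)) measure \<Rightarrow>
   ((real^'k) \<times> (real^'d) \<Rightarrow> real^'d) \<Rightarrow> (real^'d \<Rightarrow> real^'k^'k) \<Rightarrow>
   (real \<Rightarrow> (real^'k) \<times> (real^'d)) measure \<Rightarrow> bool" where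
  "solves_martingale_problem T \<epsilon> \<nu> \<mu> Q P \<longleftrightarrow>
     prob_space P \<and> sets P = sets (path_space T) \<and>
     distr P borel (\<lambda>\<omega>. \<omega> 0) = \<nu> \<and>
     (\<forall>f. test_function f \<longrightarrow>
        martingale_on P (canonical_filtration T) T
          (\<lambda>t \<omega>. f (\<omega> t) - (LBINT s:{0..t}. generator \<epsilon> \<mu> Q f (\<omega> s))))"

definition law_with_generator ::
  "real \<Rightarrow> real \<Rightarrow> ((real^'k) \<times> (real^'d)) measure \<Rightarrow>
   ((real^'k) \<times> (real^'d) \<Rightarrow> real^'d) \<Rightarrow> (real^'d \<Rightarrow> real^'k^'k) \<Rightarrow>
   (real \<Rightarrow> (real^'k) \<times> (real^'d)) measure \<Rightarrow> bool" where
  "law_with_generator T \<epsilon> \<nu> \<mu> Q P \<longleftrightarrow>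
     solves_martingale_problem T \<epsilon> \<nu> \<mu> Q P \<and>
     (\<forall>P'. solves_martingale_problem T \<epsilon> \<nu> \<mu> Q P' \<longrightarrow> P' = P)"


section \<open>Pathwise Lebesgue--Stieltjes integrals and the transition counts\<close>

text \<open>The integrator \<open>F\<close> is right-continuous and of bounded variation on the interval from \<open>a\<close> to \<open>b\<close>,
  hence a difference of two monotone right-continuous functions; the value of the integral over
  \<^term>\<open>{a<..b}\<close> does not depend on the chosen decomposition.\<close>

definition has_stieltjes_integral ::
  "(real \<Rightarrow> real) \<Rightarrow> (real \<Rightarrow> real) \<Rightarrow> real \<Rightarrow> real \<Rightarrow> real \<Rightarrow> bool" where
  "has_stieltjes_integral h F a b I \<longleftrightarrow>
     (\<exists>A B. mono A \<and> mono B \<and>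
        (\<forall>s. continuous (at_right s) A) \<and> (\<forall>s. continuous (at_right s) B) \<and>
        (\<forall>s\<in>{a..b}. F s = A s - B s) \<and>
        set_integrable (interval_measure A) {a<..b} h \<and>
        set_integrable (interval_measure B) {a<..b} h \<and>
        I = (LINT s:{a<..b}|interval_measure A. h s) - (LINT s:{a<..b}|interval_measure B. h s))"

definition stieltjes_integral ::
  "(real \<Rightarrow> real) \<Rightarrow> (real \<Rightarrow> real) \<Rightarrow> real \<Rightarrow> real \<Rightarrow> real" where
  "stieltjes_integral h F a b = (THE I. has_stieltjes_integral h F a b I)"

text \<open>\<open>transition_count \<omega> j i t\<close> is the number of transitions \<^emph>\<open>from\<close> \<open>i\<close> \<^emph>\<open>to\<close> \<open>j\<close> up to time \<open>t\<close>
  (for \<open>i \<noteq> j\<close>), i.e. the integral of the indicator of being in state \<open>i\<close> just before time \<open>s\<close> against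
  the \<open>j\<close>-th coordinate of the discrete part.\<close>

definition transition_count ::
  "(real \<Rightarrow> (real^'k) \<times> (real^'d)) \<Rightarrow> 'k \<Rightarrow> 'k \<Rightarrow> real \<Rightarrow> real" where
  "transition_count \<omega> j i t =
     stieltjes_integral
       (\<lambda>s. Lim (at_left s) (\<lambda>u. fst (\<omega> u)) \<bullet> axis i 1)
       (\<lambda>s. axis j 1 \<bullet> fst (\<omega> s)) 0 t"


section \<open>Stochastic integrals\<close>

text \<open>\<open>K\<close> is a bounded simple adapted integrand and \<open>J\<close> its elementary integral against \<open>Y\<close>.\<close>

definition elementary_integral ::
  "'w measure \<Rightarrow> (real \<Rightarrow> 'w measure) \<Rightarrow> real \<Rightarrow> (real \<Rightarrow> 'w \<Rightarrow> 'a::euclidean_space) \<Rightarrow>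
   (real \<Rightarrow> 'w \<Rightarrow> 'a) \<Rightarrow> ('w \<Rightarrow> real) \<Rightarrow> bool" where
  "elementary_integral P F T Y K J \<longleftrightarrow>
     (\<exists>n \<tau> \<xi>. \<tau> 0 = 0 \<and> \<tau> n = T \<and> (\<forall>m<n. \<tau> m < \<tau> (Suc m)) \<and>
        (\<forall>m<n. \<xi> m \<in> borel_measurable (F (\<tau> m)) \<and> bounded (\<xi> m ` space P)) \<and>
        K = (\<lambda>s \<omega>. \<Sum>m<n. indicator {\<tau> m<..\<tau> (Suc m)} s *\<^sub>R \<xi> m \<omega>) \<and>
        J = (\<lambda>\<omega>. \<Sum>m<n. \<xi> m \<omega> \<bullet> (Y (\<tau> (Suc m)) \<omega> - Y (\<tau> m) \<omega>)))"

definition mean_square_approx ::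
  "'w measure \<Rightarrow> real \<Rightarrow> (nat \<Rightarrow> real \<Rightarrow> 'w \<Rightarrow> 'a::euclidean_space) \<Rightarrow> (real \<Rightarrow> 'w \<Rightarrow> 'a) \<Rightarrow> bool" where
  "mean_square_approx P T K H \<longleftrightarrow>
     (\<lambda>m. \<integral>\<^sup>+\<omega>. (\<integral>\<^sup>+s\<in>{0..T}. ennreal ((norm (K m s \<omega> - H s \<omega>))\<^sup>2) \<partial>lborel) \<partial>P) \<longlonglongrightarrow> 0"

definition tends_in_prob :: "'w measure \<Rightarrow> (nat \<Rightarrow> 'w \<Rightarrow> real) \<Rightarrow> ('w \<Rightarrow> real) \<Rightarrow> bool" where
  "tends_in_prob P J I \<longleftrightarrow>
     (\<forall>\<delta>>0. (\<lambda>m. measure P {\<omega> \<in> space P. \<delta> < \<bar>J m \<omega> - I \<omega>\<bar>}) \<longlonglongrightarrow> 0)"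

text \<open>The Ito integral of \<open>H\<close> against \<open>Y\<close> over the interval from 0 to \<open>T\<close>, for integrators
  \<open>Y\<^sub>t = Y\<^sub>0 + \<integral>\<^sub>0\<^sup>t b\<^sub>s ds + \<epsilon> W\<^sub>t\<close> with bounded drift: for these, mean square convergence of the
  integrands in time and probability entails mean square convergence of the elementary integrals
  (by the Ito isometry and the Cauchy--Schwarz inequality), and the limit is
  \<open>\<integral> \<langle>H, b\<rangle> ds + \<epsilon> \<integral> \<langle>H, dW\<rangle>\<close>. Both the existence of an approximating sequence and the independence
  of its choice are required, so the integral is unique up to null sets.\<close>

definition has_ito_integral ::
  "'w measure \<Rightarrow> (real \<Rightarrow> 'w measure) \<Rightarrow> real \<Rightarrow> (real \<Rightarrow> 'w \<Rightarrow> 'a::euclidean_space) \<Rightarrow>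
   (real \<Rightarrow> 'w \<Rightarrow> 'a) \<Rightarrow> ('w \<Rightarrow> real) \<Rightarrow> bool" where
  "has_ito_integral P F T Y H I \<longleftrightarrow>
     I \<in> borel_measurable P \<and>
     (\<exists>K J. (\<forall>m. elementary_integral P F T Y (K m) (J m)) \<and> mean_square_approx P T K H) \<and>
     (\<forall>K J. (\<forall>m. elementary_integral P F T Y (K m) (J m)) \<and> mean_square_approx P T K H \<longrightarrow>
        tends_in_prob P J I)"

definition ito_integral ::
  "'w measure \<Rightarrow> (real \<Rightarrow> 'w measure) \<Rightarrow> real \<Rightarrow> (real \<Rightarrow> 'w \<Rightarrow> 'a::euclidean_space) \<Rightarrow>
   (real \<Rightarrow> 'w \<Rightarrow> 'a) \<Rightarrow> 'w \<Rightarrow> real" where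
  "ito_integral P F T Y H = (SOME I. has_ito_integral P F T Y H I)"


section \<open>Ratios and log likelihood\<close>

text \<open>Quotient with the convention 0/0 = 1. It is extended-valued, so that \<open>a/0\<close> is infinite for
  \<open>a \<noteq> 0\<close> rather than 0; boundedness of a ratio therefore excludes a vanishing denominator
  under a non-vanishing numerator.\<close>

definition ratio :: "real \<Rightarrow> real \<Rightarrow> ereal" where
  "ratio a b = (if a = 0 \<and> b = 0 then 1 else ereal a / ereal b)"

definition bounded_ratio :: "('a \<Rightarrow> real) \<Rightarrow> ('a \<Rightarrow> real) \<Rightarrow> bool" where
  "bounded_ratio f g \<longleftrightarrow> (\<exists>C::real. \<forall>y. \<bar>ratio (f y) (g y)\<bar> \<le> ereal C)"

definition equivalent_measures :: "'w measure \<Rightarrow> 'w measure \<Rightarrow> bool" where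
  "equivalent_measures P P' \<longleftrightarrow>
     sets P = sets P' \<and> absolutely_continuous P P' \<and> absolutely_continuous P' P"

definition log_likelihood :: "'w measure \<Rightarrow> 'w measure \<Rightarrow> 'w \<Rightarrow> real" where
  "log_likelihood P P\<^sub>0 \<omega> = ln (enn2real (RN_deriv P\<^sub>0 P \<omega>))"

end

theory Submission
  imports Defs
begin

text \<open>The density is built by stepping through time. On a time interval on which the shift \<open>\<epsilon>\<^sup>2 \<xi>\<close> of the
  drift and the log ratios \<open>\<rho>\<close> of the rates are frozen, the martingale problem of \<open>\<theta>\<^sub>0\<close> applied to
  test functions times \<open>h = exp (\<rho>\<^sub>i + sin (s \<langle>\<xi>, y\<rangle>) / s)\<close> shows that the \<open>h\<close>-transform has the shifted
  drift and rates up to a factor \<open>cos\<close>, with a bounded density. Products of such densities settle piecewise constant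
  coefficients. The square of a density is dominated by the density with doubled coefficients, so second
  moments are bounded uniformly and almost sure convergence of the densities suffices to let \<open>s \<rightarrow> 0\<close> and
  to let the coefficients tend to \<open>\<epsilon>\<^sup>-\<^sup>2 (\<mu>\<^sup>\<theta> - \<mu>\<^sup>\<theta>\<^sup>0)\<close> and \<open>ln (q\<^sup>\<theta> / q\<^sup>\<theta>\<^sup>0)\<close>. In the limit the log densities
  become the asserted formula: sums over the cells of a grid turn into sums over the jumps, elementary
  integrals into the Ito integral. The limiting density is positive, and it turns \<open>P\<^sup>\<theta>\<^sup>0\<close> into a solution of
  the martingale problem of \<open>\<theta>\<close>, which is \<open>P\<^sup>\<theta>\<close> by uniqueness.\<close>

subsection \<open>Calculus of smooth functions\<close>

text \<open>The obstacle is that a martingale problem yields expectations of increments of compactly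
  supported functions and nothing pathwise: no Brownian motion, no Ito formula, not even continuity
  of Y. All of this is drawn from the densities themselves. That a density with \<rho> = 0 has mass
  one is an exponential moment identity for an elementary integral of Y. Markov's inequality turns
  it into a tail bound, which takes the place of the Ito isometry, makes elementary integrals Cauchy
  in probability, and shows that Y does not jump. Continuity of Y matters because grid sums sample
  the rates at the left ends of cells, whereas the formula evaluates them at Y_t at the jump times.
  Identities are tested against bounded weights known at the earlier time, so that Fubini can move
  time integrals out of expectations. The drift is only Borel, hence approximated in mean square
  under the occupation measure; the log ratios of the rates enter a sum over jump times, which
  convergence almost everywhere in time does not control directly, and are therefore first made
  continuous.\<close>

definition smooth :: "('a::euclidean_space \<Rightarrow> real) \<Rightarrow> bool" where
 "smooth f \<longleftrightarrow> (\<forall>n. C_k n f)"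

lemma C_k_continuous: "C_k n f \<Longrightarrow> continuous_on UNIV f"
 by (cases n) (auto intro!: differentiable_imp_continuous_on simp: differentiable_on_def
   intro: differentiable_at_imp_differentiable_on)

lemma C_k_SucD: "C_k (Suc n) f \<Longrightarrow> C_k n f"
proof (induction n arbitrary: f)
 case 0
 then show ?case using C_k_continuous[OF 0] by simp
qed auto

lemma smooth_differentiable: "smooth f \<Longrightarrow> f differentiable (at y)"
 unfolding smooth_def using C_k.simps(2) by blast

lemma smooth_partial: "smooth f \<Longrightarrow> b \<in> Basis \<Longrightarrow> smooth (partial_deriv b f)"
 unfolding smooth_def using C_k.simps(2) by blast

lemma smooth_continuous: "smooth f \<Longrightarrow> continuous_on UNIV f"
 unfolding smooth_def using C_k_continuous by blast

lemma partial_deriv_has: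
 "(f has_derivative f') (at y) \<Longrightarrow> partial_deriv b f y = f' b"
 unfolding partial_deriv_def by (metis frechet_derivative_at)

lemma partial_deriv_eqI:
 "(\<And>y. (f has_derivative f' y) (at y)) \<Longrightarrow> partial_deriv b f = (\<lambda>y. f' y b)"
 by (rule ext) (rule partial_deriv_has)

lemma frechet_has: "f differentiable (at y) \<Longrightarrow> (f has_derivative frechet_derivative f (at y)) (at y)"
 by (simp add: frechet_derivative_works)

lemma partial_deriv_add:
 assumes "\<And>y. f differentiable (at y)" "\<And>y. g differentiable (at y)"
 shows "partial_deriv b (\<lambda>y. f y + g y) = (\<lambda>y. partial_deriv b f y + partial_deriv b g y)"
 by (subst partial_deriv_eqI[OF has_derivative_add[OF frechet_has frechet_has], OF assms])
   (simp add: partial_deriv_def)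

lemma partial_deriv_mult:
 fixes f g :: "'a::euclidean_space \<Rightarrow> real"
 assumes "\<And>y. f differentiable (at y)" "\<And>y. g differentiable (at y)"
 shows "partial_deriv b (\<lambda>y. f y * g y) = (\<lambda>y. f y * partial_deriv b g y + partial_deriv b f y * g y)"
 by (subst partial_deriv_eqI[OF has_derivative_mult[OF frechet_has frechet_has], OF assms])
   (simp add: partial_deriv_def)

lemma C_k_add: "C_k n f \<Longrightarrow> C_k n g \<Longrightarrow> C_k n (\<lambda>y. f y + g y)"
 by (induction n arbitrary: f g) (auto intro!: continuous_intros simp: partial_deriv_add)

lemma C_k_mult:
 fixes f g :: "'a::euclidean_space \<Rightarrow> real"
 shows "C_k n f \<Longrightarrow> C_k n g \<Longrightarrow> C_k n (\<lambda>y. f y * g y)"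
proof (induction n arbitrary: f g)
 case (Suc n)
 have "C_k n f" "C_k n g" using Suc.prems C_k_SucD by blast+
 then show ?case using Suc by (auto simp: partial_deriv_mult intro!: C_k_add)
qed (auto intro!: continuous_intros)

lemma partial_deriv_compose_real:
 assumes "\<And>x. (h has_field_derivative h' x) (at x)" "\<And>y. f differentiable (at y)"
 shows "partial_deriv b (\<lambda>y. h (f y)) = (\<lambda>y. h' (f y) * partial_deriv b f y)"
  and "(\<lambda>y. h (f y)) differentiable (at y)"
proof -
 have *: "((\<lambda>y. h (f y)) has_derivative (\<lambda>v. h' (f y) * frechet_derivative f (at y) v)) (at y)" for y
  using has_derivative_compose[OF frechet_has[OF assms(2)], of h "\<lambda>v. h' (f y) * v" y]
   assms(1)[of "f y"] by (simp add: has_field_derivative_def)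
 show "partial_deriv b (\<lambda>y. h (f y)) = (\<lambda>y. h' (f y) * partial_deriv b f y)"
  by (subst partial_deriv_eqI[OF *]) (simp add: partial_deriv_def)
 show "(\<lambda>y. h (f y)) differentiable (at y)"
  using * differentiable_def by blast
qed

text \<open>The outer function comes with the tower \<open>hs\<close> of all its derivatives, since
  the chain rule for \<open>hs m\<close> produces \<open>hs (Suc m)\<close>; the induction on the
  order therefore runs over all m at once.\<close>

lemma C_k_compose_real:
 assumes "\<And>m x. (hs m has_field_derivative hs (Suc m) x) (at x)"
 shows "C_k n f \<Longrightarrow> C_k n (\<lambda>y. hs m (f y))"
proof (induction n arbitrary: m)
 case 0
 have "continuous_on UNIV (hs m)"
  by (meson assms DERIV_continuous_on has_field_derivative_at_within)
 then show ?case using 0 by (auto intro: continuous_on_compose2)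
next
 case (Suc n)
 have d: "\<And>y. f differentiable (at y)" using Suc.prems by simp
 show ?case
  using Suc C_k_SucD[OF Suc.prems] partial_deriv_compose_real[OF assms d]
  by (auto intro!: C_k_mult)
qed

lemma C_k_const: "C_k n (\<lambda>_. c)"
proof (induction n arbitrary: c)
 case (Suc n)
 have "partial_deriv b (\<lambda>_::'a. c) = (\<lambda>_. 0)" for b
  using partial_deriv_eqI[OF has_derivative_const, of b c] by simp
 then show ?case using Suc[of 0] by simp
qed auto

lemma partial_deriv_inner: "partial_deriv b (\<lambda>y. v \<bullet> y) = (\<lambda>_. v \<bullet> b)"
 by (rule partial_deriv_eqI) (auto intro!: derivative_eq_intros)

lemma C_k_inner: "C_k n (\<lambda>y. v \<bullet> y)"
 by (cases n) (auto intro!: continuous_intros simp: partial_deriv_inner C_k_const)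

lemma partial_deriv_norm2: "partial_deriv b (\<lambda>y. y \<bullet> y) = (\<lambda>y. 2 * (b \<bullet> y))"
 by (rule partial_deriv_eqI) (auto intro!: derivative_eq_intros simp: inner_commute)

lemma C_k_norm2: "C_k n (\<lambda>y. y \<bullet> y)"
 by (cases n) (auto intro!: continuous_intros C_k_mult C_k_const C_k_inner simp: partial_deriv_norm2)

lemma partial_deriv_scale:
 fixes f :: "'a::euclidean_space \<Rightarrow> real"
 assumes "\<And>y. f differentiable (at y)"
 shows "partial_deriv b (\<lambda>y. f (c *\<^sub>R y)) = (\<lambda>y. c * partial_deriv b f (c *\<^sub>R y))"
  and "(\<lambda>y. f (c *\<^sub>R y)) differentiable (at y)"
proof -
 have *: "((\<lambda>y. f (c *\<^sub>R y)) has_derivative (\<lambda>v. frechet_derivative f (at (c *\<^sub>R y)) (c *\<^sub>R v))) (at y)" for y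
  by (rule has_derivative_compose[OF _ frechet_has[OF assms]]) (auto intro!: derivative_eq_intros)
 have "linear (frechet_derivative f (at y))" for y
  by (metis assms linear_frechet_derivative)
 then show "partial_deriv b (\<lambda>y. f (c *\<^sub>R y)) = (\<lambda>y. c * partial_deriv b f (c *\<^sub>R y))"
  by (subst partial_deriv_eqI[OF *]) (simp add: partial_deriv_def linear_cmul)
 show "(\<lambda>y. f (c *\<^sub>R y)) differentiable (at y)"
  using * differentiable_def by blast
qed

lemma C_k_scale:
 fixes f :: "'a::euclidean_space \<Rightarrow> real"
 shows "C_k n f \<Longrightarrow> C_k n (\<lambda>y. f (c *\<^sub>R y))"
proof (induction n arbitrary: f)
 case 0 then show ?case by (auto intro!: continuous_intros continuous_on_compose2[of UNIV f])
next
 case (Suc n)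
 have d: "\<And>y. f differentiable (at y)" using Suc.prems by simp
 show ?case using Suc by (auto simp: partial_deriv_scale[OF d] intro!: C_k_mult C_k_const)
qed

lemma smooth_sin_exp: "smooth (\<lambda>y. exp (c * sin (s * (\<xi> \<bullet> y))))"
 unfolding smooth_def
proof
 fix n
 \<comment> \<open>The m-th derivative of sin in closed form, as a shift by m quarter turns.\<close>
 define hs where "hs m x = sin (x + real m * (pi / 2))" for m x
 have hs: "(hs m has_field_derivative hs (Suc m) x) (at x)" for m x
  unfolding hs_def by (auto intro!: derivative_eq_intros simp: sin_add cos_add algebra_simps add_divide_distrib)
 have "C_k n (\<lambda>y. s * (\<xi> \<bullet> y))" by (intro C_k_mult C_k_const C_k_inner)
 from C_k_compose_real[of hs, OF hs this, of 0]
 have *: "C_k n (\<lambda>y. c * sin (s * (\<xi> \<bullet> y)))"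
  by (intro C_k_mult C_k_const) (simp add: hs_def)
 show "C_k n (\<lambda>y. exp (c * sin (s * (\<xi> \<bullet> y))))"
  by (rule C_k_compose_real[of "\<lambda>_. exp", OF DERIV_exp *])
qed

subsection \<open>A smooth bump function\<close>

text \<open>The functions p(1/t) exp(-1/t), continued by zero, form a class closed under
  differentiation, with \<open>flat_op\<close> the induced operation on p. This makes the tower of
  derivatives of exp(-1/t) explicit.\<close>

definition flat :: "real poly \<Rightarrow> real \<Rightarrow> real" where
 "flat p t = (if t > 0 then poly p (1 / t) * exp (- (1 / t)) else 0)"

definition flat_op :: "real poly \<Rightarrow> real poly" where
 "flat_op p = [:0, 0, 1:] * (p - pderiv p)"

lemma flat_deriv: "(flat p has_field_derivative flat (flat_op p) t) (at t)"
proof (cases t "0::real" rule: linorder_cases)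
 case greater
 have "((\<lambda>t. poly p (1 / t) * exp (- (1 / t))) has_field_derivative
   poly (pderiv p) (1 / t) * (- 1 / t^2) * exp (- (1/t)) + poly p (1 / t) * (exp (- (1 / t)) * (1 / t^2))) (at t)"
  using greater by (auto intro!: derivative_eq_intros DERIV_chain'[OF _ poly_DERIV] simp: power2_eq_square)
 also have "poly (pderiv p) (1 / t) * (- 1 / t^2) * exp (- (1/t)) + poly p (1 / t) * (exp (- (1 / t)) * (1 / t^2))
   = flat (flat_op p) t"
  using greater by (simp add: flat_def flat_op_def field_simps power2_eq_square)
 finally show ?thesis
  using greater
  by (elim has_field_derivative_transform_within_open[where S="{0<..}"]) (auto simp: flat_def)
next
 case less
 have "((\<lambda>t. 0) has_field_derivative flat (flat_op p) t) (at t)"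
  using less by (simp add: flat_def)
 then show ?thesis
  using less by (elim has_field_derivative_transform_within_open[where S="{..<0}"]) (auto simp: flat_def)
next
 case equal
 \<comment> \<open>In the variable x = 1/t the difference quotient of \<open>flat p\<close> at 0
   from the right is x p(x) / exp x, and \<open>pCons 0 p\<close> is the polynomial x p(x).\<close>
 have lim: "((\<lambda>x. poly (pCons 0 p) x / exp x) \<longlongrightarrow> 0) at_top" for p :: "real poly"
 proof -
  have "((\<lambda>x. \<Sum>i\<le>degree (pCons 0 p). coeff (pCons 0 p) i * (x ^ i / exp x)) \<longlongrightarrow>
    (\<Sum>i\<le>degree (pCons 0 p). coeff (pCons 0 p) i * 0)) at_top"
   by (intro tendsto_intros tendsto_power_div_exp_0)
  then show ?thesis
   by (simp add: poly_altdef sum_divide_distrib del: degree_pCons_eq_if)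
 qed
 have "((\<lambda>y. poly (pCons 0 p) (inverse y) / exp (inverse y)) \<longlongrightarrow> 0) (at_right 0)"
  by (rule filterlim_compose[OF lim filterlim_inverse_at_top_right])
 then have "((\<lambda>y. (flat p y - flat p 0) / (y - 0)) \<longlongrightarrow> 0) (at_right 0)"
  by (rule Lim_transform_eventually)
    (auto simp: eventually_at_right_field flat_def field_simps exp_minus intro!: exI[of _ 1])
 moreover have "((\<lambda>y. (flat p y - flat p 0) / (y - 0)) \<longlongrightarrow> 0) (at_left 0)"
  by (rule Lim_transform_eventually[OF tendsto_const])
    (auto simp: eventually_at_left_field flat_def intro!: exI[of _ "-1"])
 ultimately have "((\<lambda>y. (flat p y - flat p 0) / (y - 0)) \<longlongrightarrow> 0) (at 0)"
  by (simp add: filterlim_split_at_real)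
 then show ?thesis
  using equal by (simp add: has_field_derivative_iff flat_def)
qed

text \<open>The factor e normalises the value at the origin to 1, so that bumps stretched ever wider
  converge to the constant 1.\<close>

definition bump :: "'a::euclidean_space \<Rightarrow> real" where
 "bump y = exp 1 * flat 1 (1 + (-1) * (y \<bullet> y))"

lemma smooth_bump: "smooth bump"
proof -
 have "C_k n (\<lambda>y::'a. (\<lambda>m. flat ((flat_op ^^ m) 1)) 0 (1 + (-1) * (y \<bullet> y)))" for n
  by (rule C_k_compose_real[of "\<lambda>m. flat ((flat_op ^^ m) 1)"])
    (simp_all only: funpow.simps o_def flat_deriv C_k_add C_k_mult C_k_const C_k_norm2)
 then show ?thesis
  unfolding smooth_def bump_def by (auto intro!: C_k_mult C_k_const)
qed

lemma bump_0: "bump 0 = 1"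
 by (simp add: bump_def flat_def exp_minus)

lemma bump_support: "{y. bump y \<noteq> 0} \<subseteq> cball 0 1"
proof
 fix y :: 'a assume "y \<in> {y. bump y \<noteq> 0}"
 then have "1 - y \<bullet> y > 0" by (simp add: bump_def flat_def split: if_splits)
 then show "y \<in> cball 0 1"
  by (simp add: norm_eq_sqrt_inner)
qed

section \<open>Compactly supported smooth functions\<close>

definition compactly_supported :: "('a::euclidean_space \<Rightarrow> real) \<Rightarrow> bool" where
 "compactly_supported f \<longleftrightarrow> compact (closure {y. f y \<noteq> 0})"

lemma compactly_supportedI: "{y. f y \<noteq> 0} \<subseteq> S \<Longrightarrow> compact S \<Longrightarrow> compactly_supported f"
 unfolding compactly_supported_def
 by (meson bounded_subset closure_minimal compact_closure compact_eq_bounded_closed)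

lemma compactly_supported_partial:
 assumes "compactly_supported f"
 shows "compactly_supported (partial_deriv b f)"
proof (rule compactly_supportedI)
 show "compact (closure {y. f y \<noteq> 0})" using assms compactly_supported_def by blast
 show "{y. partial_deriv b f y \<noteq> 0} \<subseteq> closure {y. f y \<noteq> 0}"
 proof (rule ccontr)
  assume "\<not> ?thesis"
  then obtain y where y: "partial_deriv b f y \<noteq> 0" "y \<in> - closure {y. f y \<noteq> 0}" by auto
  have "((\<lambda>_. 0) has_derivative (\<lambda>_. 0)) (at y)" by simp
  then have "(f has_derivative (\<lambda>_. 0)) (at y)"
   by (rule has_derivative_transform_within_open[OF _ _ y(2)])
     (use closure_subset[of "{y. f y \<noteq> 0}"] in auto)
  then show False using y(1) partial_deriv_has by blast
 qed
qed

lemma compactly_supported_bounded: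
 assumes "compactly_supported f" "continuous_on UNIV f"
 obtains B where "B \<ge> 0" "\<And>y. \<bar>f y\<bar> \<le> B"
proof -
 have "compact (f ` closure {y. f y \<noteq> 0})"
  by (rule compact_continuous_image[OF continuous_on_subset[OF assms(2) subset_UNIV]
    assms(1)[unfolded compactly_supported_def]])
 then obtain B where B: "\<And>y. y \<in> closure {y. f y \<noteq> 0} \<Longrightarrow> \<bar>f y\<bar> \<le> B"
  using compact_imp_bounded bounded_iff by (metis image_eqI real_norm_def)
 have "\<bar>f y\<bar> \<le> max B 0" for y
 proof (cases "f y = 0")
  case False
  then have "y \<in> closure {y. f y \<noteq> 0}" by (intro subsetD[OF closure_subset]) simp
  from B[OF this] show ?thesis by simp
 qed simp
 then show thesis by (rule that[rotated]) simp
qed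

text \<open>The test functions of the martingale problem, read as one function of y for each
  discrete state.\<close>

definition tf :: "('k \<Rightarrow> 'a::euclidean_space \<Rightarrow> real) \<Rightarrow> bool" where
 "tf \<phi> \<longleftrightarrow> (\<forall>i. smooth (\<phi> i) \<and> compactly_supported (\<phi> i))"

lemma gradient_inner: "b \<in> Basis \<Longrightarrow> gradient f y \<bullet> b = partial_deriv b f y"
 by (simp add: gradient_def)

lemma gradient_continuous: "smooth f \<Longrightarrow> continuous_on UNIV (gradient f)"
 unfolding gradient_def
 by (intro continuous_intros smooth_continuous smooth_partial)

lemma laplacian_continuous: "smooth f \<Longrightarrow> continuous_on UNIV (laplacian f)"
 unfolding laplacian_def
 by (intro continuous_intros smooth_continuous smooth_partial)

lemma test_bounded:
 assumes "smooth f" "compactly_supported f"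
 obtains B where "B \<ge> 0" "\<And>y. \<bar>f y\<bar> \<le> B" "\<And>y. norm (gradient f y) \<le> B" "\<And>y. \<bar>laplacian f y\<bar> \<le> B"
proof -
 obtain B0 where B0: "\<And>y. \<bar>f y\<bar> \<le> B0"
  using compactly_supported_bounded[OF assms(2) smooth_continuous[OF assms(1)]] by metis
 have "\<forall>b\<in>Basis. \<exists>B. \<forall>y. \<bar>partial_deriv b f y\<bar> \<le> B"
  by (metis compactly_supported_bounded[OF compactly_supported_partial[OF assms(2)] smooth_continuous[OF smooth_partial[OF assms(1)]]])
 then obtain B1 where B1: "\<And>b y. b\<in>Basis \<Longrightarrow> \<bar>partial_deriv b f y\<bar> \<le> B1 b" by metis
 have "\<forall>b\<in>Basis. \<exists>B. \<forall>y. \<bar>partial_deriv b (partial_deriv b f) y\<bar> \<le> B"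
  by (metis compactly_supported_bounded[OF compactly_supported_partial[OF compactly_supported_partial[OF assms(2)]]
     smooth_continuous[OF smooth_partial[OF smooth_partial[OF assms(1)]]]])
 then obtain B2 where B2: "\<And>b y. b\<in>Basis \<Longrightarrow> \<bar>partial_deriv b (partial_deriv b f) y\<bar> \<le> B2 b" by metis
 have g: "norm (gradient f y) \<le> (\<Sum>b\<in>Basis. B1 b)" for y
  unfolding gradient_def by (rule sum_norm_le) (simp add: B1)
 have l: "\<bar>laplacian f y\<bar> \<le> (\<Sum>b\<in>Basis. B2 b)" for y
  unfolding laplacian_def by (rule order_trans[OF sum_abs sum_mono]) (simp add: B2)
 show thesis
  by (rule that[of "max 0 (max B0 (max (\<Sum>b\<in>Basis. B1 b) (\<Sum>b\<in>Basis. B2 b)))"])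
    (use B0 g l in \<open>auto simp: le_max_iff_disj\<close>)
qed

subsection \<open>Product rules\<close>

lemma gradient_mult:
 assumes "smooth f" "smooth g"
 shows "gradient (\<lambda>y. f y * g y) y = f y *\<^sub>R gradient g y + g y *\<^sub>R gradient f y"
 by (simp add: gradient_def partial_deriv_mult smooth_differentiable assms scaleR_add_left
   sum.distrib scaleR_sum_right mult.commute)

lemma smooth_mult: "smooth f \<Longrightarrow> smooth g \<Longrightarrow> smooth (\<lambda>y. f y * g y :: real)"
 by (simp add: smooth_def C_k_mult)

lemma smooth_const: "smooth (\<lambda>_. c)"
 by (simp add: smooth_def C_k_const)

lemma laplacian_mult:
 assumes "smooth f" "smooth g"
 shows "laplacian (\<lambda>y. f y * g y) y
  = f y * laplacian g y + 2 * (gradient f y \<bullet> gradient g y) + g y * laplacian f y"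
proof -
 have "partial_deriv b (partial_deriv b (\<lambda>y. f y * g y)) y
   = f y * partial_deriv b (partial_deriv b g) y + 2 * (partial_deriv b f y * partial_deriv b g y)
    + g y * partial_deriv b (partial_deriv b f) y" if "b \<in> Basis" for b
  using that assms
  by (simp add: partial_deriv_mult partial_deriv_add smooth_differentiable smooth_mult smooth_partial)
 moreover have "gradient f y \<bullet> gradient g y = (\<Sum>b\<in>Basis. partial_deriv b f y * partial_deriv b g y)"
  by (subst euclidean_inner) (simp add: gradient_inner)
 ultimately show ?thesis
  unfolding laplacian_def by (simp add: sum.distrib sum_distrib_left)
qed

text \<open>For s -> 0 the cosines tend to 1 and the term with \<open>s * sin\<close> disappears,
  which leaves the derivatives of exp \<langle>\<xi>, y\<rangle>.\<close>

lemma sin_exp_derivatives: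
 assumes "s \<noteq> 0"
 shows "gradient (\<lambda>y. exp (1 / s * sin (s * (\<xi> \<bullet> y)))) y
   = (exp (1 / s * sin (s * (\<xi> \<bullet> y))) * cos (s * (\<xi> \<bullet> y))) *\<^sub>R \<xi>" (is "gradient ?g y = _")
  and "laplacian (\<lambda>y. exp (1 / s * sin (s * (\<xi> \<bullet> y)))) y
   = exp (1 / s * sin (s * (\<xi> \<bullet> y))) * (cos (s * (\<xi> \<bullet> y))^2 - s * sin (s * (\<xi> \<bullet> y))) * (\<xi> \<bullet> \<xi>)"
proof -
 have d1: "partial_deriv b ?g = (\<lambda>y. (exp (1 / s * sin (s * (\<xi> \<bullet> y))) * cos (s * (\<xi> \<bullet> y))) * (\<xi> \<bullet> b))" for b
  using assms by (intro partial_deriv_eqI) (auto intro!: derivative_eq_intros simp: field_simps)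
 have d2: "partial_deriv b (\<lambda>y. (exp (1 / s * sin (s * (\<xi> \<bullet> y))) * cos (s * (\<xi> \<bullet> y))) * (\<xi> \<bullet> b))
   = (\<lambda>y. exp (1 / s * sin (s * (\<xi> \<bullet> y))) * (cos (s * (\<xi> \<bullet> y))^2 - s * sin (s * (\<xi> \<bullet> y))) * (\<xi> \<bullet> b)^2)" for b
  using assms
  by (subst partial_deriv_eqI[where f'="\<lambda>y v. exp (1 / s * sin (s * (\<xi> \<bullet> y)))
     * (cos (s * (\<xi> \<bullet> y))^2 - s * sin (s * (\<xi> \<bullet> y))) * (\<xi> \<bullet> v) * (\<xi> \<bullet> b)"])
    (auto intro!: derivative_eq_intros simp: field_simps power2_eq_square)
 show "gradient ?g y = (exp (1 / s * sin (s * (\<xi> \<bullet> y))) * cos (s * (\<xi> \<bullet> y))) *\<^sub>R \<xi>"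
  unfolding gradient_def d1
  by (subst (3) euclidean_representation[symmetric, of \<xi>]) (simp add: scaleR_sum_right)
 have *: "\<xi> \<bullet> \<xi> = (\<Sum>b\<in>Basis. (\<xi> \<bullet> b)^2)"
  by (subst euclidean_inner) (simp add: power2_eq_square)
 show "laplacian ?g y
   = exp (1 / s * sin (s * (\<xi> \<bullet> y))) * (cos (s * (\<xi> \<bullet> y))^2 - s * sin (s * (\<xi> \<bullet> y))) * (\<xi> \<bullet> \<xi>)"
  unfolding laplacian_def d1 d2 * by (simp add: sum_distrib_left)
qed

lemma gradient_cmult: "smooth f \<Longrightarrow> gradient (\<lambda>y. c * f y) y = c *\<^sub>R gradient f y"
 using gradient_mult[OF smooth_const, of f c y]
 by (simp add: gradient_def partial_deriv_has[OF has_derivative_const])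

lemma laplacian_cmult: "smooth f \<Longrightarrow> laplacian (\<lambda>y. c * f y) y = c * laplacian f y"
 by (simp add: laplacian_def partial_deriv_mult smooth_differentiable smooth_const smooth_mult
   smooth_partial partial_deriv_eqI[OF has_derivative_const] sum_distrib_left)

text \<open>The factors c and c^2 are what makes the generator of a bump stretched by 1/c vanish as
  c -> 0.\<close>

lemma scale_derivatives:
 assumes "smooth f"
 shows "gradient (\<lambda>y. f (c *\<^sub>R y)) y = c *\<^sub>R gradient f (c *\<^sub>R y)"
  and "laplacian (\<lambda>y. f (c *\<^sub>R y)) y = c^2 * laplacian f (c *\<^sub>R y)"
  and "smooth (\<lambda>y. f (c *\<^sub>R y))"
proof -
 show s: "smooth (\<lambda>y. f (c *\<^sub>R y))" using assms by (simp add: smooth_def C_k_scale)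
 note d = partial_deriv_scale(1)[OF smooth_differentiable]
 show "gradient (\<lambda>y. f (c *\<^sub>R y)) y = c *\<^sub>R gradient f (c *\<^sub>R y)"
  by (simp add: gradient_def d[OF assms] scaleR_sum_right)
 have "partial_deriv b (partial_deriv b (\<lambda>y. f (c *\<^sub>R y))) y = c^2 * partial_deriv b (partial_deriv b f) (c *\<^sub>R y)"
  if "b \<in> Basis" for b
 proof -
  have s': "smooth (\<lambda>y. partial_deriv b f (c *\<^sub>R y))"
   using smooth_partial[OF assms that] by (simp add: smooth_def C_k_scale)
  have "partial_deriv b (\<lambda>y. c * partial_deriv b f (c *\<^sub>R y)) = (\<lambda>y. c * (c * partial_deriv b (partial_deriv b f) (c *\<^sub>R y)))"
   by (subst partial_deriv_mult)
     (auto simp: smooth_differentiable[OF smooth_const] smooth_differentiable[OF s']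
      d[OF smooth_partial[OF assms that]] partial_deriv_eqI[OF has_derivative_const])
  then show ?thesis by (simp add: d[OF assms] power2_eq_square)
 qed
 then show "laplacian (\<lambda>y. f (c *\<^sub>R y)) y = c^2 * laplacian f (c *\<^sub>R y)"
  by (simp add: laplacian_def sum_distrib_left)
qed

subsection \<open>Functions on the state space\<close>

text \<open>A function on the state space is given by its restrictions \<open>\<phi> i\<close> to the sheets
 \<open>{e\<^sub>i} \<times> \<real>\<^sup>d\<close>; extending it linearly in the discrete coordinate keeps it measurable and continuous.\<close>

definition lift :: "('k \<Rightarrow> real^'d \<Rightarrow> 'b::real_normed_vector) \<Rightarrow> (real^'k) \<times> (real^'d) \<Rightarrow> 'b" where
 "lift \<phi> z = (\<Sum>i\<in>UNIV. (fst z $ i) *\<^sub>R \<phi> i (snd z))"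

lemma lift_axis [simp]: "lift \<phi> (axis i 1, y) = \<phi> i y"
 by (simp add: lift_def axis_def sum.delta if_distrib[of "\<lambda>c. c *\<^sub>R _"] cong: if_cong)

lemma state_spaceE:
 assumes "z \<in> state_space"
 obtains i where "z = (axis i 1, snd z)"
 using assms unfolding state_space_def by (cases z) auto

lemma borel_measurable_vec_nth [measurable]: "(\<lambda>x::real^'n. x $ i) \<in> borel_measurable borel"
 by (intro borel_measurable_continuous_onI continuous_intros)

lemma measurable_lift [measurable]:
 fixes \<phi> :: "'k::finite \<Rightarrow> real^'d \<Rightarrow> 'b::{real_normed_vector, second_countable_topology}"
 assumes [measurable]: "\<And>i. \<phi> i \<in> borel_measurable borel"
 shows "lift \<phi> \<in> borel_measurable borel"
 unfolding lift_def borel_prod[symmetric] by measurable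

lemma continuous_lift:
 assumes "\<And>i. continuous_on UNIV (\<phi> i)"
 shows "continuous_on UNIV (lift \<phi>)"
 unfolding lift_def
 by (intro continuous_intros continuous_on_compose2[OF assms]) auto

lemma norm_lift_le:
 assumes "z \<in> state_space" "\<And>i y. norm (\<phi> i y) \<le> B"
 shows "norm (lift \<phi> z) \<le> B"
 using assms by (metis lift_axis state_spaceE)

subsection \<open>Path space and filtration\<close>

lemma cadlag_in_state_space: "p \<in> cadlag_paths T \<Longrightarrow> 0 \<le> t \<Longrightarrow> t \<le> T \<Longrightarrow> p t \<in> state_space"
 by (auto simp: cadlag_paths_def)

lemma space_path_space [simp]: "space (path_space T) = cadlag_paths T"
proof -
 have "cadlag_paths T \<subseteq> space (\<Pi>\<^sub>M t\<in>{0..T}. borel)"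
  by (auto simp: space_PiM cadlag_paths_def PiE_def)
 then show ?thesis by (auto simp: path_space_def space_restrict_space)
qed

lemma filtration_gen_Pow:
 "(\<Union>s\<in>{0..t}. {(\<lambda>p. p s) -` B \<inter> cadlag_paths T | B. B \<in> sets borel}) \<subseteq> Pow (cadlag_paths T)"
 by auto

lemma space_filtration [simp]: "space (canonical_filtration T t) = cadlag_paths T"
 unfolding canonical_filtration_def by (rule space_measure_of[OF filtration_gen_Pow])

lemma sets_filtration:
 "sets (canonical_filtration T t) = sigma_sets (cadlag_paths T)
   (\<Union>s\<in>{0..t}. {(\<lambda>p. p s) -` B \<inter> cadlag_paths T | B. B \<in> sets borel})"
 unfolding canonical_filtration_def by (rule sets_measure_of[OF filtration_gen_Pow])

lemma filtration_eval:
 assumes "0 \<le> s" "s \<le> t"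
 shows "(\<lambda>p. p s) \<in> borel_measurable (canonical_filtration T t)"
proof (rule measurableI)
 fix A :: "((real^'k) \<times> (real^'d)) set" assume "A \<in> sets borel"
 then show "(\<lambda>p. p s) -` A \<inter> space (canonical_filtration T t) \<in> sets (canonical_filtration T t)"
  unfolding sets_filtration space_filtration using assms by (intro sigma_sets.Basic UN_I[of s]) auto
qed simp

lemma filtration_mono: "s \<le> t \<Longrightarrow> sets (canonical_filtration T s) \<subseteq> sets (canonical_filtration T t)"
 unfolding sets_filtration by (intro sigma_sets_mono' UN_mono) auto

lemma path_space_eval:
 assumes "0 \<le> s" "s \<le> T"
 shows "(\<lambda>p. p s) \<in> borel_measurable (path_space T)"
 unfolding path_space_def using assms by (intro measurable_restrict_space1 measurable_component_singleton) auto

lemma filtration_path_space: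
 assumes "t \<le> T"
 shows "sets (canonical_filtration T t) \<subseteq> sets (path_space T)"
proof -
 have "(\<lambda>p. p s) -` B \<inter> cadlag_paths T \<in> sets (path_space T)"
  if "s \<in> {0..t}" "B \<in> sets borel" for s and B :: "((real^'k) \<times> (real^'d)) set"
  using measurable_sets[OF path_space_eval that(2), of s T] that assms by simp
 then have "sigma_sets (space (path_space T))
   (\<Union>s\<in>{0..t}. {(\<lambda>p. p s) -` B \<inter> cadlag_paths T | B. B \<in> sets borel}) \<subseteq> sets (path_space T)"
  by (intro sets.sigma_sets_subset subsetI) blast
 then show ?thesis by (simp add: sets_filtration)
qed

lemma measurable_filtration_mono:
 "f \<in> measurable (canonical_filtration T s) N \<Longrightarrow> s \<le> t \<Longrightarrow> f \<in> measurable (canonical_filtration T t) N"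
 using filtration_mono[of s t T] unfolding measurable_def by auto

text \<open>Projection of the time axis onto {0..t}. A process composed with it is defined at all
  real times, so that joint measurability can be stated over the whole Borel line.\<close>

definition clip :: "real \<Rightarrow> real \<Rightarrow> real" where
 "clip t w = max 0 (min t w)"

text \<open>Progressive measurability of the canonical process: by right-continuity it is the limit of
 its values at the next point of a grid.\<close>

lemma progressive_eval:
 assumes t: "0 \<le> t" "t \<le> T"
 shows "(\<lambda>(w, p). p (clip t w)) \<in> borel_measurable (borel \<Otimes>\<^sub>M canonical_filtration T t)"
proof (rule borel_measurable_LIMSEQ_metric)
 let ?M = "borel \<Otimes>\<^sub>M canonical_filtration T t"
 define k where "k n w = \<lfloor>clip t w * real (Suc n)\<rfloor>" for n w
 \<comment> \<open>\<open>g n w\<close> is the first point of the grid of mesh 1/(n+1) strictly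
   after the clipped time, cut off at t: strictness leads to right limits, the cut-off keeps the
   value measurable with respect to F_t.\<close>
 define g where "g n w = clip t ((real_of_int (k n w) + 1) / real (Suc n))" for n w
 let ?u = "\<lambda>n (w, p). p (g n w)"
 have clip_cases: "0 \<le> clip t w" "clip t w \<le> t" for w using t by (auto simp: clip_def)
 show "?u n \<in> borel_measurable ?M" for n
 proof -
  have k: "(\<lambda>x. k n (fst x)) \<in> measurable ?M (count_space UNIV)"
   unfolding k_def clip_def by measurable
  have "(\<lambda>x. snd x (clip t ((real_of_int j + 1) / real (Suc n)))) \<in> borel_measurable ?M" for j
   by (rule measurable_compose[OF measurable_snd filtration_eval]) (auto simp: clip_cases)
  from measurable_compose_countable[OF this k]
  show ?thesis by (simp add: g_def split_beta')
 qed
 fix x :: "real \<times> (real \<Rightarrow> (real^'k) \<times> (real^'d))" assume "x \<in> space ?M"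
 then obtain w p where x: "x = (w, p)" and p: "p \<in> cadlag_paths T"
  by (auto simp: space_pair_measure)
 let ?c = "clip t w"
 have less: "?c < (real_of_int (k n w) + 1) / real (Suc n)" for n
  unfolding k_def by (simp add: pos_less_divide_eq del: of_nat_Suc)
 have le: "(real_of_int (k n w) + 1) / real (Suc n) \<le> ?c + 1 / real (Suc n)" for n
 proof -
  have "real_of_int (k n w) \<le> ?c * real (Suc n)" unfolding k_def by linarith
  then show ?thesis by (simp add: field_simps del: of_nat_Suc)
 qed
 have "(\<lambda>n. p (g n w)) \<longlonglongrightarrow> p ?c"
 \<comment> \<open>At the right end the cut-off makes \<open>g n w\<close> equal to t for every n,
   so no right limit has to exist there; t may be T.\<close>
 proof (cases "?c = t")
  case True
  then have "g n w = ?c" for n using less[of n] t by (auto simp: g_def clip_def)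
  then show ?thesis by simp
 next
  case False
  then have c: "?c < t" "0 \<le> ?c" using clip_cases[of w] by auto
  have gt: "?c < g n w" for n
   using less[of n] c unfolding g_def clip_def[of t "_ / _"] by auto
  have g_le: "g n w \<le> ?c + 1 / real (Suc n)" for n
  proof -
   have "0 \<le> 1 / real (Suc n)" by simp
   then show ?thesis using le[of n] c unfolding g_def clip_def[of t "_ / _"] max_def min_def by argo
  qed
  have "(\<lambda>n. g n w) \<longlonglongrightarrow> ?c"
  proof (rule tendsto_sandwich[of "\<lambda>_. ?c" _ _ "\<lambda>n. ?c + 1 / real (Suc n)"])
   show "\<forall>\<^sub>F n in sequentially. g n w \<le> ?c + 1 / real (Suc n)"
    using g_le by (intro always_eventually allI)
   have "(\<lambda>n. ?c + 1 / real (Suc n)) \<longlonglongrightarrow> ?c + 0"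
    by (intro tendsto_intros LIMSEQ_Suc[OF lim_1_over_n])
   then show "(\<lambda>n. ?c + 1 / real (Suc n)) \<longlonglongrightarrow> ?c" by simp
  qed (use gt in \<open>auto intro!: always_eventually less_imp_le\<close>)
  then have "filterlim (\<lambda>n. g n w) (at_right ?c) sequentially"
   using gt by (auto simp: filterlim_at less_imp_neq[THEN not_sym] intro!: always_eventually)
  moreover have "(p \<longlongrightarrow> p ?c) (at_right ?c)"
   using p c t by (auto simp: cadlag_paths_def)
  ultimately show ?thesis by (rule filterlim_compose[rotated])
 qed
 then show "(\<lambda>n. ?u n x) \<longlonglongrightarrow> (\<lambda>(w, p). p (clip t w)) x" by (simp add: x)
qed

text \<open>On {r..t} the path agrees with its clipped version, which is jointly measurable with
  respect to F_t by \<open>progressive_eval\<close>.\<close>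

lemma filtration_integral:
 assumes t: "0 \<le> t" "t \<le> T" and [measurable]: "\<phi> \<in> borel_measurable borel" and "0 \<le> r"
 shows "(\<lambda>p. LBINT w:{r..t}. (\<phi> (p w) :: real)) \<in> borel_measurable (canonical_filtration T t)"
proof -
 have [measurable]: "(\<lambda>(w, p). p (clip t w)) \<in> borel_measurable (borel \<Otimes>\<^sub>M canonical_filtration T t)"
  by (rule progressive_eval[OF t])
 have "(\<lambda>(p, w). indicator {r..t} w *\<^sub>R \<phi> (p (clip t w)))
   \<in> borel_measurable (canonical_filtration T t \<Otimes>\<^sub>M lborel)"
  by (subst measurable_pair_swap_iff) (simp add: split_beta')
 then have "(\<lambda>p. LBINT w:{r..t}. \<phi> (p (clip t w))) \<in> borel_measurable (canonical_filtration T t)"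
  unfolding set_lebesgue_integral_def by (intro lborel.borel_measurable_lebesgue_integral) simp
 moreover have "(LBINT w:{r..t}. \<phi> (p (clip t w))) = (LBINT w:{r..t}. \<phi> (p w))" for p
  using \<open>0 \<le> r\<close> by (intro set_lebesgue_integral_cong) (auto simp: clip_def)
 ultimately show ?thesis by simp
qed

type_synonym ('k, 'd) path = "real \<Rightarrow> (real^'k) \<times> (real^'d)"

text \<open>Kept free of the martingale problem so that it can be interpreted a second time, at the
  reweighted measure.\<close>

locale path_law =
 fixes T :: real and P :: "(real \<Rightarrow> (real^'k) \<times> (real^'d)) measure"
 assumes T_pos: "0 < T" and prob_P: "prob_space P" and sets_P: "sets P = sets (path_space T)"
begin

sublocale prob_space P by (rule prob_P)

abbreviation \<P> where "\<P> \<equiv> (borel :: real measure) \<Otimes>\<^sub>M P"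

abbreviation joint where "joint X \<equiv> (\<lambda>(w, p). X w p) \<in> borel_measurable \<P>"

abbreviation F where "F \<equiv> canonical_filtration T"

abbreviation \<Omega> :: "(real \<Rightarrow> (real^'k) \<times> (real^'d)) set" where "\<Omega> \<equiv> cadlag_paths T"

lemma space_P [simp]: "space P = cadlag_paths T"
 using sets_eq_imp_space_eq[OF sets_P] by simp

lemma cadlag_paths_sets [measurable, simp]: "cadlag_paths T \<in> sets P"
 using sets.top[of P] by simp

lemma subalgebra_F: "t \<le> T \<Longrightarrow> subalgebra P (F t)"
 using filtration_path_space[of t T] by (auto simp: subalgebra_def sets_P)

lemma measurable_F_P: "f \<in> measurable (F t) N \<Longrightarrow> t \<le> T \<Longrightarrow> f \<in> measurable P N"
 using measurable_from_subalg[OF subalgebra_F] .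

lemma eval_measurable: "0 \<le> t \<Longrightarrow> t \<le> T \<Longrightarrow> (\<lambda>p. p t) \<in> borel_measurable P"
 by (rule measurable_F_P[OF filtration_eval]) auto

text \<open>Outside {0..T} every path takes the constant value \<open>undefined\<close>, so joint
  measurability extends from the horizon to the whole line.\<close>

lemma process_measurable [measurable]: "(\<lambda>(w, p). p w) \<in> borel_measurable \<P>"
proof -
 have F_T: "(\<lambda>(w, p). p (clip T w)) \<in> borel_measurable (borel \<Otimes>\<^sub>M F T)"
  using T_pos by (intro progressive_eval) auto
 have "(\<lambda>x. x) \<in> measurable P (F T)"
  using subalgebra_F[of T] by (auto simp: measurable_def subalgebra_def)
 then have "(\<lambda>x. (fst x, snd x)) \<in> measurable \<P> (borel \<Otimes>\<^sub>M F T)"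
  by (intro measurable_Pair measurable_fst measurable_compose[OF measurable_snd])
 from measurable_compose[OF this F_T]
 have [measurable]: "(\<lambda>(w, p). p (clip T w)) \<in> borel_measurable \<P>"
  by (simp only: prod.collapse)
 have "(\<lambda>x. if fst x \<in> {0..T} then (\<lambda>(w, p). p (clip T w)) x else undefined) \<in> borel_measurable \<P>"
  by measurable
 then show ?thesis
  by (rule measurable_cong[THEN iffD1, rotated])
    (auto simp: space_pair_measure cadlag_paths_def extensional_def clip_def)
qed

sublocale pair: pair_sigma_finite lborel P ..

lemma Fubini_bounded:
 fixes X :: "real \<Rightarrow> ('k, 'd) path \<Rightarrow> 'b::euclidean_space"
 assumes [measurable]: "joint X"
  and B: "\<And>w p. u \<le> w \<Longrightarrow> w \<le> v \<Longrightarrow> p \<in> cadlag_paths T \<Longrightarrow> norm (X w p) \<le> B"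
 shows "(\<integral>p. (LBINT w:{u..v}. X w p) \<partial>P) = (LBINT w:{u..v}. \<integral>p. X w p \<partial>P)"
  and "(\<lambda>p. LBINT w:{u..v}. X w p) \<in> borel_measurable P"
  and "\<And>p. p \<in> cadlag_paths T \<Longrightarrow> set_integrable lborel {u..v} (\<lambda>w. X w p)"
  and "\<And>p. p \<in> cadlag_paths T \<Longrightarrow> norm (LBINT w:{u..v}. X w p) \<le> B * max 0 (v - u)"
  and "set_integrable lborel {u..v} (\<lambda>w. \<integral>p. X w p \<partial>P)"
proof -
 have fin: "emeasure (lborel \<Otimes>\<^sub>M P) ({u..v} \<times> space P) < \<infinity>"
  by (subst emeasure_pair_measure_Times) (auto simp: emeasure_space_1 emeasure_lborel_Icc_eq ennreal_mult_less_top simp del: space_P)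
 have "set_integrable (lborel \<Otimes>\<^sub>M P) ({u..v} \<times> space P) (\<lambda>(w, p). X w p)"
  unfolding set_integrable_def
  by (rule integrableI_bounded_set[where A="{u..v} \<times> space P" and B=B])
    (use fin B in \<open>auto split: split_indicator\<close>)
 then have *: "integrable (lborel \<Otimes>\<^sub>M P) (\<lambda>(w, p). indicator {u..v} w *\<^sub>R X w p)"
  unfolding set_integrable_def
  by (rule Bochner_Integration.integrable_cong[THEN iffD1, rotated -1])
    (auto simp: space_pair_measure indicator_def)
 show "(\<integral>p. (LBINT w:{u..v}. X w p) \<partial>P) = (LBINT w:{u..v}. \<integral>p. X w p \<partial>P)"
  using pair.Fubini_integral[OF *] by (simp add: set_lebesgue_integral_def)
 show "set_integrable lborel {u..v} (\<lambda>w. \<integral>p. X w p \<partial>P)"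
  using pair.integrable_fst[OF *] by (simp add: set_integrable_def)
 show "(\<lambda>p. LBINT w:{u..v}. X w p) \<in> borel_measurable P"
  unfolding set_lebesgue_integral_def
  by (intro lborel.borel_measurable_lebesgue_integral) (subst measurable_pair_swap_iff, simp add: split_beta')
 fix p :: "('k, 'd) path" assume p: "p \<in> cadlag_paths T"
 have [measurable]: "(\<lambda>w. X w p) \<in> borel_measurable borel"
  using measurable_Pair_compose_split[OF assms(1), of "\<lambda>x. x" borel "\<lambda>_. p"] p by simp
 show si: "set_integrable lborel {u..v} (\<lambda>w. X w p)"
  unfolding set_integrable_def
  by (rule integrableI_bounded_set[where A="{u..v}" and B=B])
    (use B p in \<open>auto simp: indicator_def emeasure_lborel_Icc_eq split: if_splits\<close>)
 have "norm (LBINT w:{u..v}. X w p) \<le> (LBINT w:{u..v}. norm (X w p))"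
  by (rule set_integral_norm_bound[OF si])
 also have "\<dots> \<le> (LBINT w:{u..v}. B)"
  using B p by (intro set_integral_mono set_integrable_norm si)
    (auto simp: set_integrable_def emeasure_lborel_Icc_eq intro!: integrable_scaleR_left)
 also have "\<dots> = B * max 0 (v - u)"
  by (simp add: set_lebesgue_integral_def)
 finally show "norm (LBINT w:{u..v}. X w p) \<le> B * max 0 (v - u)" .
qed

lemma integrable_bdd:
 assumes "X \<in> borel_measurable P" "\<And>p. p \<in> cadlag_paths T \<Longrightarrow> norm (X p :: 'b::{banach, second_countable_topology}) \<le> B"
 shows "integrable P X"
 by (rule integrable_const_bound[where B=B]) (use assms in auto)

end

subsection \<open>Integrals over bounded intervals\<close>

lemma interval_integral_measurable:
 fixes f :: "'m \<Rightarrow> real \<Rightarrow> real"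
 assumes [measurable]: "a \<in> borel_measurable M" "c \<in> borel_measurable M" "(\<lambda>(y, x). f y x) \<in> borel_measurable (M \<Otimes>\<^sub>M borel)"
 shows "(\<lambda>y. LBINT x:{a y..c y}. f y x) \<in> borel_measurable M"
proof -
 have "(\<lambda>(y, x). if a y \<le> x \<and> x \<le> c y then f y x else 0) \<in> borel_measurable (M \<Otimes>\<^sub>M borel)"
  by measurable
 then have "(\<lambda>y. LBINT x. if a y \<le> x \<and> x \<le> c y then f y x else 0) \<in> borel_measurable M"
  by (intro lborel.borel_measurable_lebesgue_integral) (simp add: split_beta' cong: measurable_cong_sets)
 moreover have "(\<lambda>y. LBINT x:{a y..c y}. f y x) = (\<lambda>y. LBINT x. if a y \<le> x \<and> x \<le> c y then f y x else 0)"
  unfolding set_lebesgue_integral_def by (intro ext Bochner_Integration.integral_cong) auto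
 ultimately show ?thesis by simp
qed

lemma set_integrable_bdd:
 fixes f :: "real \<Rightarrow> 'b::{banach, second_countable_topology}"
 assumes [measurable]: "f \<in> borel_measurable borel" and "\<And>w. u \<le> w \<Longrightarrow> w \<le> v \<Longrightarrow> norm (f w) \<le> B"
 shows "set_integrable lborel {u..v} f"
 unfolding set_integrable_def
 by (rule integrableI_bounded_set[where A="{u..v}" and B=B])
   (use assms(2) in \<open>auto simp: indicator_def emeasure_lborel_Icc_eq split: if_splits\<close>)

lemma set_integrable_mult_bdd:
 fixes f g :: "real \<Rightarrow> real"
 assumes [measurable]: "f \<in> borel_measurable borel" "g \<in> borel_measurable borel"
  and f: "\<And>w. u \<le> w \<Longrightarrow> w \<le> v \<Longrightarrow> \<bar>f w\<bar> \<le> B" and g: "\<And>w. u \<le> w \<Longrightarrow> w \<le> v \<Longrightarrow> \<bar>g w\<bar> \<le> C"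
 shows "set_integrable lborel {u..v} (\<lambda>w. f w * g w)"
proof (rule set_integrable_bdd[where B="B * C"])
 show "norm (f w * g w) \<le> B * C" if "u \<le> w" "w \<le> v" for w
  using f[OF that] g[OF that] by (auto simp: abs_mult intro!: mult_mono)
qed measurable

lemma set_integral_bdd:
 fixes f :: "real \<Rightarrow> 'b::{banach, second_countable_topology}"
 assumes [measurable]: "f \<in> borel_measurable borel" and B: "\<And>w. u \<le> w \<Longrightarrow> w \<le> v \<Longrightarrow> norm (f w) \<le> B"
  and "u \<le> v"
 shows "norm (LBINT w:{u..v}. f w) \<le> B * (v - u)"
proof -
 have si: "set_integrable lborel {u..v} f" by (rule set_integrable_bdd[OF assms(1) B])
 have "norm (LBINT w:{u..v}. f w) \<le> (LBINT w:{u..v}. norm (f w))"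
  by (rule set_integral_norm_bound[OF si])
 also have "\<dots> \<le> (LBINT w:{u..v}. B)"
  using B by (intro set_integral_mono set_integrable_norm si)
    (auto simp: set_integrable_def emeasure_lborel_Icc_eq intro!: integrable_scaleR_left)
 also have "\<dots> = B * (v - u)"
  using \<open>u \<le> v\<close> by (simp add: set_lebesgue_integral_def)
 finally show ?thesis .
qed

lemma set_integral_split:
 fixes f :: "real \<Rightarrow> 'b::{banach, second_countable_topology}"
 assumes "set_integrable lborel {a..c} f" "a \<le> b" "b \<le> c"
 shows "(LBINT w:{a..c}. f w) = (LBINT w:{a..b}. f w) + (LBINT w:{b..c}. f w)"
proof -
 have sub: "set_integrable lborel {a..b} f" "set_integrable lborel {b..c} f"
  using assms by (auto intro: set_integrable_subset)
 have "AE w in lborel. w \<notin> {b}" by (rule AE_not_in) (simp add: null_sets_def)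
 then have *: "AE w in lborel. \<not> (w \<in> {a..b} \<and> w \<in> {b..c})" by (rule AE_mp) auto
 have "{a..c} = {a..b} \<union> {b..c}" using assms by auto
 then show ?thesis using set_integral_Un_AE[OF * _ _ sub] by simp
qed

text \<open>Both sides are the integral of a(w) g(x) over the triangle s \<le> w \<le> x \<le>
  t.\<close>

lemma triangle_Fubini:
 fixes a g :: "real \<Rightarrow> real"
 assumes [measurable]: "a \<in> borel_measurable borel" "g \<in> borel_measurable borel"
  and "\<And>w. s \<le> w \<Longrightarrow> w \<le> t \<Longrightarrow> \<bar>a w\<bar> \<le> B" "\<And>w. s \<le> w \<Longrightarrow> w \<le> t \<Longrightarrow> \<bar>g w\<bar> \<le> C"
 shows "(LBINT w:{s..t}. a w * (LBINT x:{w..t}. g x)) = (LBINT x:{s..t}. g x * (LBINT w:{s..x}. a w))"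
proof -
 let ?f = "\<lambda>(w, x). indicator {z \<in> {s..t} \<times> {s..t}. fst z \<le> snd z} (w, x) *\<^sub>R (a w * g x)"
 have [measurable]: "{z \<in> {s..t} \<times> {s..t}. fst z \<le> snd z} \<in> sets (borel \<Otimes>\<^sub>M (borel :: real measure))"
  by measurable
 have fin: "emeasure (lborel \<Otimes>\<^sub>M lborel) {z \<in> {s..t} \<times> {s..t}. fst z \<le> snd z} < \<infinity>"
 proof -
  have "emeasure (lborel \<Otimes>\<^sub>M lborel) {z \<in> {s..t} \<times> {s..t}. fst z \<le> snd z}
   \<le> emeasure (lborel \<Otimes>\<^sub>M lborel) ({s..t} \<times> {s..t})"
   by (rule emeasure_mono) auto
  also have "\<dots> < \<infinity>"
   by (subst lborel.emeasure_pair_measure_Times) (auto simp: emeasure_lborel_Icc_eq ennreal_mult_less_top)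
  finally show ?thesis .
 qed
 have "norm (a w * g x) \<le> B * C" if "s \<le> w" "w \<le> t" "s \<le> x" "x \<le> t" for w x
  using assms(3)[of w] assms(4)[of x] that unfolding real_norm_def abs_mult
  by (intro mult_mono) auto
 then have int: "integrable (lborel \<Otimes>\<^sub>M lborel) ?f"
  by (intro integrableI_bounded_set[where A="{z \<in> {s..t} \<times> {s..t}. fst z \<le> snd z}" and B="B * C"])
    (use fin in \<open>auto simp: split_beta' indicator_def\<close>)
 have "(LBINT w:{s..t}. a w * (LBINT x:{w..t}. g x)) = (LBINT w. (LBINT x. ?f (w, x)))"
  unfolding set_lebesgue_integral_def
  by (intro Bochner_Integration.integral_cong)
    (auto simp flip: integral_mult_right_zero split: split_indicator intro!: Bochner_Integration.integral_cong)
 also have "\<dots> = (LBINT x. (LBINT w. ?f (w, x)))"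
  using lborel_pair.Fubini_integral[OF int] by simp
 also have "\<dots> = (LBINT x:{s..t}. g x * (LBINT w:{s..x}. a w))"
  unfolding set_lebesgue_integral_def
  by (intro Bochner_Integration.integral_cong)
    (auto simp flip: integral_mult_right_zero split: split_indicator intro!: Bochner_Integration.integral_cong)
 finally show ?thesis .
qed

lemma interval_dct:
 fixes f :: "nat \<Rightarrow> real \<Rightarrow> real"
 assumes "\<And>k. f k \<in> borel_measurable borel" "g \<in> borel_measurable borel"
  and "\<And>k w. u \<le> w \<Longrightarrow> w \<le> v \<Longrightarrow> \<bar>f k w\<bar> \<le> C"
  and "AE w\<in>{u..v} in lborel. (\<lambda>k. f k w) \<longlonglongrightarrow> g w"
 shows "(\<lambda>k. LBINT w:{u..v}. f k w) \<longlonglongrightarrow> (LBINT w:{u..v}. g w)"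
 unfolding set_lebesgue_integral_def
proof (rule integral_dominated_convergence[where w="\<lambda>w. indicator {u..v} w *\<^sub>R C"])
 show "integrable lborel (\<lambda>w. indicator {u..v} w *\<^sub>R C)"
  by (intro integrable_scaleR_left) (simp add: emeasure_lborel_Icc_eq)
 show "AE w in lborel. (\<lambda>k. indicator {u..v} w *\<^sub>R f k w) \<longlonglongrightarrow> indicator {u..v} w *\<^sub>R g w"
  using assms(4) by (rule AE_mp) (auto split: split_indicator)
qed (use assms(1-3) in \<open>auto split: split_indicator\<close>)

text \<open>As v is merely bounded and measurable, V need not be differentiable everywhere, and the
  chain rule is replaced by the power series: \<open>triangle_Fubini\<close> gives the integral of v
  V^n as V^(n+1) / (n+1), and the exponential series is integrated term by term.\<close>

lemma exp_integral_ftc: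
 fixes v :: "real \<Rightarrow> real"
 assumes [measurable]: "v \<in> borel_measurable borel" and B: "\<And>w. r \<le> w \<Longrightarrow> w \<le> t \<Longrightarrow> \<bar>v w\<bar> \<le> B"
  and rt: "r \<le> t"
 defines "V \<equiv> \<lambda>u. LBINT w:{r..u}. v w"
 shows "(LBINT w:{r..t}. v w * exp (V w)) = exp (V t) - 1"
proof -
 have B0: "B \<ge> 0" using B[of r] rt by auto
 have V[measurable]: "V \<in> borel_measurable borel"
  unfolding V_def by (rule interval_integral_measurable) measurable
 define L where "L = B * (t - r)"
 have VL: "\<bar>V x\<bar> \<le> L" if "r \<le> x" "x \<le> t" for x
  unfolding V_def L_def real_norm_def[symmetric]
  using that B B0 by (intro order_trans[OF set_integral_bdd[of v r x B] mult_left_mono]) auto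
 have b: "\<bar>v w * V w ^ n\<bar> \<le> B * L ^ n" if "r \<le> w" "w \<le> t" for w n
  unfolding abs_mult power_abs using that B VL B0 by (intro mult_mono power_mono) auto
 have si: "set_integrable lborel {r..x} (\<lambda>w. v w * V w ^ n)" if "x \<le> t" for x n
  by (rule set_integrable_bdd[where B="B * L ^ n"]) (use b that in auto)
 have pow: "(LBINT w:{r..x}. v w * V w ^ n) = V x ^ Suc n / real (Suc n)" if x: "r \<le> x" "x \<le> t" for n x
  using x
 proof (induction n arbitrary: x)
  case (Suc n)
  let ?N = "real (Suc n)"
  have tail: "(LBINT y:{w..x}. v y * V y ^ n) = (V x ^ Suc n - V w ^ Suc n) / ?N" if "r \<le> w" "w \<le> x" for w
   using set_integral_split[OF si[of x n] that] Suc that by (simp add: diff_divide_distrib)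
  have "(LBINT w:{r..x}. v w * V w ^ Suc n) = (LBINT y:{r..x}. (v y * V y ^ n) * (LBINT w:{r..y}. v w))"
   by (simp add: V_def mult_ac)
  also have "\<dots> = (LBINT w:{r..x}. v w * (LBINT y:{w..x}. v y * V y ^ n))"
   by (rule triangle_Fubini[where B=B and C="B * L ^ n", symmetric]) (use B b Suc.prems in auto)
  also have "\<dots> = (LBINT w:{r..x}. V x ^ Suc n / ?N * v w - v w * V w ^ Suc n / ?N)"
   by (intro set_lebesgue_integral_cong) (auto simp: tail algebra_simps diff_divide_distrib simp del: power_Suc of_nat_Suc)
  also have "\<dots> = V x ^ Suc n / ?N * V x - (LBINT w:{r..x}. v w * V w ^ Suc n) / ?N"
   using si[OF Suc.prems(2), of 0] si[OF Suc.prems(2), of "Suc n"]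
   by (subst set_integral_diff(2)) (auto simp: V_def simp del: power_Suc of_nat_Suc)
  \<comment> \<open>The integral sought occurs again on the right, divided by n + 1; solving for it
    yields the denominator n + 2 of the next power.\<close>
  finally have "(LBINT w:{r..x}. v w * V w ^ Suc n) * (?N + 1) = V x ^ Suc n * V x"
   by (simp add: eq_divide_eq distrib_left diff_divide_eq_iff del: power_Suc of_nat_Suc flip: diff_divide_distrib)
  then show ?case by (simp add: eq_divide_eq mult_ac)
 qed (simp add: V_def)
 let ?S = "\<lambda>N w. \<Sum>n<N. v w * V w ^ n / fact n"
 have "(\<lambda>N. LBINT w:{r..t}. ?S N w) \<longlonglongrightarrow> (LBINT w:{r..t}. v w * exp (V w))"
 proof (rule interval_dct[where C="B * exp L"])
  fix N w assume w: "r \<le> w" "w \<le> t"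
  have "\<bar>?S N w\<bar> \<le> (\<Sum>n<N. B * (L ^ n / fact n))"
   using b[OF w] by (intro order_trans[OF sum_abs sum_mono]) (auto simp: divide_right_mono)
  also have "\<dots> = B * (\<Sum>n<N. L ^ n / fact n)" by (simp add: sum_distrib_left)
  also have "\<dots> \<le> B * exp L"
  proof (intro mult_left_mono B0)
   have "0 \<le> L" using VL[OF w] by linarith
   then show "(\<Sum>n<N. L ^ n / fact n) \<le> exp L"
    using sum_le_suminf[of "\<lambda>n. L ^ n /\<^sub>R fact n" "{..<N}"] summable_exp_generic[of L]
    by (simp add: exp_def divide_inverse_commute)
  qed
  finally show "\<bar>?S N w\<bar> \<le> B * exp L" .
 next
  have "(\<lambda>N. ?S N w) \<longlonglongrightarrow> v w * exp (V w)" for w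
   using sums_mult[OF exp_converges[of "V w"], of "v w"] by (simp add: sums_def divide_inverse_commute mult_ac)
  then show "AE w\<in>{r..t} in lborel. (\<lambda>N. ?S N w) \<longlonglongrightarrow> v w * exp (V w)" by simp
 qed measurable
 moreover have "(LBINT w:{r..t}. ?S N w) = (\<Sum>n<N. V t ^ Suc n / fact (Suc n))" for N
 proof -
  have "(LBINT w:{r..t}. ?S N w) = (\<Sum>n<N. LBINT w:{r..t}. v w * V w ^ n / fact n)"
   using set_integrable_divide[OF si[OF order_refl]]
   unfolding set_lebesgue_integral_def set_integrable_def scaleR_sum_right by (intro Bochner_Integration.integral_sum) blast
  then show ?thesis using rt by (simp add: pow mult.commute del: power_Suc of_nat_Suc)
 qed
 ultimately have "(\<lambda>n. V t ^ Suc n / fact (Suc n)) sums (LBINT w:{r..t}. v w * exp (V w))" by (simp add: sums_def)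
 moreover have "(\<lambda>n. V t ^ Suc n / fact (Suc n)) sums (exp (V t) - 1)"
  using exp_converges[of "V t"] by (subst sums_Suc_iff) (simp add: divide_inverse_commute)
 ultimately show ?thesis by (rule sums_unique2)
qed

subsection \<open>The martingale problem in integrated form\<close>

text \<open>The generator at one point z with the drift \<beta> and the vector \<kappa> of jump
  rates as plain values, \<open>\<kappa> $ j\<close> being the rate of going to j. In this form the
  coefficients may be random and depend on time.\<close>

definition gen :: "real \<Rightarrow> ('k \<Rightarrow> real^'d \<Rightarrow> real) \<Rightarrow> real^'d \<Rightarrow> real^'k \<Rightarrow> (real^'k) \<times> (real^'d) \<Rightarrow> real" where
 "gen \<epsilon> \<phi> \<beta> \<kappa> z = \<beta> \<bullet> lift (\<lambda>i. gradient (\<phi> i)) z + \<epsilon>\<^sup>2 / 2 * lift (\<lambda>i. laplacian (\<phi> i)) z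
   + (\<Sum>j\<in>UNIV. (\<phi> j (snd z) - lift \<phi> z) * \<kappa> $ j)"

lemma tf_smooth: "tf \<phi> \<Longrightarrow> smooth (\<phi> i)"
 by (simp add: tf_def)

lemma tf_bounded:
 fixes \<phi> :: "'k::finite \<Rightarrow> real^'d \<Rightarrow> real"
 assumes "tf \<phi>"
 obtains C where "C \<ge> 0" "\<And>i y. \<bar>\<phi> i y\<bar> \<le> C" "\<And>i y. norm (gradient (\<phi> i) y) \<le> C" "\<And>i y. \<bar>laplacian (\<phi> i) y\<bar> \<le> C"
proof -
 have "\<forall>i. \<exists>B\<ge>0. \<forall>y. \<bar>\<phi> i y\<bar> \<le> B \<and> norm (gradient (\<phi> i) y) \<le> B \<and> \<bar>laplacian (\<phi> i) y\<bar> \<le> B"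
  using assms unfolding tf_def by (metis test_bounded)
 then obtain B where B: "\<And>i. B i \<ge> 0"
   "\<And>i y. \<bar>\<phi> i y\<bar> \<le> B i \<and> norm (gradient (\<phi> i) y) \<le> B i \<and> \<bar>laplacian (\<phi> i) y\<bar> \<le> B i" by metis
 have "B i \<le> (\<Sum>i\<in>UNIV. B i)" for i by (rule member_le_sum) (auto simp: B(1))
 then show thesis
  using B(2) order_trans sum_nonneg[of UNIV B] B(1) by (intro that[of "\<Sum>i\<in>UNIV. B i"]) blast+
qed

lemma tf_continuous:
 assumes "tf \<phi>"
 shows "continuous_on UNIV (\<phi> i)" "continuous_on UNIV (gradient (\<phi> i))" "continuous_on UNIV (laplacian (\<phi> i))"
 using assms by (auto simp: tf_def intro!: smooth_continuous gradient_continuous laplacian_continuous)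

lemma tf_measurable [measurable]:
 fixes \<phi> :: "'k::finite \<Rightarrow> real^'d \<Rightarrow> real"
 assumes "tf \<phi>"
 shows "\<phi> i \<in> borel_measurable borel" "gradient (\<phi> i) \<in> borel_measurable borel" "laplacian (\<phi> i) \<in> borel_measurable borel"
  "lift \<phi> \<in> borel_measurable borel"
 using tf_continuous[OF assms] by (auto intro!: borel_measurable_continuous_onI measurable_lift)

lemma gen_measurable:
 fixes \<phi> :: "'k::finite \<Rightarrow> real^'d \<Rightarrow> real"
 assumes "tf \<phi>"
  and [measurable]: "\<beta> \<in> borel_measurable M" "\<kappa> \<in> borel_measurable M" "Z \<in> borel_measurable M"
 shows "(\<lambda>x. gen \<epsilon> \<phi> (\<beta> x) (\<kappa> x) (Z x)) \<in> borel_measurable M"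
proof -
 note [measurable] = tf_measurable[OF assms(1)]
 have [measurable]: "snd \<in> borel_measurable (borel :: ((real^'k) \<times> (real^'d)) measure)"
  by (intro borel_measurable_continuous_onI continuous_intros)
 show ?thesis unfolding gen_def by measurable
qed

lemma gen_bound:
 fixes \<phi> :: "'k::finite \<Rightarrow> real^'d \<Rightarrow> real"
 assumes "tf \<phi>"
 obtains C where "C \<ge> 0"
  "\<And>\<beta> \<kappa> z. z \<in> state_space \<Longrightarrow> \<bar>gen \<epsilon> \<phi> \<beta> \<kappa> z\<bar> \<le> C * (1 + norm \<beta> + norm \<kappa>)"
proof -
 obtain C where C: "C \<ge> 0" "\<And>i y. \<bar>\<phi> i y\<bar> \<le> C" "\<And>i y. norm (gradient (\<phi> i) y) \<le> C" "\<And>i y. \<bar>laplacian (\<phi> i) y\<bar> \<le> C"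
  using tf_bounded[OF assms] by blast
 let ?K = "1 + 2 * real CARD('k) + \<epsilon>\<^sup>2 / 2"
 show thesis
 proof (rule that[of "C * ?K"])
  show "0 \<le> C * ?K" using C(1) by simp
  fix \<beta> \<kappa> and z :: "(real^'k) \<times> (real^'d)" assume z: "z \<in> state_space"
  have "\<bar>\<beta> \<bullet> lift (\<lambda>i. gradient (\<phi> i)) z\<bar> \<le> norm \<beta> * C"
   using z C by (intro order_trans[OF Cauchy_Schwarz_ineq2 mult_left_mono] norm_lift_le) auto
  moreover have "\<bar>\<Sum>j\<in>UNIV. (\<phi> j (snd z) - lift \<phi> z) * \<kappa> $ j\<bar> \<le> (\<Sum>j\<in>(UNIV::'k set). 2 * C * norm \<kappa>)"
  proof (rule order_trans[OF sum_abs sum_mono])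
   fix j
   have "\<bar>lift \<phi> z\<bar> \<le> C" using norm_lift_le[OF z, of \<phi> C] C(2) by simp
   then have "\<bar>\<phi> j (snd z) - lift \<phi> z\<bar> \<le> 2 * C" using C(2)[of j "snd z"] by linarith
   then show "\<bar>(\<phi> j (snd z) - lift \<phi> z) * \<kappa> $ j\<bar> \<le> 2 * C * norm \<kappa>"
    unfolding abs_mult using component_le_norm_cart[of \<kappa> j] C(1) by (intro mult_mono) auto
  qed
  moreover have "\<bar>\<epsilon>\<^sup>2 / 2 * lift (\<lambda>i. laplacian (\<phi> i)) z\<bar> \<le> \<epsilon>\<^sup>2 / 2 * C"
   using norm_lift_le[OF z, of "\<lambda>i. laplacian (\<phi> i)" C] C(4) by (simp add: abs_mult mult_left_mono)
  ultimately have "\<bar>gen \<epsilon> \<phi> \<beta> \<kappa> z\<bar> \<le> C * (norm \<beta> + 2 * real CARD('k) * norm \<kappa> + \<epsilon>\<^sup>2 / 2)"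
   unfolding gen_def by (simp add: algebra_simps)
  also have "\<dots> \<le> C * (?K * norm \<beta> + ?K * norm \<kappa> + ?K * 1)"
   by (intro mult_left_mono C(1) add_mono mult_right_mono) (auto simp: mult_right_mono intro: mult_right_mono[of 1 ?K, simplified])
  also have "\<dots> = C * ?K * (1 + norm \<beta> + norm \<kappa>)" by algebra
  finally show "\<bar>gen \<epsilon> \<phi> \<beta> \<kappa> z\<bar> \<le> C * ?K * (1 + norm \<beta> + norm \<kappa>)" .
 qed
qed

context path_law begin

lemma path_section_measurable:
 assumes "(\<lambda>(w, p). X w p) \<in> measurable \<P> N" "p \<in> cadlag_paths T"
 shows "(\<lambda>w. X w p) \<in> measurable borel N"
 using measurable_Pair_compose_split[OF assms(1), of "\<lambda>x. x" borel "\<lambda>_. p"] assms(2) by simp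

lemma time_section_measurable:
 assumes "(\<lambda>(w, p). X w p) \<in> measurable \<P> N"
 shows "X w \<in> measurable P N"
 using measurable_Pair_compose_split[OF assms, of "\<lambda>_. w" P "\<lambda>x. x"] by simp

lemma path_measurable: "p \<in> \<Omega> \<Longrightarrow> p \<in> borel_measurable borel"
 by (rule path_section_measurable[where X="\<lambda>w p. p w", OF process_measurable])

end

text \<open>\<open>mp\<close> is the martingale property tested against bounded weights known at
  time u, which keeps conditional expectations out of the computations. \<open>q i y $ j\<close>
  stands for the rate from i to j.\<close>

locale diffusion = path_law T P for T and P :: "(real \<Rightarrow> (real^'k) \<times> (real^'d)) measure" +
 fixes \<epsilon> :: real and b :: "'k \<Rightarrow> real^'d \<Rightarrow> real^'d" and q :: "'k \<Rightarrow> real^'d \<Rightarrow> real^'k" and B :: real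
 assumes b_measurable [measurable]: "\<And>i. b i \<in> borel_measurable borel"
  and q_measurable [measurable]: "\<And>i. q i \<in> borel_measurable borel"
  and b_bound: "\<And>i y. norm (b i y) \<le> B" and q_bound: "\<And>i y. norm (q i y) \<le> B"
  and mp: "\<And>\<phi> u v W C. tf \<phi> \<Longrightarrow> 0 \<le> u \<Longrightarrow> u \<le> v \<Longrightarrow> v \<le> T \<Longrightarrow>
   W \<in> borel_measurable (canonical_filtration T u) \<Longrightarrow> (\<And>p. p \<in> cadlag_paths T \<Longrightarrow> \<bar>W p\<bar> \<le> C) \<Longrightarrow>
   (\<integral>p. W p * (lift \<phi> (p v) - lift \<phi> (p u)
     - (LBINT w:{u..v}. gen \<epsilon> \<phi> (lift b (p w)) (lift q (p w)) (p w))) \<partial>P) = 0"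
begin

abbreviation gen_at where
 "gen_at \<phi> \<beta> \<kappa> w p \<equiv> gen \<epsilon> \<phi> (\<beta> w p) (\<kappa> w p) (p w)"

abbreviation gen_of where
 "gen_of \<phi> \<beta> \<kappa> z \<equiv> gen \<epsilon> \<phi> (\<beta> z) (\<kappa> z) z"

lemma B_nonneg: "0 \<le> B"
 using b_bound norm_ge_zero order_trans by blast

lemma gen_process:
 assumes "tf \<phi>"
 obtains C where "C \<ge> 0"
  "\<And>w p. 0 \<le> w \<Longrightarrow> w \<le> T \<Longrightarrow> p \<in> \<Omega> \<Longrightarrow> \<bar>gen_of \<phi> (lift b) (lift q) (p w)\<bar> \<le> C"
  "\<And>w p. 0 \<le> w \<Longrightarrow> w \<le> T \<Longrightarrow> p \<in> \<Omega> \<Longrightarrow> \<bar>lift \<phi> (p w)\<bar> \<le> C"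
  "(\<lambda>(w, p). gen_of \<phi> (lift b) (lift q) (p w)) \<in> borel_measurable \<P>"
  "(\<lambda>(w, p). lift \<phi> (p w)) \<in> borel_measurable \<P>"
proof -
 obtain C where C: "C \<ge> 0" "\<And>\<beta> \<kappa> z. z \<in> state_space \<Longrightarrow> \<bar>gen \<epsilon> \<phi> \<beta> \<kappa> z\<bar> \<le> C * (1 + norm \<beta> + norm \<kappa>)"
  using gen_bound[OF assms] by metis
 obtain C' where C': "C' \<ge> 0" "\<And>i y. \<bar>\<phi> i y\<bar> \<le> C'" using tf_bounded[OF assms] by metis
 note [measurable] = tf_measurable[OF assms]
 have m: "(\<lambda>x. snd x (fst x)) \<in> borel_measurable \<P>"
  using process_measurable by (simp add: split_beta')
 show thesis
 proof (rule that[of "C * (1 + B + B) + C'"])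
  show "0 \<le> C * (1 + B + B) + C'" using C C' B_nonneg by simp
  show "(\<lambda>(w, p). gen_of \<phi> (lift b) (lift q) (p w)) \<in> borel_measurable \<P>"
   unfolding split_beta' by (intro gen_measurable assms measurable_compose[OF m] measurable_lift) measurable
  show "(\<lambda>(w, p). lift \<phi> (p w)) \<in> borel_measurable \<P>"
   unfolding split_beta' by (intro measurable_compose[OF m]) measurable
  fix w p assume "0 \<le> w" "w \<le> T" "p \<in> (cadlag_paths T :: ('k, 'd) path set)"
  then have z: "p w \<in> state_space" by (simp add: cadlag_in_state_space)
  have n: "norm (lift b (p w)) \<le> B" "norm (lift q (p w)) \<le> B"
   using norm_lift_le[OF z] b_bound q_bound by auto
  have "\<bar>gen_of \<phi> (lift b) (lift q) (p w)\<bar> \<le> C * (1 + norm (lift b (p w)) + norm (lift q (p w)))"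
   by (rule C(2)[OF z])
  also have "\<dots> \<le> C * (1 + B + B)" using n C(1) by (intro mult_left_mono) auto
  finally show "\<bar>gen_of \<phi> (lift b) (lift q) (p w)\<bar> \<le> C * (1 + B + B) + C'"
   using C' by simp
  show "\<bar>lift \<phi> (p w)\<bar> \<le> C * (1 + B + B) + C'"
   using norm_lift_le[OF z, of \<phi> C'] C' C B_nonneg by (simp add: add_increasing)
 qed
qed

lemma adapted_eval: "0 \<le> w \<Longrightarrow> \<phi> \<in> borel_measurable borel \<Longrightarrow> (\<lambda>p. \<phi> (p w)) \<in> borel_measurable (F w)"
 using measurable_compose[OF filtration_eval[of w w]] by auto

text \<open>Integration by parts for a test function of the process times an absolutely continuous
 adapted process; both parts of the martingale problem and of the drift are handled by Fubini.\<close>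

lemma product_rule:
 assumes \<psi>: "tf \<psi>" and st: "0 \<le> s" "s \<le> t" "t \<le> T"
  and a_m: "joint a"
  and A_m: "joint A"
  and a_F: "\<And>w. s \<le> w \<Longrightarrow> w \<le> t \<Longrightarrow> a w \<in> borel_measurable (F w)"
  and A_F: "A s \<in> borel_measurable (F s)"
  and a_b: "\<And>w p. s \<le> w \<Longrightarrow> w \<le> t \<Longrightarrow> p \<in> \<Omega> \<Longrightarrow> \<bar>a w p\<bar> \<le> K"
  and A_b: "\<And>w p. s \<le> w \<Longrightarrow> w \<le> t \<Longrightarrow> p \<in> \<Omega> \<Longrightarrow> \<bar>A w p\<bar> \<le> K"
  and ftc: "\<And>x p. s \<le> x \<Longrightarrow> x \<le> t \<Longrightarrow> p \<in> \<Omega> \<Longrightarrow> (LBINT w:{s..x}. a w p) = A x p - A s p"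
  and W_F: "W \<in> borel_measurable (F s)" and W_b: "\<And>p. p \<in> \<Omega> \<Longrightarrow> \<bar>W p\<bar> \<le> L"
 shows "(\<integral>p. W p * (A t p * lift \<psi> (p t) - A s p * lift \<psi> (p s)
   - (LBINT w:{s..t}. a w p * lift \<psi> (p w) + A w p * gen_of \<psi> (lift b) (lift q) (p w))) \<partial>P) = 0"
proof -
 obtain C where C: "C \<ge> 0"
  "\<And>w p. 0 \<le> w \<Longrightarrow> w \<le> T \<Longrightarrow> p \<in> \<Omega> \<Longrightarrow> \<bar>gen_of \<psi> (lift b) (lift q) (p w)\<bar> \<le> C"
  "\<And>w p. 0 \<le> w \<Longrightarrow> w \<le> T \<Longrightarrow> p \<in> \<Omega> \<Longrightarrow> \<bar>lift \<psi> (p w)\<bar> \<le> C"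
  and g_m: "(\<lambda>(w, p). gen_of \<psi> (lift b) (lift q) (p w)) \<in> borel_measurable \<P>"
  and f_m: "(\<lambda>(w, p). lift \<psi> (p w)) \<in> borel_measurable \<P>"
  by (rule gen_process[OF \<psi>]) blast
 define g where "g w p = gen_of \<psi> (lift b) (lift q) (p w)" for w :: real and p
 define f where "f w p = lift \<psi> (p w)" for w :: real and p
 note [measurable] = a_m A_m
 have [measurable]: "joint g" using g_m by (simp add: g_def)
 have [measurable]: "joint f" using f_m by (simp add: f_def)
 have [measurable]: "W \<in> borel_measurable P" using W_F st by (auto intro: measurable_F_P)
 have [measurable]: "A w \<in> borel_measurable P" "f w \<in> borel_measurable P" for w
  by (rule time_section_measurable, measurable)+
 have g_b: "\<bar>g w p\<bar> \<le> C" "\<bar>f w p\<bar> \<le> C" if "s \<le> w" "w \<le> t" "p \<in> \<Omega>" for w p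
  using C st that by (auto simp: g_def f_def)
 define I where "I w p = (LBINT x:{w..t}. g x p)" for w p
 have I_m[measurable]: "joint I"
  unfolding I_def split_beta' by (rule interval_integral_measurable) measurable
 have gi: "set_integrable lborel {x..t} (\<lambda>w. g w p)" if "s \<le> x" "p \<in> \<Omega>" for x p
  by (rule Fubini_bounded(3)[where B=C]) (use g_b that in auto)
 have I_b: "\<bar>I w p\<bar> \<le> C * (t - s)" if "s \<le> w" "w \<le> t" "p \<in> \<Omega>" for w p
 proof -
  have "\<bar>I w p\<bar> \<le> C * (t - w)"
   unfolding I_def real_norm_def[symmetric] using that g_b
   by (intro set_integral_bdd path_section_measurable[of g]) auto
  also have "\<dots> \<le> C * (t - s)" using that C(1) by (intro mult_left_mono) auto
  finally show ?thesis .
 qed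
 have K0: "0 \<le> K" "0 \<le> L" if "p \<in> \<Omega>" for p
  using a_b[of s p] W_b[of p] st that by auto
 \<comment> \<open>Write A_t - A_s as the integral of a. What remains of A_t f_t - A_s f_s, apart
   from A_s (f_t - f_s), pairs a(w) with the increment of f from w to t; once centred, this has
   expectation zero against the F_w-measurable weight W a(w), for each w.\<close>
 define X where "X w p = W p * a w p * (f t p - f w p - I w p)" for w p
 have X_m[measurable]: "joint X"
  unfolding X_def by measurable
 have X_b: "norm (X w p) \<le> L * K * (2 * C + C * (t - s))" if "s \<le> w" "w \<le> t" "p \<in> \<Omega>" for w p
 proof -
  have "\<bar>f t p - f w p - I w p\<bar> \<le> 2 * C + C * (t - s)"
   using g_b(2)[of t p] g_b(2)[of w p] I_b[of w p] that st by auto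
  moreover have "\<bar>W p * a w p\<bar> \<le> L * K"
   unfolding abs_mult using W_b a_b that K0 by (intro mult_mono) auto
  ultimately show ?thesis
   unfolding X_def real_norm_def abs_mult[of "_ * _" "_ - _"] using K0[OF that(3)] by (intro mult_mono) auto
 qed
 have EX: "(\<integral>p. X w p \<partial>P) = 0" if "s \<le> w" "w \<le> t" for w
 proof -
  have "(\<lambda>p. W p * a w p) \<in> borel_measurable (F w)"
   by (intro borel_measurable_times measurable_filtration_mono[OF W_F that(1)] a_F[OF that])
  moreover have "\<bar>W p * a w p\<bar> \<le> L * K" if "p \<in> \<Omega>" for p
   unfolding abs_mult using W_b a_b that \<open>s \<le> w\<close> \<open>w \<le> t\<close> K0 by (intro mult_mono) auto
  ultimately show ?thesis
   using mp[OF \<psi>, of w t "\<lambda>p. W p * a w p" "L * K"] that st by (simp add: X_def f_def g_def I_def)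
 qed
 have 1: "(\<integral>p. (LBINT w:{s..t}. X w p) \<partial>P) = 0"
  using EX by (subst Fubini_bounded(1)[OF X_m X_b]) (auto simp: set_lebesgue_integral_def intro!: integral_eq_zero_AE split: split_indicator)
 have WA: "\<bar>W p * A s p\<bar> \<le> L * K" if "p \<in> \<Omega>" for p
  unfolding abs_mult using W_b A_b that st K0 by (intro mult_mono) auto
 have 2: "(\<integral>p. W p * A s p * (f t p - f s p - I s p) \<partial>P) = 0"
  using mp[OF \<psi> st borel_measurable_times[OF W_F A_F] WA] by (simp add: f_def g_def I_def)
 have int1: "integrable P (\<lambda>p. LBINT w:{s..t}. X w p)"
  by (rule integrable_bdd[OF Fubini_bounded(2)[OF X_m X_b] Fubini_bounded(4)[OF X_m X_b]])
 have I_mP[measurable]: "I s \<in> borel_measurable P"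
  by (rule time_section_measurable[OF I_m])
 have int2: "integrable P (\<lambda>p. W p * A s p * (f t p - f s p - I s p))"
 proof (rule integrable_bdd)
  fix p :: "('k, 'd) path" assume p: "p \<in> \<Omega>"
  have "\<bar>f t p - f s p - I s p\<bar> \<le> 2 * C + C * (t - s)"
   using g_b(2)[of t p] g_b(2)[of s p] I_b[of s p] p st by auto
  then show "norm (W p * A s p * (f t p - f s p - I s p)) \<le> L * K * (2 * C + C * (t - s))"
   unfolding real_norm_def abs_mult[of "_ * _" "_ - _"] using K0[OF p] WA[OF p] by (intro mult_mono) auto
 qed measurable
 have key: "W p * (A t p * f t p - A s p * f s p - (LBINT w:{s..t}. a w p * f w p + A w p * g w p))
   = W p * A s p * (f t p - f s p - I s p) + (LBINT w:{s..t}. X w p)" if p: "p \<in> \<Omega>" for p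
 proof -
  have [measurable]: "(\<lambda>w. a w p) \<in> borel_measurable borel" "(\<lambda>w. A w p) \<in> borel_measurable borel"
   "(\<lambda>w. g w p) \<in> borel_measurable borel" "(\<lambda>w. f w p) \<in> borel_measurable borel" "(\<lambda>w. I w p) \<in> borel_measurable borel"
   by (auto intro!: path_section_measurable[OF _ p])
  have s1: "set_integrable lborel {s..t} (\<lambda>w. a w p * f w p)" by (rule set_integrable_mult_bdd[where B=K and C=C]) (use a_b g_b p in auto)
  have s2: "set_integrable lborel {s..t} (\<lambda>w. A w p * g w p)" by (rule set_integrable_mult_bdd[where B=K and C=C]) (use A_b g_b p in auto)
  have s3: "set_integrable lborel {s..t} (\<lambda>w. a w p * I w p)" by (rule set_integrable_mult_bdd[where B=K and C="C * (t - s)"]) (use a_b I_b p in auto)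
  have s4: "set_integrable lborel {s..t} (\<lambda>w. a w p)" using a_b p by (intro set_integrable_bdd[where B=K]) auto
  have s5: "set_integrable lborel {s..t} (\<lambda>w. A s p * g w p)"
   using gi[of s p] p by (intro set_integrable_mult_right) auto
  \<comment> \<open>The drift of f over {w..t}, weighted by a(w), becomes the drift weighted by A_x
    - A_s: the term A g of the product rule appears.\<close>
  have "(LBINT w:{s..t}. a w p * I w p) = (LBINT x:{s..t}. g x p * (LBINT w:{s..x}. a w p))"
   unfolding I_def by (rule triangle_Fubini[where B=K and C=C]) (use a_b g_b p in auto)
  also have "\<dots> = (LBINT x:{s..t}. A x p * g x p - A s p * g x p)"
   by (intro set_lebesgue_integral_cong) (auto simp: ftc[OF _ _ p] algebra_simps)
  also have "\<dots> = (LBINT x:{s..t}. A x p * g x p) - A s p * I s p"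
   using set_integral_diff(2)[OF s2 s5] by (simp add: I_def)
  finally have aI: "(LBINT w:{s..t}. a w p * I w p) = (LBINT x:{s..t}. A x p * g x p) - A s p * I s p" .
  have "(LBINT w:{s..t}. X w p) = (LBINT w:{s..t}. W p * (f t p * a w p - a w p * f w p - a w p * I w p))"
   by (simp add: X_def algebra_simps)
  also have "\<dots> = W p * (LBINT w:{s..t}. f t p * a w p - a w p * f w p - a w p * I w p)"
   by simp
  also have "(LBINT w:{s..t}. f t p * a w p - a w p * f w p - a w p * I w p)
    = f t p * (A t p - A s p) - (LBINT w:{s..t}. a w p * f w p) - (LBINT w:{s..t}. a w p * I w p)"
   using s1 s3 s4 ftc[of t p] p st
   by (simp add: set_integral_diff set_integrable_mult_right)
  finally show ?thesis
   unfolding aI using set_integral_add(2)[OF s1 s2] by (simp add: algebra_simps)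
 qed
 have "(\<integral>p. W p * (A t p * f t p - A s p * f s p - (LBINT w:{s..t}. a w p * f w p + A w p * g w p)) \<partial>P)
   = (\<integral>p. W p * A s p * (f t p - f s p - I s p) + (LBINT w:{s..t}. X w p) \<partial>P)"
  by (rule Bochner_Integration.integral_cong) (auto simp: key)
 also have "\<dots> = 0" using 1 2 int1 int2 by simp
 finally show ?thesis by (simp add: f_def g_def)
qed

end

subsection \<open>Exponential change of measure with constant coefficients\<close>

text \<open>The density factor uses the positive function \<open>exp (\<rho>\<^sub>i + sin (s \<langle>\<xi>, y\<rangle>) / s)\<close>: for \<open>s > 0\<close> it is
 bounded, so that no integrability question arises, and for \<open>s \<rightarrow> 0\<close> it becomes the
 exponential \<open>exp (\<rho>\<^sub>i + \<langle>\<xi>, y\<rangle>)\<close> of Girsanov's theorem.\<close>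

definition sn :: "real \<Rightarrow> real \<Rightarrow> real" where
 "sn s x = (if s = 0 then x else sin (s * x) / s)"

definition potential :: "real \<Rightarrow> real^'d \<Rightarrow> real^'k \<Rightarrow> (real^'k) \<times> (real^'d) \<Rightarrow> real" where
 "potential s \<xi> \<rho> z = \<rho> \<bullet> fst z + sn s (\<xi> \<bullet> snd z)"

lemma sn_measurable [measurable]: "sn s \<in> borel_measurable borel"
 unfolding sn_def by measurable

lemma sn_bound: "s > 0 \<Longrightarrow> \<bar>sn s x\<bar> \<le> 1 / s"
 by (simp add: sn_def field_simps)

lemma fst_snd_measurable:
 "fst \<in> borel_measurable (borel :: ('a::second_countable_topology \<times> 'b::second_countable_topology) measure)"
 "snd \<in> borel_measurable (borel :: ('a::second_countable_topology \<times> 'b::second_countable_topology) measure)"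
 by (simp_all flip: borel_prod)

section \<open>The h-transform of the generator\<close>

context diffusion begin

text \<open>With V = \<open>potential s \<xi> \<rho>\<close> and h = exp V this is L h / h, that is
  \<langle>b, grad V\<rangle> + \<epsilon>^2 / 2 (|grad V|^2 + Laplacian V) + sum over j of (exp
  (V_j - V_i) - 1) q_j.\<close>

definition compensator :: "real \<Rightarrow> real^'d \<Rightarrow> real^'k \<Rightarrow> (real^'k) \<times> (real^'d) \<Rightarrow> real" where
 "compensator s \<xi> \<rho> z = (\<xi> \<bullet> lift b z) * cos (s * (\<xi> \<bullet> snd z))
   + \<epsilon>\<^sup>2 / 2 * (\<xi> \<bullet> \<xi>) * ((cos (s * (\<xi> \<bullet> snd z)))\<^sup>2 - s * sin (s * (\<xi> \<bullet> snd z)))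
   + (\<Sum>j\<in>UNIV. (exp (\<rho> $ j - \<rho> \<bullet> fst z) - 1) * lift q z $ j)"

text \<open>Under the transform the drift gains \<epsilon>^2 times the gradient of the potential,
  and (in \<open>rates\<close>) the rate from i to j is multiplied by the quotient of the values of
  h at j and at i.\<close>

definition drift :: "real \<Rightarrow> real^'d \<Rightarrow> (real^'k) \<times> (real^'d) \<Rightarrow> real^'d" where
 "drift s \<xi> z = lift b z + (\<epsilon>\<^sup>2 * cos (s * (\<xi> \<bullet> snd z))) *\<^sub>R \<xi>"

definition rates :: "real^'k \<Rightarrow> (real^'k) \<times> (real^'d) \<Rightarrow> real^'k" where
 "rates \<rho> z = (\<chi> j. exp (\<rho> $ j - \<rho> \<bullet> fst z) * lift q z $ j)"

lemma lift_bq_bound: "z \<in> state_space \<Longrightarrow> norm (lift b z) \<le> B" "z \<in> state_space \<Longrightarrow> norm (lift q z) \<le> B"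
 using norm_lift_le b_bound q_bound by blast+

lemma lift_bq_measurable [measurable]: "lift b \<in> borel_measurable borel" "lift q \<in> borel_measurable borel"
 by measurable

lemma coeff_measurable:
 assumes [measurable]: "\<xi> \<in> borel_measurable M" "\<rho> \<in> borel_measurable M" "Z \<in> borel_measurable M"
 shows "(\<lambda>x. compensator s (\<xi> x) (\<rho> x) (Z x)) \<in> borel_measurable M"
  and "(\<lambda>x. drift s (\<xi> x) (Z x)) \<in> borel_measurable M"
  and "(\<lambda>x. rates (\<rho> x) (Z x)) \<in> borel_measurable M"
  and "(\<lambda>x. potential s (\<xi> x) (\<rho> x) (Z x)) \<in> borel_measurable M"
proof -
 have Z: "(\<lambda>x. lift b (Z x)) \<in> borel_measurable M" "(\<lambda>x. lift q (Z x)) \<in> borel_measurable M"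
  "(\<lambda>x. fst (Z x)) \<in> borel_measurable M" "(\<lambda>x. snd (Z x)) \<in> borel_measurable M"
  by (rule measurable_compose[OF assms(3) lift_bq_measurable(1)] measurable_compose[OF assms(3) lift_bq_measurable(2)]
   measurable_compose[OF assms(3) fst_snd_measurable(1)] measurable_compose[OF assms(3) fst_snd_measurable(2)])+
 have c: "(\<lambda>x. lift q (Z x) $ j) \<in> borel_measurable M" "(\<lambda>x. \<rho> x $ j) \<in> borel_measurable M" for j
  by (rule measurable_compose[OF Z(2) borel_measurable_vec_nth] measurable_compose[OF assms(2) borel_measurable_vec_nth])+
 have r: "(\<lambda>x. \<rho> x \<bullet> fst (Z x)) \<in> borel_measurable M"
  by (intro borel_measurable_inner Z assms)
 have e: "(\<lambda>x. exp (\<rho> x $ j - \<rho> x \<bullet> fst (Z x))) \<in> borel_measurable M" for j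
  by (rule measurable_compose[OF borel_measurable_diff[OF c(2) r] borel_measurable_exp])
 have 1: "(\<lambda>x. \<xi> x \<bullet> lift b (Z x)) \<in> borel_measurable M" "(\<lambda>x. \<xi> x \<bullet> \<xi> x) \<in> borel_measurable M"
  "(\<lambda>x. \<xi> x \<bullet> snd (Z x)) \<in> borel_measurable M"
  by (intro borel_measurable_inner Z assms)+
 have 2: "(\<lambda>x. s * (\<xi> x \<bullet> snd (Z x))) \<in> borel_measurable M"
  by (intro borel_measurable_times 1 borel_measurable_const)
 have 3: "(\<lambda>x. cos (s * (\<xi> x \<bullet> snd (Z x)))) \<in> borel_measurable M"
   "(\<lambda>x. sin (s * (\<xi> x \<bullet> snd (Z x)))) \<in> borel_measurable M"
  by (rule measurable_compose[OF 2 borel_measurable_continuous_onI], intro continuous_intros)+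
 show "(\<lambda>x. compensator s (\<xi> x) (\<rho> x) (Z x)) \<in> borel_measurable M"
  unfolding compensator_def
  by (intro borel_measurable_add borel_measurable_times borel_measurable_diff borel_measurable_power
     borel_measurable_const borel_measurable_sum 1 3 c e)
 show "(\<lambda>x. drift s (\<xi> x) (Z x)) \<in> borel_measurable M"
  unfolding drift_def
  by (intro borel_measurable_add borel_measurable_scaleR borel_measurable_times borel_measurable_const Z 3 assms)
 show "(\<lambda>x. potential s (\<xi> x) (\<rho> x) (Z x)) \<in> borel_measurable M"
  unfolding potential_def
  by (intro borel_measurable_add r measurable_compose[OF 1(3) sn_measurable])
 have "(\<lambda>x. rates (\<rho> x) (Z x) \<bullet> axis j 1) \<in> borel_measurable M" for j
  using borel_measurable_times[OF e c(1)] by (simp add: rates_def inner_axis)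
 then have "\<forall>v\<in>Basis. (\<lambda>x. rates (\<rho> x) (Z x) \<bullet> v) \<in> borel_measurable M"
  by (simp add: Basis_vec_def)
 then show "(\<lambda>x. rates (\<rho> x) (Z x)) \<in> borel_measurable M"
  by (subst borel_measurable_euclidean_space)
qed

text \<open>Uniform in s \<in> [0, 1]: the factor 2 bounds cos^2 - s sin, and exp (2 M) bounds exp
  (\<rho>_j - \<rho>_i).\<close>

definition comp_bound :: "real \<Rightarrow> real" where
 "comp_bound M = M * B + \<epsilon>\<^sup>2 / 2 * M\<^sup>2 * 2 + real CARD('k) * ((exp (2 * M) + 1) * B)"

lemma exp_rho_bound:
 assumes "z \<in> state_space" "norm \<rho> \<le> M"
 shows "exp (\<rho> $ j - \<rho> \<bullet> fst z) \<le> exp (2 * M)"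
proof -
 obtain i where i: "z = (axis i 1, snd z)" using assms(1) by (rule state_spaceE)
 have "\<rho> \<bullet> fst z = \<rho> $ i" by (subst i) (simp add: inner_axis)
 then show ?thesis
  using component_le_norm_cart[of \<rho> i] component_le_norm_cart[of \<rho> j] assms(2) by simp
qed

lemma compensator_bound:
 assumes z: "z \<in> state_space" and s: "0 \<le> s" "s \<le> 1" and \<xi>: "norm \<xi> \<le> M" and \<rho>: "norm \<rho> \<le> M"
 shows "\<bar>compensator s \<xi> \<rho> z\<bar> \<le> comp_bound M"
proof -
 have M: "0 \<le> M" using \<xi> norm_ge_zero order_trans by blast
 have "\<bar>\<xi> \<bullet> lift b z\<bar> \<le> M * B"
  using Cauchy_Schwarz_ineq2[of \<xi> "lift b z"] mult_mono[OF \<xi> lift_bq_bound(1)[OF z]] M by simp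
 then have 1: "\<bar>(\<xi> \<bullet> lift b z) * cos (s * (\<xi> \<bullet> snd z))\<bar> \<le> (M * B) * 1"
  unfolding abs_mult by (intro mult_mono) auto
 have "\<bar>s * sin (s * (\<xi> \<bullet> snd z))\<bar> \<le> 1 * 1"
  unfolding abs_mult using s by (intro mult_mono) auto
 moreover have "(cos (s * (\<xi> \<bullet> snd z)))\<^sup>2 \<le> 1" "(cos (s * (\<xi> \<bullet> snd z)))\<^sup>2 \<ge> 0"
  by (auto simp: abs_square_le_1)
 ultimately have c: "\<bar>(cos (s * (\<xi> \<bullet> snd z)))\<^sup>2 - s * sin (s * (\<xi> \<bullet> snd z))\<bar> \<le> 2" by linarith
 have "\<bar>\<xi> \<bullet> \<xi>\<bar> \<le> M\<^sup>2" using \<xi> by (simp add: power2_norm_eq_inner[symmetric] power_mono)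
 then have 2: "\<bar>\<epsilon>\<^sup>2 / 2 * (\<xi> \<bullet> \<xi>) * ((cos (s * (\<xi> \<bullet> snd z)))\<^sup>2 - s * sin (s * (\<xi> \<bullet> snd z)))\<bar> \<le> \<epsilon>\<^sup>2 / 2 * M\<^sup>2 * 2"
  unfolding abs_mult using c by (intro mult_mono) auto
 have 3: "\<bar>\<Sum>j\<in>UNIV. (exp (\<rho> $ j - \<rho> \<bullet> fst z) - 1) * lift q z $ j\<bar> \<le> (\<Sum>j\<in>(UNIV::'k set). (exp (2 * M) + 1) * B)"
 proof (rule order_trans[OF sum_abs sum_mono])
  fix j
  have "0 < exp (\<rho> $ j - \<rho> \<bullet> fst z)" by simp
  then have "\<bar>exp (\<rho> $ j - \<rho> \<bullet> fst z) - 1\<bar> \<le> exp (2 * M) + 1"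
   using exp_rho_bound[OF z \<rho>, of j] by linarith
  moreover have "\<bar>lift q z $ j\<bar> \<le> B"
   using component_le_norm_cart[of "lift q z" j] lift_bq_bound(2)[OF z] by simp
  ultimately show "\<bar>(exp (\<rho> $ j - \<rho> \<bullet> fst z) - 1) * lift q z $ j\<bar> \<le> (exp (2 * M) + 1) * B"
   unfolding abs_mult using B_nonneg by (intro mult_mono) auto
 qed
 show ?thesis
  unfolding compensator_def comp_bound_def using 1 2 3 by simp
qed

lemma drift_bound:
 assumes "z \<in> state_space" "norm \<xi> \<le> M"
 shows "norm (drift s \<xi> z) \<le> B + \<epsilon>\<^sup>2 * M"
proof -
 have "norm ((\<epsilon>\<^sup>2 * cos (s * (\<xi> \<bullet> snd z))) *\<^sub>R \<xi>) \<le> (\<epsilon>\<^sup>2 * 1) * M"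
  unfolding norm_scaleR abs_mult using assms(2) by (intro mult_mono) auto
 then show ?thesis
  unfolding drift_def using lift_bq_bound(1)[OF assms(1)] norm_triangle_ineq[of "lift b z"] by (smt (verit))
qed

lemma rates_bound:
 assumes "z \<in> state_space" "norm \<rho> \<le> M"
 shows "norm (rates \<rho> z) \<le> real CARD('k) * (exp (2 * M) * B)"
proof -
 have "norm (rates \<rho> z) \<le> (\<Sum>j\<in>UNIV. \<bar>rates \<rho> z $ j\<bar>)" by (rule norm_le_l1_cart)
 also have "\<dots> \<le> (\<Sum>j\<in>(UNIV::'k set). exp (2 * M) * B)"
 proof (rule sum_mono)
  fix j
  have "\<bar>lift q z $ j\<bar> \<le> B"
   using component_le_norm_cart[of "lift q z" j] lift_bq_bound(2)[OF assms(1)] by simp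
  then show "\<bar>rates \<rho> z $ j\<bar> \<le> exp (2 * M) * B"
   unfolding rates_def using exp_rho_bound[OF assms, of j] by (auto simp: abs_mult intro!: mult_mono)
 qed
 finally show ?thesis by simp
qed

lemma potential_bound:
 assumes "z \<in> state_space" "s > 0"
 shows "\<bar>potential s \<xi> \<rho> z\<bar> \<le> norm \<rho> + 1 / s"
proof -
 obtain i where i: "z = (axis i 1, snd z)" using assms(1) by (rule state_spaceE)
 have "\<rho> \<bullet> fst z = \<rho> $ i" by (subst i) (simp add: inner_axis)
 then show ?thesis
  using component_le_norm_cart[of \<rho> i] sn_bound[OF assms(2), of "\<xi> \<bullet> snd z"] by (simp add: potential_def)
qed

text \<open>The test function multiplied by h = exp (potential). The function h itself has no
  compact support, the product has.\<close>

definition weighted :: "real \<Rightarrow> real^'d \<Rightarrow> real^'k \<Rightarrow> ('k \<Rightarrow> real^'d \<Rightarrow> real) \<Rightarrow> 'k \<Rightarrow> real^'d \<Rightarrow> real" where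
 "weighted s \<xi> \<rho> \<phi> i y = exp (\<rho> $ i) * (exp (1 / s * sin (s * (\<xi> \<bullet> y))) * \<phi> i y)"

lemma tf_weighted:
 assumes "tf \<phi>"
 shows "tf (weighted s \<xi> \<rho> \<phi>)"
 unfolding tf_def
proof (intro allI conjI)
 fix i
 show "smooth (weighted s \<xi> \<rho> \<phi> i)"
  unfolding weighted_def using assms by (intro smooth_mult smooth_const smooth_sin_exp) (auto simp: tf_def)
 show "compactly_supported (weighted s \<xi> \<rho> \<phi> i)"
  using assms by (simp add: tf_def weighted_def compactly_supported_def)
qed

lemma lift_weighted:
 assumes "z \<in> state_space" "s > 0"
 shows "lift (weighted s \<xi> \<rho> \<phi>) z = exp (potential s \<xi> \<rho> z) * lift \<phi> z"
proof -
 obtain i where i: "z = (axis i 1, snd z)" using assms(1) by (rule state_spaceE)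
 show ?thesis
  using assms(2) by (subst (1 2 3) i) (simp add: weighted_def potential_def sn_def inner_axis exp_add)
qed

text \<open>The \<open>h\<close>-transform of the generator by \<open>exp (potential s \<xi> \<rho>)\<close>.\<close>

lemma gen_weighted:
 assumes \<phi>: "tf \<phi>" and z: "z \<in> state_space" and s: "s > 0"
 shows "gen_of (weighted s \<xi> \<rho> \<phi>) (lift b) (lift q) z
   = exp (potential s \<xi> \<rho> z) * gen_of \<phi> (drift s \<xi>) (rates \<rho>) z
    + compensator s \<xi> \<rho> z * lift (weighted s \<xi> \<rho> \<phi>) z"
proof -
 obtain i where i: "z = (axis i 1, snd z)" using z by (rule state_spaceE)
 define y where "y = snd z"
 have zi: "z = (axis i 1, y)" using i by (simp add: y_def)
 define \<gamma> where "\<gamma> = (\<lambda>y. exp (1 / s * sin (s * (\<xi> \<bullet> y))))"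
 have sm: "smooth \<gamma>" "smooth (\<phi> j)" for j
  unfolding \<gamma>_def by (rule smooth_sin_exp tf_smooth[OF \<phi>])+
 have g: "gradient \<gamma> y = (\<gamma> y * cos (s * (\<xi> \<bullet> y))) *\<^sub>R \<xi>"
  "laplacian \<gamma> y = \<gamma> y * (cos (s * (\<xi> \<bullet> y))^2 - s * sin (s * (\<xi> \<bullet> y))) * (\<xi> \<bullet> \<xi>)"
  unfolding \<gamma>_def using s by (intro sin_exp_derivatives; simp)+
 have w: "weighted s \<xi> \<rho> \<phi> = (\<lambda>i y. exp (\<rho> $ i) * (\<gamma> y * \<phi> i y))" by (simp add: weighted_def \<gamma>_def fun_eq_iff)
 have gr: "gradient (weighted s \<xi> \<rho> \<phi> i) y
   = (exp (\<rho> $ i) * \<gamma> y) *\<^sub>R (gradient (\<phi> i) y + (cos (s * (\<xi> \<bullet> y)) * \<phi> i y) *\<^sub>R \<xi>)"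
  unfolding w gradient_cmult[OF smooth_mult[OF sm]] gradient_mult[OF sm] g(1)
  by (simp add: algebra_simps)
 have la: "laplacian (weighted s \<xi> \<rho> \<phi> i) y
   = (exp (\<rho> $ i) * \<gamma> y) * (laplacian (\<phi> i) y + 2 * cos (s * (\<xi> \<bullet> y)) * (\<xi> \<bullet> gradient (\<phi> i) y)
     + (cos (s * (\<xi> \<bullet> y))^2 - s * sin (s * (\<xi> \<bullet> y))) * (\<xi> \<bullet> \<xi>) * \<phi> i y)"
  unfolding w laplacian_cmult[OF smooth_mult[OF sm]] laplacian_mult[OF sm] g
  by (simp add: algebra_simps)
 have pot: "exp (potential s \<xi> \<rho> z) = exp (\<rho> $ i) * \<gamma> y"
  using s by (simp add: zi potential_def sn_def \<gamma>_def inner_axis exp_add)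
 have sum: "(\<Sum>j\<in>UNIV. (weighted s \<xi> \<rho> \<phi> j y - weighted s \<xi> \<rho> \<phi> i y) * q i y $ j)
   = exp (\<rho> $ i) * \<gamma> y * (\<Sum>j\<in>UNIV. (\<phi> j y - \<phi> i y) * (exp (\<rho> $ j - \<rho> $ i) * q i y $ j))
    + (\<Sum>j\<in>UNIV. (exp (\<rho> $ j - \<rho> $ i) - 1) * q i y $ j) * (exp (\<rho> $ i) * (\<gamma> y * \<phi> i y))"
  unfolding sum_distrib_left sum_distrib_right sum.distrib[symmetric]
 proof (rule sum.cong[OF refl])
  fix j
  have "exp (\<rho> $ j) = exp (\<rho> $ i) * exp (\<rho> $ j - \<rho> $ i)" by (simp flip: exp_add)
  then show "(weighted s \<xi> \<rho> \<phi> j y - weighted s \<xi> \<rho> \<phi> i y) * q i y $ j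
   = exp (\<rho> $ i) * \<gamma> y * ((\<phi> j y - \<phi> i y) * (exp (\<rho> $ j - \<rho> $ i) * q i y $ j))
    + (exp (\<rho> $ j - \<rho> $ i) - 1) * q i y $ j * (exp (\<rho> $ i) * (\<gamma> y * \<phi> i y))"
   by (simp add: w algebra_simps)
 qed
 have "gen_of (weighted s \<xi> \<rho> \<phi>) (lift b) (lift q) z
   = b i y \<bullet> gradient (weighted s \<xi> \<rho> \<phi> i) y + \<epsilon>\<^sup>2 / 2 * laplacian (weighted s \<xi> \<rho> \<phi> i) y
    + (\<Sum>j\<in>UNIV. (weighted s \<xi> \<rho> \<phi> j y - weighted s \<xi> \<rho> \<phi> i y) * q i y $ j)"
  by (simp add: gen_def zi)
 also have "\<dots> = exp (\<rho> $ i) * \<gamma> y * (drift s \<xi> z \<bullet> gradient (\<phi> i) y + \<epsilon>\<^sup>2 / 2 * laplacian (\<phi> i) y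
     + (\<Sum>j\<in>UNIV. (\<phi> j y - \<phi> i y) * rates \<rho> z $ j))
    + compensator s \<xi> \<rho> z * (exp (\<rho> $ i) * (\<gamma> y * \<phi> i y))"
 proof -
  define S1 S2 c n where "S1 = (\<Sum>j\<in>UNIV. (\<phi> j y - \<phi> i y) * (exp (\<rho> $ j - \<rho> $ i) * q i y $ j))"
   and "S2 = (\<Sum>j\<in>UNIV. (exp (\<rho> $ j - \<rho> $ i) - 1) * q i y $ j)"
   and "c = cos (s * (\<xi> \<bullet> y))" and "n = sin (s * (\<xi> \<bullet> y))"
  note folds = S1_def[symmetric] S2_def[symmetric] c_def[symmetric] n_def[symmetric]
  have d: "drift s \<xi> z \<bullet> G = b i y \<bullet> G + \<epsilon>\<^sup>2 * c * (\<xi> \<bullet> G)" for G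
   by (simp add: drift_def zi inner_add_left c_def)
  have k: "compensator s \<xi> \<rho> z = (b i y \<bullet> \<xi>) * c + \<epsilon>\<^sup>2 / 2 * (\<xi> \<bullet> \<xi>) * (c\<^sup>2 - s * n) + S2"
   by (simp add: compensator_def zi inner_axis c_def n_def S2_def inner_commute)
  have r: "(\<Sum>j\<in>UNIV. (\<phi> j y - \<phi> i y) * rates \<rho> z $ j) = S1"
   by (simp add: rates_def zi inner_axis S1_def)
  show ?thesis
   unfolding sum gr la d k r folds inner_scaleR_right inner_add_right by (simp add: field_simps)
 qed
 also have "\<dots> = exp (potential s \<xi> \<rho> z) * gen_of \<phi> (drift s \<xi>) (rates \<rho>) z
    + compensator s \<xi> \<rho> z * lift (weighted s \<xi> \<rho> \<phi>) z"
  unfolding pot by (simp add: gen_def zi w)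
 finally show ?thesis .
qed

text \<open>Logarithm of h(Z_x) / h(Z_r) times the exponential of minus the integral of L h / h over
  {r..x}: the density of the h-transform on this interval.\<close>

definition log_factor :: "real \<Rightarrow> real^'d \<Rightarrow> real^'k \<Rightarrow> real \<Rightarrow> real \<Rightarrow> ('k, 'd) path \<Rightarrow> real" where
 "log_factor s \<xi> \<rho> r x p = potential s \<xi> \<rho> (p x) - potential s \<xi> \<rho> (p r)
   - (LBINT w:{r..x}. compensator s \<xi> \<rho> (p w))"

lemma compensator_measurable: "compensator s \<xi> \<rho> \<in> borel_measurable borel"
 by (rule coeff_measurable(1)[where \<xi>="\<lambda>_. \<xi>" and \<rho>="\<lambda>_. \<rho>" and Z="\<lambda>z. z"]) auto

lemma potential_measurable:
 fixes \<xi> :: "real^'d" and \<rho> :: "real^'k"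
 shows "potential s \<xi> \<rho> \<in> borel_measurable borel"
 by (rule coeff_measurable(4)[where \<xi>="\<lambda>_. \<xi>" and \<rho>="\<lambda>_. \<rho>" and Z="\<lambda>z. z"]) auto

lemma comp_path:
 assumes "p \<in> \<Omega>"
 shows "(\<lambda>w. compensator s \<xi> \<rho> (p w)) \<in> borel_measurable borel"
 by (rule measurable_compose[OF path_measurable[OF assms] compensator_measurable])

lemma log_factor_measurable_F:
 assumes "0 \<le> r" "r \<le> x" "x \<le> T"
 shows "log_factor s \<xi> \<rho> r x \<in> borel_measurable (F x)"
proof -
 have [measurable]: "(\<lambda>p. LBINT w:{r..x}. compensator s \<xi> \<rho> (p w)) \<in> borel_measurable (F x)"
  using assms by (intro filtration_integral compensator_measurable) auto
 have [measurable]: "(\<lambda>p. potential s \<xi> \<rho> (p x)) \<in> borel_measurable (F x)"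
   "(\<lambda>p. potential s \<xi> \<rho> (p r)) \<in> borel_measurable (F x)"
  using assms by (auto intro!: measurable_compose[OF filtration_eval potential_measurable])
 show ?thesis unfolding log_factor_def[abs_def] by measurable
qed

lemma log_factor_process:
 "(\<lambda>(x, p). log_factor s \<xi> \<rho> r x p) \<in> borel_measurable \<P>"
 "(\<lambda>(x, p). LBINT w:{r..x}. compensator s \<xi> \<rho> (p w)) \<in> borel_measurable \<P>"
proof -
 have m: "(\<lambda>x. snd x (fst x)) \<in> borel_measurable \<P>"
  using process_measurable by (simp add: split_beta')
 have [measurable]: "(\<lambda>(w, p). compensator s \<xi> \<rho> (p w)) \<in> borel_measurable \<P>"
   "(\<lambda>(w, p). potential s \<xi> \<rho> (p w)) \<in> borel_measurable \<P>"
  unfolding split_beta' by (rule measurable_compose[OF m compensator_measurable] measurable_compose[OF m potential_measurable])+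
 show [measurable]: "(\<lambda>(x, p). LBINT w:{r..x}. compensator s \<xi> \<rho> (p w)) \<in> borel_measurable \<P>"
  unfolding split_beta' by (rule interval_integral_measurable) measurable
 have "(\<lambda>p. potential s \<xi> \<rho> (p r)) \<in> borel_measurable P"
  by (rule time_section_measurable[where X="\<lambda>r p. potential s \<xi> \<rho> (p r)"]) measurable
 then have [measurable]: "(\<lambda>x. potential s \<xi> \<rho> (snd x r)) \<in> borel_measurable \<P>"
  by (rule measurable_compose[OF measurable_snd])
 show "(\<lambda>(x, p). log_factor s \<xi> \<rho> r x p) \<in> borel_measurable \<P>"
  unfolding log_factor_def split_beta' by measurable
qed

lemma compensator_integral_bound:
 assumes "0 \<le> s" "s \<le> 1" "norm \<xi> \<le> M" "norm \<rho> \<le> M" "0 \<le> r" "r \<le> x" "x \<le> T" "p \<in> \<Omega>"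
 shows "\<bar>LBINT w:{r..x}. compensator s \<xi> \<rho> (p w)\<bar> \<le> comp_bound M * (x - r)"
 unfolding real_norm_def[symmetric]
 by (rule set_integral_bdd[OF comp_path])
   (use assms in \<open>auto intro!: compensator_bound cadlag_in_state_space\<close>)

lemma log_factor_bound:
 assumes s: "0 < s" "s \<le> 1" and "norm \<xi> \<le> M" "norm \<rho> \<le> M" "0 \<le> r" "r \<le> x" "x \<le> T" "p \<in> \<Omega>"
 shows "\<bar>log_factor s \<xi> \<rho> r x p\<bar> \<le> 2 * (M + 1 / s) + comp_bound M * (x - r)"
proof -
 have "\<bar>potential s \<xi> \<rho> (p x)\<bar> \<le> M + 1 / s" "\<bar>potential s \<xi> \<rho> (p r)\<bar> \<le> M + 1 / s"
  using potential_bound[of "p x" s \<xi> \<rho>] potential_bound[of "p r" s \<xi> \<rho>] assms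
  by (auto intro: order_trans simp: cadlag_in_state_space)
 then show ?thesis
  unfolding log_factor_def using compensator_integral_bound[of s \<xi> M \<rho> r x p] assms by simp
qed

end

lemma tf_bump: "0 < c \<Longrightarrow> tf (\<lambda>i y. bump (c *\<^sub>R y))"
 unfolding tf_def
proof (intro allI conjI)
 assume c: "0 < c"
 show "smooth (\<lambda>y::'b. bump (c *\<^sub>R y))" by (rule scale_derivatives(3)[OF smooth_bump])
 show "compactly_supported (\<lambda>y::'b. bump (c *\<^sub>R y))"
 proof (rule compactly_supportedI[of _ "cball 0 (1 / c)"])
  show "{y::'b. bump (c *\<^sub>R y) \<noteq> 0} \<subseteq> cball 0 (1 / c)"
  proof
   fix y :: 'b assume "y \<in> {y. bump (c *\<^sub>R y) \<noteq> 0}"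
   then have "c *\<^sub>R y \<in> cball 0 1" using bump_support by blast
   then show "y \<in> cball 0 (1 / c)" using c by (simp add: field_simps)
  qed
 qed simp
qed

lemma lift_const: "z \<in> state_space \<Longrightarrow> lift (\<lambda>i y. h y) z = h (snd z)"
 by (metis (mono_tags) lift_axis state_spaceE)

text \<open>The bump does not depend on the discrete state, so the jump term drops out; the
  derivatives contribute c and c^2 \<le> c.\<close>

lemma gen_bump_bound:
 obtains C where "C \<ge> 0" "\<And>c \<epsilon> \<beta> \<kappa> (z :: (real^'k) \<times> (real^'d)). 0 < c \<Longrightarrow> c \<le> 1 \<Longrightarrow> z \<in> state_space \<Longrightarrow>
  \<bar>gen \<epsilon> (\<lambda>i y. bump (c *\<^sub>R y)) \<beta> \<kappa> z\<bar> \<le> C * c * (norm \<beta> + \<epsilon>\<^sup>2)"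
  "\<And>y::real^'d. \<bar>bump y\<bar> \<le> C"
proof -
 have "tf (\<lambda>i::'k. \<lambda>y::real^'d. bump (1 *\<^sub>R y))" by (rule tf_bump) simp
 then obtain C where C: "C \<ge> 0" "\<And>y::real^'d. \<bar>bump y\<bar> \<le> C"
   "\<And>y::real^'d. norm (gradient bump y) \<le> C" "\<And>y::real^'d. \<bar>laplacian bump y\<bar> \<le> C"
  by (rule tf_bounded) auto
 have "\<bar>gen \<epsilon> (\<lambda>i y. bump (c *\<^sub>R y)) \<beta> \<kappa> z\<bar> \<le> C * c * (norm \<beta> + \<epsilon>\<^sup>2)"
  if c: "0 < c" "c \<le> 1" and z: "z \<in> state_space" for c \<epsilon> \<beta> \<kappa> and z :: "(real^'k) \<times> (real^'d)"
 proof -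
  obtain i where i: "z = (axis i 1, snd z)" using z by (rule state_spaceE)
  have "gen \<epsilon> (\<lambda>i y. bump (c *\<^sub>R y)) \<beta> \<kappa> z
    = \<beta> \<bullet> (c *\<^sub>R gradient bump (c *\<^sub>R snd z)) + \<epsilon>\<^sup>2 / 2 * (c\<^sup>2 * laplacian bump (c *\<^sub>R snd z))"
   unfolding gen_def scale_derivatives(1,2)[OF smooth_bump] lift_const[OF z] by simp
  moreover have "\<bar>\<beta> \<bullet> (c *\<^sub>R gradient bump (c *\<^sub>R snd z))\<bar> \<le> norm \<beta> * (c * C)"
   by (rule order_trans[OF Cauchy_Schwarz_ineq2]) (use C(3) c in \<open>auto intro!: mult_left_mono\<close>)
  moreover have "\<bar>\<epsilon>\<^sup>2 / 2 * (c\<^sup>2 * laplacian bump (c *\<^sub>R snd z))\<bar> \<le> \<epsilon>\<^sup>2 * (c * C)"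
   unfolding abs_mult using C(1,4) c by (intro mult_mono) (auto simp: power2_eq_square)
  ultimately show ?thesis by (simp add: algebra_simps)
 qed
 then show thesis using C(1,2) by (intro that)
qed

section \<open>The density of a single time interval\<close>

context diffusion begin

lemma gen_coeff_measurable:
 assumes "tf \<phi>"
 shows "(\<lambda>z. gen_of \<phi> (drift s \<xi>) (rates \<rho>) z) \<in> borel_measurable borel"
proof (rule gen_measurable[OF assms])
 show "(\<lambda>z. drift s \<xi> z) \<in> borel_measurable borel"
  by (rule coeff_measurable(2)[where \<xi>="\<lambda>_. \<xi>" and \<rho>="\<lambda>_. 0" and Z="\<lambda>z. z"]) auto
 show "(\<lambda>z. rates \<rho> z) \<in> borel_measurable borel"
  by (rule coeff_measurable(3)[where \<xi>="\<lambda>_. 0" and \<rho>="\<lambda>_. \<rho>" and Z="\<lambda>z. z"]) auto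
qed auto

text \<open>Integration by parts for the test function \<phi> h and the factor A = exp (- integral
  of the compensator): the zeroth order term of the transformed generator cancels against the
  derivative of A.\<close>

lemma block_process:
 assumes \<phi>: "tf \<phi>" and s: "0 < s" "s \<le> 1" and ru: "0 \<le> r" "r \<le> u" "u \<le> v" "v \<le> T"
  and W_F: "W \<in> borel_measurable (F u)" and W_b: "\<And>p. p \<in> \<Omega> \<Longrightarrow> \<bar>W p\<bar> \<le> L"
 shows "(\<integral>p. W p * (exp (log_factor s \<xi> \<rho> r v p) * lift \<phi> (p v) - exp (log_factor s \<xi> \<rho> r u p) * lift \<phi> (p u)
   - (LBINT w:{u..v}. exp (log_factor s \<xi> \<rho> r w p) * gen_of \<phi> (drift s \<xi>) (rates \<rho>) (p w))) \<partial>P) = 0"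
proof -
 define M where "M = max (norm \<xi>) (norm \<rho>)"
 have M: "norm \<xi> \<le> M" "norm \<rho> \<le> M" "0 \<le> M" by (auto simp: M_def le_max_iff_disj)
 define A where "A w p = exp (- (LBINT x:{r..w}. compensator s \<xi> \<rho> (p x)))" for w p
 define a where "a w p = - compensator s \<xi> \<rho> (p w) * A w p" for w p
 \<comment> \<open>The factor 1 / h(Z_r) is bounded and known at time r, hence passes into the
   weight.\<close>
 define W' where "W' p = W p * exp (- potential s \<xi> \<rho> (p r))" for p
 have Am: "joint A"
  using log_factor_process(2)[where s=s and \<xi>=\<xi> and \<rho>=\<rho> and r=r] unfolding A_def split_beta' by measurable
 have cm: "(\<lambda>(w, p). compensator s \<xi> \<rho> (p w)) \<in> borel_measurable \<P>"
  using measurable_compose[OF process_measurable compensator_measurable] by (simp add: split_beta')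
 have am: "joint a"
  using cm Am unfolding a_def split_beta' by measurable
 have AF: "A w \<in> borel_measurable (F w)" if "u \<le> w" "w \<le> v" for w
 proof -
  have "(\<lambda>p. LBINT x:{r..w}. compensator s \<xi> \<rho> (p x)) \<in> borel_measurable (F w)"
   using that ru by (intro filtration_integral compensator_measurable) auto
  then show ?thesis unfolding A_def[abs_def] by measurable
 qed
 have aF: "a w \<in> borel_measurable (F w)" if "u \<le> w" "w \<le> v" for w
  using adapted_eval[OF _ compensator_measurable, of w s \<xi> \<rho>] AF[OF that] that ru
  unfolding a_def[abs_def] by (intro borel_measurable_times borel_measurable_uminus) auto
 have comp0: "0 \<le> comp_bound M" unfolding comp_bound_def using B_nonneg M(3) by (intro add_nonneg_nonneg mult_nonneg_nonneg) auto
 define K where "K = exp (comp_bound M * T)"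
 have Ab: "\<bar>A w p\<bar> \<le> K" if "r \<le> w" "w \<le> v" "p \<in> \<Omega>" for w p
 proof -
  have "comp_bound M * (w - r) \<le> comp_bound M * T" using comp0 that ru by (intro mult_left_mono) auto
  then show ?thesis
   using compensator_integral_bound[of s \<xi> M \<rho> r w p] s M that ru by (simp add: A_def K_def)
 qed
 have ab: "\<bar>a w p\<bar> \<le> comp_bound M * K" if "r \<le> w" "w \<le> v" "p \<in> \<Omega>" for w p
  unfolding a_def abs_mult abs_minus
  using compensator_bound[of "p w" s \<xi> M \<rho>] Ab[OF that] s M that ru comp0
  by (intro mult_mono) (auto simp: cadlag_in_state_space)
 have K1: "K \<ge> 0" by (simp add: K_def)
 define K' where "K' = max K (comp_bound M * K)"
 have ftc: "(LBINT w:{u..x}. a w p) = A x p - A u p" if x: "u \<le> x" "x \<le> v" "p \<in> \<Omega>" for x p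
 proof -
  have am': "(\<lambda>w. a w p) \<in> borel_measurable borel" by (rule path_section_measurable[OF am x(3)])
  have *: "(LBINT w:{r..y}. a w p) = A y p - 1" if "r \<le> y" "y \<le> v" for y
   using exp_integral_ftc[of "\<lambda>w. - compensator s \<xi> \<rho> (p w)" r y "comp_bound M"]
    comp_path[OF x(3)] compensator_bound[of _ s \<xi> M \<rho>] s M that ru x
   by (simp add: a_def A_def cadlag_in_state_space set_lebesgue_integral_def)
  have "set_integrable lborel {r..x} (\<lambda>w. a w p)"
   using ab x by (intro set_integrable_bdd[OF am', where B="comp_bound M * K"]) auto
  from set_integral_split[OF this, of u] show ?thesis using *[of x] *[of u] ru x by simp
 qed
 have W'F: "W' \<in> borel_measurable (F u)"
  unfolding W'_def[abs_def]
  by (intro borel_measurable_times W_F measurable_compose[OF borel_measurable_uminus borel_measurable_exp]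
    measurable_compose[OF filtration_eval potential_measurable]) (use ru in auto)
 have W'b: "\<bar>W' p\<bar> \<le> L * exp (M + 1 / s)" if "p \<in> \<Omega>" for p
  unfolding W'_def abs_mult
  using W_b[OF that] potential_bound[of "p r" s \<xi> \<rho>] that ru s M
  by (intro mult_mono) (auto simp: cadlag_in_state_space)
 have pr: "(\<integral>p. W' p * (A v p * lift (weighted s \<xi> \<rho> \<phi>) (p v) - A u p * lift (weighted s \<xi> \<rho> \<phi>) (p u)
   - (LBINT w:{u..v}. a w p * lift (weighted s \<xi> \<rho> \<phi>) (p w)
     + A w p * gen_of (weighted s \<xi> \<rho> \<phi>) (lift b) (lift q) (p w))) \<partial>P) = 0"
 proof (rule product_rule[where K=K'])
  show "\<bar>a w p\<bar> \<le> K'" "\<bar>A w p\<bar> \<le> K'" if "u \<le> w" "w \<le> v" "p \<in> \<Omega>" for w p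
   using ab[of w p] Ab[of w p] that ru by (auto simp: K'_def le_max_iff_disj)
 qed (use ru aF AF am Am ftc W'F W'b tf_weighted[OF \<phi>] in auto)
 have eq: "W' p * (A v p * lift (weighted s \<xi> \<rho> \<phi>) (p v) - A u p * lift (weighted s \<xi> \<rho> \<phi>) (p u)
   - (LBINT w:{u..v}. a w p * lift (weighted s \<xi> \<rho> \<phi>) (p w)
     + A w p * gen_of (weighted s \<xi> \<rho> \<phi>) (lift b) (lift q) (p w)))
   = W p * (exp (log_factor s \<xi> \<rho> r v p) * lift \<phi> (p v) - exp (log_factor s \<xi> \<rho> r u p) * lift \<phi> (p u)
   - (LBINT w:{u..v}. exp (log_factor s \<xi> \<rho> r w p) * gen_of \<phi> (drift s \<xi>) (rates \<rho>) (p w)))"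
  if p: "p \<in> \<Omega>" for p
 proof -
  let ?p = "\<lambda>w. potential s \<xi> \<rho> (p w)"
  have S: "p w \<in> state_space" if "u \<le> w" "w \<le> v" for w using that ru p by (auto simp: cadlag_in_state_space)
  have e: "exp (log_factor s \<xi> \<rho> r w p) = exp (- ?p r) * (A w p * exp (?p w))" for w
   by (simp add: log_factor_def A_def flip: exp_add)
  have "a w p * lift (weighted s \<xi> \<rho> \<phi>) (p w) + A w p * gen_of (weighted s \<xi> \<rho> \<phi>) (lift b) (lift q) (p w)
    = A w p * exp (?p w) * gen_of \<phi> (drift s \<xi>) (rates \<rho>) (p w)" if "u \<le> w" "w \<le> v" for w
   by (simp add: gen_weighted[OF \<phi> S[OF that] s(1)] a_def algebra_simps)
  then have i: "(LBINT w:{u..v}. a w p * lift (weighted s \<xi> \<rho> \<phi>) (p w)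
     + A w p * gen_of (weighted s \<xi> \<rho> \<phi>) (lift b) (lift q) (p w))
    = (LBINT w:{u..v}. A w p * exp (?p w) * gen_of \<phi> (drift s \<xi>) (rates \<rho>) (p w))"
   by (intro set_lebesgue_integral_cong) auto
  have i2: "(LBINT w:{u..v}. exp (log_factor s \<xi> \<rho> r w p) * gen_of \<phi> (drift s \<xi>) (rates \<rho>) (p w))
    = exp (- ?p r) * (LBINT w:{u..v}. A w p * exp (?p w) * gen_of \<phi> (drift s \<xi>) (rates \<rho>) (p w))"
   unfolding e mult.assoc by simp
  show ?thesis
   unfolding i i2 unfolding e W'_def using lift_weighted[OF S s(1), of v \<xi> \<rho> \<phi>] lift_weighted[OF S s(1), of u \<xi> \<rho> \<phi>] ru
   by (simp add: algebra_simps)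
 qed
 have "(\<integral>p. W p * (exp (log_factor s \<xi> \<rho> r v p) * lift \<phi> (p v) - exp (log_factor s \<xi> \<rho> r u p) * lift \<phi> (p u)
   - (LBINT w:{u..v}. exp (log_factor s \<xi> \<rho> r w p) * gen_of \<phi> (drift s \<xi>) (rates \<rho>) (p w))) \<partial>P)
   = (\<integral>p. W' p * (A v p * lift (weighted s \<xi> \<rho> \<phi>) (p v) - A u p * lift (weighted s \<xi> \<rho> \<phi>) (p u)
   - (LBINT w:{u..v}. a w p * lift (weighted s \<xi> \<rho> \<phi>) (p w)
     + A w p * gen_of (weighted s \<xi> \<rho> \<phi>) (lift b) (lift q) (p w))) \<partial>P)"
  by (rule Bochner_Integration.integral_cong) (auto simp: eq)
 then show ?thesis unfolding pr .
qed

lemma log_factor_bdd: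
 assumes "0 < s" "s \<le> 1"
 obtains K where "\<And>r x p. 0 \<le> r \<Longrightarrow> r \<le> x \<Longrightarrow> x \<le> T \<Longrightarrow> p \<in> \<Omega> \<Longrightarrow> exp (log_factor s \<xi> \<rho> r x p) \<le> K" "K \<ge> 0"
proof -
 define M where "M = max (norm \<xi>) (norm \<rho>)"
 have M: "norm \<xi> \<le> M" "norm \<rho> \<le> M" "0 \<le> M" by (auto simp: M_def le_max_iff_disj)
 have comp0: "0 \<le> comp_bound M" unfolding comp_bound_def using B_nonneg M(3) by (intro add_nonneg_nonneg mult_nonneg_nonneg) auto
 show thesis
 proof (rule that[of "exp (2 * (M + 1 / s) + comp_bound M * T)"])
  fix r x p assume *: "0 \<le> r" "r \<le> x" "x \<le> T" "p \<in> \<Omega>"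
  have "comp_bound M * (x - r) \<le> comp_bound M * T" using comp0 * by (intro mult_left_mono) auto
  then show "exp (log_factor s \<xi> \<rho> r x p) \<le> exp (2 * (M + 1 / s) + comp_bound M * T)"
   using log_factor_bound[OF assms M(1,2) *] by simp
 qed simp
qed

text \<open>The constant 1 is not a test function. It is replaced by bumps stretched by 1/c with c
  -> 0, whose transformed generator is of order c; for s > 0 the density factor is bounded, so that
  dominated convergence applies.\<close>

lemma block_mass:
 assumes s: "0 < s" "s \<le> 1" and ru: "0 \<le> r" "r \<le> u" "u \<le> v" "v \<le> T"
  and W_F: "W \<in> borel_measurable (F u)" and W_b: "\<And>p. p \<in> \<Omega> \<Longrightarrow> \<bar>W p\<bar> \<le> L"
 shows "(\<integral>p. W p * exp (log_factor s \<xi> \<rho> r v p) \<partial>P) = (\<integral>p. W p * exp (log_factor s \<xi> \<rho> r u p) \<partial>P)"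
proof -
 obtain C where C: "C \<ge> 0" "\<And>c \<beta> \<kappa> (z :: (real^'k) \<times> (real^'d)). 0 < c \<Longrightarrow> c \<le> 1 \<Longrightarrow> z \<in> state_space \<Longrightarrow>
  \<bar>gen \<epsilon> (\<lambda>i y. bump (c *\<^sub>R y)) \<beta> \<kappa> z\<bar> \<le> C * c * (norm \<beta> + \<epsilon>\<^sup>2)" and bb: "\<And>y::real^'d. \<bar>bump y\<bar> \<le> C"
  by (rule gen_bump_bound) blast
 obtain K where K: "\<And>x p. r \<le> x \<Longrightarrow> x \<le> T \<Longrightarrow> p \<in> \<Omega> \<Longrightarrow> exp (log_factor s \<xi> \<rho> r x p) \<le> K" "K \<ge> 0"
  using log_factor_bdd[OF s] ru(1) by metis
 define c where "c n = 1 / real (Suc n)" for n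
 have c: "0 < c n" "c n \<le> 1" for n by (auto simp: c_def)
 have c0: "c \<longlonglongrightarrow> 0" unfolding c_def by (rule LIMSEQ_Suc[OF lim_1_over_n])
 define \<phi> where "\<phi> n = (\<lambda>i::'k. \<lambda>y::real^'d. bump (c n *\<^sub>R y))" for n
 have tf: "tf (\<phi> n)" for n unfolding \<phi>_def by (rule tf_bump[OF c(1)])
 define e where "e w p = exp (log_factor s \<xi> \<rho> r w p)" for w p
 have em: "joint e"
  using log_factor_process(1)[where s=s and \<xi>=\<xi> and \<rho>=\<rho> and r=r] unfolding e_def split_beta' by measurable
 define g where "g n w p = e w p * gen_of (\<phi> n) (drift s \<xi>) (rates \<rho>) (p w)" for n w p
 have gm: "(\<lambda>(w, p). g n w p) \<in> borel_measurable \<P>" for n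
 proof -
  have "(\<lambda>(w, p). gen_of (\<phi> n) (drift s \<xi>) (rates \<rho>) (p w)) \<in> borel_measurable \<P>"
   using measurable_compose[OF process_measurable gen_coeff_measurable[OF tf]] by (simp add: split_beta')
  then show ?thesis using em unfolding g_def split_beta' by measurable
 qed
 define G where "G = K * (C * (B + \<epsilon>\<^sup>2 * norm \<xi> + \<epsilon>\<^sup>2))"
 have G0: "0 \<le> G" using C(1) K(2) B_nonneg by (auto simp: G_def)
 have gb: "norm (g n w p) \<le> G * c n" if "u \<le> w" "w \<le> v" "p \<in> \<Omega>" for n w p
 proof -
  have z: "p w \<in> state_space" using that ru by (simp add: cadlag_in_state_space)
  have "\<bar>gen_of (\<phi> n) (drift s \<xi>) (rates \<rho>) (p w)\<bar> \<le> C * c n * (norm (drift s \<xi> (p w)) + \<epsilon>\<^sup>2)"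
   unfolding \<phi>_def by (rule C(2)[OF c z])
  also have "\<dots> \<le> C * c n * (B + \<epsilon>\<^sup>2 * norm \<xi> + \<epsilon>\<^sup>2)"
   using drift_bound[OF z, of \<xi> "norm \<xi>" s] C(1) c[of n] by (intro mult_left_mono) auto
  finally have "\<bar>g n w p\<bar> \<le> K * (C * c n * (B + \<epsilon>\<^sup>2 * norm \<xi> + \<epsilon>\<^sup>2))"
   unfolding g_def abs_mult e_def using K(1)[of w p] K(2) that ru by (intro mult_mono) auto
  then show ?thesis by (simp add: G_def mult_ac)
 qed
 define X where "X n p = W p * (e v p * lift (\<phi> n) (p v) - e u p * lift (\<phi> n) (p u) - (LBINT w:{u..v}. g n w p))" for n p
 have L0: "0 \<le> L" if "p \<in> \<Omega>" for p using W_b[OF that] by auto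
 have Wm[measurable]: "W \<in> borel_measurable P" using W_F ru by (auto intro: measurable_F_P)
 have em'[measurable]: "e w \<in> borel_measurable P" for w by (rule time_section_measurable[OF em])
 have "(\<lambda>n. \<integral>p. X n p \<partial>P) \<longlonglongrightarrow> (\<integral>p. W p * (e v p - e u p) \<partial>P)"
 proof (rule integral_dominated_convergence[where w="\<lambda>_. L * (K * C + K * C + G * T)"])
  show "(\<lambda>p. W p * (e v p - e u p)) \<in> borel_measurable P" by measurable
  have m: "(\<lambda>p. lift (\<phi> n) (p w)) \<in> borel_measurable P" if "0 \<le> w" "w \<le> T" for n w
   using measurable_compose[OF eval_measurable[OF that] tf_measurable(4)[OF tf[of n]]] .
  show "X n \<in> borel_measurable P" for n
   unfolding X_def[abs_def]
   using Fubini_bounded(2)[OF gm gb, of u v n] m[of v n] m[of u n] ru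
   by (intro borel_measurable_times borel_measurable_diff) auto
  show "integrable P (\<lambda>_. L * (K * C + K * C + G * T))" by simp
  show "AE p in P. norm (X n p) \<le> L * (K * C + K * C + G * T)" for n
  proof (rule AE_I2)
   fix p assume "p \<in> space P" then have p: "p \<in> \<Omega>" by simp
   have "\<bar>e w p * lift (\<phi> n) (p w)\<bar> \<le> K * C" if "u \<le> w" "w \<le> v" for w
    unfolding abs_mult e_def using K(1)[of w p] K(2) that ru p norm_lift_le[of "p w" "\<phi> n" C] bb
    by (intro mult_mono) (auto simp: \<phi>_def cadlag_in_state_space)
   then have 1: "\<bar>e v p * lift (\<phi> n) (p v)\<bar> \<le> K * C" "\<bar>e u p * lift (\<phi> n) (p u)\<bar> \<le> K * C" using ru by auto
   have "norm (LBINT w:{u..v}. g n w p) \<le> (G * c n) * max 0 (v - u)"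
    using Fubini_bounded(4)[OF gm gb p] .
   also have "\<dots> \<le> (G * 1) * T" using G0 c[of n] ru T_pos by (intro mult_mono) auto
   finally have "\<bar>e v p * lift (\<phi> n) (p v) - e u p * lift (\<phi> n) (p u) - (LBINT w:{u..v}. g n w p)\<bar> \<le> K * C + K * C + G * T"
    using 1 by (simp only: real_norm_def mult_1_right)
   then show "norm (X n p) \<le> L * (K * C + K * C + G * T)"
    unfolding X_def real_norm_def abs_mult using W_b[OF p] L0[OF p] by (intro mult_mono) auto
  qed
  show "AE p in P. (\<lambda>n. X n p) \<longlonglongrightarrow> W p * (e v p - e u p)"
  proof (rule AE_I2)
   fix p assume "p \<in> space P" then have p: "p \<in> \<Omega>" by simp
   have l: "(\<lambda>n. lift (\<phi> n) (p w)) \<longlonglongrightarrow> 1" if "u \<le> w" "w \<le> v" for w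
   proof -
    have S: "p w \<in> state_space" using that ru p by (simp add: cadlag_in_state_space)
    have "isCont bump (0 :: real^'d)" using smooth_continuous[OF smooth_bump[where 'a="real^'d"]]
     by (simp add: continuous_on_eq_continuous_at)
    moreover have "(\<lambda>n. c n *\<^sub>R snd (p w)) \<longlonglongrightarrow> 0 *\<^sub>R snd (p w)" by (intro tendsto_intros c0)
    ultimately have "(\<lambda>n. bump (c n *\<^sub>R snd (p w))) \<longlonglongrightarrow> bump (0 :: real^'d)"
     by (intro isCont_tendsto_compose[of _ bump]) auto
    then show ?thesis by (simp add: \<phi>_def lift_const[OF S] bump_0)
   qed
   have "(\<lambda>n. LBINT w:{u..v}. g n w p) \<longlonglongrightarrow> 0"
   proof (rule tendsto_0_le[where K="G * max 0 (v - u)"])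
    show "c \<longlonglongrightarrow> 0" by (rule c0)
    show "\<forall>\<^sub>F n in sequentially. norm (LBINT w:{u..v}. g n w p) \<le> norm (c n) * (G * max 0 (v - u))"
     using Fubini_bounded(4)[OF gm gb p] c(1) by (intro always_eventually) (simp add: mult_ac less_imp_le abs_of_pos)
   qed
   then have "(\<lambda>n. X n p) \<longlonglongrightarrow> W p * (e v p * 1 - e u p * 1 - 0)"
    unfolding X_def using ru by (intro tendsto_intros l) auto
   then show "(\<lambda>n. X n p) \<longlonglongrightarrow> W p * (e v p - e u p)" by simp
  qed
 qed
 moreover have "(\<integral>p. X n p \<partial>P) = 0" for n
  unfolding X_def e_def g_def by (rule block_process[OF tf s ru W_F W_b])
 ultimately have "(\<integral>p. W p * (e v p - e u p) \<partial>P) = 0" by (simp add: LIMSEQ_const_iff)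
 moreover have "integrable P (\<lambda>p. W p * e w p)" if "u \<le> w" "w \<le> v" for w
 proof (rule integrable_bdd)
  show "norm (W p * e w p) \<le> L * K" if "p \<in> \<Omega>" for p
   unfolding real_norm_def abs_mult e_def using W_b[OF that] L0[OF that] K(1)[of w p] that ru \<open>u \<le> w\<close> \<open>w \<le> v\<close>
   by (intro mult_mono) auto
 qed measurable
 ultimately show ?thesis using ru by (simp add: e_def right_diff_distrib)
qed

end

section \<open>Bounded weights and adapted random coefficients\<close>

context diffusion begin

definition bdd :: "(('k, 'd) path \<Rightarrow> real) \<Rightarrow> bool" where
 "bdd W \<longleftrightarrow> (\<exists>L. \<forall>p\<in>\<Omega>. \<bar>W p\<bar> \<le> L)"

lemma bddI: "(\<And>p. p \<in> \<Omega> \<Longrightarrow> \<bar>W p\<bar> \<le> L) \<Longrightarrow> bdd W"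
 unfolding bdd_def by blast

lemma bddE:
 assumes "bdd W" obtains L where "L \<ge> 0" "\<And>p. p \<in> \<Omega> \<Longrightarrow> \<bar>W p\<bar> \<le> L"
proof -
 obtain L where "\<forall>p\<in>\<Omega>. \<bar>W p\<bar> \<le> L" using assms bdd_def by blast
 then show thesis by (intro that[of "max L 0"]) (auto simp: le_max_iff_disj)
qed

lemma bdd_mult: "bdd W \<Longrightarrow> bdd V \<Longrightarrow> bdd (\<lambda>p. W p * V p)"
proof -
 assume "bdd W" "bdd V"
 then obtain L L' where "L \<ge> 0" "\<And>p. p \<in> \<Omega> \<Longrightarrow> \<bar>W p\<bar> \<le> L" "L' \<ge> 0" "\<And>p. p \<in> \<Omega> \<Longrightarrow> \<bar>V p\<bar> \<le> L'"
  by (elim bddE) blast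
 then show ?thesis by (intro bddI[of _ "L * L'"]) (auto simp: abs_mult intro!: mult_mono)
qed

lemma bdd_diff: "bdd W \<Longrightarrow> bdd V \<Longrightarrow> bdd (\<lambda>p. W p - V p)"
proof -
 assume "bdd W" "bdd V"
 then obtain L L' where *: "\<And>p. p \<in> \<Omega> \<Longrightarrow> \<bar>W p\<bar> \<le> L" "\<And>p. p \<in> \<Omega> \<Longrightarrow> \<bar>V p\<bar> \<le> L'"
  by (elim bddE) blast
 show ?thesis by (intro bddI[of _ "L + L'"] order_trans[OF abs_triangle_ineq4] add_mono *)
qed

lemma bdd_indicator: "bdd (indicator A)"
 by (rule bddI[of _ 1]) (auto simp: indicator_def)

lemma bdd_integrable: "W \<in> borel_measurable P \<Longrightarrow> bdd W \<Longrightarrow> integrable P W"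
 using integrable_bdd[of W] unfolding bdd_def by (metis real_norm_def)

lemma bdd_lift: "tf \<phi> \<Longrightarrow> 0 \<le> w \<Longrightarrow> w \<le> T \<Longrightarrow> bdd (\<lambda>p. lift \<phi> (p w))"
 by (rule gen_process[of \<phi>], assumption, rule bddI, blast)

lemma lift_adapted: "tf \<phi> \<Longrightarrow> 0 \<le> w \<Longrightarrow> (\<lambda>p. lift \<phi> (p w)) \<in> borel_measurable (F w)"
 using adapted_eval[OF _ tf_measurable(4)] .

definition admissible ::
 "(real \<Rightarrow> ('k, 'd) path \<Rightarrow> real^'d) \<Rightarrow> (real \<Rightarrow> ('k, 'd) path \<Rightarrow> real^'k) \<Rightarrow> real \<Rightarrow> bool" where
 "admissible \<beta> \<kappa> M \<longleftrightarrow>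
   joint \<beta> \<and> joint \<kappa> \<and>
   (\<forall>w. 0 \<le> w \<and> w \<le> T \<longrightarrow> \<beta> w \<in> borel_measurable (F w) \<and> \<kappa> w \<in> borel_measurable (F w)) \<and>
   (\<forall>w p. 0 \<le> w \<and> w \<le> T \<and> p \<in> \<Omega> \<longrightarrow> norm (\<beta> w p) \<le> M \<and> norm (\<kappa> w p) \<le> M)"

lemma admissible_gen:
 assumes \<phi>: "tf \<phi>" and adm: "admissible \<beta> \<kappa> M"
 obtains C where "C \<ge> 0"
  "\<And>w p. 0 \<le> w \<Longrightarrow> w \<le> T \<Longrightarrow> p \<in> \<Omega> \<Longrightarrow> \<bar>gen_at \<phi> \<beta> \<kappa> w p\<bar> \<le> C"
  "(\<lambda>(w, p). gen_at \<phi> \<beta> \<kappa> w p) \<in> borel_measurable \<P>"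
  "\<And>w. 0 \<le> w \<Longrightarrow> w \<le> T \<Longrightarrow> (\<lambda>p. gen_at \<phi> \<beta> \<kappa> w p) \<in> borel_measurable (F w)"
proof -
 obtain C where C: "C \<ge> 0" "\<And>\<beta> \<kappa> z. z \<in> state_space \<Longrightarrow> \<bar>gen \<epsilon> \<phi> \<beta> \<kappa> z\<bar> \<le> C * (1 + norm \<beta> + norm \<kappa>)"
  using gen_bound[OF \<phi>] by metis
 show thesis
 proof (rule that[of "C * (1 + \<bar>M\<bar> + \<bar>M\<bar>)"])
  show "0 \<le> C * (1 + \<bar>M\<bar> + \<bar>M\<bar>)" using C(1) by simp
  fix w p assume *: "0 \<le> w" "w \<le> T" "p \<in> \<Omega>"
  then have "norm (\<beta> w p) \<le> \<bar>M\<bar>" "norm (\<kappa> w p) \<le> \<bar>M\<bar>"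
   using adm unfolding admissible_def by (meson abs_ge_self order_trans)+
  then have "C * (1 + norm (\<beta> w p) + norm (\<kappa> w p)) \<le> C * (1 + \<bar>M\<bar> + \<bar>M\<bar>)"
   using C(1) by (intro mult_left_mono) auto
  then show "\<bar>gen_at \<phi> \<beta> \<kappa> w p\<bar> \<le> C * (1 + \<bar>M\<bar> + \<bar>M\<bar>)"
   using C(2)[of "p w" "\<beta> w p" "\<kappa> w p"] * cadlag_in_state_space by fastforce
 next
  have "(\<lambda>x. gen \<epsilon> \<phi> (case x of (w, p) \<Rightarrow> \<beta> w p) (case x of (w, p) \<Rightarrow> \<kappa> w p) (case x of (w, p) \<Rightarrow> p w))
    \<in> borel_measurable \<P>"
   using adm unfolding admissible_def by (intro gen_measurable \<phi> process_measurable) auto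
  then show "(\<lambda>(w, p). gen_at \<phi> \<beta> \<kappa> w p) \<in> borel_measurable \<P>"
   by (simp add: split_beta')
 next
  fix w assume "0 \<le> w" "w \<le> T"
  then show "(\<lambda>p. gen_at \<phi> \<beta> \<kappa> w p) \<in> borel_measurable (F w)"
   using adm unfolding admissible_def by (intro gen_measurable \<phi> filtration_eval) auto
 qed
qed

definition increment ::
 "('k \<Rightarrow> real^'d \<Rightarrow> real) \<Rightarrow> (real \<Rightarrow> ('k, 'd) path \<Rightarrow> real^'d) \<Rightarrow>
  (real \<Rightarrow> ('k, 'd) path \<Rightarrow> real^'k) \<Rightarrow> real \<Rightarrow> real \<Rightarrow> ('k, 'd) path \<Rightarrow> real" where
 "increment \<phi> \<beta> \<kappa> u v p = lift \<phi> (p v) - lift \<phi> (p u) - (LBINT w:{u..v}. gen_at \<phi> \<beta> \<kappa> w p)"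

lemma gen_section_measurable:
 assumes \<phi>: "tf \<phi>" and adm: "admissible \<beta> \<kappa> M" and "p \<in> \<Omega>"
 shows "(\<lambda>w. gen_at \<phi> \<beta> \<kappa> w p) \<in> borel_measurable borel"
 by (rule admissible_gen[OF \<phi> adm], rule path_section_measurable[where X="\<lambda>w p. gen_at \<phi> \<beta> \<kappa> w p"])
   (use assms(3) in auto)

lemma increment_props:
 assumes \<phi>: "tf \<phi>" and adm: "admissible \<beta> \<kappa> M" and uv: "0 \<le> u" "u \<le> v" "v \<le> T"
 shows "increment \<phi> \<beta> \<kappa> u v \<in> borel_measurable P" "bdd (increment \<phi> \<beta> \<kappa> u v)"
  "(\<lambda>p. LBINT w:{u..v}. gen_at \<phi> \<beta> \<kappa> w p) \<in> borel_measurable P"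
  "bdd (\<lambda>p. LBINT w:{u..v}. gen_at \<phi> \<beta> \<kappa> w p)"
proof -
 obtain C where C: "C \<ge> 0"
  "\<And>w p. 0 \<le> w \<Longrightarrow> w \<le> T \<Longrightarrow> p \<in> \<Omega> \<Longrightarrow> \<bar>gen_at \<phi> \<beta> \<kappa> w p\<bar> \<le> C"
  and m: "(\<lambda>(w, p). gen_at \<phi> \<beta> \<kappa> w p) \<in> borel_measurable \<P>"
  by (rule admissible_gen[OF \<phi> adm]) blast
 have nb: "norm (gen_at \<phi> \<beta> \<kappa> w p) \<le> C" if "u \<le> w" "w \<le> v" "p \<in> \<Omega>" for w p
  using C that uv by simp
 show i: "(\<lambda>p. LBINT w:{u..v}. gen_at \<phi> \<beta> \<kappa> w p) \<in> borel_measurable P"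
  by (rule Fubini_bounded(2)[OF m nb])
 show bi: "bdd (\<lambda>p. LBINT w:{u..v}. gen_at \<phi> \<beta> \<kappa> w p)"
  using Fubini_bounded(4)[OF m nb] by (auto intro!: bddI)
 have l: "(\<lambda>p. lift \<phi> (p w)) \<in> borel_measurable P" if "0 \<le> w" "w \<le> T" for w
  using that by (rule measurable_F_P[OF lift_adapted[OF \<phi>]])
 show "increment \<phi> \<beta> \<kappa> u v \<in> borel_measurable P"
  unfolding increment_def[abs_def] using i l uv by (intro borel_measurable_diff) auto
 show "bdd (increment \<phi> \<beta> \<kappa> u v)"
  unfolding increment_def[abs_def] using bi bdd_lift[OF \<phi>] uv by (intro bdd_diff) auto
qed

lemma increment_split:
 assumes \<phi>: "tf \<phi>" and adm: "admissible \<beta> \<kappa> M" and uv: "0 \<le> u" "u \<le> r" "r \<le> v" "v \<le> T" and p: "p \<in> \<Omega>"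
 shows "increment \<phi> \<beta> \<kappa> u v p = increment \<phi> \<beta> \<kappa> u r p + increment \<phi> \<beta> \<kappa> r v p"
proof -
 obtain C where C: "C \<ge> 0"
  "\<And>w p. 0 \<le> w \<Longrightarrow> w \<le> T \<Longrightarrow> p \<in> \<Omega> \<Longrightarrow> \<bar>gen_at \<phi> \<beta> \<kappa> w p\<bar> \<le> C"
  by (rule admissible_gen[OF \<phi> adm]) blast
 have "set_integrable lborel {u..v} (\<lambda>w. gen_at \<phi> \<beta> \<kappa> w p)"
  by (rule set_integrable_bdd[OF gen_section_measurable[OF \<phi> adm p], where B=C]) (use C uv p in auto)
 from set_integral_split[OF this uv(2,3)] show ?thesis by (simp add: increment_def)
qed

lemma weighted_increment:
 assumes \<phi>: "tf \<phi>" and adm: "admissible \<beta> \<kappa> M" and uv: "0 \<le> u" "u \<le> v" "v \<le> T"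
  and D: "\<And>w p. u \<le> w \<Longrightarrow> w \<le> v \<Longrightarrow> p \<in> \<Omega> \<Longrightarrow> \<bar>D w p\<bar> \<le> K"
  and Dm [measurable]: "joint D"
  and W: "W \<in> borel_measurable (F u)" "bdd W"
 shows "(\<integral>p. W p * (D v p * lift \<phi> (p v) - D u p * lift \<phi> (p u)
    - (LBINT w:{u..v}. D w p * gen_at \<phi> \<beta> \<kappa> w p)) \<partial>P)
  = (\<integral>p. W p * (D v p * lift \<phi> (p v)) \<partial>P) - (\<integral>p. W p * (D u p * lift \<phi> (p u)) \<partial>P)
    - (LBINT w:{u..v}. \<integral>p. W p * (D w p * gen_at \<phi> \<beta> \<kappa> w p) \<partial>P)"
proof -
 obtain C where C: "C \<ge> 0"
  "\<And>w p. 0 \<le> w \<Longrightarrow> w \<le> T \<Longrightarrow> p \<in> \<Omega> \<Longrightarrow> \<bar>gen_at \<phi> \<beta> \<kappa> w p\<bar> \<le> C"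
  and [measurable]: "(\<lambda>(w, p). gen_at \<phi> \<beta> \<kappa> w p) \<in> borel_measurable \<P>"
  by (rule admissible_gen[OF \<phi> adm]) blast
 obtain L where L: "L \<ge> 0" "\<And>p. p \<in> \<Omega> \<Longrightarrow> \<bar>W p\<bar> \<le> L" using W(2) by (rule bddE) blast
 have [measurable]: "W \<in> borel_measurable P" using W(1) uv by (auto intro: measurable_F_P)
 let ?X = "\<lambda>w p. W p * (D w p * gen_at \<phi> \<beta> \<kappa> w p)"
 have m: "joint ?X" by measurable
 have b: "norm (?X w p) \<le> L * (K * C)" if "u \<le> w" "w \<le> v" "p \<in> \<Omega>" for w p
 proof -
  have "0 \<le> K" using D[of u p] uv that by auto
  then show ?thesis unfolding real_norm_def abs_mult using L D C that uv by (intro mult_mono) auto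
 qed
 have i: "integrable P (\<lambda>p. LBINT w:{u..v}. ?X w p)"
  by (rule integrable_bdd[OF Fubini_bounded(2)[OF m b] Fubini_bounded(4)[OF m b]])
 have ip: "integrable P (\<lambda>p. W p * (D w p * lift \<phi> (p w)))" if w: "u \<le> w" "w \<le> v" for w
  using w uv D[OF w] time_section_measurable[OF Dm]
  by (intro bdd_integrable bdd_mult W(2) bddI[of "D w" K] bdd_lift[OF \<phi>] borel_measurable_times measurable_F_P[OF lift_adapted[OF \<phi>]]) auto
 have "(\<integral>p. W p * (D v p * lift \<phi> (p v) - D u p * lift \<phi> (p u)
    - (LBINT w:{u..v}. D w p * gen_at \<phi> \<beta> \<kappa> w p)) \<partial>P)
  = (\<integral>p. W p * (D v p * lift \<phi> (p v)) - W p * (D u p * lift \<phi> (p u)) - (LBINT w:{u..v}. ?X w p) \<partial>P)"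
  by (rule Bochner_Integration.integral_cong[OF refl]) (simp add: right_diff_distrib)
 then show ?thesis using i ip[of v] ip[of u] uv Fubini_bounded(1)[OF m b] by simp
qed

text \<open>Replacing a weight by one with the same conditional expectation: only the adaptedness of the
 integrand at each time is needed, because the time integral is exchanged with the expectation.\<close>

lemma increment_replace:
 assumes \<phi>: "tf \<phi>" and adm: "admissible \<beta> \<kappa> M" and uv: "0 \<le> u" "u \<le> v" "v \<le> T"
  and D: "\<And>w p. u \<le> w \<Longrightarrow> w \<le> v \<Longrightarrow> p \<in> \<Omega> \<Longrightarrow> \<bar>D w p\<bar> \<le> K"
  and Dm: "joint D"
  and E: "E \<in> borel_measurable P" "bdd E"
  and DE: "\<And>w V. u \<le> w \<Longrightarrow> w \<le> v \<Longrightarrow> V \<in> borel_measurable (F w) \<Longrightarrow> bdd V \<Longrightarrow>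
    (\<integral>p. V p * E p \<partial>P) = (\<integral>p. V p * D w p \<partial>P)"
  and W: "W \<in> borel_measurable (F u)" "bdd W"
 shows "(\<integral>p. W p * (E p * increment \<phi> \<beta> \<kappa> u v p) \<partial>P)
  = (\<integral>p. W p * (D v p * lift \<phi> (p v) - D u p * lift \<phi> (p u)
     - (LBINT w:{u..v}. D w p * gen_at \<phi> \<beta> \<kappa> w p)) \<partial>P)"
proof -
 obtain C where C: "\<And>w p. 0 \<le> w \<Longrightarrow> w \<le> T \<Longrightarrow> p \<in> \<Omega> \<Longrightarrow> \<bar>gen_at \<phi> \<beta> \<kappa> w p\<bar> \<le> C"
  and gF: "\<And>w. 0 \<le> w \<Longrightarrow> w \<le> T \<Longrightarrow> (\<lambda>p. gen_at \<phi> \<beta> \<kappa> w p) \<in> borel_measurable (F w)"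
  by (rule admissible_gen[OF \<phi> adm]) blast
 obtain N where N: "\<And>p. p \<in> \<Omega> \<Longrightarrow> \<bar>E p\<bar> \<le> N" using E(2) by (rule bddE) blast
 have Em: "(\<lambda>(w :: real, p). E p) \<in> borel_measurable \<P>"
  using measurable_compose[OF measurable_snd E(1)] by (simp add: split_beta')
 have eq: "(\<integral>p. W p * (E p * V p) \<partial>P) = (\<integral>p. W p * (D w p * V p) \<partial>P)"
  if w: "u \<le> w" "w \<le> v" and "V \<in> borel_measurable (F w)" "bdd V" for w V
  using DE[OF w borel_measurable_times[OF measurable_filtration_mono[OF W(1) w(1)] that(3)] bdd_mult[OF W(2) that(4)]]
  by (simp add: mult_ac)
 have "(\<integral>p. W p * (E p * increment \<phi> \<beta> \<kappa> u v p) \<partial>P) = (\<integral>p. W p * (E p * lift \<phi> (p v) - E p * lift \<phi> (p u)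
     - (LBINT w:{u..v}. E p * gen_at \<phi> \<beta> \<kappa> w p)) \<partial>P)"
  by (rule Bochner_Integration.integral_cong[OF refl]) (simp add: increment_def right_diff_distrib)
 also have "\<dots> = (\<integral>p. W p * (E p * lift \<phi> (p v)) \<partial>P) - (\<integral>p. W p * (E p * lift \<phi> (p u)) \<partial>P)
    - (LBINT w:{u..v}. \<integral>p. W p * (E p * gen_at \<phi> \<beta> \<kappa> w p) \<partial>P)"
  by (rule weighted_increment[OF \<phi> adm uv N Em W])
 also have "(LBINT w:{u..v}. \<integral>p. W p * (E p * gen_at \<phi> \<beta> \<kappa> w p) \<partial>P)
   = (LBINT w:{u..v}. \<integral>p. W p * (D w p * gen_at \<phi> \<beta> \<kappa> w p) \<partial>P)"
  using uv by (intro set_lebesgue_integral_cong allI impI eq gF bddI[OF C]) auto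
 finally show ?thesis
  using eq[OF _ _ lift_adapted[OF \<phi>] bdd_lift[OF \<phi>]] uv by (simp add: weighted_increment[OF \<phi> adm uv D Dm W])
qed

definition coeff_bound :: "real \<Rightarrow> real" where
 "coeff_bound M = max (B + \<epsilon>\<^sup>2 * M) (real CARD('k) * (exp (2 * M) * B))"

lemma coeff_admissible:
 assumes X: "joint X" "\<And>w. 0 \<le> w \<Longrightarrow> w \<le> T \<Longrightarrow> X w \<in> borel_measurable (F w)"
   "\<And>w p. 0 \<le> w \<Longrightarrow> w \<le> T \<Longrightarrow> p \<in> \<Omega> \<Longrightarrow> norm (X w p) \<le> M"
  and R: "joint R" "\<And>w. 0 \<le> w \<Longrightarrow> w \<le> T \<Longrightarrow> R w \<in> borel_measurable (F w)"
   "\<And>w p. 0 \<le> w \<Longrightarrow> w \<le> T \<Longrightarrow> p \<in> \<Omega> \<Longrightarrow> norm (R w p) \<le> M"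
 shows "admissible (\<lambda>w p. if 0 \<le> w \<and> w \<le> T then drift s (X w p) (p w) else 0)
  (\<lambda>w p. if 0 \<le> w \<and> w \<le> T then rates (R w p) (p w) else 0) (coeff_bound M)"
proof -
 have m: "(\<lambda>x. snd x (fst x)) \<in> borel_measurable \<P>"
  using process_measurable by (simp add: split_beta')
 have ind: "{x \<in> space \<P>. 0 \<le> fst x \<and> fst x \<le> T} \<in> sets \<P>" by measurable
 note X1 = X(1)[unfolded split_beta'] and R1 = R(1)[unfolded split_beta']
 show ?thesis
  unfolding admissible_def split_beta'
 proof (intro conjI allI impI; (elim conjE)?)
  fix w assume w: "0 \<le> w" "w \<le> T"
  have e: "(\<lambda>p. p w) \<in> borel_measurable (F w)" using w by (intro filtration_eval) auto
  show "(\<lambda>p. if 0 \<le> w \<and> w \<le> T then drift s (X w p) (p w) else 0) \<in> borel_measurable (F w)"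
   "(\<lambda>p. if 0 \<le> w \<and> w \<le> T then rates (R w p) (p w) else 0) \<in> borel_measurable (F w)"
   using coeff_measurable(2)[where \<rho>="\<lambda>_. 0", OF X(2)[OF w] borel_measurable_const e]
    coeff_measurable(3)[where \<xi>="\<lambda>_. 0", OF borel_measurable_const R(2)[OF w] e]
   by (simp_all only: w simp_thms if_True)
  fix p assume p: "p \<in> \<Omega>"
  then have z: "p w \<in> state_space" using w by (simp add: cadlag_in_state_space)
  show "norm (if 0 \<le> w \<and> w \<le> T then drift s (X w p) (p w) else 0) \<le> coeff_bound M"
   using drift_bound[OF z X(3)[OF w p], of s] w by (simp add: coeff_bound_def max.coboundedI1)
  show "norm (if 0 \<le> w \<and> w \<le> T then rates (R w p) (p w) else 0) \<le> coeff_bound M"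
   using rates_bound[OF z R(3)[OF w p]] w by (simp add: coeff_bound_def max.coboundedI2)
 qed (intro measurable_If borel_measurable_const ind coeff_measurable(2)[where \<rho>="\<lambda>_. 0"] coeff_measurable(3)[where \<xi>="\<lambda>_. 0"] X1 R1 m)+
qed

lemma const_admissible:
 "admissible (\<lambda>w p. if 0 \<le> w \<and> w \<le> T then drift s \<xi> (p w) else 0) (\<lambda>w p. if 0 \<le> w \<and> w \<le> T then rates \<rho> (p w) else 0)
   (coeff_bound (max (norm \<xi>) (norm \<rho>)))"
 by (rule coeff_admissible) (auto simp: split_beta')

text \<open>By \<open>block_mass\<close> the factor up to t may be replaced at each time w by the
  factor up to w, which turns the claim into \<open>block_process\<close>.\<close>

lemma block_const:
 assumes \<phi>: "tf \<phi>" and s: "0 < s" "s \<le> 1" and ru: "0 \<le> r" "r \<le> u" "u \<le> v" "v \<le> t" "t \<le> T"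
  and W: "W \<in> borel_measurable (F u)" "bdd W"
 shows "(\<integral>p. W p * (exp (log_factor s \<xi> \<rho> r t p) *
   increment \<phi> (\<lambda>w p. drift s \<xi> (p w)) (\<lambda>w p. rates \<rho> (p w)) u v p) \<partial>P) = 0"
proof -
 obtain K where K: "\<And>x p. r \<le> x \<Longrightarrow> x \<le> T \<Longrightarrow> p \<in> \<Omega> \<Longrightarrow> exp (log_factor s \<xi> \<rho> r x p) \<le> K" "K \<ge> 0"
  using log_factor_bdd[OF s] ru(1) by metis
 define D where "D w p = exp (log_factor s \<xi> \<rho> r w p)" for w p
 let ?\<beta> = "\<lambda>w p. if 0 \<le> w \<and> w \<le> T then drift s \<xi> (p w) else 0"
 let ?\<kappa> = "\<lambda>w p. if 0 \<le> w \<and> w \<le> T then rates \<rho> (p w) else 0"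
 have Dm: "joint D"
  using log_factor_process(1)[where s=s and \<xi>=\<xi> and \<rho>=\<rho> and r=r] unfolding D_def split_beta' by measurable
 have Dm': "D w \<in> borel_measurable P" for w by (rule time_section_measurable[OF Dm])
 have Db: "\<bar>D w p\<bar> \<le> K" if "r \<le> w" "w \<le> T" "p \<in> \<Omega>" for w p
  using K that by (simp add: D_def)
 have inc: "increment \<phi> ?\<beta> ?\<kappa> u v p = increment \<phi> (\<lambda>w p. drift s \<xi> (p w)) (\<lambda>w p. rates \<rho> (p w)) u v p" for p
  unfolding increment_def by (intro arg_cong2[where f="(-)"] refl set_lebesgue_integral_cong) (use ru in auto)
 have "(\<integral>p. W p * (D t p * increment \<phi> ?\<beta> ?\<kappa> u v p) \<partial>P)
   = (\<integral>p. W p * (D v p * lift \<phi> (p v) - D u p * lift \<phi> (p u)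
     - (LBINT w:{u..v}. D w p * gen_at \<phi> ?\<beta> ?\<kappa> w p)) \<partial>P)"
 proof (rule increment_replace[where K=K, OF \<phi> const_admissible])
  show "bdd (D t)" using Db ru by (intro bddI[of _ K]) auto
  fix w V assume w: "u \<le> w" "w \<le> v" and V: "V \<in> borel_measurable (F w)" "bdd V"
  obtain L where "\<And>p. p \<in> \<Omega> \<Longrightarrow> \<bar>V p\<bar> \<le> L" using V(2) by (rule bddE) blast
  then show "(\<integral>p. V p * D t p \<partial>P) = (\<integral>p. V p * D w p \<partial>P)"
   unfolding D_def using w ru by (intro block_mass[OF s _ _ _ _ V(1)]) auto
 qed (use ru W Dm Dm' Db in auto)
 also have "\<dots> = (\<integral>p. W p * (D v p * lift \<phi> (p v) - D u p * lift \<phi> (p u)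
     - (LBINT w:{u..v}. D w p * gen_of \<phi> (drift s \<xi>) (rates \<rho>) (p w))) \<partial>P)"
  by (intro Bochner_Integration.integral_cong arg_cong2[where f="(-)"] arg_cong2[where f="(*)"] refl
    set_lebesgue_integral_cong) (use ru in auto)
 also have "\<dots> = 0"
 proof -
  obtain L where "\<And>p. p \<in> \<Omega> \<Longrightarrow> \<bar>W p\<bar> \<le> L" using W(2) by (rule bddE) blast
  then show ?thesis unfolding D_def using ru by (intro block_process[OF \<phi> s _ _ _ _ W(1)]) auto
 qed
 finally show ?thesis unfolding inc D_def .
qed

end

subsection \<open>Piecewise constant random coefficients\<close>

lemma set_integral_cong_Ioc:
 fixes f g :: "real \<Rightarrow> real"
 assumes "f \<in> borel_measurable borel" "g \<in> borel_measurable borel" and eq: "\<And>w. u < w \<Longrightarrow> w \<le> v \<Longrightarrow> f w = g w"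
 shows "(LBINT w:{u..v}. f w) = (LBINT w:{u..v}. g w)"
proof -
 have "AE w in lborel. w \<notin> {u}" by (rule AE_not_in) (simp add: null_sets_def)
 then have "AE w in lborel. indicator {u..v} w *\<^sub>R f w = indicator {u..v} w *\<^sub>R g w"
  by (rule AE_mp) (use eq in \<open>auto split: split_indicator\<close>)
 then show ?thesis
  unfolding set_lebesgue_integral_def using assms(1,2) by (intro integral_cong_AE) auto
qed

text \<open>Cells are open on the left and closed on the right, so that the value used at time w is
  known strictly before w.\<close>

definition stepp :: "(nat \<Rightarrow> real) \<Rightarrow> nat \<Rightarrow> (nat \<Rightarrow> 'w \<Rightarrow> 'a::real_vector) \<Rightarrow> real \<Rightarrow> 'w \<Rightarrow> 'a" where
 "stepp \<tau> n \<xi> w p = (\<Sum>m<n. indicator {\<tau> m<..\<tau> (Suc m)} w *\<^sub>R \<xi> m p)"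

lemma partition_less:
 assumes "\<And>m. m < n \<Longrightarrow> \<tau> m < (\<tau> (Suc m) :: real)" "i < j" "j \<le> n"
 shows "\<tau> i < \<tau> j"
 using assms(2,3)
proof (induction j)
 case (Suc j)
 then show ?case using assms(1)[of j] by (cases "i = j") auto
qed simp

lemma partition_le:
 assumes "\<And>m. m < n \<Longrightarrow> \<tau> m < (\<tau> (Suc m) :: real)" "i \<le> j" "j \<le> n"
 shows "\<tau> i \<le> \<tau> j"
 using partition_less[of n \<tau>, OF assms(1)] assms(2,3) by (cases "i = j") (auto simp: less_le)

lemma stepp_eq:
 assumes \<tau>: "\<And>m. m < n \<Longrightarrow> \<tau> m < \<tau> (Suc m)" and m: "m < n" and w: "\<tau> m < w" "w \<le> \<tau> (Suc m)"
 shows "stepp \<tau> n \<xi> w p = \<xi> m p"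
proof -
 have "indicator {\<tau> k<..\<tau> (Suc k)} w = (if k = m then 1 else 0 :: real)" if "k < n" for k
 proof (cases k m rule: linorder_cases)
  case less
  then have "\<tau> (Suc k) \<le> \<tau> m" using m by (intro partition_le[of n]) (auto intro: \<tau>)
  then show ?thesis using less w by (auto simp: indicator_def)
 next
  case greater
  then have "\<tau> (Suc m) \<le> \<tau> k" using that by (intro partition_le[of n]) (auto intro: \<tau>)
  then show ?thesis using greater w by (auto simp: indicator_def)
 qed (use w in \<open>auto simp: indicator_def\<close>)
 then have "stepp \<tau> n \<xi> w p = (\<Sum>k<n. if k = m then \<xi> k p else 0)"
  unfolding stepp_def by (intro sum.cong) auto
 then show ?thesis using m by simp
qed

lemma stepp_cases:
 assumes \<tau>: "\<And>m. m < n \<Longrightarrow> \<tau> m < \<tau> (Suc m)"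
 obtains "stepp \<tau> n \<xi> w p = 0" | m where "m < n" "\<tau> m < w" "w \<le> \<tau> (Suc m)" "stepp \<tau> n \<xi> w p = \<xi> m p"
proof (cases "\<exists>m<n. \<tau> m < w \<and> w \<le> \<tau> (Suc m)")
 case True
 then obtain m where m: "m < n" "\<tau> m < w" "w \<le> \<tau> (Suc m)" by blast
 show thesis by (rule that(2)[OF m stepp_eq[of n \<tau>, OF \<tau> m]])
next
 case False
 then have "stepp \<tau> n \<xi> w p = 0" unfolding stepp_def by (intro sum.neutral) (auto simp: indicator_def)
 then show thesis by (rule that(1))
qed

lemma partition_cover:
 assumes "\<tau> 0 < (w::real)" "w \<le> \<tau> n"
 obtains m where "m < n" "\<tau> m < w" "w \<le> \<tau> (Suc m)"
proof -
 have "\<exists>m<n. \<tau> m < w \<and> w \<le> \<tau> (Suc m)"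
  using assms
 proof (induction n)
  case (Suc n)
  show ?case
  proof (cases "w \<le> \<tau> n")
   case True
   then show ?thesis using Suc.IH[OF Suc.prems(1)] less_SucI by blast
  next
   case False
   then show ?thesis using Suc.prems by (intro exI[of _ n]) simp
  qed
 qed simp
 then show thesis using that by blast
qed

section \<open>Freezing finitely valued coefficients\<close>

context diffusion begin

text \<open>A parameter with finitely many values is constant on finitely many events;
  measurability, and in \<open>freeze_integral\<close> the vanishing of expectations, pass from
  constants to the random parameter by summing over these events.\<close>

lemma freeze:
 fixes \<theta> :: "('k, 'd) path \<Rightarrow> 'c"
 assumes fin: "finite (\<theta> ` \<Omega>)" and sp: "space M = \<Omega>"
  and A: "\<And>c. c \<in> \<theta> ` \<Omega> \<Longrightarrow> {p \<in> \<Omega>. \<theta> p = c} \<in> sets M"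
  and h: "\<And>c. c \<in> \<theta> ` \<Omega> \<Longrightarrow> h c \<in> borel_measurable M"
 shows "(\<lambda>p. h (\<theta> p) p :: real) \<in> borel_measurable M"
  and "p \<in> \<Omega> \<Longrightarrow> h (\<theta> p) p = (\<Sum>c\<in>\<theta> ` \<Omega>. indicator {p \<in> \<Omega>. \<theta> p = c} p * h c p)"
proof -
 show eq: "h (\<theta> p) p = (\<Sum>c\<in>\<theta> ` \<Omega>. indicator {p \<in> \<Omega>. \<theta> p = c} p * h c p)" if "p \<in> \<Omega>" for p
 proof -
  have "(\<Sum>c\<in>\<theta> ` \<Omega>. indicator {p \<in> \<Omega>. \<theta> p = c} p * h c p) = (\<Sum>c\<in>\<theta> ` \<Omega>. if c = \<theta> p then h c p else 0)"
   using that by (intro sum.cong) auto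
  then show ?thesis using fin that by simp
 qed
 have "(\<lambda>p. \<Sum>c\<in>\<theta> ` \<Omega>. indicator {p \<in> \<Omega>. \<theta> p = c} p * h c p) \<in> borel_measurable M"
  using A h by (intro borel_measurable_sum borel_measurable_times borel_measurable_indicator) auto
 then show "(\<lambda>p. h (\<theta> p) p) \<in> borel_measurable M"
  by (rule measurable_cong[THEN iffD2, rotated]) (simp add: eq sp)
qed

lemma freeze_integral:
 fixes \<theta> :: "('k, 'd) path \<Rightarrow> 'c"
 assumes fin: "finite (\<theta> ` \<Omega>)"
  and A: "\<And>c. c \<in> \<theta> ` \<Omega> \<Longrightarrow> {p \<in> \<Omega>. \<theta> p = c} \<in> sets P"
  and h: "\<And>c. c \<in> \<theta> ` \<Omega> \<Longrightarrow> h c \<in> borel_measurable P" "\<And>c. c \<in> \<theta> ` \<Omega> \<Longrightarrow> bdd (h c)"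
  and 0: "\<And>c. c \<in> \<theta> ` \<Omega> \<Longrightarrow> (\<integral>p. indicator {p \<in> \<Omega>. \<theta> p = c} p * h c p \<partial>P) = 0"
 shows "(\<integral>p. h (\<theta> p) p \<partial>P) = 0"
proof -
 have "(\<integral>p. h (\<theta> p) p \<partial>P) = (\<integral>p. (\<Sum>c\<in>\<theta> ` \<Omega>. indicator {p \<in> \<Omega>. \<theta> p = c} p * h c p) \<partial>P)"
  by (intro Bochner_Integration.integral_cong refl freeze(2)[OF fin _ A h(1)]) auto
 also have "\<dots> = (\<Sum>c\<in>\<theta> ` \<Omega>. \<integral>p. indicator {p \<in> \<Omega>. \<theta> p = c} p * h c p \<partial>P)"
  using A h by (intro Bochner_Integration.integral_sum bdd_integrable bdd_mult bdd_indicator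
    borel_measurable_times borel_measurable_indicator) auto
 finally show ?thesis using 0 by simp
qed

lemma freeze_bdd:
 fixes \<theta> :: "('k, 'd) path \<Rightarrow> 'c"
 assumes fin: "finite (\<theta> ` \<Omega>)" and h: "\<And>c. c \<in> \<theta> ` \<Omega> \<Longrightarrow> bdd (h c)"
 shows "bdd (\<lambda>p. h (\<theta> p) p)"
proof -
 obtain L where L: "\<And>c p. c \<in> \<theta> ` \<Omega> \<Longrightarrow> p \<in> \<Omega> \<Longrightarrow> \<bar>h c p\<bar> \<le> L c" using h unfolding bdd_def by metis
 show ?thesis
 proof (rule bddI)
  fix p assume p: "p \<in> \<Omega>"
  then have "L (\<theta> p) \<le> Max (L ` \<theta> ` \<Omega>)" using fin by (intro Max_ge) auto
  then show "\<bar>h (\<theta> p) p\<bar> \<le> Max (L ` \<theta> ` \<Omega>)" using L[of "\<theta> p" p] p by auto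
 qed
qed

lemma increment_cong:
 assumes "\<And>w. u \<le> w \<Longrightarrow> w \<le> v \<Longrightarrow> \<beta> w p = \<beta>' w p" "\<And>w. u \<le> w \<Longrightarrow> w \<le> v \<Longrightarrow> \<kappa> w p = \<kappa>' w p"
 shows "increment \<phi> \<beta> \<kappa> u v p = increment \<phi> \<beta>' \<kappa>' u v p"
 unfolding increment_def by (intro arg_cong2[where f="(-)"] refl set_lebesgue_integral_cong) (use assms in auto)

lemma const_increment_props:
 assumes \<phi>: "tf \<phi>" and uv: "0 \<le> u" "u \<le> v" "v \<le> T"
 shows "increment \<phi> (\<lambda>w p. drift s \<xi> (p w)) (\<lambda>w p. rates \<rho> (p w)) u v \<in> borel_measurable P"
  "bdd (increment \<phi> (\<lambda>w p. drift s \<xi> (p w)) (\<lambda>w p. rates \<rho> (p w)) u v)"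
proof -
 let ?\<beta> = "\<lambda>w p. if 0 \<le> w \<and> w \<le> T then drift s \<xi> (p w) else 0"
 let ?\<kappa> = "\<lambda>w p. if 0 \<le> w \<and> w \<le> T then rates \<rho> (p w) else 0"
 have eq: "increment \<phi> (\<lambda>w p. drift s \<xi> (p w)) (\<lambda>w p. rates \<rho> (p w)) u v = increment \<phi> ?\<beta> ?\<kappa> u v"
  by (intro ext increment_cong) (use uv in auto)
 show "increment \<phi> (\<lambda>w p. drift s \<xi> (p w)) (\<lambda>w p. rates \<rho> (p w)) u v \<in> borel_measurable P"
  "bdd (increment \<phi> (\<lambda>w p. drift s \<xi> (p w)) (\<lambda>w p. rates \<rho> (p w)) u v)"
  unfolding eq using increment_props(1,2)[OF \<phi> const_admissible uv] by auto
qed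

context
 fixes s r t :: real and \<xi> :: "('k, 'd) path \<Rightarrow> real^'d" and \<rho> :: "('k, 'd) path \<Rightarrow> real^'k"
 assumes s: "0 < s" "s \<le> 1" and rt: "0 \<le> r" "r \<le> t" "t \<le> T"
  and \<xi>: "\<xi> \<in> borel_measurable (F r)" and \<rho>: "\<rho> \<in> borel_measurable (F r)"
  and fin: "finite ((\<lambda>p. (\<xi> p, \<rho> p)) ` \<Omega>)"
begin

lemma freeze_sets:
 assumes "r \<le> u" shows "{p \<in> \<Omega>. (\<xi> p, \<rho> p) = c} \<in> sets (F u)"
proof -
 have "\<xi> -` {fst c} \<inter> space (F r) \<in> sets (F r)" "\<rho> -` {snd c} \<inter> space (F r) \<in> sets (F r)"
  by (rule measurable_sets[OF \<xi>] measurable_sets[OF \<rho>], simp)+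
 then have "(\<xi> -` {fst c} \<inter> space (F r)) \<inter> (\<rho> -` {snd c} \<inter> space (F r)) \<in> sets (F r)" by (rule sets.Int)
 moreover have "{p \<in> \<Omega>. (\<xi> p, \<rho> p) = c} = (\<xi> -` {fst c} \<inter> space (F r)) \<inter> (\<rho> -` {snd c} \<inter> space (F r))"
  by (cases c) auto
 ultimately show ?thesis using filtration_mono[OF assms] by auto
qed

lemma freeze_sets_P: "{p \<in> \<Omega>. (\<xi> p, \<rho> p) = c} \<in> sets P"
 using freeze_sets[of T c] filtration_path_space[of T T] rt by (auto simp: sets_P)

lemma factor_measurable: "log_factor s x y r t \<in> borel_measurable (F t)" "(\<lambda>p. exp (log_factor s x y r t p)) \<in> borel_measurable (F t)"
 using log_factor_measurable_F[OF rt] by auto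

lemma factor_bdd: "bdd (\<lambda>p. exp (log_factor s x y r t p))"
 by (rule log_factor_bdd[OF s, of x y], rule bddI) (use rt in auto)

lemma random_block_measurable: "(\<lambda>p. exp (log_factor s (\<xi> p) (\<rho> p) r t p)) \<in> borel_measurable (F t)"
 using freeze(1)[OF fin, where M="F t" and h="\<lambda>c p. exp (log_factor s (fst c) (snd c) r t p)"] freeze_sets[OF rt(2)] factor_measurable
 by simp

lemma random_block_bdd: "bdd (\<lambda>p. exp (log_factor s (\<xi> p) (\<rho> p) r t p))"
 using freeze_bdd[OF fin, where h="\<lambda>c p. exp (log_factor s (fst c) (snd c) r t p)"] factor_bdd by simp

lemma indicator_F: "r \<le> u \<Longrightarrow> V \<in> borel_measurable (F u) \<Longrightarrow>
  (\<lambda>p. indicator {p \<in> \<Omega>. (\<xi> p, \<rho> p) = c} p * V p :: real) \<in> borel_measurable (F u)"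
 by (intro borel_measurable_times borel_measurable_indicator freeze_sets)

text \<open>The atoms of (\<xi>, \<rho>) lie in F_r, so their indicators may join the weight, and
  \<open>block_mass\<close> applies from r to t; the factor over {r..r} is 1.\<close>

lemma random_block_mass:
 assumes V: "V \<in> borel_measurable (F r)" "bdd V"
 shows "(\<integral>p. V p * exp (log_factor s (\<xi> p) (\<rho> p) r t p) \<partial>P) = (\<integral>p. V p \<partial>P)"
proof -
 have VP: "V \<in> borel_measurable P" using V(1) rt by (auto intro: measurable_F_P)
 have eP: "(\<lambda>p. exp (log_factor s x y r t p)) \<in> borel_measurable P" for x y
  using factor_measurable(2) rt(3) by (rule measurable_F_P)
 have r0: "log_factor s x y r r p = 0" for x y p
 proof -
  have "(LBINT w:{r..r}. compensator s x y (p w)) = 0"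
   unfolding set_lebesgue_integral_def by (intro integral_eq_zero_AE AE_I[where N="{r}"]) (auto split: split_indicator)
  then show ?thesis by (simp add: log_factor_def)
 qed
 have bd: "bdd (\<lambda>p. V p * exp (log_factor s x y r t p) - V p)" for x y
  by (intro bdd_diff bdd_mult V factor_bdd)
 have "(\<integral>p. (\<lambda>c p. V p * exp (log_factor s (fst c) (snd c) r t p) - V p) (\<xi> p, \<rho> p) p \<partial>P) = 0"
 proof (rule freeze_integral[OF fin freeze_sets_P])
  fix c
  show "(\<lambda>p. V p * exp (log_factor s (fst c) (snd c) r t p) - V p) \<in> borel_measurable P"
   by (intro borel_measurable_diff borel_measurable_times VP eP)
  show "bdd (\<lambda>p. V p * exp (log_factor s (fst c) (snd c) r t p) - V p)" by (rule bd)
  let ?I = "indicator {p \<in> \<Omega>. (\<xi> p, \<rho> p) = c} :: _ \<Rightarrow> real"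
  have IV: "bdd (\<lambda>p. ?I p * V p)" by (intro bdd_mult bdd_indicator V)
  obtain L where L: "\<And>p. p \<in> \<Omega> \<Longrightarrow> \<bar>?I p * V p\<bar> \<le> L" using IV by (rule bddE) blast
  have "(\<integral>p. ?I p * V p * exp (log_factor s (fst c) (snd c) r t p) \<partial>P) = (\<integral>p. ?I p * V p \<partial>P)"
   using block_mass[OF s rt(1) order_refl rt(2,3) indicator_F[OF order_refl V(1)] L] by (simp add: r0)
  moreover have "integrable P (\<lambda>p. ?I p * V p * exp (log_factor s (fst c) (snd c) r t p))" "integrable P (\<lambda>p. ?I p * V p)"
   by (intro bdd_integrable bdd_mult bdd_indicator V factor_bdd borel_measurable_times borel_measurable_indicator freeze_sets_P VP eP)+
  ultimately show "(\<integral>p. ?I p * (V p * exp (log_factor s (fst c) (snd c) r t p) - V p) \<partial>P) = 0"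
   by (simp add: right_diff_distrib mult.assoc)
 qed
 moreover have "integrable P (\<lambda>p. V p * exp (log_factor s (\<xi> p) (\<rho> p) r t p))" "integrable P V"
  by (intro bdd_integrable bdd_mult V random_block_bdd borel_measurable_times VP measurable_F_P[OF random_block_measurable rt(3)])+
 ultimately show ?thesis by simp
qed

lemma random_block_increment:
 assumes \<phi>: "tf \<phi>" and uv: "r \<le> u" "u \<le> v" "v \<le> t" and W: "W \<in> borel_measurable (F u)" "bdd W"
 shows "(\<integral>p. W p * (exp (log_factor s (\<xi> p) (\<rho> p) r t p) *
   increment \<phi> (\<lambda>w p. drift s (\<xi> p) (p w)) (\<lambda>w p. rates (\<rho> p) (p w)) u v p) \<partial>P) = 0"
proof -
 have WP: "W \<in> borel_measurable P" using W(1) rt uv by (auto intro: measurable_F_P)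
 have eP: "(\<lambda>p. exp (log_factor s x y r t p)) \<in> borel_measurable P" for x y
  using factor_measurable(2) rt(3) by (rule measurable_F_P)
 let ?inc = "\<lambda>c. increment \<phi> (\<lambda>w p. drift s (fst c) (p w)) (\<lambda>w p. rates (snd c) (p w)) u v"
 have inc: "?inc c \<in> borel_measurable P" "bdd (?inc c)" for c
  using const_increment_props[OF \<phi>, of u v] rt uv by auto
 have "(\<integral>p. (\<lambda>c p. W p * (exp (log_factor s (fst c) (snd c) r t p) * ?inc c p)) (\<xi> p, \<rho> p) p \<partial>P) = 0"
 proof (rule freeze_integral[OF fin freeze_sets_P])
  fix c
  show "(\<lambda>p. W p * (exp (log_factor s (fst c) (snd c) r t p) * ?inc c p)) \<in> borel_measurable P"
   by (intro borel_measurable_times WP eP inc)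
  show "bdd (\<lambda>p. W p * (exp (log_factor s (fst c) (snd c) r t p) * ?inc c p))"
   by (intro bdd_mult W factor_bdd inc)
  let ?I = "indicator {p \<in> \<Omega>. (\<xi> p, \<rho> p) = c} :: _ \<Rightarrow> real"
  have "(\<integral>p. (?I p * W p) * (exp (log_factor s (fst c) (snd c) r t p) * ?inc c p) \<partial>P) = 0"
   by (rule block_const[OF \<phi> s rt(1) uv rt(3) indicator_F[OF uv(1) W(1)]]) (intro bdd_mult bdd_indicator W)
  then show "(\<integral>p. ?I p * (W p * (exp (log_factor s (fst c) (snd c) r t p) * ?inc c p)) \<partial>P) = 0"
   by (simp add: mult.assoc)
 qed
 then show ?thesis by (simp add: increment_def)
qed

end

text \<open>D acts as a density on F_x. It leaves expectations of F_0-measurable weights unchanged,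
  which later preserves the initial distribution, and it centres the increments with coefficients
  \<beta>, \<kappa> up to time x against weights from the past.\<close>

definition good_on :: "real \<Rightarrow> ((real \<Rightarrow> (real^'k) \<times> (real^'d)) \<Rightarrow> real) \<Rightarrow>
 (real \<Rightarrow> (real \<Rightarrow> (real^'k) \<times> (real^'d)) \<Rightarrow> real^'d) \<Rightarrow> (real \<Rightarrow> (real \<Rightarrow> (real^'k) \<times> (real^'d)) \<Rightarrow> real^'k) \<Rightarrow> bool" where
 "good_on x D \<beta> \<kappa> \<longleftrightarrow> D \<in> borel_measurable (F x) \<and> bdd D \<and>
   (\<forall>W. W \<in> borel_measurable (F 0) \<longrightarrow> bdd W \<longrightarrow> (\<integral>p. W p * D p \<partial>P) = (\<integral>p. W p \<partial>P)) \<and>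
   (\<forall>\<phi> u v W. tf \<phi> \<longrightarrow> 0 \<le> u \<longrightarrow> u \<le> v \<longrightarrow> v \<le> x \<longrightarrow> W \<in> borel_measurable (F u) \<longrightarrow> bdd W \<longrightarrow>
    (\<integral>p. W p * (D p * increment \<phi> \<beta> \<kappa> u v p) \<partial>P) = 0)"

text \<open>An increment before r does not feel the new factor, which has conditional mean one given
  F_r. For an increment after r, D is part of the weight and \<open>random_block_increment\<close>
  applies. An increment that straddles r is split there.\<close>

lemma good_on_extend:
 assumes g: "good_on r D \<beta> \<kappa>" and adm: "admissible \<beta> \<kappa> M"
  and s: "0 < s" "s \<le> 1" and rt: "0 \<le> r" "r \<le> t" "t \<le> T"
  and \<xi>: "\<xi> \<in> borel_measurable (F r)" and \<rho>: "\<rho> \<in> borel_measurable (F r)"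
  and fin: "finite ((\<lambda>p. (\<xi> p, \<rho> p)) ` \<Omega>)"
  and \<beta>: "\<And>w p. r < w \<Longrightarrow> w \<le> t \<Longrightarrow> \<beta> w p = drift s (\<xi> p) (p w)"
  and \<kappa>: "\<And>w p. r < w \<Longrightarrow> w \<le> t \<Longrightarrow> \<kappa> w p = rates (\<rho> p) (p w)"
 shows "good_on t (\<lambda>p. D p * exp (log_factor s (\<xi> p) (\<rho> p) r t p)) \<beta> \<kappa>"
proof -
 let ?E = "\<lambda>p. exp (log_factor s (\<xi> p) (\<rho> p) r t p)"
 have D: "D \<in> borel_measurable (F r)" "bdd D" using g by (auto simp: good_on_def)
 note E = random_block_measurable[OF s rt \<xi> \<rho> fin] random_block_bdd[OF s rt \<xi> \<rho> fin]
 note mass = random_block_mass[OF s rt \<xi> \<rho> fin]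
 have EP: "?E \<in> borel_measurable P" by (rule measurable_F_P[OF E(1) rt(3)])
 have DP: "D \<in> borel_measurable P" using D(1) rt by (auto intro: measurable_F_P)
 have F0: "W \<in> borel_measurable (F r)" if "W \<in> borel_measurable (F u)" "u \<le> r" for u and W :: "_ \<Rightarrow> real"
  using that by (rule measurable_filtration_mono)
 have low: "(\<integral>p. W p * (D p * ?E p * increment \<phi> \<beta> \<kappa> u v p) \<partial>P) = 0"
  if \<phi>: "tf \<phi>" and uv: "0 \<le> u" "u \<le> v" "v \<le> r" and W: "W \<in> borel_measurable (F u)" "bdd W" for \<phi> u v W
 proof -
  obtain K where K: "\<And>p. p \<in> \<Omega> \<Longrightarrow> \<bar>D p\<bar> \<le> K" using D(2) by (rule bddE) blast
  have Dm: "(\<lambda>(w, p). D p) \<in> borel_measurable (borel \<Otimes>\<^sub>M P)" using DP by measurable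
  have vT: "v \<le> T" using uv rt by simp
  have "(\<integral>p. W p * ((D p * ?E p) * increment \<phi> \<beta> \<kappa> u v p) \<partial>P)
    = (\<integral>p. W p * (D p * lift \<phi> (p v) - D p * lift \<phi> (p u)
     - (LBINT w:{u..v}. D p * gen \<epsilon> \<phi> (\<beta> w p) (\<kappa> w p) (p w))) \<partial>P)"
  proof (rule increment_replace[where D="\<lambda>_. D" and K=K, OF \<phi> adm uv(1,2) vT K Dm])
   show "(\<lambda>p. D p * ?E p) \<in> borel_measurable P" by (intro borel_measurable_times DP EP)
   show "bdd (\<lambda>p. D p * ?E p)" by (intro bdd_mult D E)
   fix w V assume w: "u \<le> w" "w \<le> v" and V: "V \<in> borel_measurable (F w)" "bdd V"
   have "w \<le> r" using w uv by simp
   from mass[OF borel_measurable_times[OF F0[OF V(1) this] D(1)] bdd_mult[OF V(2) D(2)]]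
   show "(\<integral>p. V p * (D p * ?E p) \<partial>P) = (\<integral>p. V p * D p \<partial>P)" by (simp add: mult.assoc)
  qed (use W in auto)
  also have "\<dots> = (\<integral>p. W p * (D p * increment \<phi> \<beta> \<kappa> u v p) \<partial>P)"
   by (rule Bochner_Integration.integral_cong[OF refl]) (simp add: increment_def algebra_simps)
  also have "\<dots> = 0" using g \<phi> uv W unfolding good_on_def by blast
  finally show ?thesis .
 qed
 have high: "(\<integral>p. W p * (D p * ?E p * increment \<phi> \<beta> \<kappa> u v p) \<partial>P) = 0"
  if \<phi>: "tf \<phi>" and uv: "r \<le> u" "u \<le> v" "v \<le> t" and W: "W \<in> borel_measurable (F u)" "bdd W" for \<phi> u v W
 proof -
  have "increment \<phi> \<beta> \<kappa> u v p = increment \<phi> (\<lambda>w p. drift s (\<xi> p) (p w)) (\<lambda>w p. rates (\<rho> p) (p w)) u v p" if p: "p \<in> \<Omega>" for p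
   unfolding increment_def
  proof (intro arg_cong2[where f="(-)"] refl set_integral_cong_Ioc gen_section_measurable[OF \<phi> adm p])
   show "(\<lambda>w. gen \<epsilon> \<phi> (drift s (\<xi> p) (p w)) (rates (\<rho> p) (p w)) (p w)) \<in> borel_measurable borel"
    by (rule measurable_compose[OF path_measurable[OF p] gen_coeff_measurable[OF \<phi>]])
  qed (use \<beta> \<kappa> uv in auto)
  then have "(\<integral>p. W p * (D p * ?E p * increment \<phi> \<beta> \<kappa> u v p) \<partial>P)
    = (\<integral>p. (W p * D p) * (?E p * increment \<phi> (\<lambda>w p. drift s (\<xi> p) (p w)) (\<lambda>w p. rates (\<rho> p) (p w)) u v p) \<partial>P)"
   by (intro Bochner_Integration.integral_cong refl) (simp add: mult.assoc)
  also have "\<dots> = 0"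
   by (rule random_block_increment[OF s rt \<xi> \<rho> fin \<phi> uv])
     (intro borel_measurable_times W bdd_mult D measurable_filtration_mono[OF D(1) uv(1)])+
  finally show ?thesis .
 qed
 show ?thesis
  unfolding good_on_def
 proof (intro conjI allI impI)
  show "(\<lambda>p. D p * ?E p) \<in> borel_measurable (F t)"
   by (intro borel_measurable_times E measurable_filtration_mono[OF D(1) rt(2)])
  show "bdd (\<lambda>p. D p * ?E p)" by (intro bdd_mult D E)
 next
  fix W assume W: "W \<in> borel_measurable (F 0)" "bdd W"
  have "(\<integral>p. W p * (D p * ?E p) \<partial>P) = (\<integral>p. W p * D p \<partial>P)"
   using mass[OF borel_measurable_times[OF F0[OF W(1) rt(1)] D(1)] bdd_mult[OF W(2) D(2)]] by (simp add: mult.assoc)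
  also have "\<dots> = (\<integral>p. W p \<partial>P)" using g W unfolding good_on_def by blast
  finally show "(\<integral>p. W p * (D p * ?E p) \<partial>P) = (\<integral>p. W p \<partial>P)" .
 next
  fix \<phi> :: "'k \<Rightarrow> real^'d \<Rightarrow> real" and u v W
  assume \<phi>: "tf \<phi>" and uv: "0 \<le> u" "u \<le> v" "v \<le> t" and W: "W \<in> borel_measurable (F u)" "bdd W"
  consider "v \<le> r" | "r \<le> u" | "u \<le> r" "r \<le> v" by linarith
  then show "(\<integral>p. W p * (D p * ?E p * increment \<phi> \<beta> \<kappa> u v p) \<partial>P) = 0"
  proof cases
   case 3
   have vT: "v \<le> T" "r \<le> T" using uv rt by auto
   have WP: "W \<in> borel_measurable P" using W(1) 3 vT by (auto intro: measurable_F_P)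
   have i: "integrable P (\<lambda>p. W p * (D p * ?E p * increment \<phi> \<beta> \<kappa> u r p))"
     "integrable P (\<lambda>p. W p * (D p * ?E p * increment \<phi> \<beta> \<kappa> r v p))"
    by (intro bdd_integrable bdd_mult borel_measurable_times W D E WP DP EP
      increment_props(1,2)[OF \<phi> adm uv(1) 3(1) vT(2)] increment_props(1,2)[OF \<phi> adm rt(1) 3(2) vT(1)])+
   have "(\<integral>p. W p * (D p * ?E p * increment \<phi> \<beta> \<kappa> u v p) \<partial>P)
    = (\<integral>p. W p * (D p * ?E p * increment \<phi> \<beta> \<kappa> u r p) + W p * (D p * ?E p * increment \<phi> \<beta> \<kappa> r v p) \<partial>P)"
    by (rule Bochner_Integration.integral_cong[OF refl])
      (simp add: increment_split[OF \<phi> adm uv(1) 3 vT(1)] algebra_simps)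
   also have "\<dots> = 0"
    using i low[OF \<phi> uv(1) 3(1) order_refl W] high[OF \<phi> order_refl 3(2) uv(3) F0[OF W(1) 3(1)] W(2)] by simp
   finally show ?thesis .
  qed (use low[OF \<phi> uv(1,2) _ W] high[OF \<phi> _ uv(2,3) W] in auto)
 qed
qed

end

text \<open>The second moment bound gives uniform integrability: cutting Z at m changes the integral
  of V Z by at most L C / m, since Z - min Z m \<le> Z^2 / m. The truncated integrals converge by
  dominated convergence, and Fatou's lemma carries the bound over to the limit.\<close>

lemma (in prob_space) L2_limit:
 fixes X :: "nat \<Rightarrow> 'a \<Rightarrow> real"
 assumes X[measurable]: "\<And>n. X n \<in> borel_measurable M" "X' \<in> borel_measurable M"
  and Y[measurable]: "\<And>n. Y n \<in> borel_measurable M" "Y' \<in> borel_measurable M"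
  and nn: "\<And>n x. x \<in> space M \<Longrightarrow> 0 \<le> X n x" "\<And>x. x \<in> space M \<Longrightarrow> 0 \<le> X' x"
  and L2: "\<And>n. (\<integral>\<^sup>+x. ennreal ((X n x)\<^sup>2) \<partial>M) \<le> ennreal C" and C: "0 \<le> C"
  and Xlim: "AE x in M. (\<lambda>n. X n x) \<longlonglongrightarrow> X' x"
  and Ylim: "AE x in M. (\<lambda>n. Y n x) \<longlonglongrightarrow> Y' x"
  and Yb: "\<And>n x. x \<in> space M \<Longrightarrow> \<bar>Y n x\<bar> \<le> L" "\<And>x. x \<in> space M \<Longrightarrow> \<bar>Y' x\<bar> \<le> L"
 shows "(\<lambda>n. \<integral>x. Y n x * X n x \<partial>M) \<longlonglongrightarrow> (\<integral>x. Y' x * X' x \<partial>M)"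
  and "(\<integral>\<^sup>+x. ennreal ((X' x)\<^sup>2) \<partial>M) \<le> ennreal C"
proof -
 have "AE x in M. ennreal ((X' x)\<^sup>2) = liminf (\<lambda>n. ennreal ((X n x)\<^sup>2))"
  using Xlim
 proof (rule AE_mp, intro AE_I2 impI)
  fix x assume "(\<lambda>n. X n x) \<longlonglongrightarrow> X' x"
  then have "(\<lambda>n. ennreal ((X n x)\<^sup>2)) \<longlonglongrightarrow> ennreal ((X' x)\<^sup>2)" by (intro tendsto_ennrealI tendsto_power)
  then show "ennreal ((X' x)\<^sup>2) = liminf (\<lambda>n. ennreal ((X n x)\<^sup>2))"
   by (rule lim_imp_Liminf[OF sequentially_bot, symmetric])
 qed
 then have "(\<integral>\<^sup>+x. ennreal ((X' x)\<^sup>2) \<partial>M) = (\<integral>\<^sup>+x. liminf (\<lambda>n. ennreal ((X n x)\<^sup>2)) \<partial>M)"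
  by (rule nn_integral_cong_AE)
 also have "\<dots> \<le> liminf (\<lambda>n. \<integral>\<^sup>+x. ennreal ((X n x)\<^sup>2) \<partial>M)"
  by (intro nn_integral_liminf) measurable
 also have "\<dots> \<le> limsup (\<lambda>n. \<integral>\<^sup>+x. ennreal ((X n x)\<^sup>2) \<partial>M)" by (intro Liminf_le_Limsup) simp
 also have "\<dots> \<le> ennreal C" using L2 by (intro Limsup_bounded) auto
 finally show L2': "(\<integral>\<^sup>+x. ennreal ((X' x)\<^sup>2) \<partial>M) \<le> ennreal C" .
 have sq: "integrable M (\<lambda>x. (Z x)\<^sup>2)" "(\<integral>x. (Z x)\<^sup>2 \<partial>M) \<le> C"
  if [measurable]: "Z \<in> borel_measurable M" and "(\<integral>\<^sup>+x. ennreal ((Z x)\<^sup>2) \<partial>M) \<le> ennreal C" for Z :: "'a \<Rightarrow> real"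
 proof -
  show "integrable M (\<lambda>x. (Z x)\<^sup>2)"
   using that(2) by (intro integrableI_bounded) (auto intro: le_less_trans)
  then show "(\<integral>x. (Z x)\<^sup>2 \<partial>M) \<le> C"
   using that(2) C by (simp add: nn_integral_eq_integral)
 qed
 have trunc: "\<bar>(\<integral>x. V x * Z x \<partial>M) - (\<integral>x. V x * min (Z x) m \<partial>M)\<bar> \<le> L * C / m"
  if [measurable]: "Z \<in> borel_measurable M" "V \<in> borel_measurable M" and b: "(\<integral>\<^sup>+x. ennreal ((Z x)\<^sup>2) \<partial>M) \<le> ennreal C"
   and V: "\<And>x. x \<in> space M \<Longrightarrow> \<bar>V x\<bar> \<le> L" and Z: "\<And>x. x \<in> space M \<Longrightarrow> 0 \<le> Z x" and m: "m > 0"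
  for Z V :: "'a \<Rightarrow> real" and m
 proof -
  note s = sq[OF that(1) b]
  have L0: "0 \<le> L" using V not_empty by (metis abs_ge_zero ex_in_conv order_trans)
  have Zi: "integrable M Z"
  proof (rule Bochner_Integration.integrable_bound[OF Bochner_Integration.integrable_add[OF s(1) integrable_const[of 1]]])
   have "\<bar>z\<bar> \<le> z\<^sup>2 + 1" for z :: real
    using zero_le_power2[of "\<bar>z\<bar> - 1"] unfolding power2_diff by (simp add: power2_abs)
   then show "AE x in M. norm (Z x) \<le> norm ((Z x)\<^sup>2 + 1)" by (simp add: abs_of_nonneg)
  qed measurable
  have VZi: "integrable M (\<lambda>x. V x * Z x)"
   by (rule Bochner_Integration.integrable_bound[OF integrable_mult_right[OF Zi, of L]])
     (use V Z L0 in \<open>auto simp: abs_mult intro!: AE_I2 mult_right_mono\<close>)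
  have VMi: "integrable M (\<lambda>x. V x * min (Z x) m)"
   by (rule Bochner_Integration.integrable_bound[OF integrable_mult_right[OF Zi, of L]])
     (use V Z L0 m in \<open>auto simp: abs_mult intro!: AE_I2 mult_mono\<close>)
  have "\<bar>(\<integral>x. V x * Z x \<partial>M) - (\<integral>x. V x * min (Z x) m \<partial>M)\<bar> = \<bar>\<integral>x. V x * Z x - V x * min (Z x) m \<partial>M\<bar>"
   using VZi VMi by simp
  also have "\<dots> \<le> (\<integral>x. \<bar>V x * Z x - V x * min (Z x) m\<bar> \<partial>M)" by (rule integral_abs_bound)
  also have "\<dots> \<le> (\<integral>x. L / m * (Z x)\<^sup>2 \<partial>M)"
  proof (rule integral_mono)
   fix x assume x: "x \<in> space M"
   have "m * (Z x - min (Z x) m) \<le> (Z x)\<^sup>2"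
   proof (cases "Z x \<le> m")
    case False
    have "m * Z x \<le> Z x * Z x" using False Z[OF x] by (intro mult_right_mono) auto
    moreover have "m * (Z x - min (Z x) m) = m * Z x - m * m" using False by (simp add: right_diff_distrib)
    moreover have "0 \<le> m * m" by simp
    ultimately show ?thesis unfolding power2_eq_square by linarith
   qed simp
   then have "Z x - min (Z x) m \<le> (Z x)\<^sup>2 / m" using m by (simp add: pos_le_divide_eq mult.commute)
   then have "\<bar>V x\<bar> * \<bar>Z x - min (Z x) m\<bar> \<le> L * ((Z x)\<^sup>2 / m)"
    using V[OF x] L0 by (intro mult_mono) auto
   then show "\<bar>V x * Z x - V x * min (Z x) m\<bar> \<le> L / m * (Z x)\<^sup>2"
    by (simp add: abs_mult flip: right_diff_distrib)
  qed (use VZi VMi s in auto)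
  also have "\<dots> \<le> L / m * C" using s(2) L0 m by (simp add: mult_left_mono divide_right_mono)
  finally show ?thesis by simp
 qed
 have L0: "0 \<le> L" using Yb(2) not_empty by (metis abs_ge_zero ex_in_conv order_trans)
 show "(\<lambda>n. \<integral>x. Y n x * X n x \<partial>M) \<longlonglongrightarrow> (\<integral>x. Y' x * X' x \<partial>M)"
 proof (rule LIMSEQ_I)
  fix r :: real assume r: "0 < r"
  \<comment> \<open>Makes each of the two truncation errors L C / m at most r / 4; the summand 1
    keeps m positive when L C = 0.\<close>
  define m where "m = 4 * (L * C + 1) / r"
  have LC: "0 \<le> L * C" using L0 C by simp
  have m: "m > 0" using r LC by (simp add: m_def)
  have "L * C / m = r * (L * C) / (4 * (L * C + 1))" using r by (simp add: m_def)
  also have "\<dots> \<le> r / 4" using r LC by (simp add: field_simps)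
  finally have e: "L * C / m \<le> r / 4" .
  have "(\<lambda>n. \<integral>x. Y n x * min (X n x) m \<partial>M) \<longlonglongrightarrow> (\<integral>x. Y' x * min (X' x) m \<partial>M)"
  proof (rule integral_dominated_convergence[where w="\<lambda>_. L * m"])
   show "AE x in M. norm (Y n x * min (X n x) m) \<le> L * m" for n
    using Yb(1) nn(1) m L0 by (intro AE_I2) (auto simp: abs_mult intro!: mult_mono)
   show "AE x in M. (\<lambda>n. Y n x * min (X n x) m) \<longlonglongrightarrow> Y' x * min (X' x) m"
    using Xlim Ylim by eventually_elim (intro tendsto_intros)
  qed auto
  from LIMSEQ_D[OF this, of "r / 4"] r obtain N where N: "\<And>n. n \<ge> N \<Longrightarrow> \<bar>(\<integral>x. Y n x * min (X n x) m \<partial>M) - (\<integral>x. Y' x * min (X' x) m \<partial>M)\<bar> < r / 4"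
   unfolding real_norm_def by auto
  have "\<bar>(\<integral>x. Y n x * X n x \<partial>M) - (\<integral>x. Y' x * X' x \<partial>M)\<bar> < r" if "n \<ge> N" for n
  proof -
   have "\<bar>(\<integral>x. Y n x * X n x \<partial>M) - (\<integral>x. Y n x * min (X n x) m \<partial>M)\<bar> \<le> L * C / m"
    by (rule trunc[OF X(1) Y(1) L2 Yb(1) nn(1) m])
   moreover have "\<bar>(\<integral>x. Y' x * X' x \<partial>M) - (\<integral>x. Y' x * min (X' x) m \<partial>M)\<bar> \<le> L * C / m"
    by (rule trunc[OF X(2) Y(2) L2' Yb(2) nn(2) m])
   ultimately show ?thesis using N[OF that] e r by linarith
  qed
  then show "\<exists>no. \<forall>n\<ge>no. norm ((\<integral>x. Y n x * X n x \<partial>M) - (\<integral>x. Y' x * X' x \<partial>M)) < r"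
   by auto
 qed
qed

section \<open>Square integrable densities and their limits\<close>

context diffusion begin

text \<open>Analogue of \<open>good_on\<close> at the horizon for densities that are no longer
  bounded: a second moment bound takes the place of boundedness, and it survives almost sure
  limits.\<close>

definition good :: "(('k, 'd) path \<Rightarrow> real) \<Rightarrow>
 (real \<Rightarrow> ('k, 'd) path \<Rightarrow> real^'d) \<Rightarrow> (real \<Rightarrow> ('k, 'd) path \<Rightarrow> real^'k) \<Rightarrow> real \<Rightarrow> bool" where
 "good D \<beta> \<kappa> C \<longleftrightarrow> D \<in> borel_measurable P \<and> (\<forall>p\<in>\<Omega>. 0 \<le> D p) \<and> (\<integral>\<^sup>+p. ennreal ((D p)\<^sup>2) \<partial>P) \<le> ennreal C \<and>
   (\<forall>W. W \<in> borel_measurable (F 0) \<longrightarrow> bdd W \<longrightarrow> (\<integral>p. W p * D p \<partial>P) = (\<integral>p. W p \<partial>P)) \<and>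
   (\<forall>\<phi> u v W. tf \<phi> \<longrightarrow> 0 \<le> u \<longrightarrow> u \<le> v \<longrightarrow> v \<le> T \<longrightarrow> W \<in> borel_measurable (F u) \<longrightarrow> bdd W \<longrightarrow>
    (\<integral>p. W p * (D p * increment \<phi> \<beta> \<kappa> u v p) \<partial>P) = 0)"

text \<open>Convergence of the coefficients at almost every time suffices: the increments then
  converge boundedly by dominated convergence in time, and \<open>L2_limit\<close> pairs them with
  the densities.\<close>

lemma good_limit:
 assumes g: "\<And>n. good (D n) (\<beta> n) (\<kappa> n) C" and adm: "\<And>n. admissible (\<beta> n) (\<kappa> n) M" and adm': "admissible \<beta>' \<kappa>' M"
  and D'[measurable]: "D' \<in> borel_measurable P" and nn: "\<And>p. p \<in> \<Omega> \<Longrightarrow> 0 \<le> D' p" and C: "0 \<le> C"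
  and Dlim: "AE p in P. (\<lambda>n. D n p) \<longlonglongrightarrow> D' p"
  and \<beta>lim: "AE p in P. AE w\<in>{0..T} in lborel. (\<lambda>n. \<beta> n w p) \<longlonglongrightarrow> \<beta>' w p"
  and \<kappa>lim: "AE p in P. AE w\<in>{0..T} in lborel. (\<lambda>n. \<kappa> n w p) \<longlonglongrightarrow> \<kappa>' w p"
 shows "good D' \<beta>' \<kappa>' C"
proof -
 have Dm: "D n \<in> borel_measurable P" and Dnn: "\<And>p. p \<in> \<Omega> \<Longrightarrow> 0 \<le> D n p"
  and L2: "(\<integral>\<^sup>+p. ennreal ((D n p)\<^sup>2) \<partial>P) \<le> ennreal C" for n
  using g unfolding good_def by blast+
 note lim = L2_limit[OF Dm D' _ _ _ _ L2 C Dlim]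
 show ?thesis
  unfolding good_def
 proof (intro conjI allI impI ballI nn)
  show "D' \<in> borel_measurable P" by (rule D')
  show "(\<integral>\<^sup>+p. ennreal ((D' p)\<^sup>2) \<partial>P) \<le> ennreal C"
   by (rule lim(2)[where Y="\<lambda>_ _. 0" and Y'="\<lambda>_. 0" and L=0]) (use Dnn nn in auto)
 next
  fix W assume W: "W \<in> borel_measurable (F 0)" "bdd W"
  obtain L where L: "\<And>p. p \<in> \<Omega> \<Longrightarrow> \<bar>W p\<bar> \<le> L" using W(2) by (rule bddE) blast
  have WP: "W \<in> borel_measurable P" using W(1) T_pos by (auto intro: measurable_F_P)
  have "(\<lambda>n. \<integral>p. W p * D n p \<partial>P) \<longlonglongrightarrow> (\<integral>p. W p * D' p \<partial>P)"
   by (rule lim(1)[where L=L]) (use WP L Dnn nn in auto)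
  moreover have "(\<integral>p. W p * D n p \<partial>P) = (\<integral>p. W p \<partial>P)" for n using g[of n] W unfolding good_def by blast
  ultimately show "(\<integral>p. W p * D' p \<partial>P) = (\<integral>p. W p \<partial>P)" by (simp add: LIMSEQ_const_iff)
 next
  fix \<phi> :: "'k \<Rightarrow> real^'d \<Rightarrow> real" and u v W
  assume \<phi>: "tf \<phi>" and uv: "0 \<le> u" "u \<le> v" "v \<le> T" and W: "W \<in> borel_measurable (F u)" "bdd W"
  obtain G where G: "G \<ge> 0" "\<And>\<beta> \<kappa> z. z \<in> state_space \<Longrightarrow> \<bar>gen \<epsilon> \<phi> \<beta> \<kappa> z\<bar> \<le> G * (1 + norm \<beta> + norm \<kappa>)"
   by (rule gen_bound[OF \<phi>]) blast
  obtain K where K: "K \<ge> 0" "\<And>i y. \<bar>\<phi> i y\<bar> \<le> K" using tf_bounded[OF \<phi>] by metis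
  obtain L where L: "L \<ge> 0" "\<And>p. p \<in> \<Omega> \<Longrightarrow> \<bar>W p\<bar> \<le> L" using W(2) by (rule bddE) blast
  have WP: "W \<in> borel_measurable P" using W(1) uv by (auto intro: measurable_F_P)
  have gb: "\<bar>gen_at \<phi> b' k' w p\<bar> \<le> G * (1 + M + M)"
   if a: "admissible b' k' M" and p: "p \<in> \<Omega>" and w: "u \<le> w" "w \<le> v" for b' k' w p
  proof -
   have "norm (b' w p) \<le> M" "norm (k' w p) \<le> M" using a w uv p unfolding admissible_def by auto
   then have "G * (1 + norm (b' w p) + norm (k' w p)) \<le> G * (1 + M + M)" using G(1) by (intro mult_left_mono) auto
   then show ?thesis
    using G(2)[of "p w" "b' w p" "k' w p"] w uv p by (simp add: cadlag_in_state_space)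
  qed
  have ib: "\<bar>increment \<phi> b' k' u v p\<bar> \<le> 2 * K + G * (1 + M + M) * (v - u)"
   if a: "admissible b' k' M" and p: "p \<in> \<Omega>" for b' k' p
  proof -
   have "norm (LBINT w:{u..v}. gen_at \<phi> b' k' w p) \<le> G * (1 + M + M) * (v - u)"
    using gb[OF a p] uv by (intro set_integral_bdd[OF gen_section_measurable[OF \<phi> a p]]) auto
   then show ?thesis
    using norm_lift_le[of "p v" \<phi> K] norm_lift_le[of "p u" \<phi> K] K uv p
    by (simp add: increment_def cadlag_in_state_space)
  qed
  have ilim: "AE p in P. (\<lambda>n. increment \<phi> (\<beta> n) (\<kappa> n) u v p) \<longlonglongrightarrow> increment \<phi> \<beta>' \<kappa>' u v p"
   using \<beta>lim \<kappa>lim AE_space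
  proof eventually_elim
   fix p assume b: "AE w\<in>{0..T} in lborel. (\<lambda>n. \<beta> n w p) \<longlonglongrightarrow> \<beta>' w p"
    and k: "AE w\<in>{0..T} in lborel. (\<lambda>n. \<kappa> n w p) \<longlonglongrightarrow> \<kappa>' w p" and "p \<in> space P"
   then have p: "p \<in> \<Omega>" by simp
   have "(\<lambda>n. LBINT w:{u..v}. gen \<epsilon> \<phi> (\<beta> n w p) (\<kappa> n w p) (p w)) \<longlonglongrightarrow> (LBINT w:{u..v}. gen_at \<phi> \<beta>' \<kappa>' w p)"
   proof (rule interval_dct[OF gen_section_measurable[OF \<phi> adm p] gen_section_measurable[OF \<phi> adm' p] gb[OF adm p]])
    show "AE w\<in>{u..v} in lborel. (\<lambda>n. gen \<epsilon> \<phi> (\<beta> n w p) (\<kappa> n w p) (p w)) \<longlonglongrightarrow> gen_at \<phi> \<beta>' \<kappa>' w p"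
     using b k
    proof (eventually_elim, intro impI)
     fix w assume *: "w \<in> {0..T} \<longrightarrow> (\<lambda>n. \<beta> n w p) \<longlonglongrightarrow> \<beta>' w p" "w \<in> {0..T} \<longrightarrow> (\<lambda>n. \<kappa> n w p) \<longlonglongrightarrow> \<kappa>' w p" and "w \<in> {u..v}"
     then have w: "w \<in> {0..T}" using uv by simp
     show "(\<lambda>n. gen \<epsilon> \<phi> (\<beta> n w p) (\<kappa> n w p) (p w)) \<longlonglongrightarrow> gen_at \<phi> \<beta>' \<kappa>' w p"
      unfolding gen_def by (intro tendsto_intros *(1)[rule_format, OF w] *(2)[rule_format, OF w])
    qed
   qed
   then show "(\<lambda>n. increment \<phi> (\<beta> n) (\<kappa> n) u v p) \<longlonglongrightarrow> increment \<phi> \<beta>' \<kappa>' u v p"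
    unfolding increment_def by (intro tendsto_intros)
  qed
  let ?L = "L * (2 * K + G * (1 + M + M) * (v - u))"
  have "(\<lambda>n. \<integral>p. (W p * increment \<phi> (\<beta> n) (\<kappa> n) u v p) * D n p \<partial>P) \<longlonglongrightarrow> (\<integral>p. (W p * increment \<phi> \<beta>' \<kappa>' u v p) * D' p \<partial>P)"
  proof (rule lim(1)[where L="?L"])
   show "(\<lambda>p. W p * increment \<phi> (\<beta> n) (\<kappa> n) u v p) \<in> borel_measurable P" for n
    by (intro borel_measurable_times WP increment_props(1)[OF \<phi> adm uv])
   show "(\<lambda>p. W p * increment \<phi> \<beta>' \<kappa>' u v p) \<in> borel_measurable P"
    by (intro borel_measurable_times WP increment_props(1)[OF \<phi> adm' uv])
   show "AE p in P. (\<lambda>n. W p * increment \<phi> (\<beta> n) (\<kappa> n) u v p) \<longlonglongrightarrow> W p * increment \<phi> \<beta>' \<kappa>' u v p"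
    using ilim by eventually_elim (intro tendsto_intros)
   fix p assume "p \<in> space P" then have p: "p \<in> \<Omega>" by simp
   show "\<bar>W p * increment \<phi> (\<beta> n) (\<kappa> n) u v p\<bar> \<le> ?L" for n
    unfolding abs_mult using L ib[OF adm p, of n] p by (intro mult_mono) auto
   show "\<bar>W p * increment \<phi> \<beta>' \<kappa>' u v p\<bar> \<le> ?L"
    unfolding abs_mult using L ib[OF adm' p] p by (intro mult_mono) auto
  qed (use Dnn nn in auto)
  moreover have "(\<integral>p. (W p * increment \<phi> (\<beta> n) (\<kappa> n) u v p) * D n p \<partial>P) = 0" for n
  proof -
   have "(\<integral>p. W p * (D n p * increment \<phi> (\<beta> n) (\<kappa> n) u v p) \<partial>P) = 0"
    using g[of n] \<phi> uv W unfolding good_def by blast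
   then show ?thesis by (simp add: mult_ac)
  qed
  ultimately have "(\<integral>p. (W p * increment \<phi> \<beta>' \<kappa>' u v p) * D' p \<partial>P) = 0" by (simp add: LIMSEQ_const_iff)
  then show "(\<integral>p. W p * (D' p * increment \<phi> \<beta>' \<kappa>' u v p) \<partial>P) = 0" by (simp add: mult_ac)
 qed
qed

end

section \<open>Densities for step coefficients\<close>

context diffusion begin

definition step_data :: "nat \<Rightarrow> (nat \<Rightarrow> real) \<Rightarrow> (nat \<Rightarrow> ('k, 'd) path \<Rightarrow> real^'d) \<Rightarrow>
  (nat \<Rightarrow> ('k, 'd) path \<Rightarrow> real^'k) \<Rightarrow> real \<Rightarrow> bool" where
 "step_data n \<tau> \<xi> \<rho> M \<longleftrightarrow> \<tau> 0 = 0 \<and> \<tau> n = T \<and> (\<forall>m<n. \<tau> m < \<tau> (Suc m)) \<and>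
   (\<forall>m<n. \<xi> m \<in> borel_measurable (F (\<tau> m)) \<and> \<rho> m \<in> borel_measurable (F (\<tau> m))) \<and>
   (\<forall>m<n. \<forall>p\<in>\<Omega>. norm (\<xi> m p) \<le> M \<and> norm (\<rho> m p) \<le> M) \<and> 0 \<le> M"

definition step_drift where
 "step_drift s n \<tau> \<xi> w p = (if 0 \<le> w \<and> w \<le> T then drift s (stepp \<tau> n \<xi> w p) (p w) else 0)"

definition step_rates where
 "step_rates n \<tau> \<rho> w p = (if 0 \<le> w \<and> w \<le> T then rates (stepp \<tau> n \<rho> w p) (p w) else 0)"

definition log_density where
 "log_density s n \<tau> \<xi> \<rho> p = (\<Sum>m<n. log_factor s (\<xi> m p) (\<rho> m p) (\<tau> m) (\<tau> (Suc m)) p)"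

lemma step_dataD:
 assumes "step_data n \<tau> \<xi> \<rho> M"
 shows "\<tau> 0 = 0" "\<tau> n = T" "\<And>m. m < n \<Longrightarrow> \<tau> m < \<tau> (Suc m)"
  "\<And>m. m < n \<Longrightarrow> \<xi> m \<in> borel_measurable (F (\<tau> m))" "\<And>m. m < n \<Longrightarrow> \<rho> m \<in> borel_measurable (F (\<tau> m))"
  "\<And>m p. m < n \<Longrightarrow> p \<in> \<Omega> \<Longrightarrow> norm (\<xi> m p) \<le> M" "\<And>m p. m < n \<Longrightarrow> p \<in> \<Omega> \<Longrightarrow> norm (\<rho> m p) \<le> M" "0 \<le> M"
  "\<And>m. m \<le> n \<Longrightarrow> 0 \<le> \<tau> m" "\<And>m. m \<le> n \<Longrightarrow> \<tau> m \<le> T"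
proof -
 show *: "\<tau> 0 = 0" "\<tau> n = T" "\<And>m. m < n \<Longrightarrow> \<tau> m < \<tau> (Suc m)"
  "\<And>m. m < n \<Longrightarrow> \<xi> m \<in> borel_measurable (F (\<tau> m))" "\<And>m. m < n \<Longrightarrow> \<rho> m \<in> borel_measurable (F (\<tau> m))"
  "\<And>m p. m < n \<Longrightarrow> p \<in> \<Omega> \<Longrightarrow> norm (\<xi> m p) \<le> M" "\<And>m p. m < n \<Longrightarrow> p \<in> \<Omega> \<Longrightarrow> norm (\<rho> m p) \<le> M" "0 \<le> M"
  using assms unfolding step_data_def by blast+
 show "0 \<le> \<tau> m" "\<tau> m \<le> T" if "m \<le> n" for m
  using partition_le[of n \<tau> 0 m, OF *(3)] partition_le[of n \<tau> m n, OF *(3)] that *(1,2) by auto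
qed

lemma step_props:
 assumes "\<tau> 0 = 0" "\<tau> n = T" and \<tau>: "\<And>m. m < n \<Longrightarrow> \<tau> m < \<tau> (Suc m)"
  and \<xi>: "\<And>m. m < n \<Longrightarrow> (\<xi> m :: _ \<Rightarrow> 'c::euclidean_space) \<in> borel_measurable (F (\<tau> m))"
 shows "(\<lambda>(w, p). stepp \<tau> n \<xi> w p) \<in> borel_measurable \<P>"
  and "stepp \<tau> n \<xi> w \<in> borel_measurable (F w)"
  and "(\<And>m. m < n \<Longrightarrow> norm (\<xi> m p) \<le> M) \<Longrightarrow> 0 \<le> M \<Longrightarrow> norm (stepp \<tau> n \<xi> w p) \<le> M"
proof -
 have \<tau>T: "\<tau> m \<le> T" if "m < n" for m using partition_le[of n \<tau> m n, OF \<tau>] that assms(2) by simp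
 have P: "\<xi> m \<in> borel_measurable P" if "m < n" for m by (rule measurable_F_P[OF \<xi>[OF that] \<tau>T[OF that]])
 show "(\<lambda>(w, p). stepp \<tau> n \<xi> w p) \<in> borel_measurable \<P>"
  unfolding stepp_def split_beta'
 proof (intro borel_measurable_sum borel_measurable_scaleR)
  fix m assume "m \<in> {..<n}"
  then show "(\<lambda>x. \<xi> m (snd x)) \<in> borel_measurable \<P>"
   using measurable_compose[OF measurable_snd P[of m]] by simp
  show "(\<lambda>x. indicator {\<tau> m<..\<tau> (Suc m)} (fst x)) \<in> borel_measurable \<P>" by measurable
 qed
 show "stepp \<tau> n \<xi> w \<in> borel_measurable (F w)"
  unfolding stepp_def[abs_def]
 proof (intro borel_measurable_sum)
  fix m assume m: "m \<in> {..<n}"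
  show "(\<lambda>p. indicator {\<tau> m<..\<tau> (Suc m)} w *\<^sub>R \<xi> m p) \<in> borel_measurable (F w)"
  proof (cases "\<tau> m < w")
   case True
   then show ?thesis
    using m by (intro borel_measurable_scaleR borel_measurable_const measurable_filtration_mono[OF \<xi>]) auto
  qed simp
 qed
 show "norm (stepp \<tau> n \<xi> w p) \<le> M" if "\<And>m. m < n \<Longrightarrow> norm (\<xi> m p) \<le> M" "0 \<le> M"
  by (rule stepp_cases[of n \<tau> \<xi> w p, OF \<tau>]) (use that in auto)
qed

lemma step_admissible:
 assumes sd: "step_data n \<tau> \<xi> \<rho> M"
 shows "admissible (step_drift s n \<tau> \<xi>) (step_rates n \<tau> \<rho>) (coeff_bound M)"
proof -
 note d = step_dataD[OF sd]
 note X = step_props[OF d(1-4)] and R = step_props[OF d(1-3,5)]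
 have b: "norm (stepp \<tau> n \<xi> w p) \<le> M" "norm (stepp \<tau> n \<rho> w p) \<le> M" if "p \<in> \<Omega>" for w p
  using d(6-8) that by (intro step_props(3)[OF d(1-4)] step_props(3)[OF d(1-3,5)]; simp)+
 show ?thesis
  unfolding step_drift_def[abs_def] step_rates_def[abs_def]
  by (rule coeff_admissible[OF X(1,2) b(1) R(1,2) b(2)])
qed

lemma good_onD:
 assumes "good_on x D \<beta> \<kappa>"
 shows "D \<in> borel_measurable (F x)" "bdd D"
  "\<And>W. W \<in> borel_measurable (F 0) \<Longrightarrow> bdd W \<Longrightarrow> (\<integral>p. W p * D p \<partial>P) = (\<integral>p. W p \<partial>P)"
  "\<And>\<phi> u v W. tf \<phi> \<Longrightarrow> 0 \<le> u \<Longrightarrow> u \<le> v \<Longrightarrow> v \<le> x \<Longrightarrow> W \<in> borel_measurable (F u) \<Longrightarrow> bdd W \<Longrightarrow>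
    (\<integral>p. W p * (D p * increment \<phi> \<beta> \<kappa> u v p) \<partial>P) = 0"
 using assms unfolding good_on_def by blast+

lemma good_on_simple:
 assumes sd: "step_data n \<tau> \<xi> \<rho> M" and s: "0 < s" "s \<le> 1"
  and fin: "\<And>m. m < n \<Longrightarrow> finite ((\<lambda>p. (\<xi> m p, \<rho> m p)) ` \<Omega>)"
  and "m \<le> n"
 shows "good_on (\<tau> m) (\<lambda>p. exp (log_density s m \<tau> \<xi> \<rho> p)) (step_drift s n \<tau> \<xi>) (step_rates n \<tau> \<rho>)"
 using \<open>m \<le> n\<close>
proof (induction m)
 case 0
 have i0: "increment \<phi> \<beta> \<kappa> u u p = 0" for \<phi> \<beta> \<kappa> u p
 proof -
  have "(LBINT w:{u..u}. gen_at \<phi> \<beta> \<kappa> w p) = 0"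
   unfolding set_lebesgue_integral_def by (intro integral_eq_zero_AE AE_I[where N="{u}"]) (auto split: split_indicator)
  then show ?thesis by (simp add: increment_def)
 qed
 have "bdd (\<lambda>_. 1)" by (rule bddI[of _ 1]) simp
 moreover have "increment \<phi> \<beta> \<kappa> u v p = 0" if "0 \<le> u" "u \<le> v" "v \<le> \<tau> 0" for u v \<phi> \<beta> \<kappa> p
  using that step_dataD(1)[OF sd] i0[of \<phi> \<beta> \<kappa> u p] by (cases "u = v") auto
 ultimately show ?case unfolding good_on_def log_density_def by simp
next
 case (Suc m)
 then have m: "m < n" by simp
 note d = step_dataD[OF sd]
 have le: "0 \<le> \<tau> m" "\<tau> m \<le> \<tau> (Suc m)" "\<tau> (Suc m) \<le> T" using d(9)[of m] d(3)[OF m] d(10)[of "Suc m"] m by auto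
 have "good_on (\<tau> (Suc m)) (\<lambda>p. exp (log_density s m \<tau> \<xi> \<rho> p) * exp (log_factor s (\<xi> m p) (\<rho> m p) (\<tau> m) (\<tau> (Suc m)) p))
   (step_drift s n \<tau> \<xi>) (step_rates n \<tau> \<rho>)"
 proof (rule good_on_extend[OF _ step_admissible[OF sd] s le d(4,5)[OF m] fin[OF m]])
  show "good_on (\<tau> m) (\<lambda>p. exp (log_density s m \<tau> \<xi> \<rho> p)) (step_drift s n \<tau> \<xi>) (step_rates n \<tau> \<rho>)"
   using Suc by simp
  fix w p assume w: "\<tau> m < w" "w \<le> \<tau> (Suc m)"
  show "step_drift s n \<tau> \<xi> w p = drift s (\<xi> m p) (p w)" "step_rates n \<tau> \<rho> w p = rates (\<rho> m p) (p w)"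
   using le w stepp_eq[of n \<tau>, OF d(3) m w, where \<xi>=\<xi>] stepp_eq[of n \<tau>, OF d(3) m w, where \<xi>=\<rho>] by (simp_all add: step_drift_def step_rates_def)
 qed
 then show ?case by (simp add: log_density_def exp_add)
qed

text \<open>Doubling \<xi> and \<rho> while halving s doubles the potential exactly, as sin (s/2 * 2
  u) / (s/2) = 2 sin (s u) / s. Only the bounded compensators differ, which costs a term
  proportional to x - r.\<close>

lemma log_factor_double:
 assumes s: "0 < s" "s \<le> 1" and b: "norm \<xi> \<le> M" "norm \<rho> \<le> M" and rx: "0 \<le> r" "r \<le> x" "x \<le> T" and p: "p \<in> \<Omega>"
 shows "2 * log_factor s \<xi> \<rho> r x p \<le> log_factor (s / 2) (2 *\<^sub>R \<xi>) (2 *\<^sub>R \<rho>) r x p + (comp_bound (2 * M) + 2 * comp_bound M) * (x - r)"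
proof -
 have "potential (s / 2) (2 *\<^sub>R \<xi>) (2 *\<^sub>R \<rho>) z = 2 * potential s \<xi> \<rho> z" for z :: "(real^'k) \<times> (real^'d)"
  using s by (simp add: potential_def sn_def)
 moreover have "\<bar>LBINT w:{r..x}. compensator (s / 2) (2 *\<^sub>R \<xi>) (2 *\<^sub>R \<rho>) (p w)\<bar> \<le> comp_bound (2 * M) * (x - r)"
  by (rule compensator_integral_bound) (use s b rx p in auto)
 moreover have "\<bar>LBINT w:{r..x}. compensator s \<xi> \<rho> (p w)\<bar> \<le> comp_bound M * (x - r)"
  by (rule compensator_integral_bound) (use s b rx p in auto)
 ultimately show ?thesis unfolding log_factor_def by (simp add: algebra_simps)
qed

definition L2_bound :: "real \<Rightarrow> real" where
 "L2_bound M = exp ((comp_bound (2 * M) + 2 * comp_bound M) * T)"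

text \<open>The square of a density is, up to a bounded factor, the density with doubled coefficients.\<close>

lemma good_simple:
 assumes sd: "step_data n \<tau> \<xi> \<rho> M" and s: "0 < s" "s \<le> 1"
  and fin: "\<And>m. m < n \<Longrightarrow> finite ((\<lambda>p. (\<xi> m p, \<rho> m p)) ` \<Omega>)"
 shows "good (\<lambda>p. exp (log_density s n \<tau> \<xi> \<rho> p)) (step_drift s n \<tau> \<xi>) (step_rates n \<tau> \<rho>) (L2_bound M)"
proof -
 note d = step_dataD[OF sd]
 have g: "good_on T (\<lambda>p. exp (log_density s n \<tau> \<xi> \<rho> p)) (step_drift s n \<tau> \<xi>) (step_rates n \<tau> \<rho>)"
  using good_on_simple[OF sd s fin order_refl] d(2) by simp
 let ?\<xi>2 = "\<lambda>m p. 2 *\<^sub>R \<xi> m p" and ?\<rho>2 = "\<lambda>m p. 2 *\<^sub>R \<rho> m p"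
 have sd2: "step_data n \<tau> ?\<xi>2 ?\<rho>2 (2 * M)"
  unfolding step_data_def using d by (auto intro!: borel_measurable_scaleR)
 have fin2: "finite ((\<lambda>p. (?\<xi>2 m p, ?\<rho>2 m p)) ` \<Omega>)" if "m < n" for m
 proof -
  have "(\<lambda>p. (?\<xi>2 m p, ?\<rho>2 m p)) ` \<Omega> = (\<lambda>(a, c). (2 *\<^sub>R a, 2 *\<^sub>R c)) ` (\<lambda>p. (\<xi> m p, \<rho> m p)) ` \<Omega>"
   by (auto simp: image_iff)
  then show ?thesis using fin[OF that] by simp
 qed
 have s2: "0 < s / 2" "s / 2 \<le> 1" using s by auto
 have g2: "good_on T (\<lambda>p. exp (log_density (s / 2) n \<tau> ?\<xi>2 ?\<rho>2 p)) (step_drift (s / 2) n \<tau> ?\<xi>2) (step_rates n \<tau> ?\<rho>2)"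
  using good_on_simple[OF sd2 s2 fin2 order_refl] d(2) by simp
 let ?D = "\<lambda>p. exp (log_density s n \<tau> \<xi> \<rho> p)" and ?D2 = "\<lambda>p. exp (log_density (s / 2) n \<tau> ?\<xi>2 ?\<rho>2 p)"
 have D2: "?D2 \<in> borel_measurable P" "bdd ?D2"
  by (rule measurable_F_P[OF good_onD(1)[OF g2] order_refl], rule good_onD(2)[OF g2])
 have one: "bdd (\<lambda>_. 1)" by (rule bddI[of _ 1]) simp
 have "(\<integral>p. 1 * ?D2 p \<partial>P) = (\<integral>p. 1 \<partial>P)"
  by (rule good_onD(3)[OF g2 borel_measurable_const one])
 then have E2: "(\<integral>p. ?D2 p \<partial>P) = 1" by (simp add: prob_space del: space_P)
 have sq: "(?D p)\<^sup>2 \<le> L2_bound M * ?D2 p" if p: "p \<in> \<Omega>" for p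
 proof -
  let ?K = "comp_bound (2 * M) + 2 * comp_bound M"
  have "2 * log_density s n \<tau> \<xi> \<rho> p \<le> (\<Sum>m<n. log_factor (s / 2) (?\<xi>2 m p) (?\<rho>2 m p) (\<tau> m) (\<tau> (Suc m)) p + ?K * (\<tau> (Suc m) - \<tau> m))"
   unfolding log_density_def sum_distrib_left
   using d p by (intro sum_mono log_factor_double[OF s]) (auto simp: less_imp_le Suc_le_eq)
  also have "\<dots> = log_density (s / 2) n \<tau> ?\<xi>2 ?\<rho>2 p + ?K * T"
   unfolding sum.distrib log_density_def sum_distrib_left[symmetric] sum_lessThan_telescope using d(1,2) by simp
  finally have "exp (2 * log_density s n \<tau> \<xi> \<rho> p) \<le> exp (log_density (s / 2) n \<tau> ?\<xi>2 ?\<rho>2 p + ?K * T)" by simp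
  then show ?thesis by (simp add: L2_bound_def exp_add exp_double power2_eq_square mult.commute)
 qed
 have "(\<integral>\<^sup>+p. ennreal ((?D p)\<^sup>2) \<partial>P) \<le> (\<integral>\<^sup>+p. ennreal (L2_bound M * ?D2 p) \<partial>P)"
  using sq by (intro nn_integral_mono ennreal_leI) simp
 also have "\<dots> = ennreal (\<integral>p. L2_bound M * ?D2 p \<partial>P)"
  using bdd_integrable[OF D2] by (intro nn_integral_eq_integral) (auto simp: L2_bound_def)
 also have "\<dots> = ennreal (L2_bound M)" using E2 by simp
 finally have L2: "(\<integral>\<^sup>+p. ennreal ((?D p)\<^sup>2) \<partial>P) \<le> ennreal (L2_bound M)" .
 show ?thesis
  unfolding good_def using L2 good_onD(3,4)[OF g] measurable_F_P[OF good_onD(1)[OF g] order_refl] by simp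
qed

end

text \<open>sn s x = x sinc (s x), and sinc is continuous also at 0, so the limit s' = 0 is
  covered.\<close>

lemma sn_tendsto:
 assumes "s \<longlonglongrightarrow> s'" "x \<longlonglongrightarrow> x'"
 shows "(\<lambda>k. sn (s k) (x k)) \<longlonglongrightarrow> sn s' x'"
proof -
 have eq: "sn s x = x * sinc (s * x)" for s x by (simp add: sn_def)
 have "(\<lambda>k. sinc (s k * x k)) \<longlonglongrightarrow> sinc (s' * x')"
  by (intro isCont_tendsto_compose[OF isCont_sinc] tendsto_mult assms)
 then show ?thesis unfolding eq by (intro tendsto_mult assms)
qed

lemma tendsto_if_const:
 "(f \<longlongrightarrow> a) G \<Longrightarrow> (g \<longlongrightarrow> b) G \<Longrightarrow> ((\<lambda>k. if A then f k else g k) \<longlongrightarrow> (if A then a else b)) G"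
 by (cases A) simp_all

section \<open>The limit s = 0 and arbitrary bounded step coefficients\<close>

context diffusion begin

lemma coeff_tendsto:
 assumes "s \<longlonglongrightarrow> s'" "\<xi> \<longlonglongrightarrow> \<xi>'" "\<rho> \<longlonglongrightarrow> \<rho>'"
 shows "(\<lambda>k. compensator (s k) (\<xi> k) (\<rho> k) z) \<longlonglongrightarrow> compensator s' \<xi>' \<rho>' z"
  and "(\<lambda>k. drift (s k) (\<xi> k) z) \<longlonglongrightarrow> drift s' \<xi>' z"
  and "(\<lambda>k. rates (\<rho> k) z) \<longlonglongrightarrow> rates \<rho>' z"
  and "(\<lambda>k. potential (s k) (\<xi> k) (\<rho> k) z) \<longlonglongrightarrow> potential s' \<xi>' \<rho>' z"
proof -
 have r: "(\<lambda>k. \<rho> k $ j) \<longlonglongrightarrow> \<rho>' $ j" for j by (rule tendsto_vec_nth[OF assms(3)])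
 show "(\<lambda>k. compensator (s k) (\<xi> k) (\<rho> k) z) \<longlonglongrightarrow> compensator s' \<xi>' \<rho>' z"
  unfolding compensator_def by (intro tendsto_intros assms r)
 show "(\<lambda>k. drift (s k) (\<xi> k) z) \<longlonglongrightarrow> drift s' \<xi>' z"
  unfolding drift_def by (intro tendsto_intros assms r)
 show "(\<lambda>k. rates (\<rho> k) z) \<longlonglongrightarrow> rates \<rho>' z"
  unfolding rates_def by (rule vec_tendstoI) (simp, intro tendsto_intros assms r)
 show "(\<lambda>k. potential (s k) (\<xi> k) (\<rho> k) z) \<longlonglongrightarrow> potential s' \<xi>' \<rho>' z"
  unfolding potential_def by (intro tendsto_intros assms sn_tendsto)
qed

lemma log_factor_tendsto:
 assumes s: "s \<longlonglongrightarrow> s'" "\<And>k. 0 \<le> s k" "\<And>k. s k \<le> 1" and x: "\<xi> \<longlonglongrightarrow> \<xi>'" "\<rho> \<longlonglongrightarrow> \<rho>'"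
  and b: "\<And>k. norm (\<xi> k) \<le> M" "\<And>k. norm (\<rho> k) \<le> M" and rx: "0 \<le> r" "r \<le> x" "x \<le> T" and p: "p \<in> \<Omega>"
 shows "(\<lambda>k. log_factor (s k) (\<xi> k) (\<rho> k) r x p) \<longlonglongrightarrow> log_factor s' \<xi>' \<rho>' r x p"
proof -
 have "(\<lambda>k. LBINT w:{r..x}. compensator (s k) (\<xi> k) (\<rho> k) (p w)) \<longlonglongrightarrow> (LBINT w:{r..x}. compensator s' \<xi>' \<rho>' (p w))"
 proof (rule interval_dct[OF comp_path[OF p] comp_path[OF p]])
  show "\<bar>compensator (s k) (\<xi> k) (\<rho> k) (p w)\<bar> \<le> comp_bound M" if "r \<le> w" "w \<le> x" for k w
   using that rx p by (intro compensator_bound s b) (auto simp: cadlag_in_state_space)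
  show "AE w\<in>{r..x} in lborel. (\<lambda>k. compensator (s k) (\<xi> k) (\<rho> k) (p w)) \<longlonglongrightarrow> compensator s' \<xi>' \<rho>' (p w)"
   using coeff_tendsto(1)[OF s(1) x] by (intro AE_I2) blast
 qed
 then show ?thesis unfolding log_factor_def by (intro tendsto_diff coeff_tendsto(4) s x)
qed

lemma stepp_tendsto: "(\<And>m. m < n \<Longrightarrow> (\<lambda>k. X k m p) \<longlonglongrightarrow> \<xi> m p) \<Longrightarrow> (\<lambda>k. stepp \<tau> n (X k) w p) \<longlonglongrightarrow> stepp \<tau> n \<xi> w p"
 for \<xi> :: "nat \<Rightarrow> _ \<Rightarrow> 'c::real_normed_vector"
 unfolding stepp_def by (intro tendsto_intros) auto

lemma step_data_mono: "step_data n \<tau> \<xi> \<rho> M \<Longrightarrow> M \<le> N \<Longrightarrow> step_data n \<tau> \<xi> \<rho> N"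
 unfolding step_data_def by (meson order_trans)

lemma goodD:
 assumes "good D \<beta> \<kappa> C"
 shows "D \<in> borel_measurable P" "\<And>p. p \<in> \<Omega> \<Longrightarrow> 0 \<le> D p" "(\<integral>\<^sup>+p. ennreal ((D p)\<^sup>2) \<partial>P) \<le> ennreal C"
  "\<And>W. W \<in> borel_measurable (F 0) \<Longrightarrow> bdd W \<Longrightarrow> (\<integral>p. W p * D p \<partial>P) = (\<integral>p. W p \<partial>P)"
  "\<And>\<phi> u v W. tf \<phi> \<Longrightarrow> 0 \<le> u \<Longrightarrow> u \<le> v \<Longrightarrow> v \<le> T \<Longrightarrow> W \<in> borel_measurable (F u) \<Longrightarrow> bdd W \<Longrightarrow>
    (\<integral>p. W p * (D p * increment \<phi> \<beta> \<kappa> u v p) \<partial>P) = 0"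
 using assms unfolding good_def by blast+

text \<open>Simultaneous passage to the limit \<open>s \<rightarrow> 0\<close> and from finitely valued to arbitrary bounded
 coefficients.\<close>

lemma good_step:
 assumes sd: "step_data n \<tau> \<xi> \<rho> M"
 shows "good (\<lambda>p. exp (log_density 0 n \<tau> \<xi> \<rho> p)) (step_drift 0 n \<tau> \<xi>) (step_rates n \<tau> \<rho>) (L2_bound (2 * M))"
proof -
 note d = step_dataD[OF sd]
 \<comment> \<open>The simple approximations are only dominated by twice the norm of their limit,
   whence the bound 2 * M in the conclusion.\<close>
 have "\<forall>m. \<exists>X. m < n \<longrightarrow> (\<forall>k. simple_function (F (\<tau> m)) (X k)) \<and> (\<forall>p\<in>\<Omega>. (\<lambda>k. X k p) \<longlonglongrightarrow> \<xi> m p) \<and>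
   (\<forall>k. \<forall>p\<in>\<Omega>. norm (X k p) \<le> 2 * norm (\<xi> m p))"
  using borel_measurable_implies_sequence_metric[OF d(4), of _ 0] by simp
 then obtain X where X: "\<And>m k. m < n \<Longrightarrow> simple_function (F (\<tau> m)) (X m k)"
  "\<And>m p. m < n \<Longrightarrow> p \<in> \<Omega> \<Longrightarrow> (\<lambda>k. X m k p) \<longlonglongrightarrow> \<xi> m p" "\<And>m k p. m < n \<Longrightarrow> p \<in> \<Omega> \<Longrightarrow> norm (X m k p) \<le> 2 * norm (\<xi> m p)"
  by metis
 have "\<forall>m. \<exists>X. m < n \<longrightarrow> (\<forall>k. simple_function (F (\<tau> m)) (X k)) \<and> (\<forall>p\<in>\<Omega>. (\<lambda>k. X k p) \<longlonglongrightarrow> \<rho> m p) \<and>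
   (\<forall>k. \<forall>p\<in>\<Omega>. norm (X k p) \<le> 2 * norm (\<rho> m p))"
  using borel_measurable_implies_sequence_metric[OF d(5), of _ 0] by simp
 then obtain R where R: "\<And>m k. m < n \<Longrightarrow> simple_function (F (\<tau> m)) (R m k)"
  "\<And>m p. m < n \<Longrightarrow> p \<in> \<Omega> \<Longrightarrow> (\<lambda>k. R m k p) \<longlonglongrightarrow> \<rho> m p" "\<And>m k p. m < n \<Longrightarrow> p \<in> \<Omega> \<Longrightarrow> norm (R m k p) \<le> 2 * norm (\<rho> m p)"
  by metis
 define \<xi>' \<rho>' where "\<xi>' k m = X m k" and "\<rho>' k m = R m k" for k m
 define s where "s k = 1 / real (Suc k)" for k
 have s: "0 < s k" "s k \<le> 1" for k by (auto simp: s_def)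
 have s0: "s \<longlonglongrightarrow> 0" unfolding s_def by (rule LIMSEQ_Suc[OF lim_1_over_n])
 have bX: "norm (X m k p) \<le> 2 * M" "norm (R m k p) \<le> 2 * M" if "m < n" "p \<in> \<Omega>" for m k p
  using X(3)[OF that, of k] R(3)[OF that, of k] d(6,7)[OF that] by linarith+
 have sd': "step_data n \<tau> (\<xi>' k) (\<rho>' k) (2 * M)" for k
  unfolding step_data_def \<xi>'_def \<rho>'_def
  using d bX X(1) R(1) by (auto intro: borel_measurable_simple_function)
 have sd2: "step_data n \<tau> \<xi> \<rho> (2 * M)" using step_data_mono[OF sd, of "2 * M"] d(8) by simp
 have fin: "finite ((\<lambda>p. (\<xi>' k m p, \<rho>' k m p)) ` \<Omega>)" if "m < n" for k m
 proof -
  have "finite (X m k ` \<Omega>)" "finite (R m k ` \<Omega>)"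
   using X(1)[OF that] R(1)[OF that] by (auto simp: simple_function_def)
  then show ?thesis
   by (rule finite_subset[OF _ finite_cartesian_product, rotated]) (auto simp: \<xi>'_def \<rho>'_def)
 qed
 have g: "good (\<lambda>p. exp (log_density (s k) n \<tau> (\<xi>' k) (\<rho>' k) p)) (step_drift (s k) n \<tau> (\<xi>' k)) (step_rates n \<tau> (\<rho>' k)) (L2_bound (2 * M))" for k
  by (rule good_simple[OF sd' s fin])
 have lim: "(\<lambda>k. exp (log_density (s k) n \<tau> (\<xi>' k) (\<rho>' k) p)) \<longlonglongrightarrow> exp (log_density 0 n \<tau> \<xi> \<rho> p)" if p: "p \<in> \<Omega>" for p
  unfolding log_density_def
 proof (intro tendsto_exp tendsto_sum)
  fix m assume "m \<in> {..<n}"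
  then have m: "m < n" by simp
  show "(\<lambda>k. log_factor (s k) (\<xi>' k m p) (\<rho>' k m p) (\<tau> m) (\<tau> (Suc m)) p)
    \<longlonglongrightarrow> log_factor 0 (\<xi> m p) (\<rho> m p) (\<tau> m) (\<tau> (Suc m)) p"
   unfolding \<xi>'_def \<rho>'_def
   by (rule log_factor_tendsto[OF s0 _ _ X(2)[OF m p] R(2)[OF m p] bX[OF m p]])
     (use s m d(3)[OF m] d(9)[of m] d(10)[of "Suc m"] p in \<open>auto simp: less_imp_le\<close>)
 qed
 have wl: "(\<lambda>k. step_drift (s k) n \<tau> (\<xi>' k) w p) \<longlonglongrightarrow> step_drift 0 n \<tau> \<xi> w p"
  "(\<lambda>k. step_rates n \<tau> (\<rho>' k) w p) \<longlonglongrightarrow> step_rates n \<tau> \<rho> w p" if p: "p \<in> \<Omega>" for w p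
 proof -
  have 1: "(\<lambda>k. stepp \<tau> n (\<xi>' k) w p) \<longlonglongrightarrow> stepp \<tau> n \<xi> w p"
   by (rule stepp_tendsto) (use X(2) p in \<open>auto simp: \<xi>'_def\<close>)
  have 2: "(\<lambda>k. stepp \<tau> n (\<rho>' k) w p) \<longlonglongrightarrow> stepp \<tau> n \<rho> w p"
   by (rule stepp_tendsto) (use R(2) p in \<open>auto simp: \<rho>'_def\<close>)
  show "(\<lambda>k. step_drift (s k) n \<tau> (\<xi>' k) w p) \<longlonglongrightarrow> step_drift 0 n \<tau> \<xi> w p"
   unfolding step_drift_def by (intro tendsto_if_const coeff_tendsto(2)[OF s0 1 2] tendsto_const)
  show "(\<lambda>k. step_rates n \<tau> (\<rho>' k) w p) \<longlonglongrightarrow> step_rates n \<tau> \<rho> w p"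
   unfolding step_rates_def by (intro tendsto_if_const coeff_tendsto(3)[OF s0 1 2] tendsto_const)
 qed
 show ?thesis
 proof (rule good_limit[OF g step_admissible[OF sd'] step_admissible[OF sd2]])
  show "(\<lambda>p. exp (log_density 0 n \<tau> \<xi> \<rho> p)) \<in> borel_measurable P"
   by (rule borel_measurable_LIMSEQ_real[OF lim goodD(1)[OF g]]) simp
  show "AE p in P. (\<lambda>k. exp (log_density (s k) n \<tau> (\<xi>' k) (\<rho>' k) p)) \<longlonglongrightarrow> exp (log_density 0 n \<tau> \<xi> \<rho> p)"
   by (intro AE_I2 lim) simp
  show "AE p in P. AE w\<in>{0..T} in lborel. (\<lambda>k. step_drift (s k) n \<tau> (\<xi>' k) w p) \<longlonglongrightarrow> step_drift 0 n \<tau> \<xi> w p"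
   by (intro AE_I2 impI wl(1)) simp
  show "AE p in P. AE w\<in>{0..T} in lborel. (\<lambda>k. step_rates n \<tau> (\<rho>' k) w p) \<longlonglongrightarrow> step_rates n \<tau> \<rho> w p"
   by (intro AE_I2 impI wl(2)) simp
 qed (auto simp: L2_bound_def)
qed

lemma set_integral_partition:
 fixes f :: "real \<Rightarrow> real"
 assumes \<tau>: "\<And>m. m < n \<Longrightarrow> \<tau> m < \<tau> (Suc m)" and si: "set_integrable lborel {\<tau> 0..\<tau> n} f" and "m \<le> n"
 shows "(LBINT w:{\<tau> 0..\<tau> m}. f w) = (\<Sum>k<m. LBINT w:{\<tau> k..\<tau> (Suc k)}. f w)"
 using \<open>m \<le> n\<close>
proof (induction m)
 case 0
 have "(LBINT w:{\<tau> 0..\<tau> 0}. f w) = 0"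
  unfolding set_lebesgue_integral_def by (intro integral_eq_zero_AE AE_I[where N="{\<tau> 0}"]) (auto split: split_indicator)
 then show ?case by simp
next
 case (Suc m)
 have le: "\<tau> 0 \<le> \<tau> m" "\<tau> m \<le> \<tau> (Suc m)" "\<tau> (Suc m) \<le> \<tau> n"
  using Suc.prems by (auto intro!: partition_le[of n \<tau>] \<tau>)
 have "set_integrable lborel {\<tau> 0..\<tau> (Suc m)} f" by (rule set_integrable_subset[OF si]) (use le in auto)
 from set_integral_split[OF this le(1,2)] show ?case using Suc by simp
qed

text \<open>At s = 0 the potential is the linear function \<langle>\<rho>, x\<rangle> +
  \<langle>\<xi>, y\<rangle>, so the log density becomes an elementary integral against X and Y
  minus one time integral over the whole horizon.\<close>

lemma log_density_0:
 assumes sd: "step_data n \<tau> \<xi> \<rho> M" and p: "p \<in> \<Omega>"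
 shows "log_density 0 n \<tau> \<xi> \<rho> p = (\<Sum>m<n. \<rho> m p \<bullet> (fst (p (\<tau> (Suc m))) - fst (p (\<tau> m)))
   + \<xi> m p \<bullet> (snd (p (\<tau> (Suc m))) - snd (p (\<tau> m))))
  - (LBINT w:{0..T}. compensator 0 (stepp \<tau> n \<xi> w p) (stepp \<tau> n \<rho> w p) (p w))"
proof -
 note d = step_dataD[OF sd]
 let ?f = "\<lambda>w. compensator 0 (stepp \<tau> n \<xi> w p) (stepp \<tau> n \<rho> w p) (p w)"
 have X: "(\<lambda>w. stepp \<tau> n \<xi> w p) \<in> borel_measurable borel" "(\<lambda>w. stepp \<tau> n \<rho> w p) \<in> borel_measurable borel"
  by (rule path_section_measurable[OF step_props(1)[OF d(1-4)] p] path_section_measurable[OF step_props(1)[OF d(1-3,5)] p], assumption+)+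
 have fm: "?f \<in> borel_measurable borel"
  by (rule coeff_measurable(1)[OF X path_measurable[OF p]])
 have si: "set_integrable lborel {\<tau> 0..\<tau> n} ?f"
 proof (rule set_integrable_bdd[OF fm, where B="comp_bound M"])
  fix w assume w: "\<tau> 0 \<le> w" "w \<le> \<tau> n"
  show "norm (?f w) \<le> comp_bound M"
   unfolding real_norm_def
  proof (rule compensator_bound)
   show "p w \<in> state_space" using w d(1,2) p by (simp add: cadlag_in_state_space)
   show "norm (stepp \<tau> n \<xi> w p) \<le> M" by (rule step_props(3)[OF d(1-4) d(6)[OF _ p] d(8)])
   show "norm (stepp \<tau> n \<rho> w p) \<le> M" by (rule step_props(3)[OF d(1-3,5) d(7)[OF _ p] d(8)])
  qed auto
 qed
 have "(LBINT w:{\<tau> m..\<tau> (Suc m)}. compensator 0 (\<xi> m p) (\<rho> m p) (p w)) = (LBINT w:{\<tau> m..\<tau> (Suc m)}. ?f w)" if "m < n" for m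
  by (rule set_integral_cong_Ioc[OF comp_path[OF p] fm])
    (simp add: stepp_eq[of n \<tau>, OF d(3) that])
 then have "(\<Sum>m<n. LBINT w:{\<tau> m..\<tau> (Suc m)}. compensator 0 (\<xi> m p) (\<rho> m p) (p w)) = (LBINT w:{0..T}. ?f w)"
  using set_integral_partition[of n \<tau>, OF d(3) si order_refl] d(1,2) by simp
 moreover have "potential 0 a c z - potential 0 a c z' = c \<bullet> (fst z - fst z') + a \<bullet> (snd z - snd z')"
  for a c and z z' :: "(real^'k) \<times> (real^'d)"
  by (simp add: potential_def sn_def inner_diff_right)
 ultimately show ?thesis
  unfolding log_density_def log_factor_def by (simp add: sum_subtractf)
qed

end

subsection \<open>Convergence in probability\<close>

context prob_space begin

text \<open>Borel-Cantelli: the probabilities of the exceedances are dominated by a geometric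
  series.\<close>

lemma fast_convergence:
 fixes X :: "nat \<Rightarrow> 'a \<Rightarrow> real"
 assumes [measurable]: "\<And>k. X k \<in> borel_measurable M"
  and X: "\<And>k. prob {x \<in> space M. (1 / 2) ^ k < \<bar>X k x\<bar>} \<le> (1 / 2) ^ k"
 shows "AE x in M. \<forall>\<^sub>F k in sequentially. \<bar>X k x\<bar> \<le> (1 / 2) ^ k"
proof -
 have "summable (\<lambda>k. prob {x \<in> space M. (1 / 2) ^ k < \<bar>X k x\<bar>})"
  by (rule summable_comparison_test'[OF complete_algebra_summable_geometric[of "1/2 :: real"], of 0]) (use X in auto)
 then have "AE x in M. \<forall>\<^sub>F k in sequentially. x \<in> space M - {x \<in> space M. (1 / 2) ^ k < \<bar>X k x\<bar>}"
  by (intro borel_cantelli_AE1) (auto simp: emeasure_eq_measure)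
 then show ?thesis by (simp add: not_less)
qed

lemma tends_in_prob_AE_subseq:
 assumes [measurable]: "\<And>k. J k \<in> borel_measurable M" "I \<in> borel_measurable M"
  and J: "tends_in_prob M J I"
 obtains r where "strict_mono r" "AE x in M. (\<lambda>k. J (r k) x) \<longlonglongrightarrow> I x"
proof -
 have "\<exists>N. \<forall>n\<ge>N. prob {x \<in> space M. (1 / 2) ^ k < \<bar>J n x - I x\<bar>} \<le> (1 / 2) ^ k" for k :: nat
 proof -
  have "\<forall>\<^sub>F n in sequentially. prob {x \<in> space M. (1 / 2) ^ k < \<bar>J n x - I x\<bar>} < (1 / 2) ^ k"
   using J[unfolded tends_in_prob_def, rule_format, of "(1 / 2) ^ k"] by (intro order_tendstoD(2)) auto
  then show ?thesis unfolding eventually_sequentially by (meson less_imp_le)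
 qed
 then obtain N where N: "\<And>k n. n \<ge> N k \<Longrightarrow> prob {x \<in> space M. (1 / 2) ^ k < \<bar>J n x - I x\<bar>} \<le> (1 / 2) ^ k" by metis
 \<comment> \<open>The sum lies above \<open>N k\<close>, and the summand k makes r strictly
   increasing.\<close>
 define r where "r k = (\<Sum>i\<le>k. N i) + k" for k
 have r: "strict_mono r" by (rule strict_mono_Suc_iff[THEN iffD2]) (simp add: r_def)
 have rN: "r k \<ge> N k" for k using member_le_sum[of k "{..k}" N] by (simp add: r_def)
 have "AE x in M. \<forall>\<^sub>F k in sequentially. \<bar>J (r k) x - I x\<bar> \<le> (1 / 2) ^ k"
  by (rule fast_convergence) (use N rN in auto)
 then have "AE x in M. (\<lambda>k. J (r k) x) \<longlonglongrightarrow> I x"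
 proof eventually_elim
  fix x assume "\<forall>\<^sub>F k in sequentially. \<bar>J (r k) x - I x\<bar> \<le> (1 / 2) ^ k"
  then have "(\<lambda>k. J (r k) x - I x) \<longlonglongrightarrow> 0"
   by (intro Lim_null_comparison[OF _ LIMSEQ_power_zero[of "1/2 :: real"]]) auto
  then show "(\<lambda>k. J (r k) x) \<longlonglongrightarrow> I x" by (rule LIM_zero_cancel)
 qed
 then show thesis using r that by blast
qed

lemma prob_union_le:
 assumes "A \<in> sets M" "B \<in> sets M" "C \<subseteq> A \<union> B"
 shows "prob C \<le> prob A + prob B"
 by (rule order_trans[OF finite_measure_mono[OF assms(3) sets.Un[OF assms(1,2)]] measure_Un_le[OF assms(1,2)]])

lemma AE_tends_in_prob:
 assumes [measurable]: "\<And>k. J k \<in> borel_measurable M" "I \<in> borel_measurable M"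
  and lim: "AE x in M. (\<lambda>k. J k x) \<longlonglongrightarrow> I x"
 shows "tends_in_prob M J I"
 unfolding tends_in_prob_def
proof (intro allI impI)
 fix \<delta> :: real assume \<delta>: "0 < \<delta>"
 have "(\<lambda>k. \<integral>x. indicator {x \<in> space M. \<delta> < \<bar>J k x - I x\<bar>} x \<partial>M) \<longlonglongrightarrow> (\<integral>x. (0::real) \<partial>M)"
 proof (rule integral_dominated_convergence[where w="\<lambda>_. 1"])
  show "AE x in M. (\<lambda>k. indicator {x \<in> space M. \<delta> < \<bar>J k x - I x\<bar>} x :: real) \<longlonglongrightarrow> 0"
   using lim
  proof eventually_elim
   fix x assume "(\<lambda>k. J k x) \<longlonglongrightarrow> I x"
   then have "(\<lambda>k. \<bar>J k x - I x\<bar>) \<longlonglongrightarrow> 0" using LIM_zero tendsto_rabs_zero by blast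
   then have "\<forall>\<^sub>F k in sequentially. \<bar>J k x - I x\<bar> < \<delta>" using \<delta> order_tendstoD(2) by blast
   then show "(\<lambda>k. indicator {x \<in> space M. \<delta> < \<bar>J k x - I x\<bar>} x :: real) \<longlonglongrightarrow> 0"
    by (intro tendsto_eventually) (auto elim!: eventually_mono simp: indicator_def)
  qed
 qed (auto simp: indicator_def)
 then show "(\<lambda>k. prob {x \<in> space M. \<delta> < \<bar>J k x - I x\<bar>}) \<longlonglongrightarrow> 0" by simp
qed

text \<open>Along the chosen subsequence consecutive differences are eventually below 2^(-k), hence
  summable, and \<open>lim\<close> provides a measurable limit.\<close>

lemma Cauchy_in_prob:
 fixes J :: "nat \<Rightarrow> 'a \<Rightarrow> real"
 assumes [measurable]: "\<And>k. J k \<in> borel_measurable M"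
  and C: "\<And>\<delta> e. 0 < \<delta> \<Longrightarrow> 0 < e \<Longrightarrow> \<exists>N. \<forall>m\<ge>N. \<forall>n\<ge>N. prob {x \<in> space M. \<delta> < \<bar>J m x - J n x\<bar>} \<le> e"
 obtains I r where "I \<in> borel_measurable M" "strict_mono r" "AE x in M. (\<lambda>k. J (r k) x) \<longlonglongrightarrow> I x"
proof -
 have "\<exists>N. \<forall>m\<ge>N. \<forall>n\<ge>N. prob {x \<in> space M. (1 / 2) ^ k < \<bar>J m x - J n x\<bar>} \<le> (1 / 2) ^ k" for k :: nat
  by (rule C) auto
 then obtain N where N: "\<And>k m n. m \<ge> N k \<Longrightarrow> n \<ge> N k \<Longrightarrow> prob {x \<in> space M. (1 / 2) ^ k < \<bar>J m x - J n x\<bar>} \<le> (1 / 2) ^ k" by metis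
 define r where "r k = (\<Sum>i\<le>k. N i) + k" for k
 have r: "strict_mono r" by (rule strict_mono_Suc_iff[THEN iffD2]) (simp add: r_def)
 have rN: "r k \<ge> N k" "r (Suc k) \<ge> N k" for k using member_le_sum[of k "{..k}" N] by (auto simp: r_def)
 have "AE x in M. \<forall>\<^sub>F k in sequentially. \<bar>J (r (Suc k)) x - J (r k) x\<bar> \<le> (1 / 2) ^ k"
  by (rule fast_convergence) (use N rN in auto)
 then have lim: "AE x in M. (\<lambda>k. J (r k) x) \<longlonglongrightarrow> lim (\<lambda>k. J (r k) x)"
 proof eventually_elim
  fix x assume "\<forall>\<^sub>F k in sequentially. \<bar>J (r (Suc k)) x - J (r k) x\<bar> \<le> (1 / 2) ^ k"
  then have "summable (\<lambda>k. J (r (Suc k)) x - J (r k) x)"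
   by (intro summable_comparison_test_ev[OF _ complete_algebra_summable_geometric[of "1/2 :: real"]]) auto
  then have "convergent (\<lambda>k. J (r k) x - J (r 0) x)"
   by (simp add: summable_iff_convergent sum_lessThan_telescope[of "\<lambda>k. J (r k) x"])
  from convergent_add[OF this convergent_const[of "J (r 0) x"]] have "convergent (\<lambda>k. J (r k) x)" by simp
  then show "(\<lambda>k. J (r k) x) \<longlonglongrightarrow> lim (\<lambda>k. J (r k) x)" by (simp add: convergent_LIMSEQ_iff)
 qed
 show thesis by (rule that[OF _ r lim]) measurable
qed

end

subsection \<open>Elementary stochastic integrals\<close>

definition ssum :: "(nat \<Rightarrow> real) \<Rightarrow> nat \<Rightarrow> (nat \<Rightarrow> 'w \<Rightarrow> 'a::real_inner) \<Rightarrow> (real \<Rightarrow> 'w \<Rightarrow> 'a) \<Rightarrow> 'w \<Rightarrow> real" where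
 "ssum \<tau> n \<xi> Y p = (\<Sum>m<n. \<xi> m p \<bullet> (Y (\<tau> (Suc m)) p - Y (\<tau> m) p))"

text \<open>\<open>a j\<close> is the index of \<open>\<tau> j\<close> in the finer partition
  \<sigma>. The value on a fine cell is read off at its right end, because cells contain their right
  end and not their left one. The last conclusion says that this value is already known at the left
  end, which preserves adaptedness.\<close>

lemma refine_step:
 fixes \<tau> \<sigma> :: "nat \<Rightarrow> real" and \<xi> :: "nat \<Rightarrow> 'w \<Rightarrow> 'a::real_inner"
 assumes \<tau>: "\<And>m. m < n \<Longrightarrow> \<tau> m < \<tau> (Suc m)" and \<sigma>: "\<And>m. m < c \<Longrightarrow> \<sigma> m < \<sigma> (Suc m)"
  and a: "\<And>j. j \<le> n \<Longrightarrow> a j \<le> c \<and> \<sigma> (a j) = \<tau> j" and a0: "a 0 = 0" "a n = c"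
 defines "\<xi>' \<equiv> \<lambda>m. stepp \<tau> n \<xi> (\<sigma> (Suc m))"
 shows "stepp \<sigma> c \<xi>' w p = stepp \<tau> n \<xi> w p" and "ssum \<sigma> c \<xi>' Y p = ssum \<tau> n \<xi> Y p"
  and "m < c \<Longrightarrow> \<exists>j<n. \<tau> j \<le> \<sigma> m \<and> \<xi>' m = \<xi> j"
proof -
 have am: "a j < a (Suc j)" if "j < n" for j
 proof (rule ccontr)
  assume "\<not> ?thesis"
  then have "\<sigma> (a (Suc j)) \<le> \<sigma> (a j)" using a[of j] that by (intro partition_le[of c \<sigma>, OF \<sigma>]) auto
  then show False using a[of j] a[of "Suc j"] \<tau>[OF that] that by simp
 qed
 have idx: "\<exists>j<n. a j \<le> m \<and> m < a (Suc j)" if "m < a i" "i \<le> n" for m i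
  using that
 proof (induction i)
  case (Suc i)
  then show ?case by (cases "m < a i") (auto intro!: exI[of _ i])
 qed (simp add: a0)
 have block: "\<tau> j \<le> \<sigma> m" "\<tau> j < \<sigma> (Suc m)" "\<sigma> (Suc m) \<le> \<tau> (Suc j)" if "j < n" "a j \<le> m" "m < a (Suc j)" for j m
 proof -
  have mp: "m < c" using that a[of "Suc j"] by simp
  have "\<sigma> (a j) \<le> \<sigma> m" using that mp by (intro partition_le[of c \<sigma>, OF \<sigma>]) auto
  then show "\<tau> j \<le> \<sigma> m" using a[of j] that by simp
  then show "\<tau> j < \<sigma> (Suc m)" using \<sigma>[OF mp] by simp
  have "\<sigma> (Suc m) \<le> \<sigma> (a (Suc j))" using that a[of "Suc j"] by (intro partition_le[of c \<sigma>, OF \<sigma>]) auto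
  then show "\<sigma> (Suc m) \<le> \<tau> (Suc j)" using a[of "Suc j"] that by simp
 qed
 have val: "\<xi>' m = \<xi> j" if "j < n" "a j \<le> m" "m < a (Suc j)" for j m
  unfolding \<xi>'_def using block[OF that] by (intro ext stepp_eq[of n \<tau>, OF \<tau> that(1)])
 show "\<exists>j<n. \<tau> j \<le> \<sigma> m \<and> \<xi>' m = \<xi> j" if "m < c" for m
  using idx[of m n] that a0 val block by (metis order_refl)
 show "stepp \<sigma> c \<xi>' w p = stepp \<tau> n \<xi> w p"
 proof (cases "\<sigma> 0 < w \<and> w \<le> \<sigma> c")
  case True
  then obtain m where m: "m < c" "\<sigma> m < w" "w \<le> \<sigma> (Suc m)" using partition_cover by blast
  obtain j where j: "j < n" "a j \<le> m" "m < a (Suc j)" using idx[of m n] m a0 by auto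
  have "stepp \<sigma> c \<xi>' w p = \<xi> j p" using stepp_eq[of c \<sigma>, OF \<sigma> m, of \<xi>'] val[OF j] by simp
  also have "\<dots> = stepp \<tau> n \<xi> w p"
   using block[OF j] m by (intro stepp_eq[of n \<tau>, OF \<tau> j(1), symmetric]) auto
  finally show ?thesis .
 next
  case False
  have "stepp \<sigma> c \<xi>' w p = 0"
  proof (rule stepp_cases[of c \<sigma> \<xi>' w p, OF \<sigma>])
   fix m assume m: "m < c" "\<sigma> m < w" "w \<le> \<sigma> (Suc m)"
   have "\<sigma> 0 \<le> \<sigma> m" "\<sigma> (Suc m) \<le> \<sigma> c" using m by (auto intro!: partition_le[of c \<sigma>] \<sigma>)
   then show ?thesis using m False by simp
  qed
  moreover have "stepp \<tau> n \<xi> w p = 0"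
  proof (rule stepp_cases[of n \<tau> \<xi> w p, OF \<tau>])
   fix m assume m: "m < n" "\<tau> m < w" "w \<le> \<tau> (Suc m)"
   have "\<tau> 0 \<le> \<tau> m" "\<tau> (Suc m) \<le> \<tau> n" using m by (auto intro!: partition_le[of n \<tau>] \<tau>)
   then show ?thesis using m False a[of 0] a[of n] a0 by simp
  qed
  ultimately show ?thesis by simp
 qed
 let ?d = "\<lambda>m. Y (\<sigma> (Suc m)) p - Y (\<sigma> m) p"
 have "(\<Sum>m<a j. \<xi>' m p \<bullet> ?d m) = (\<Sum>i<j. \<xi> i p \<bullet> (Y (\<tau> (Suc i)) p - Y (\<tau> i) p))" if "j \<le> n" for j
  using that
 proof (induction j)
  case (Suc j)
  then have j: "j < n" by simp
  have "(\<Sum>m<a (Suc j). \<xi>' m p \<bullet> ?d m) = (\<Sum>m<a j. \<xi>' m p \<bullet> ?d m) + (\<Sum>m=a j..<a (Suc j). \<xi>' m p \<bullet> ?d m)"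
   using am[OF j] by (simp add: lessThan_atLeast0 sum.atLeastLessThan_concat less_imp_le)
  also have "(\<Sum>m=a j..<a (Suc j). \<xi>' m p \<bullet> ?d m) = \<xi> j p \<bullet> (\<Sum>m=a j..<a (Suc j). ?d m)"
   unfolding inner_sum_right using val[OF j] by (intro sum.cong) auto
  also have "(\<Sum>m=a j..<a (Suc j). ?d m) = Y (\<tau> (Suc j)) p - Y (\<tau> j) p"
   using sum_Suc_diff'[of "a j" "a (Suc j)" "\<lambda>m. Y (\<sigma> m) p"] am[OF j] a[of j] a[of "Suc j"] j by simp
  finally show ?case using Suc by simp
 qed (simp add: a0)
 from this[of n] show "ssum \<sigma> c \<xi>' Y p = ssum \<tau> n \<xi> Y p" by (simp add: ssum_def a0)
qed

lemma common_refinement: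
 fixes S :: "real set"
 assumes S: "finite S" and s0: "t\<^sub>0 \<in> S" "t\<^sub>1 \<in> S" "\<And>t. t \<in> S \<Longrightarrow> t\<^sub>0 \<le> t \<and> t \<le> t\<^sub>1"
 obtains \<sigma> c where "\<And>m. m < c \<Longrightarrow> \<sigma> m < \<sigma> (Suc m)" "\<sigma> 0 = t\<^sub>0" "\<sigma> c = t\<^sub>1"
  "\<And>t. t \<in> S \<Longrightarrow> \<exists>i\<le>c. \<sigma> i = t"
proof -
 define l where "l = sorted_list_of_set S"
 have l: "set l = S" "sorted_wrt (<) l" using S by (auto simp: l_def)
 have ne: "l \<noteq> []" using l s0 by auto
 define c where "c = length l - 1"
 have c: "length l = Suc c" using ne by (simp add: c_def)
 have inc: "l ! i < l ! j" if "i < j" "j \<le> c" for i j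
  using l(2) that c by (auto simp: sorted_wrt_iff_nth_less)
 have ex: "\<exists>i\<le>c. l ! i = t" if "t \<in> S" for t
  using that l(1) c by (auto simp: in_set_conv_nth less_Suc_eq_le)
 have mem: "l ! i \<in> S" if "i \<le> c" for i using l(1) c that by (metis le_imp_less_Suc nth_mem)
 show thesis
 proof (rule that[of c "\<lambda>i. l ! i"])
  show "l ! 0 = t\<^sub>0" using ex[OF s0(1)] inc[of 0] s0(3)[OF mem[of 0]] by (metis le0 not_gr_zero not_less)
  show "l ! c = t\<^sub>1" using ex[OF s0(2)] inc[of _ c] s0(3)[OF mem[of c]] by (metis le_neq_implies_less not_less order_refl)
 qed (use inc ex in auto)
qed

section \<open>Elementary integrals against Y and their exponential moments\<close>

context diffusion begin

abbreviation Y :: "real \<Rightarrow> (real \<Rightarrow> (real^'k) \<times> (real^'d)) \<Rightarrow> real^'d" where "Y \<equiv> \<lambda>t p. snd (p t)"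

abbreviation elem where "elem \<equiv> elementary_integral P F T Y"

definition msq :: "(real \<Rightarrow> ('k, 'd) path \<Rightarrow> real^'d) \<Rightarrow> ennreal" where
 "msq K = (\<integral>\<^sup>+p. (\<integral>\<^sup>+s\<in>{0..T}. ennreal ((norm (K s p))\<^sup>2) \<partial>lborel) \<partial>P)"

lemma elemE:
 assumes "elem K J"
 obtains n \<tau> \<xi> M where "step_data n \<tau> \<xi> (\<lambda>_ _. 0) M" "K = stepp \<tau> n \<xi>" "J = ssum \<tau> n \<xi> Y"
proof -
 obtain n \<tau> \<xi> where e: "\<tau> 0 = 0" "\<tau> n = T" "\<forall>m<n. \<tau> m < \<tau> (Suc m)"
  "\<And>m. m < n \<Longrightarrow> \<xi> m \<in> borel_measurable (F (\<tau> m)) \<and> bounded (\<xi> m ` space P)"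
  "K = (\<lambda>s p. \<Sum>m<n. indicator {\<tau> m<..\<tau> (Suc m)} s *\<^sub>R \<xi> m p)"
  "J = (\<lambda>p. \<Sum>m<n. \<xi> m p \<bullet> (Y (\<tau> (Suc m)) p - Y (\<tau> m) p))"
  using assms unfolding elementary_integral_def by blast
 have "\<forall>m. \<exists>b. m < n \<longrightarrow> (\<forall>p\<in>\<Omega>. norm (\<xi> m p) \<le> b)"
  using e(4) by (auto simp: bounded_iff)
 then obtain b' where b': "\<And>m p. m < n \<Longrightarrow> p \<in> \<Omega> \<Longrightarrow> norm (\<xi> m p) \<le> b' m" by metis
 have "norm (\<xi> m p) \<le> (\<Sum>m<n. \<bar>b' m\<bar>)" if "m < n" "p \<in> \<Omega>" for m p
  using b'[OF that] member_le_sum[of m "{..<n}" "\<lambda>m. \<bar>b' m\<bar>"] that by simp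
 then have "step_data n \<tau> \<xi> (\<lambda>_ _. 0) (\<Sum>m<n. \<bar>b' m\<bar>)"
  unfolding step_data_def using e by (auto intro: sum_nonneg)
 then show thesis by (rule that) (auto simp: e(5,6) stepp_def ssum_def fun_eq_iff)
qed

lemma elemI:
 assumes "step_data n \<tau> \<xi> \<rho> M"
 shows "elem (stepp \<tau> n \<xi>) (ssum \<tau> n \<xi> Y)"
 unfolding elementary_integral_def
proof (intro exI[of _ n] exI[of _ \<tau>] exI[of _ \<xi>] conjI allI impI)
 fix m assume "m < n"
 then show "bounded (\<xi> m ` space P)" using step_dataD(6)[OF assms] by (auto simp: bounded_iff)
qed (use step_dataD[OF assms] in \<open>auto simp: stepp_def ssum_def fun_eq_iff\<close>)

lemma elem_refine:
 assumes sd: "step_data n \<tau> \<xi> \<rho> M" and \<sigma>: "\<And>m. m < c \<Longrightarrow> \<sigma> m < \<sigma> (Suc m)" "\<sigma> 0 = 0" "\<sigma> c = T"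
  and sub: "\<And>j. j \<le> n \<Longrightarrow> \<exists>i\<le>c. \<sigma> i = \<tau> j"
 obtains \<xi>' where "step_data c \<sigma> \<xi>' (\<lambda>_ _. 0) M" "stepp \<sigma> c \<xi>' = stepp \<tau> n \<xi>" "ssum \<sigma> c \<xi>' Y = ssum \<tau> n \<xi> Y"
proof -
 note d = step_dataD[OF sd]
 obtain a where a: "\<And>j. j \<le> n \<Longrightarrow> a j \<le> c \<and> \<sigma> (a j) = \<tau> j" using sub by metis
 have "a 0 = 0" using a[of 0] d(1) \<sigma>(2) partition_less[of c \<sigma> 0 "a 0", OF \<sigma>(1)] by fastforce
 moreover have "a n = c" using a[of n] d(2) \<sigma>(3) partition_less[of c \<sigma> "a n" c, OF \<sigma>(1)] by fastforce
 ultimately have r: "stepp \<sigma> c (\<lambda>m. stepp \<tau> n \<xi> (\<sigma> (Suc m))) w p = stepp \<tau> n \<xi> w p"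
   "ssum \<sigma> c (\<lambda>m. stepp \<tau> n \<xi> (\<sigma> (Suc m))) Y p = ssum \<tau> n \<xi> Y p"
   "m < c \<Longrightarrow> \<exists>j<n. \<tau> j \<le> \<sigma> m \<and> stepp \<tau> n \<xi> (\<sigma> (Suc m)) = \<xi> j" for w p m
  using refine_step[where n=n and \<tau>=\<tau> and c=c and \<sigma>=\<sigma> and a=a and \<xi>=\<xi>, OF d(3) \<sigma>(1) a] by blast+
 have "stepp \<tau> n \<xi> (\<sigma> (Suc m)) \<in> borel_measurable (F (\<sigma> m)) \<and> (\<forall>p\<in>\<Omega>. norm (stepp \<tau> n \<xi> (\<sigma> (Suc m)) p) \<le> M)" if m: "m < c" for m
 proof -
  obtain j where j: "j < n" "\<tau> j \<le> \<sigma> m" "stepp \<tau> n \<xi> (\<sigma> (Suc m)) = \<xi> j" using r(3)[OF m] by blast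
  show ?thesis unfolding j(3) using measurable_filtration_mono[OF d(4)[OF j(1)] j(2)] d(6)[OF j(1)] by blast
 qed
 then have "step_data c \<sigma> (\<lambda>m. stepp \<tau> n \<xi> (\<sigma> (Suc m))) (\<lambda>_ _. 0) M"
  unfolding step_data_def using \<sigma> d(8) by auto
 then show thesis by (rule that) (auto simp: r(1,2) fun_eq_iff)
qed

text \<open>On a common refinement the difference of two elementary integrands is again elementary;
  this is what compares approximating sequences built on different partitions.\<close>

lemma elem_diff:
 assumes "elem K J" "elem K' J'"
 shows "elem (\<lambda>w p. K w p - K' w p) (\<lambda>p. J p - J' p)"
proof -
 obtain n \<tau> \<xi> M where sd: "step_data n \<tau> \<xi> (\<lambda>_ _. 0) M" and K: "K = stepp \<tau> n \<xi>" "J = ssum \<tau> n \<xi> Y"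
  using assms(1) by (rule elemE)
 obtain n' \<tau>' \<xi>' M' where sd': "step_data n' \<tau>' \<xi>' (\<lambda>_ _. 0) M'" and K': "K' = stepp \<tau>' n' \<xi>'" "J' = ssum \<tau>' n' \<xi>' Y"
  using assms(2) by (rule elemE)
 note d = step_dataD[OF sd] and d' = step_dataD[OF sd']
 let ?S = "\<tau> ` {..n} \<union> \<tau>' ` {..n'}"
 have "0 \<in> ?S" "T \<in> ?S" using d(1,2) by (auto intro: rev_image_eqI)
 moreover have "0 \<le> t \<and> t \<le> T" if "t \<in> ?S" for t using that d(9,10) d'(9,10) by auto
 ultimately obtain \<sigma> c where \<sigma>: "\<And>m. m < c \<Longrightarrow> \<sigma> m < \<sigma> (Suc m)" "\<sigma> 0 = 0" "\<sigma> c = T" "\<And>t. t \<in> ?S \<Longrightarrow> \<exists>i\<le>c. \<sigma> i = t"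
  using common_refinement[of ?S 0 T] by (metis finite_UnI finite_atMost finite_imageI)
 obtain \<zeta> where \<zeta>: "step_data c \<sigma> \<zeta> (\<lambda>_ _. 0) M" "stepp \<sigma> c \<zeta> = K" "ssum \<sigma> c \<zeta> Y = J"
  unfolding K by (rule elem_refine[OF sd \<sigma>(1-3)]) (use \<sigma>(4) in auto)
 obtain \<zeta>' where \<zeta>': "step_data c \<sigma> \<zeta>' (\<lambda>_ _. 0) M'" "stepp \<sigma> c \<zeta>' = K'" "ssum \<sigma> c \<zeta>' Y = J'"
  unfolding K' by (rule elem_refine[OF sd' \<sigma>(1-3)]) (use \<sigma>(4) in auto)
 have "step_data c \<sigma> (\<lambda>m p. \<zeta> m p - \<zeta>' m p) (\<lambda>_ _. 0) (M + M')"
  unfolding step_data_def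
 proof (intro conjI allI impI ballI)
  fix m p assume "m < c" "p \<in> \<Omega>"
  then show "norm (\<zeta> m p - \<zeta>' m p) \<le> M + M'"
   using step_dataD(6)[OF \<zeta>(1), of m p] step_dataD(6)[OF \<zeta>'(1), of m p] norm_triangle_ineq4[of "\<zeta> m p" "\<zeta>' m p"] by simp
 qed (use \<sigma> d(8) d'(8) step_dataD(4)[OF \<zeta>(1)] step_dataD(4)[OF \<zeta>'(1)] in \<open>auto intro: borel_measurable_diff\<close>)
 from elemI[OF this]
 show ?thesis
  unfolding \<zeta>(2,3)[symmetric] \<zeta>'(2,3)[symmetric]
  by (simp add: stepp_def[abs_def] ssum_def[abs_def] scaleR_diff_right inner_diff_left sum_subtractf)
qed

lemma elem_measurable:
 assumes "elem K J" shows "J \<in> borel_measurable P" "joint K"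
proof -
 obtain n \<tau> \<xi> M where sd: "step_data n \<tau> \<xi> (\<lambda>_ _. 0) M" and K: "K = stepp \<tau> n \<xi>" "J = ssum \<tau> n \<xi> Y"
  using assms(1) by (rule elemE)
 note d = step_dataD[OF sd]
 show "joint K" unfolding K by (rule step_props(1)[OF d(1-4)])
 have Y: "Y (\<tau> m) \<in> borel_measurable P" if "m \<le> n" for m
  using measurable_compose[OF eval_measurable[OF d(9,10)[OF that]] fst_snd_measurable(2)] .
 show "J \<in> borel_measurable P"
  unfolding K ssum_def[abs_def]
  by (intro borel_measurable_sum borel_measurable_inner borel_measurable_diff Y measurable_F_P[OF d(4)] d(10)) auto
qed

text \<open>With \<rho> = 0 and s = 0 the density of \<open>good_step\<close> is the exponential
  martingale of the elementary integral, and testing with the weight 1 shows that its mean is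
  one.\<close>

lemma exp_elem:
 assumes sd: "step_data n \<tau> \<xi> (\<lambda>_ _. 0) M"
 defines "E \<equiv> \<lambda>p. exp (ssum \<tau> n \<xi> Y p
   - (LBINT w:{0..T}. stepp \<tau> n \<xi> w p \<bullet> lift b (p w) + \<epsilon>\<^sup>2 / 2 * (stepp \<tau> n \<xi> w p \<bullet> stepp \<tau> n \<xi> w p)))"
 shows "(\<integral>\<^sup>+p. ennreal (E p) \<partial>P) = 1" and "E \<in> borel_measurable P"
proof -
 let ?D = "\<lambda>p. exp (log_density 0 n \<tau> \<xi> (\<lambda>_ _. 0) p)"
 note g = goodD[OF good_step[OF sd]]
 have 0: "stepp \<tau> n (\<lambda>_ _. 0) w p = 0" for w and p :: "('k, 'd) path" by (simp add: stepp_def)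
 have eq: "?D p = E p" if "p \<in> \<Omega>" for p
  unfolding log_density_0[OF sd that] E_def ssum_def compensator_def 0 by simp
 show "E \<in> borel_measurable P" using g(1) by (rule measurable_cong[THEN iffD1, rotated]) (simp add: eq)
 have one: "bdd (\<lambda>_. 1)" by (rule bddI[of _ 1]) simp
 have "(\<integral>p. ?D p \<partial>P) = 1" using g(4)[OF borel_measurable_const one] by (simp add: prob_space del: space_P)
 moreover have "integrable P ?D" using calculation not_integrable_integral_eq by fastforce
 ultimately have "(\<integral>\<^sup>+p. ennreal (?D p) \<partial>P) = 1" by (subst nn_integral_eq_integral) auto
 then show "(\<integral>\<^sup>+p. ennreal (E p) \<partial>P) = 1" by (subst nn_integral_cong[of _ _ ?D]) (auto simp: eq)
qed

text \<open>With K multiplied by l the compensator of the exponent consists of l \<langle>K,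
  b\<rangle> and \<epsilon>^2 l^2 |K|^2 / 2. The first is at most 1 / (2 T) + (l B)^2 T |K|^2 / 2 by
  the inequality of arithmetic and geometric means; the coefficients of |K|^2 add up to this
  constant.\<close>

definition tail_const :: "real \<Rightarrow> real" where
 "tail_const l = (l * B)\<^sup>2 * T / 2 + l\<^sup>2 * \<epsilon>\<^sup>2 / 2"

text \<open>The exponential martingale with integrand \<open>l K\<close> controls the upper tail of the elementary
 integral of \<open>K\<close> as long as the energy of \<open>K\<close> is small.\<close>

lemma elem_tail1:
 assumes sd: "step_data n \<tau> \<xi> (\<lambda>_ _. 0) M"
 shows "prob {p \<in> \<Omega>. \<delta> < l * ssum \<tau> n \<xi> Y p \<and> tail_const l * (LBINT w:{0..T}. (norm (stepp \<tau> n \<xi> w p))\<^sup>2) \<le> 1 / 2} \<le> exp (1 - \<delta>)"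
  (is "prob ?A \<le> _")
proof -
 note d = step_dataD[OF sd]
 have sd': "step_data n \<tau> (\<lambda>m p. l *\<^sub>R \<xi> m p) (\<lambda>_ _. 0) (\<bar>l\<bar> * M)"
  unfolding step_data_def using d by (auto intro!: borel_measurable_scaleR mult_left_mono)
 have sl: "stepp \<tau> n (\<lambda>m p. l *\<^sub>R \<xi> m p) w p = l *\<^sub>R stepp \<tau> n \<xi> w p" for w and p :: "('k, 'd) path"
  unfolding stepp_def scaleR_sum_right by (intro sum.cong refl scaleR_left_commute)
 have sj: "ssum \<tau> n (\<lambda>m p. l *\<^sub>R \<xi> m p) Y p = l * ssum \<tau> n \<xi> Y p" for p
  by (simp add: ssum_def sum_distrib_left)
 define E where "E p = exp (l * ssum \<tau> n \<xi> Y p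
   - (LBINT w:{0..T}. (l *\<^sub>R stepp \<tau> n \<xi> w p) \<bullet> lift b (p w) + \<epsilon>\<^sup>2 / 2 * ((l *\<^sub>R stepp \<tau> n \<xi> w p) \<bullet> (l *\<^sub>R stepp \<tau> n \<xi> w p))))" for p
 have E: "(\<integral>\<^sup>+p. ennreal (E p) \<partial>P) = 1" "E \<in> borel_measurable P"
  using exp_elem[OF sd'] unfolding sl sj E_def[abs_def] by auto
 have sub: "?A \<subseteq> {p \<in> space P. 1 \<le> ennreal (exp (1 - \<delta>)) * ennreal (E p)}"
 proof
  fix p assume A: "p \<in> ?A"
  then have p: "p \<in> \<Omega>" by simp
  let ?k = "\<lambda>w. stepp \<tau> n \<xi> w p"
  have km: "?k \<in> borel_measurable borel" by (rule path_section_measurable[OF step_props(1)[OF d(1-4)] p])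
  have kb: "norm (?k w) \<le> M" for w by (rule step_props(3)[OF d(1-4) d(6)[OF _ p] d(8)])
  have bm: "(\<lambda>w. lift b (p w)) \<in> borel_measurable borel" by (rule measurable_compose[OF path_measurable[OF p] lift_bq_measurable(1)])
  let ?f = "\<lambda>w. (l *\<^sub>R ?k w) \<bullet> lift b (p w) + \<epsilon>\<^sup>2 / 2 * ((l *\<^sub>R ?k w) \<bullet> (l *\<^sub>R ?k w))"
  \<comment> \<open>On the event the integral of \<open>?g\<close> is at most 1: the constant part
    integrates to 1/2, and the energy condition bounds the rest by 1/2. Hence E p \<ge> exp
    (\<delta> - 1) there, and Markov's inequality for a mean of one gives the bound.\<close>
  let ?g = "\<lambda>w. 1 / (2 * T) + tail_const l * (norm (?k w))\<^sup>2"
  have le: "?f w \<le> ?g w" and fb: "\<bar>?f w\<bar> \<le> ?g w" if "0 \<le> w" "w \<le> T" for w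
  proof -
   have z: "p w \<in> state_space" using that p by (simp add: cadlag_in_state_space)
   have "\<bar>(l *\<^sub>R ?k w) \<bullet> lift b (p w)\<bar> \<le> norm (l *\<^sub>R ?k w) * norm (lift b (p w))" by (rule Cauchy_Schwarz_ineq2)
   also have "\<dots> \<le> \<bar>l\<bar> * norm (?k w) * B"
    using lift_bq_bound(1)[OF z] by (simp add: mult_left_mono)
   also have "\<dots> \<le> 1 / (2 * T) + (l * B)\<^sup>2 * T / 2 * (norm (?k w))\<^sup>2"
   proof -
    have "0 \<le> (1 - T * (\<bar>l\<bar> * norm (?k w) * B))\<^sup>2" by simp
    then have "T * (\<bar>l\<bar> * norm (?k w) * B) \<le> (1 + (T * (\<bar>l\<bar> * norm (?k w) * B))\<^sup>2) / 2" by (simp add: power2_diff)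
    then show ?thesis using T_pos by (simp add: field_simps power_mult_distrib power2_eq_square)
   qed
   finally have 1: "\<bar>(l *\<^sub>R ?k w) \<bullet> lift b (p w)\<bar> \<le> 1 / (2 * T) + (l * B)\<^sup>2 * T / 2 * (norm (?k w))\<^sup>2" .
   have 2: "\<epsilon>\<^sup>2 / 2 * ((l *\<^sub>R ?k w) \<bullet> (l *\<^sub>R ?k w)) = l\<^sup>2 * \<epsilon>\<^sup>2 / 2 * (norm (?k w))\<^sup>2"
    unfolding power2_norm_eq_inner by (simp add: power2_eq_square)
   have "0 \<le> l\<^sup>2 * \<epsilon>\<^sup>2 / 2 * (norm (?k w))\<^sup>2" by simp
   then show "\<bar>?f w\<bar> \<le> ?g w" unfolding 2 tail_const_def distrib_right using 1 by linarith
   then show "?f w \<le> ?g w" by linarith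
  qed
  have tc: "0 \<le> tail_const l" using T_pos by (simp add: tail_const_def)
  have gb: "\<bar>?g w\<bar> \<le> 1 / (2 * T) + tail_const l * M\<^sup>2" for w
   using kb[of w] tc T_pos by (simp add: abs_of_nonneg mult_left_mono power_mono)
  have gm: "?g \<in> borel_measurable borel" "(\<lambda>w. (norm (?k w))\<^sup>2) \<in> borel_measurable borel"
   using km by measurable
  have gi: "set_integrable lborel {0..T} ?g" by (rule set_integrable_bdd[OF gm(1)]) (use gb in auto)
  have fi: "set_integrable lborel {0..T} ?f"
  proof (rule set_integrable_bdd)
   show "?f \<in> borel_measurable borel"
    by (intro borel_measurable_add borel_measurable_inner borel_measurable_times borel_measurable_scaleR borel_measurable_const km bm)
   show "norm (?f w) \<le> 1 / (2 * T) + tail_const l * M\<^sup>2" if "0 \<le> w" "w \<le> T" for w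
    using fb[OF that] gb[of w] by simp
  qed
  have ni: "set_integrable lborel {0..T} (\<lambda>w. tail_const l * (norm (?k w))\<^sup>2)"
   using kb gm(2) by (intro set_integrable_mult_right set_integrable_bdd[where B="M\<^sup>2"]) (auto intro: power_mono)
  have ci: "set_integrable lborel {0..T} (\<lambda>w. 1 / (2 * T))" by (rule set_integrable_bdd[where B="1 / (2 * T)"]) (use T_pos in auto)
  have "(LBINT w:{0..T}. ?f w) \<le> (LBINT w:{0..T}. ?g w)" by (rule set_integral_mono[OF fi gi]) (use le in auto)
  also have "\<dots> = 1 / 2 + tail_const l * (LBINT w:{0..T}. (norm (?k w))\<^sup>2)"
   using T_pos by (simp add: set_integral_add(2)[OF ci ni]) (simp add: set_lebesgue_integral_def)
  also have "\<dots> \<le> 1" using A by simp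
  finally have "exp (\<delta> - 1) \<le> E p" using A by (simp add: E_def)
  then have "1 \<le> exp (1 - \<delta>) * E p"
   using mult_left_mono[of "exp (\<delta> - 1)" "E p" "exp (1 - \<delta>)"] by (simp flip: exp_add)
  then show "p \<in> {p \<in> space P. 1 \<le> ennreal (exp (1 - \<delta>)) * ennreal (E p)}"
   using p by (simp add: ennreal_mult'[symmetric] ennreal_leI[of 1, simplified])
 qed
 have "emeasure P ?A \<le> emeasure P {p \<in> space P. 1 \<le> ennreal (exp (1 - \<delta>)) * ennreal (E p)}"
  using E(2) by (intro emeasure_mono[OF sub]) measurable
 also have "\<dots> \<le> ennreal (exp (1 - \<delta>)) * (\<integral>\<^sup>+p. ennreal (E p) * indicator (space P) p \<partial>P)"
  by (rule nn_integral_Markov_inequality) (use E(2) in measurable)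
 also have "(\<integral>\<^sup>+p. ennreal (E p) * indicator (space P) p \<partial>P) = 1"
  unfolding E(1)[symmetric] by (rule nn_integral_cong) simp
 finally show ?thesis by (simp add: E(1) emeasure_eq_measure)
qed

end

section \<open>Smallness in probability and existence of the Ito integral\<close>

context diffusion begin

lemma tail_const_nonneg: "0 \<le> tail_const l"
 using T_pos by (simp add: tail_const_def)

lemma step_energy:
 assumes sd: "step_data n \<tau> \<xi> \<rho> M"
 defines "Q \<equiv> \<lambda>p. LBINT w:{0..T}. (norm (stepp \<tau> n \<xi> w p))\<^sup>2"
 shows "Q \<in> borel_measurable P" "msq (stepp \<tau> n \<xi>) = (\<integral>\<^sup>+p. ennreal (Q p) \<partial>P)" "0 \<le> Q p"
proof -
 note d = step_dataD[OF sd]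
 have m: "(\<lambda>(w, p). (norm (stepp \<tau> n \<xi> w p))\<^sup>2) \<in> borel_measurable \<P>"
  using step_props(1)[OF d(1-4)] unfolding split_beta' by measurable
 have kb: "norm (stepp \<tau> n \<xi> w p) \<le> M" if "p \<in> \<Omega>" for w p
  by (rule step_props(3)[OF d(1-4) d(6)[OF _ that] d(8)])
 have b: "norm ((norm (stepp \<tau> n \<xi> w p))\<^sup>2) \<le> M\<^sup>2" if "p \<in> \<Omega>" for w p
  using kb[OF that, of w] by (auto intro: power_mono)
 show "Q \<in> borel_measurable P" unfolding Q_def by (rule Fubini_bounded(2)[OF m b])
 show "0 \<le> Q p" unfolding Q_def set_lebesgue_integral_def by (rule integral_nonneg_AE) simp
 have "(\<integral>\<^sup>+s\<in>{0..T}. ennreal ((norm (stepp \<tau> n \<xi> s p))\<^sup>2) \<partial>lborel) = ennreal (Q p)" if p: "p \<in> \<Omega>" for p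
 proof -
  have "(\<integral>\<^sup>+s. ennreal (indicator {0..T} s *\<^sub>R (norm (stepp \<tau> n \<xi> s p))\<^sup>2) \<partial>lborel) = ennreal (Q p)"
   unfolding Q_def set_lebesgue_integral_def
   using Fubini_bounded(3)[OF m b p, of 0 T] unfolding set_integrable_def by (intro nn_integral_eq_integral) auto
  then show ?thesis by (simp add: mult.commute ennreal_mult' ennreal_indicator)
 qed
 then show "msq (stepp \<tau> n \<xi>) = (\<integral>\<^sup>+p. ennreal (Q p) \<partial>P)"
  unfolding msq_def by (intro nn_integral_cong) simp
qed

text \<open>Three events cover a large value of |J|: those of \<open>elem_tail1\<close> for l and
  for - l, and the failure of the energy condition, which Markov's inequality controls through the
  mean energy.\<close>

lemma elem_tail:
 assumes e: "elem K J" and l: "0 < l" and \<eta>: "msq K \<le> ennreal \<eta>" "0 \<le> \<eta>"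
 shows "prob {p \<in> \<Omega>. \<delta> < \<bar>J p\<bar>} \<le> 2 * exp (1 - l * \<delta>) + 2 * tail_const l * \<eta>"
proof -
 obtain n \<tau> \<xi> M where sd: "step_data n \<tau> \<xi> (\<lambda>_ _. 0) M" and K: "K = stepp \<tau> n \<xi>" "J = ssum \<tau> n \<xi> Y"
  using e by (rule elemE)
 define Q where "Q p = (LBINT w:{0..T}. (norm (stepp \<tau> n \<xi> w p))\<^sup>2)" for p
 note Q = step_energy[OF sd, folded Q_def]
 have [measurable]: "J \<in> borel_measurable P" by (rule elem_measurable(1)[OF e])
 have [measurable]: "Q \<in> borel_measurable P" using Q(1) by (simp add: Q_def[abs_def])
 let ?A = "\<lambda>l'. {p \<in> \<Omega>. l * \<delta> < l' * J p \<and> tail_const l * Q p \<le> 1 / 2}"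
 let ?C = "{p \<in> \<Omega>. 1 \<le> ennreal (2 * tail_const l) * ennreal (Q p)}"
 have [measurable]: "?A l' \<in> sets P" for l' unfolding space_P[symmetric] by measurable
 have [measurable]: "?C \<in> sets P" unfolding space_P[symmetric] by measurable
 have tm: "tail_const (- l) = tail_const l" by (simp add: tail_const_def)
 have A: "prob (?A l) \<le> exp (1 - l * \<delta>)" "prob (?A (- l)) \<le> exp (1 - l * \<delta>)"
  using elem_tail1[OF sd, of "l * \<delta>" l] elem_tail1[OF sd, of "l * \<delta>" "- l"] unfolding K Q_def tm by auto
 have "emeasure P ?C \<le> ennreal (2 * tail_const l) * (\<integral>\<^sup>+p. ennreal (Q p) * indicator \<Omega> p \<partial>P)"
  by (rule nn_integral_Markov_inequality) measurable
 also have "(\<integral>\<^sup>+p. ennreal (Q p) * indicator \<Omega> p \<partial>P) = msq K"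
  unfolding K Q(2) by (rule nn_integral_cong) (simp add: Q_def)
 also have "ennreal (2 * tail_const l) * msq K \<le> ennreal (2 * tail_const l) * ennreal \<eta>"
  by (intro mult_left_mono \<eta>) simp
 finally have C: "prob ?C \<le> 2 * tail_const l * \<eta>"
  using \<eta>(2) tail_const_nonneg[of l] by (simp add: emeasure_eq_measure flip: ennreal_mult)
 have sub: "{p \<in> \<Omega>. \<delta> < \<bar>J p\<bar>} \<subseteq> (?A l \<union> ?A (- l)) \<union> ?C"
 proof
  fix p assume w: "p \<in> {p \<in> \<Omega>. \<delta> < \<bar>J p\<bar>}"
  then have "\<delta> < J p \<or> \<delta> < - J p" by auto
  then have "l * \<delta> < l * J p \<or> l * \<delta> < - l * J p"
   using mult_strict_left_mono[OF _ l, of \<delta> "J p"] mult_strict_left_mono[OF _ l, of \<delta> "- J p"] by auto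
  moreover have "p \<in> ?C" if "\<not> tail_const l * Q p \<le> 1 / 2"
   using w that tail_const_nonneg[of l] Q(3)[of p]
   by (auto simp: Q_def ennreal_mult[symmetric] intro!: ennreal_leI[of 1, simplified])
  ultimately show "p \<in> (?A l \<union> ?A (- l)) \<union> ?C" using w by blast
 qed
 have "prob {p \<in> \<Omega>. \<delta> < \<bar>J p\<bar>} \<le> prob (?A l \<union> ?A (- l)) + prob ?C" by (rule prob_union_le[OF _ _ sub]) measurable
 also have "prob (?A l \<union> ?A (- l)) \<le> prob (?A l) + prob (?A (- l))" by (rule measure_Un_le) measurable
 finally show ?thesis using A C by linarith
qed

text \<open>Substitute for the Ito isometry. The parameter l is taken so large that the two
  exponential terms add up to at most e / 2, and then \<eta>, depending on l, so small that the
  energy term is at most e / 2 as well.\<close>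

lemma ito_small:
 assumes "0 < \<delta>" "0 < e"
 obtains \<eta> where "0 < \<eta>" "\<And>K J. elem K J \<Longrightarrow> msq K \<le> ennreal \<eta> \<Longrightarrow> prob {p \<in> \<Omega>. \<delta> < \<bar>J p\<bar>} \<le> e"
proof -
 define l where "l = (1 + \<bar>ln (e / 4)\<bar>) / \<delta>"
 have l: "0 < l" using assms by (simp add: l_def add_pos_nonneg)
 have "1 - l * \<delta> \<le> ln (e / 4)" using assms by (simp add: l_def)
 then have "exp (1 - l * \<delta>) \<le> exp (ln (e / 4))" by (simp only: exp_le_cancel_iff)
 then have le: "exp (1 - l * \<delta>) \<le> e / 4" using assms by simp
 define \<eta> where "\<eta> = e / (4 * (tail_const l + 1))"
 have \<eta>: "0 < \<eta>" using assms tail_const_nonneg[of l] by (simp add: \<eta>_def)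
 have te: "2 * tail_const l * \<eta> \<le> e / 2"
  using assms tail_const_nonneg[of l] by (simp add: \<eta>_def field_simps)
 show thesis
 proof (rule that[OF \<eta>])
  fix K J assume "elem K J" "msq K \<le> ennreal \<eta>"
  from elem_tail[OF this(1) l this(2), of \<delta>] \<eta> le te show "prob {p \<in> \<Omega>. \<delta> < \<bar>J p\<bar>} \<le> e" by linarith
 qed
qed

lemma msq_triangle:
 assumes [measurable]: "joint K" "joint K'"
  "joint H"
 shows "msq (\<lambda>w p. K w p - K' w p) \<le> 2 * msq (\<lambda>w p. K w p - H w p) + 2 * msq (\<lambda>w p. K' w p - H w p)"
proof -
 let ?f = "\<lambda>G w p. ennreal ((norm (G w p - H w p :: real^'d))\<^sup>2) * indicator {0..T} w"
 have m: "(\<lambda>(p, w). ?f G w p) \<in> borel_measurable (P \<Otimes>\<^sub>M lborel)"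
  if [measurable]: "joint G" for G
 proof -
  have "(\<lambda>(w, p). ?f G w p) \<in> borel_measurable \<P>" by measurable
  then show ?thesis by (subst measurable_pair_swap_iff) (simp add: split_beta' cong: measurable_cong_sets)
 qed
 have m1: "(\<lambda>p. \<integral>\<^sup>+w. ?f G w p \<partial>lborel) \<in> borel_measurable P"
  if "joint G" for G
  using m[OF that] by (rule lborel.borel_measurable_nn_integral)
 have m2: "(\<lambda>w. ?f G w p) \<in> borel_measurable lborel"
  if "joint G" "p \<in> \<Omega>" for G p
  using measurable_compose[OF measurable_Pair1'[of p P lborel] m[OF that(1)]] that(2) by simp
 have pt: "ennreal ((norm (x - y))\<^sup>2) \<le> 2 * ennreal ((norm (x - h))\<^sup>2) + 2 * ennreal ((norm (y - h))\<^sup>2)" for x y h :: "real^'d"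
 proof -
  have "norm (x - y) \<le> norm (x - h) + norm (y - h)" by (metis norm_minus_commute norm_triangle_sub norm_triangle_ineq4 diff_diff_eq2 diff_add_cancel add_diff_cancel)
  then have "(norm (x - y))\<^sup>2 \<le> (norm (x - h) + norm (y - h))\<^sup>2" by (intro power_mono) auto
  also have "\<dots> \<le> 2 * (norm (x - h))\<^sup>2 + 2 * (norm (y - h))\<^sup>2"
   using zero_le_power2[of "norm (x - h) - norm (y - h)"] by (simp add: power2_sum power2_diff)
  finally have "ennreal ((norm (x - y))\<^sup>2) \<le> ennreal (2 * (norm (x - h))\<^sup>2 + 2 * (norm (y - h))\<^sup>2)" by (rule ennreal_leI)
  then show ?thesis by (simp add: ennreal_mult')
 qed
 have "msq (\<lambda>w p. K w p - K' w p) \<le> (\<integral>\<^sup>+p. (\<integral>\<^sup>+w. 2 * ?f K w p + 2 * ?f K' w p \<partial>lborel) \<partial>P)"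
  unfolding msq_def by (intro nn_integral_mono) (use pt in \<open>auto split: split_indicator\<close>)
 also have "\<dots> = (\<integral>\<^sup>+p. 2 * (\<integral>\<^sup>+w. ?f K w p \<partial>lborel) + 2 * (\<integral>\<^sup>+w. ?f K' w p \<partial>lborel) \<partial>P)"
  using m2[OF assms(1)] m2[OF assms(2)] by (intro nn_integral_cong) (simp add: nn_integral_add nn_integral_cmult)
 also have "\<dots> = 2 * msq (\<lambda>w p. K w p - H w p) + 2 * msq (\<lambda>w p. K' w p - H w p)"
  unfolding msq_def using m1[OF assms(1)] m1[OF assms(2)] by (simp add: nn_integral_add nn_integral_cmult)
 finally show ?thesis .
qed

text \<open>By \<open>ito_small\<close>, elementary integrals of close integrands are close in
  probability. Within one sequence this gives a limit I along a subsequence; between two sequences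
  it shows that every approximating sequence has the same limit.\<close>

lemma ito_exists:
 assumes H: "joint H"
  and K: "\<And>m. elem (K m) (J m)" "mean_square_approx P T K H"
 obtains I where "has_ito_integral P F T Y H I"
proof -
 have lim: "(\<lambda>m. msq (\<lambda>w p. G m w p - H w p)) \<longlonglongrightarrow> 0" if "mean_square_approx P T G H" for G
  using that unfolding mean_square_approx_def msq_def .
 \<comment> \<open>A quarter of \<eta> for each sequence: \<open>msq_triangle\<close> adds two
   energies, each with the factor 2.\<close>
 have ev: "\<exists>N. \<forall>m\<ge>N. msq (\<lambda>w p. G m w p - H w p) \<le> ennreal (\<eta> / 4)" if "mean_square_approx P T G H" "0 < \<eta>" for G \<eta>
 proof -
  have "\<forall>\<^sub>F m in sequentially. msq (\<lambda>w p. G m w p - H w p) < ennreal (\<eta> / 4)"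
   using lim[OF that(1)] that(2) by (intro order_tendstoD(2)) auto
  then show ?thesis unfolding eventually_sequentially by (meson less_imp_le)
 qed
 have close: "\<exists>N. \<forall>m\<ge>N. \<forall>k\<ge>N. prob {p \<in> space P. \<delta> < \<bar>J' m p - J k p\<bar>} \<le> e"
  if K': "\<And>m. elem (K' m) (J' m)" "mean_square_approx P T K' H" and "0 < \<delta>" "0 < e" for K' J' \<delta> e
 proof -
  obtain \<eta> where \<eta>: "0 < \<eta>" "\<And>K J. elem K J \<Longrightarrow> msq K \<le> ennreal \<eta> \<Longrightarrow> prob {p \<in> \<Omega>. \<delta> < \<bar>J p\<bar>} \<le> e"
   by (rule ito_small[OF \<open>0 < \<delta>\<close> \<open>0 < e\<close>]) blast
  obtain N1 where N1: "\<And>m. m \<ge> N1 \<Longrightarrow> msq (\<lambda>w p. K' m w p - H w p) \<le> ennreal (\<eta> / 4)" using ev[OF K'(2) \<eta>(1)] by blast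
  obtain N2 where N2: "\<And>m. m \<ge> N2 \<Longrightarrow> msq (\<lambda>w p. K m w p - H w p) \<le> ennreal (\<eta> / 4)" using ev[OF K(2) \<eta>(1)] by blast
  have "prob {p \<in> space P. \<delta> < \<bar>J' m p - J k p\<bar>} \<le> e" if "m \<ge> N1" "k \<ge> N2" for m k
  proof -
   have "msq (\<lambda>w p. K' m w p - K k w p) \<le> 2 * msq (\<lambda>w p. K' m w p - H w p) + 2 * msq (\<lambda>w p. K k w p - H w p)"
    by (rule msq_triangle[OF elem_measurable(2)[OF K'(1)] elem_measurable(2)[OF K(1)] H])
   also have "\<dots> \<le> 2 * ennreal (\<eta> / 4) + 2 * ennreal (\<eta> / 4)"
    by (intro add_mono mult_left_mono N1 N2 that) auto
   also have "\<dots> = ennreal (2 * (\<eta> / 4) + 2 * (\<eta> / 4))"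
    using \<eta>(1) by (simp only: ennreal_plus ennreal_mult' ennreal_numeral)
   also have "\<dots> = ennreal \<eta>" by simp
   finally show ?thesis using \<eta>(2)[OF elem_diff[OF K'(1) K(1)], of m k] by simp
  qed
  then show ?thesis by (intro exI[of _ "max N1 N2"]) auto
 qed
 obtain I r where I: "I \<in> borel_measurable P" "strict_mono r" "AE p in P. (\<lambda>k. J (r k) p) \<longlonglongrightarrow> I p"
  by (rule Cauchy_in_prob[OF elem_measurable(1)[OF K(1)] close[OF K]]) blast
 have rI: "tends_in_prob P (\<lambda>k. J (r k)) I" by (rule AE_tends_in_prob[OF elem_measurable(1)[OF K(1)] I(1,3)])
 have "tends_in_prob P J' I" if K': "\<And>m. elem (K' m) (J' m)" "mean_square_approx P T K' H" for K' J'
  unfolding tends_in_prob_def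
 proof (intro allI impI LIMSEQ_I)
  fix \<delta> e :: real assume \<delta>: "0 < \<delta>" and e: "0 < e"
  have \<delta>2: "0 < \<delta> / 2" and e2: "0 < e / 4" using \<delta> e by auto
  obtain N where N: "\<And>m k. m \<ge> N \<Longrightarrow> k \<ge> N \<Longrightarrow> prob {p \<in> space P. \<delta> / 2 < \<bar>J' m p - J k p\<bar>} \<le> e / 4"
   using close[OF K' \<delta>2 e2] by blast
  have "\<forall>\<^sub>F k in sequentially. prob {p \<in> space P. \<delta> / 2 < \<bar>J (r k) p - I p\<bar>} < e / 4"
   by (rule order_tendstoD(2)[OF rI[unfolded tends_in_prob_def, rule_format, OF \<delta>2] e2])
  moreover have "\<forall>\<^sub>F k in sequentially. k \<ge> N" by (rule eventually_ge_at_top)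
  ultimately have "\<forall>\<^sub>F k in sequentially. prob {p \<in> space P. \<delta> / 2 < \<bar>J (r k) p - I p\<bar>} < e / 4 \<and> k \<ge> N" by (rule eventually_conj)
  from eventually_happens'[OF sequentially_bot this] obtain k where k: "prob {p \<in> space P. \<delta> / 2 < \<bar>J (r k) p - I p\<bar>} < e / 4" "k \<ge> N"
   by blast
  have rk: "r k \<ge> N" using k(2) seq_suble[OF I(2), of k] by simp
  note [measurable] = elem_measurable(1)[OF K'(1)] elem_measurable(1)[OF K(1)] I(1)
  have "prob {p \<in> space P. \<delta> < \<bar>J' m p - I p\<bar>} < e" if m: "m \<ge> N" for m
  proof -
   have "{p \<in> space P. \<delta> < \<bar>J' m p - I p\<bar>} \<subseteq> {p \<in> space P. \<delta> / 2 < \<bar>J' m p - J (r k) p\<bar>} \<union> {p \<in> space P. \<delta> / 2 < \<bar>J (r k) p - I p\<bar>}"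
    by (auto simp: abs_if split: if_splits)
   then have "prob {p \<in> space P. \<delta> < \<bar>J' m p - I p\<bar>} \<le> prob {p \<in> space P. \<delta> / 2 < \<bar>J' m p - J (r k) p\<bar>} + prob {p \<in> space P. \<delta> / 2 < \<bar>J (r k) p - I p\<bar>}"
    by (intro prob_union_le) measurable
   then show ?thesis using N[OF m rk] k(1) e by linarith
  qed
  then show "\<exists>no. \<forall>m\<ge>no. norm (prob {p \<in> space P. \<delta> < \<bar>J' m p - I p\<bar>} - 0) < e"
   by (intro exI[of _ N]) (simp del: space_P)
 qed
 then have "has_ito_integral P F T Y H I"
  unfolding has_ito_integral_def using I(1) K by blast
 then show thesis by (rule that)
qed

end

subsection \<open>Uniform grids and jumps of the discrete component\<close>

definition grid :: "real \<Rightarrow> nat \<Rightarrow> nat \<Rightarrow> real" where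
 "grid T n m = real m * T / real n"

text \<open>Index of the cell containing t, cells being left-open and right-closed as in
  \<open>stepp\<close>: hence the ceiling minus one and not the floor.\<close>

definition cell :: "real \<Rightarrow> nat \<Rightarrow> real \<Rightarrow> nat" where
 "cell T n t = nat (\<lceil>t * real n / T\<rceil> - 1)"

lemma grid_Suc: "0 < n \<Longrightarrow> grid T n (Suc m) = grid T n m + T / real n"
 by (simp add: grid_def field_simps)

lemma grid_less: "0 < T \<Longrightarrow> m < n \<Longrightarrow> grid T n m < grid T n (Suc m)"
 by (simp add: grid_Suc)

lemma grid_bounds: "0 < T \<Longrightarrow> m \<le> n \<Longrightarrow> 0 \<le> grid T n m \<and> grid T n m \<le> T"
 by (cases "n = 0") (auto simp: grid_def field_simps)

lemma grid_ends: "grid T n 0 = 0" "0 < n \<Longrightarrow> grid T n n = T"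
 by (auto simp: grid_def)

lemma cell:
 assumes "0 < T" "0 < t" "t \<le> T" "0 < n"
 shows "cell T n t < n" "grid T n (cell T n t) < t" "t \<le> grid T n (Suc (cell T n t))"
proof -
 let ?x = "t * real n / T"
 have x: "0 < ?x" "?x \<le> real n" using assms by (auto simp: field_simps)
 have c: "1 \<le> \<lceil>?x\<rceil>" "\<lceil>?x\<rceil> \<le> int n" using x by (auto simp: ceiling_le_iff)
 have r: "real (cell T n t) = real_of_int \<lceil>?x\<rceil> - 1" using c by (simp add: cell_def)
 show "cell T n t < n" using c by (simp add: cell_def nat_less_iff)
 have "real (cell T n t) < ?x" "?x \<le> real (Suc (cell T n t))" using r by linarith+
 then show "grid T n (cell T n t) < t" "t \<le> grid T n (Suc (cell T n t))"
  using assms unfolding grid_def by (simp_all add: pos_divide_less_eq pos_divide_le_eq pos_less_divide_eq pos_le_divide_eq mult.commute)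
qed

lemma cell_unique:
 assumes "0 < T" "0 < t" "t \<le> T" "m < n" "grid T n m < t" "t \<le> grid T n (Suc m)"
 shows "cell T n t = m"
proof -
 have n: "0 < n" using assms by simp
 have "real m < t * real n / T" "t * real n / T \<le> real (Suc m)"
  using assms n unfolding grid_def by (simp_all add: pos_divide_less_eq pos_divide_le_eq pos_less_divide_eq pos_le_divide_eq mult.commute)
 then have "\<lceil>t * real n / T\<rceil> = int m + 1" by (intro ceiling_unique) auto
 then show ?thesis by (simp add: cell_def)
qed

lemma cell_left:
 assumes "0 < T" "0 < t" "t \<le> T"
 shows "filterlim (\<lambda>n. grid T n (cell T n t)) (at_left t) sequentially"
proof (rule filterlim_at_withinI)
 have lim: "(\<lambda>n. t - T / real n) \<longlonglongrightarrow> t - 0" by (intro tendsto_intros tendsto_divide_0[OF tendsto_const] filterlim_real_sequentially filterlim_at_top_imp_at_infinity)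
 show "(\<lambda>n. grid T n (cell T n t)) \<longlonglongrightarrow> t"
 proof (rule tendsto_sandwich[OF _ _ lim[simplified] tendsto_const])
  show "\<forall>\<^sub>F n in sequentially. t - T / real n \<le> grid T n (cell T n t)"
   using eventually_gt_at_top[of 0]
  proof eventually_elim
   fix n :: nat assume "0 < n"
   then show "t - T / real n \<le> grid T n (cell T n t)" using cell(3)[OF assms, of n] grid_Suc[of n T "cell T n t"] by simp
  qed
  show "\<forall>\<^sub>F n in sequentially. grid T n (cell T n t) \<le> t"
   using eventually_gt_at_top[of 0] by eventually_elim (use cell(2)[OF assms] in \<open>auto intro: less_imp_le\<close>)
 qed
 show "\<forall>\<^sub>F n in sequentially. grid T n (cell T n t) \<in> {..<t} - {t}"
  using eventually_gt_at_top[of 0] by eventually_elim (use cell(2)[OF assms] in auto)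
qed

text \<open>The right end of the cell lies at or after t and never beyond T; for t = T it equals t,
  so that right-continuity is called upon only for t < T.\<close>

lemma cell_right:
 assumes T: "0 < T" "0 < t" "t \<le> T" and p: "p \<in> cadlag_paths T"
 shows "(\<lambda>n. p (grid T n (Suc (cell T n t)))) \<longlonglongrightarrow> p t"
proof (rule topological_tendstoI)
 fix S assume S: "open S" "p t \<in> S"
 have "\<exists>r>0. \<forall>u. t \<le> u \<and> u < t + r \<and> u \<le> T \<longrightarrow> p u \<in> S"
 proof (cases "t < T")
  case True
  then have "(p \<longlongrightarrow> p t) (at_right t)" using T p by (auto simp: cadlag_paths_def)
  then have "\<forall>\<^sub>F u in at_right t. p u \<in> S" using S by (auto simp: tendsto_def)
  then obtain b where "b > t" "\<forall>u>t. u < b \<longrightarrow> p u \<in> S" by (auto simp: eventually_at_right_field)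
  then show ?thesis using S by (intro exI[of _ "b - t"]) (auto simp: le_less)
 next
  case False
  then show ?thesis using S T by (intro exI[of _ 1]) (auto simp: le_less)
 qed
 then obtain r where r: "r > 0" "\<And>u. t \<le> u \<Longrightarrow> u < t + r \<Longrightarrow> u \<le> T \<Longrightarrow> p u \<in> S" by blast
 have "(\<lambda>n. T / real n) \<longlonglongrightarrow> 0" by (intro tendsto_divide_0[OF tendsto_const] filterlim_real_sequentially filterlim_at_top_imp_at_infinity)
 then have "\<forall>\<^sub>F n in sequentially. T / real n < r" using r(1) by (rule order_tendstoD)
 then show "\<forall>\<^sub>F n in sequentially. p (grid T n (Suc (cell T n t))) \<in> S"
  using eventually_gt_at_top[of 0]
 proof eventually_elim
  fix n :: nat assume n: "T / real n < r" "0 < n"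
  have "grid T n (Suc (cell T n t)) \<le> T" using grid_bounds[of T "Suc (cell T n t)" n] cell(1)[OF T n(2)] T by simp
  then show "p (grid T n (Suc (cell T n t))) \<in> S"
   using r(2) cell(2,3)[OF T n(2)] grid_Suc[OF n(2), of T "cell T n t"] n by auto
 qed
qed

lemma axis_eq_of_close: "dist (axis i 1 :: real^'k) (axis j 1) < 1 \<Longrightarrow> i = j"
 using component_le_norm_cart[of "axis i 1 - axis j 1 :: real^'k" i] by (auto simp: dist_norm axis_def split: if_splits)

text \<open>Two points within 1/2 of a common point are less than 1 apart, which distinct basis
  vectors are not.\<close>

lemma state_close:
 assumes "z \<in> state_space" "z' \<in> state_space" "dist (fst z) l < 1 / 2" "dist (fst z') l < 1 / 2"
 shows "fst z = fst z'"
proof -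
 obtain i j where "fst z = axis i 1" "fst z' = axis j 1" using assms(1,2) by (auto simp: state_space_def)
 moreover have "dist (fst z) (fst z') < 1" using assms(3,4) dist_triangle2[of "fst z" "fst z'" l] by linarith
 ultimately show ?thesis using axis_eq_of_close by metis
qed

lemma cadlag_left:
 "p \<in> cadlag_paths T \<Longrightarrow> 0 < t \<Longrightarrow> t \<le> T \<Longrightarrow> \<exists>l. (p \<longlongrightarrow> l) (at_left t)"
 by (simp add: cadlag_paths_def del: split_paired_Ex)

text \<open>A left limit of a function with values in a discrete set forces the function to be
  constant just before t.\<close>

lemma left_state:
 assumes p: "p \<in> cadlag_paths T" and t: "0 < t" "t \<le> T"
 obtains i r where "0 < r" "r \<le> t" "\<And>u. t - r < u \<Longrightarrow> u < t \<Longrightarrow> fst (p u) = axis i 1"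
proof -
 obtain l where l: "(p \<longlongrightarrow> l) (at_left t)" using cadlag_left[OF p t] by blast
 have "\<forall>\<^sub>F u in at_left t. dist (fst (p u)) (fst l) < 1 / 2"
  by (rule tendstoD[OF tendsto_fst[OF l]]) simp
 then obtain a where a: "a < t" "\<And>u. a < u \<Longrightarrow> u < t \<Longrightarrow> dist (fst (p u)) (fst l) < 1 / 2"
  by (auto simp: eventually_at_left_field)
 define r where "r = t - max a 0"
 have r: "0 < r" "r \<le> t" "t - r = max a 0" using a t by (auto simp: r_def)
 define u0 where "u0 = t - r / 2"
 have u0: "t - r < u0" "u0 < t" using r by (auto simp: u0_def)
 have S: "p u \<in> state_space" if "t - r < u" "u < t" for u
  using that r t by (intro cadlag_in_state_space[OF p]) auto
 obtain i where i: "fst (p u0) = axis i 1" using S[OF u0] by (auto simp: state_space_def)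
 have "fst (p u) = axis i 1" if "t - r < u" "u < t" for u
  using state_close[OF S[OF that] S[OF u0], of "fst l"] a(2)[of u] a(2)[of u0] that u0 r i by auto
 then show thesis using r by (intro that) auto
qed

lemma right_state:
 assumes p: "p \<in> cadlag_paths T" and t: "0 \<le> t" "t < T"
 obtains r where "0 < r" "t + r \<le> T" "\<And>u. t \<le> u \<Longrightarrow> u < t + r \<Longrightarrow> fst (p u) = fst (p t)"
proof -
 have "(p \<longlongrightarrow> p t) (at_right t)" using p t by (auto simp: cadlag_paths_def)
 from tendstoD[OF tendsto_fst[OF this], of "1/2"]
 obtain a where a: "a > t" "\<And>u. t < u \<Longrightarrow> u < a \<Longrightarrow> dist (fst (p u)) (fst (p t)) < 1 / 2"
  by (auto simp: eventually_at_right_field)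
 define r where "r = min a T - t"
 have r: "0 < r" "t + r \<le> T" "t + r \<le> a" using a t by (auto simp: r_def)
 have "fst (p u) = fst (p t)" if "t \<le> u" "u < t + r" for u
 proof (cases "u = t")
  case False
  have S: "p u \<in> state_space" "p t \<in> state_space" using that t r by (auto intro!: cadlag_in_state_space[OF p])
  have "dist (fst (p u)) (fst (p t)) < 1 / 2" using False that r(3) by (intro a(2)) linarith+
  moreover have "dist (fst (p t)) (fst (p t)) < 1 / 2" by simp
  ultimately show ?thesis by (rule state_close[OF S])
 qed simp
 then show thesis by (rule that[OF r(1,2)])
qed

section \<open>Jump times of the discrete component\<close>

definition jumps :: "real \<Rightarrow> (real \<Rightarrow> (real^'k) \<times> (real^'d)) \<Rightarrow> 'k \<Rightarrow> 'k \<Rightarrow> real set" where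
 "jumps T p j i = {s. 0 < s \<and> s \<le> T \<and> ((\<lambda>u. fst (p u)) \<longlongrightarrow> axis i 1) (at_left s) \<and> fst (p s) = axis j 1}"

definition jump_times :: "real \<Rightarrow> (real \<Rightarrow> (real^'k) \<times> (real^'d)) \<Rightarrow> real set" where
 "jump_times T p = {s. 0 < s \<and> s \<le> T \<and> \<not> ((\<lambda>u. fst (p u)) \<longlongrightarrow> fst (p s)) (at_left s)}"

lemma left_state_tendsto:
 assumes "0 < r" "\<And>u. t - r < u \<Longrightarrow> u < t \<Longrightarrow> f u = c"
 shows "(f \<longlongrightarrow> c) (at_left (t::real))"
proof (rule tendsto_eventually)
 show "\<forall>\<^sub>F u in at_left t. f u = c"
  unfolding eventually_at_left_field using assms by (intro exI[of _ "t - r"]) auto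
qed

text \<open>An infinite set of jump times would accumulate at some t of the compact horizon; yet
  left limits and right-continuity make the discrete part constant just before and just after
  t.\<close>

lemma finite_jump_times:
 assumes p: "p \<in> cadlag_paths T"
 shows "finite (jump_times T p)"
proof (rule ccontr)
 assume inf: "infinite (jump_times T p)"
 have "jump_times T p \<subseteq> {0..T}" by (auto simp: jump_times_def)
 from Heine_Borel_imp_Bolzano_Weierstrass[OF compact_Icc inf this]
 obtain t where t: "t \<in> {0..T}" and lp: "t islimpt jump_times T p" by blast
 have no: "s \<notin> jump_times T p" if "a < s" "0 \<le> a" "\<And>u. a < u \<Longrightarrow> u \<le> s \<Longrightarrow> fst (p u) = fst (p s)" for a s
 proof -
  have "((\<lambda>u. fst (p u)) \<longlongrightarrow> fst (p s)) (at_left s)"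
   using that(1) by (intro left_state_tendsto[of "s - a"] that(3)) simp_all
  then show ?thesis by (simp add: jump_times_def)
 qed
 have "\<exists>r>0. \<forall>s. t - r < s \<and> s < t \<longrightarrow> s \<notin> jump_times T p"
 proof (cases "0 < t")
  case True
  have "t \<le> T" using t by simp
  obtain i r where r: "0 < r" "r \<le> t" "\<And>u. t - r < u \<Longrightarrow> u < t \<Longrightarrow> fst (p u) = axis i 1"
   by (rule left_state[OF p True \<open>t \<le> T\<close>]) blast
  have "s \<notin> jump_times T p" if "t - r < s" "s < t" for s
   by (rule no[of "t - r"]) (use that r in simp_all)
  then show ?thesis using r(1) by blast
 next
  case False
  then show ?thesis using t by (intro exI[of _ 1]) (auto simp: jump_times_def)
 qed
 then obtain r where r: "r > 0" "\<And>s. t - r < s \<Longrightarrow> s < t \<Longrightarrow> s \<notin> jump_times T p" by blast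
 have "\<exists>r>0. \<forall>s. t < s \<and> s < t + r \<longrightarrow> s \<notin> jump_times T p"
 proof (cases "t < T")
  case True
  have t0: "0 \<le> t" using t by simp
  obtain r where r: "0 < r" "t + r \<le> T" "\<And>u. t \<le> u \<Longrightarrow> u < t + r \<Longrightarrow> fst (p u) = fst (p t)"
   by (rule right_state[OF p t0 True]) blast
  have "s \<notin> jump_times T p" if "t < s" "s < t + r" for s
  proof (rule no[OF that(1) t0])
   fix u assume "t < u" "u \<le> s"
   then show "fst (p u) = fst (p s)" using that by (intro trans[OF r(3) r(3)[symmetric]]) linarith+
  qed
  then show ?thesis using r(1) by blast
 next
  case False
  then show ?thesis using t by (intro exI[of _ 1]) (auto simp: jump_times_def)
 qed
 then obtain r' where r': "r' > 0" "\<And>s. t < s \<Longrightarrow> s < t + r' \<Longrightarrow> s \<notin> jump_times T p" by blast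
 obtain s where "s \<in> jump_times T p" "s \<noteq> t" "dist s t < min r r'"
  using lp r(1) r'(1) unfolding islimpt_approachable by (metis min_less_iff_conj)
 then show False using r(2)[of s] r'(2)[of s] by (cases "s < t") (auto simp: dist_real_def abs_if split: if_splits)
qed

text \<open>The discrete part is locally constant, hence constant on the connected interval. A jump
  at a itself does no harm, since only the right neighbourhood of a lies in {a..b}.\<close>

lemma no_jump_const:
 assumes p: "p \<in> cadlag_paths T" and ab: "0 \<le> a" "a \<le> b" "b \<le> T" and J: "jump_times T p \<inter> {a<..b} = {}"
 shows "fst (p a) = fst (p b)"
proof (rule connected_local_const[of "{a..b}"])
 show "\<forall>t\<in>{a..b}. \<forall>\<^sub>F u in at t within {a..b}. fst (p t) = fst (p u)"
 proof
  fix t assume t: "t \<in> {a..b}"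
  have "\<exists>r>0. \<forall>u. t - r < u \<and> u < t \<and> a \<le> u \<longrightarrow> fst (p u) = fst (p t)"
  proof (cases "a < t")
   case True
   have t': "0 < t" "t \<le> T" using t ab True by auto
   obtain i r where r: "0 < r" "r \<le> t" "\<And>u. t - r < u \<Longrightarrow> u < t \<Longrightarrow> fst (p u) = axis i 1"
    by (rule left_state[OF p t']) blast
   have "((\<lambda>u. fst (p u)) \<longlongrightarrow> axis i 1) (at_left t)" by (rule left_state_tendsto[OF r(1,3)])
   moreover have "((\<lambda>u. fst (p u)) \<longlongrightarrow> fst (p t)) (at_left t)"
   proof -
    have "t \<notin> jump_times T p" using J t True by auto
    then show ?thesis using t' by (simp add: jump_times_def)
   qed
   ultimately have "fst (p t) = axis i 1" using tendsto_unique trivial_limit_at_left_real by blast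
   then show ?thesis using r by metis
  next
   case False
   then show ?thesis using t by (intro exI[of _ 1]) auto
  qed
  then obtain r where r: "r > 0" "\<And>u. t - r < u \<Longrightarrow> u < t \<Longrightarrow> a \<le> u \<Longrightarrow> fst (p u) = fst (p t)" by blast
  have "\<exists>r>0. \<forall>u. t \<le> u \<and> u < t + r \<and> u \<le> b \<longrightarrow> fst (p u) = fst (p t)"
  proof (cases "t < T")
   case True
   have t0: "0 \<le> t" using t ab by simp
   show ?thesis by (rule right_state[OF p t0 True]) blast
  next
   case False
   then show ?thesis using t ab by (intro exI[of _ 1]) (auto simp: order_antisym_conv)
  qed
  then obtain r' where r': "r' > 0" "\<And>u. t \<le> u \<Longrightarrow> u < t + r' \<Longrightarrow> u \<le> b \<Longrightarrow> fst (p u) = fst (p t)" by blast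
  show "\<forall>\<^sub>F u in at t within {a..b}. fst (p t) = fst (p u)"
   unfolding eventually_at
  proof (intro exI[of _ "min r r'"] conjI ballI impI)
   fix u assume "u \<in> {a..b}" "u \<noteq> t \<and> dist u t < min r r'"
   then show "fst (p t) = fst (p u)"
    using r(2)[of u] r'(2)[of u] by (cases "u < t") (auto simp: dist_real_def abs_if split: if_splits)
  qed (use r r' in auto)
 qed
qed (use ab in auto)

definition pre :: "(real \<Rightarrow> (real^'k) \<times> (real^'d)) \<Rightarrow> real \<Rightarrow> real^'k" where
 "pre p s = Lim (at_left s) (\<lambda>u. fst (p u))"

lemma pre_eq: "((\<lambda>u. fst (p u)) \<longlongrightarrow> x) (at_left s) \<Longrightarrow> pre p s = x"
 unfolding pre_def by (rule tendsto_Lim[OF trivial_limit_at_left_real])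

lemma pre_const:
 assumes p: "p \<in> cadlag_paths T" and ab: "0 \<le> a" "a < s" "s \<le> T" and J: "jump_times T p \<inter> {a<..<s} = {}"
 shows "pre p s = fst (p a)" "((\<lambda>u. fst (p u)) \<longlongrightarrow> fst (p a)) (at_left s)"
proof -
 show *: "((\<lambda>u. fst (p u)) \<longlongrightarrow> fst (p a)) (at_left s)"
 proof (rule left_state_tendsto[of "s - a"])
  fix u assume u: "s - (s - a) < u" "u < s"
  then have "fst (p a) = fst (p u)" using ab J by (intro no_jump_const[OF p]) auto
  then show "fst (p u) = fst (p a)" by simp
 qed (use ab in simp)
 then show "pre p s = fst (p a)" by (rule pre_eq)
qed

lemma jumps_union:
 assumes p: "p \<in> cadlag_paths T"
 shows "jump_times T p = (\<Union>i. \<Union>j\<in>UNIV - {i}. jumps T p j i)"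
proof
 show "jump_times T p \<subseteq> (\<Union>i. \<Union>j\<in>UNIV - {i}. jumps T p j i)"
 proof
  fix s assume s: "s \<in> jump_times T p"
  then have st: "0 < s" "s \<le> T" by (auto simp: jump_times_def)
  obtain i r where r: "0 < r" "r \<le> s" "\<And>u. s - r < u \<Longrightarrow> u < s \<Longrightarrow> fst (p u) = axis i 1"
   using left_state[OF p st] by metis
  have l: "((\<lambda>u. fst (p u)) \<longlongrightarrow> axis i 1) (at_left s)" by (rule left_state_tendsto[OF r(1,3)])
  obtain j where j: "fst (p s) = axis j 1" using cadlag_in_state_space[OF p, of s] st by (auto simp: state_space_def)
  have "j \<noteq> i" using s l j by (auto simp: jump_times_def)
  then show "s \<in> (\<Union>i. \<Union>j\<in>UNIV - {i}. jumps T p j i)" using st l j by (auto simp: jumps_def)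
 qed
 show "(\<Union>i. \<Union>j\<in>UNIV - {i}. jumps T p j i) \<subseteq> jump_times T p"
 proof
  fix s assume "s \<in> (\<Union>i. \<Union>j\<in>UNIV - {i}. jumps T p j i)"
  then obtain i j where s: "s \<in> jumps T p j i" "j \<noteq> i" by blast
  have "\<not> ((\<lambda>u. fst (p u)) \<longlongrightarrow> axis j 1) (at_left s)"
  proof
   assume "((\<lambda>u. fst (p u)) \<longlongrightarrow> axis j 1) (at_left s)"
   then have "(axis i 1 :: real^'a) = axis j 1"
    using s(1) tendsto_unique[OF trivial_limit_at_left_real] unfolding jumps_def by blast
   then show False using s(2) by (simp add: axis_eq_axis)
  qed
  then show "s \<in> jump_times T p" using s by (auto simp: jump_times_def jumps_def)
 qed
qed

text \<open>On a fine grid every cell contains at most one jump, so a sum over the cells of a function of the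
 states at both ends, vanishing on the diagonal, is a sum over the jump times.\<close>

lemma grid_sum_jumps:
 assumes T: "0 < T" and p: "p \<in> cadlag_paths T"
 shows "\<forall>\<^sub>F n in sequentially. \<forall>h :: nat \<Rightarrow> real^'k \<Rightarrow> real^'k \<Rightarrow> real. (\<forall>m x. h m x x = 0) \<longrightarrow>
  (\<Sum>m<n. h m (fst (p (grid T n m))) (fst (p (grid T n (Suc m)))))
   = (\<Sum>s\<in>jump_times T p. h (cell T n s) (pre p s) (fst (p s)))"
proof -
 let ?J = "jump_times T p"
 have fin: "finite ?J" by (rule finite_jump_times[OF p])
 obtain r where r: "r > 0" "\<And>s s'. s \<in> ?J \<Longrightarrow> s' \<in> ?J \<Longrightarrow> s \<noteq> s' \<Longrightarrow> r \<le> dist s s'"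
  using finite_set_avoid[OF fin] fin
 proof -
  have "\<exists>r>0. \<forall>p\<in>{p \<in> ?J \<times> ?J. fst p \<noteq> snd p}. r \<le> dist (fst p) (snd p)"
  proof -
   \<comment> \<open>The minimum is a lower bound for the gaps between jump times; the inserted 1
     covers paths with at most one jump.\<close>
   let ?D = "insert 1 ((\<lambda>p. dist (fst p) (snd p)) ` {p \<in> ?J \<times> ?J. fst p \<noteq> snd p})"
   have f: "finite ?D" using fin by auto
   have "Min ?D > 0" using f by (subst Min_gr_iff) auto
   then show ?thesis using f by (intro exI[of _ "Min ?D"]) auto
  qed
  then show thesis using that by fastforce
 qed
 have "(\<lambda>n. T / real n) \<longlonglongrightarrow> 0" by (intro tendsto_divide_0[OF tendsto_const] filterlim_real_sequentially filterlim_at_top_imp_at_infinity)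
 then have "\<forall>\<^sub>F n in sequentially. T / real n < r" using r(1) by (rule order_tendstoD)
 then show ?thesis
  using eventually_gt_at_top[of 0]
 proof eventually_elim
  fix n :: nat assume n: "T / real n < r" "0 < n"
  show "\<forall>h :: nat \<Rightarrow> real^'k \<Rightarrow> real^'k \<Rightarrow> real. (\<forall>m x. h m x x = 0) \<longrightarrow>
   (\<Sum>m<n. h m (fst (p (grid T n m))) (fst (p (grid T n (Suc m)))))
    = (\<Sum>s\<in>?J. h (cell T n s) (pre p s) (fst (p s)))"
  proof (intro allI impI)
   fix h :: "nat \<Rightarrow> real^'k \<Rightarrow> real^'k \<Rightarrow> real" assume h: "\<forall>m x. h m x x = 0"
   let ?H = "\<lambda>m. h m (fst (p (grid T n m))) (fst (p (grid T n (Suc m))))"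
   have cJ: "cell T n s < n" "grid T n (cell T n s) < s" "s \<le> grid T n (Suc (cell T n s))" if "s \<in> ?J" for s
    using cell[OF T, of s n] that n(2) by (auto simp: jump_times_def)
   have only: "s' = s" if "s \<in> ?J" "s' \<in> ?J" "grid T n m < s" "s \<le> grid T n (Suc m)" "grid T n m < s'" "s' \<le> grid T n (Suc m)" for s s' m
   proof (rule ccontr)
    assume "s' \<noteq> s"
    then have "r \<le> dist s s'" using r(2) that by auto
    then show False using that n grid_Suc[OF n(2), of T m] by (auto simp: dist_real_def)
   qed
   have inj: "inj_on (cell T n) ?J"
    by (rule inj_onI) (metis cJ(2,3) only)
   have zero: "?H m = 0" if "m < n" "m \<notin> cell T n ` ?J" for m
   proof -
    have "?J \<inter> {grid T n m<..grid T n (Suc m)} = {}"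
     using that cell_unique[OF T, of _ m n] by (fastforce simp: jump_times_def)
    then have "fst (p (grid T n m)) = fst (p (grid T n (Suc m)))"
     using grid_bounds[OF T, of m n] grid_bounds[OF T, of "Suc m" n] grid_less[OF T that(1)] that(1)
     by (intro no_jump_const[OF p]) auto
    then show ?thesis using h by simp
   qed
   have val: "?H (cell T n s) = h (cell T n s) (pre p s) (fst (p s))" if s: "s \<in> ?J" for s
   proof -
    have b: "0 \<le> grid T n (cell T n s)" "grid T n (Suc (cell T n s)) \<le> T" "s \<le> T"
     using grid_bounds[OF T, of "cell T n s" n] grid_bounds[OF T, of "Suc (cell T n s)" n] cJ(1)[OF s] s by (auto simp: jump_times_def)
    have "pre p s = fst (p (grid T n (cell T n s)))"
     using only[OF s _ cJ(2,3)[OF s]] cJ[OF s] b by (intro pre_const(1)[OF p]) fastforce+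
    moreover have "fst (p s) = fst (p (grid T n (Suc (cell T n s))))"
     using only[OF s _ cJ(2,3)[OF s]] cJ[OF s] b by (intro no_jump_const[OF p]) fastforce+
    ultimately show ?thesis by simp
   qed
   have "(\<Sum>m<n. ?H m) = (\<Sum>m\<in>cell T n ` ?J. ?H m)"
    using cJ(1) zero by (intro sum.mono_neutral_right) auto
   also have "\<dots> = (\<Sum>s\<in>?J. ?H (cell T n s))" by (simp add: sum.reindex[OF inj])
   also have "\<dots> = (\<Sum>s\<in>?J. h (cell T n s) (pre p s) (fst (p s)))" by (rule sum.cong[OF refl val])
   finally show "(\<Sum>m<n. ?H m) = (\<Sum>s\<in>?J. h (cell T n s) (pre p s) (fst (p s)))" .
  qed
 qed
qed

subsection \<open>Continuity of the second coordinate\<close>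

context diffusion begin

lemma grid_partition:
 assumes "0 < n"
 shows "grid T n 0 = 0" "grid T n n = T" "\<And>m. m < n \<Longrightarrow> grid T n m < grid T n (Suc m)"
 using grid_ends assms grid_less[OF T_pos] by auto

text \<open>The elementary integrand equal to v on one cell and zero elsewhere has energy T / n, so
  \<open>elem_tail1\<close> becomes a tail bound for a single increment of Y.\<close>

lemma increment_tail:
 assumes n: "0 < n" "m < n" and v: "norm v = 1" and l: "tail_const l * (T / real n) \<le> 1 / 2"
 shows "prob {p \<in> \<Omega>. l * \<delta> < l * (v \<bullet> (Y (grid T n (Suc m)) p - Y (grid T n m) p))} \<le> exp (1 - l * \<delta>)"
proof -
 define \<xi> :: "nat \<Rightarrow> ('k, 'd) path \<Rightarrow> real^'d" where "\<xi> k p = (if k = m then v else 0)" for k p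
 note g = grid_partition[OF n(1)]
 have sd: "step_data n (grid T n) \<xi> (\<lambda>_ _. 0) 1"
  unfolding step_data_def \<xi>_def using g v by auto
 have s: "ssum (grid T n) n \<xi> Y p = v \<bullet> (Y (grid T n (Suc m)) p - Y (grid T n m) p)" for p
  using n by (simp add: ssum_def \<xi>_def if_distrib[of "\<lambda>x. x \<bullet> _"] sum.delta cong: if_cong)
 have k: "(norm (stepp (grid T n) n \<xi> w p))\<^sup>2 = indicator {grid T n m<..grid T n (Suc m)} w" for w p
  using n v by (simp add: stepp_def \<xi>_def if_distrib[of "\<lambda>x. _ *\<^sub>R x"] sum.delta indicator_def cong: if_cong)
 have sub: "{0..T} \<inter> {grid T n m<..grid T n (Suc m)} = {grid T n m<..grid T n (Suc m)}"
  using grid_bounds[OF T_pos, of m n] grid_bounds[OF T_pos, of "Suc m" n] n by auto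
 have e: "(LBINT w:{0..T}. (norm (stepp (grid T n) n \<xi> w p))\<^sup>2) = T / real n" for p
  unfolding k set_lebesgue_integral_def using g(3)[OF n(2)] n
  by (simp add: indicator_inter_arith[symmetric] sub measure_def) (simp add: grid_Suc)
 show ?thesis using elem_tail1[OF sd, of "l * \<delta>" l] l unfolding s e by simp
qed

text \<open>Union bound over n cells and the signed basis directions: each event has probability at
  most exp (1 - l \<delta>) with l of order sqrt n, which beats the factor n. Convergence in
  probability is then almost sure along a subsequence of grids.\<close>

lemma Y_increments_small:
 assumes \<delta>: "0 < \<delta>"
 shows "AE p in P. \<exists>r. strict_mono r \<and> (\<forall>\<^sub>F k in sequentially. \<forall>m<r k. \<forall>v\<in>Basis \<union> uminus ` Basis.
   v \<bullet> (Y (grid T (r k) (Suc m)) p - Y (grid T (r k) m) p) \<le> \<delta>)"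
proof -
 define V :: "(real^'d) set" where "V = Basis \<union> uminus ` Basis"
 have V: "finite V" "\<And>v. v \<in> V \<Longrightarrow> norm v = 1" by (auto simp: V_def)
 define A where "A n = {p \<in> \<Omega>. \<exists>m<n. \<exists>v\<in>V. \<delta> < v \<bullet> (Y (grid T n (Suc m)) p - Y (grid T n m) p)}" for n
 define E where "E n m v = {p \<in> \<Omega>. \<delta> < v \<bullet> (Y (grid T n (Suc m)) p - Y (grid T n m) p)}" for n m v
 have Ym: "Y (grid T n m) \<in> borel_measurable P" if "m \<le> n" for n m
  using grid_bounds[OF T_pos that] by (intro measurable_compose[OF eval_measurable fst_snd_measurable(2)]) auto
 have Em: "E n m v \<in> sets P" if "m < n" for n m v
 proof -
  have [measurable]: "Y (grid T n m) \<in> borel_measurable P" "Y (grid T n (Suc m)) \<in> borel_measurable P"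
   using Ym that by auto
  have "{p \<in> space P. \<delta> < v \<bullet> (Y (grid T n (Suc m)) p - Y (grid T n m) p)} \<in> sets P" by measurable
  then show ?thesis by (simp add: E_def)
 qed
 have A: "A n = (\<Union>p\<in>{..<n} \<times> V. E n (fst p) (snd p))" for n by (auto 0 4 simp: A_def E_def)
 have Am: "A n \<in> sets P" for n unfolding A using V(1) Em by (intro sets.finite_UN) auto
 define c where "c = (B\<^sup>2 * T + \<epsilon>\<^sup>2) / 2"
 have c: "0 \<le> c" "tail_const l = l\<^sup>2 * c" for l
  using T_pos by (simp add: c_def) (simp add: c_def tail_const_def field_simps power2_eq_square)
 \<comment> \<open>As \<open>tail_const\<close> is quadratic in l, the choice l = sqrt (a n) makes
   its value times T / n equal to c / (2 (c + 1)), which is at most 1/2 as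
   \<open>increment_tail\<close> requires.\<close>
 define a where "a = 1 / (2 * T * (c + 1))"
 have a: "0 < a" using c(1) T_pos by (simp add: a_def)
 have le: "prob (A n) \<le> real n * real (card V) * exp (1 - sqrt (a * real n) * \<delta>)" if n: "0 < n" for n
 proof -
  let ?l = "sqrt (a * real n)"
  have l: "0 < ?l" using a n by simp
  have "tail_const ?l * (T / real n) = c / (2 * (c + 1))"
   using a n c(1) T_pos by (simp add: c(2)) (simp add: a_def)
  also have "\<dots> \<le> 1 / 2" using c(1) by (simp add: field_simps)
  finally have t: "tail_const ?l * (T / real n) \<le> 1 / 2" .
  have "prob (E n m v) \<le> exp (1 - ?l * \<delta>)" if "m < n" "v \<in> V" for m v
   using increment_tail[OF n that(1) V(2)[OF that(2)] t, of \<delta>] l by (simp add: E_def)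
  then have "(\<Sum>p\<in>{..<n} \<times> V. prob (E n (fst p) (snd p))) \<le> (\<Sum>p\<in>{..<n} \<times> V. exp (1 - ?l * \<delta>))"
   by (intro sum_mono) auto
  moreover have "prob (A n) \<le> (\<Sum>p\<in>{..<n} \<times> V. prob (E n (fst p) (snd p)))"
   unfolding A using V(1) Em by (intro finite_measure_subadditive_finite) auto
  ultimately show ?thesis by (simp add: card_cartesian_product mult.assoc)
 qed
 have top: "filterlim (\<lambda>n. sqrt (a * real n) * \<delta>) at_top sequentially"
  using a \<delta>
  by (intro filterlim_at_top_mult_tendsto_pos[OF tendsto_const] filterlim_compose[OF sqrt_at_top]
    filterlim_tendsto_pos_mult_at_top[OF tendsto_const] filterlim_real_sequentially) auto
 have lim: "(\<lambda>n. real n * real (card V) * exp (1 - sqrt (a * real n) * \<delta>)) \<longlonglongrightarrow> 0"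
 proof -
  \<comment> \<open>In terms of x = sqrt (a n) \<delta> the bound is a constant times x^2 / exp
    x.\<close>
  have "(\<lambda>n. real (card V) * exp 1 / (a * \<delta>\<^sup>2) * ((sqrt (a * real n) * \<delta>) ^ 2 / exp (sqrt (a * real n) * \<delta>))) \<longlonglongrightarrow> real (card V) * exp 1 / (a * \<delta>\<^sup>2) * 0"
   by (intro tendsto_mult tendsto_const filterlim_compose[OF tendsto_power_div_exp_0 top])
  then show ?thesis using a \<delta> by (simp add: power_mult_distrib exp_diff field_simps)
 qed
 have tip: "tends_in_prob P (\<lambda>n. indicator (A n)) (\<lambda>_. 0)"
  unfolding tends_in_prob_def
 proof (intro allI impI)
  fix e :: real assume "0 < e"
  have 1: "(\<lambda>n. prob (A n)) \<longlonglongrightarrow> 0"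
   by (rule tendsto_sandwich[OF _ _ tendsto_const lim]) (use le in \<open>auto intro!: eventually_sequentiallyI[of 1]\<close>)
  have 2: "prob {p \<in> space P. e < \<bar>indicator (A n) p - 0\<bar>} \<le> prob (A n)" for n
   by (rule finite_measure_mono[OF _ Am]) (use \<open>0 < e\<close> in \<open>auto simp: indicator_def split: if_splits\<close>)
  show "(\<lambda>n. prob {p \<in> space P. e < \<bar>indicator (A n) p - 0\<bar>}) \<longlonglongrightarrow> 0"
   by (rule tendsto_sandwich[OF _ _ tendsto_const 1]; intro always_eventually allI measure_nonneg 2)
 qed
 obtain r where r: "strict_mono r" "AE p in P. (\<lambda>k. indicator (A (r k)) p :: real) \<longlonglongrightarrow> 0"
  by (rule tends_in_prob_AE_subseq[OF borel_measurable_indicator[OF Am] borel_measurable_const tip]) blast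
 show ?thesis
  using r(2) AE_space
 proof eventually_elim
  fix p assume lim: "(\<lambda>k. indicator (A (r k)) p :: real) \<longlonglongrightarrow> 0" and p: "p \<in> space P"
  have "\<forall>\<^sub>F k in sequentially. indicator (A (r k)) p < (1 :: real)" by (rule order_tendstoD(2)[OF lim]) simp
  then have "\<forall>\<^sub>F k in sequentially. \<forall>m<r k. \<forall>v\<in>V. v \<bullet> (Y (grid T (r k) (Suc m)) p - Y (grid T (r k) m) p) \<le> \<delta>"
  proof eventually_elim
   fix k assume "indicator (A (r k)) p < (1 :: real)"
   then have "p \<notin> A (r k)" by (simp add: indicator_def split: if_splits)
   then show "\<forall>m<r k. \<forall>v\<in>V. v \<bullet> (Y (grid T (r k) (Suc m)) p - Y (grid T (r k) m) p) \<le> \<delta>"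
    using p unfolding A_def by (simp add: not_less[symmetric])
  qed
  then show "\<exists>r. strict_mono r \<and> (\<forall>\<^sub>F k in sequentially. \<forall>m<r k. \<forall>v\<in>Basis \<union> uminus ` Basis.
    v \<bullet> (Y (grid T (r k) (Suc m)) p - Y (grid T (r k) m) p) \<le> \<delta>)"
   using r(1) unfolding V_def by blast
 qed
qed

text \<open>Left limits exist, so a jump of Y at t would be the limit of the increments over the
  cells containing t; for every tolerance these are small along some subsequence of grids. One-sided
  bounds in the directions of all signed basis vectors force the jump to vanish.\<close>

lemma Y_left_continuous:
 "AE p in P. \<forall>t\<in>{0<..T}. ((\<lambda>u. snd (p u)) \<longlongrightarrow> snd (p t)) (at_left t)"
proof -
 have "AE p in P. \<forall>a::nat. \<exists>r. strict_mono r \<and> (\<forall>\<^sub>F k in sequentially. \<forall>m<r k. \<forall>v\<in>Basis \<union> uminus ` Basis.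
   v \<bullet> (Y (grid T (r k) (Suc m)) p - Y (grid T (r k) m) p) \<le> 1 / real (Suc a))"
  unfolding AE_all_countable by (intro allI Y_increments_small) simp
 then show ?thesis
  using AE_space
 proof (eventually_elim, intro ballI)
  fix p t assume S: "\<forall>a. \<exists>r. strict_mono r \<and> (\<forall>\<^sub>F k in sequentially. \<forall>m<r k. \<forall>v\<in>Basis \<union> uminus ` Basis.
    v \<bullet> (Y (grid T (r k) (Suc m)) p - Y (grid T (r k) m) p) \<le> 1 / real (Suc a))"
   and p: "p \<in> space P" and t': "t \<in> {0<..T}"
  have t: "0 < t" "t \<le> T" and p': "p \<in> \<Omega>" using t' p by auto
  obtain l where l: "(p \<longlongrightarrow> l) (at_left t)" using cadlag_left[OF p' t] by blast
  have le: "v \<bullet> (snd (p t) - snd l) \<le> 1 / real (Suc a)" if v: "v \<in> Basis \<union> uminus ` Basis" for v a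
  proof -
   obtain r where r: "strict_mono r" "\<forall>\<^sub>F k in sequentially. \<forall>m<r k. \<forall>v\<in>Basis \<union> uminus ` Basis.
     v \<bullet> (Y (grid T (r k) (Suc m)) p - Y (grid T (r k) m) p) \<le> 1 / real (Suc a)"
    using S by blast
   have "(\<lambda>n. v \<bullet> (Y (grid T n (Suc (cell T n t))) p - Y (grid T n (cell T n t)) p)) \<longlonglongrightarrow> v \<bullet> (snd (p t) - snd l)"
    by (intro tendsto_intros tendsto_snd cell_right[OF T_pos t p'] filterlim_compose[OF l cell_left[OF T_pos t]])
   from LIMSEQ_subseq_LIMSEQ[OF this r(1)]
   have lim: "(\<lambda>k. v \<bullet> (Y (grid T (r k) (Suc (cell T (r k) t))) p - Y (grid T (r k) (cell T (r k) t)) p)) \<longlonglongrightarrow> v \<bullet> (snd (p t) - snd l)"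
    by (simp add: o_def)
   have "\<forall>\<^sub>F k in sequentially. 0 < r k"
    using filterlim_subseq[OF r(1)] eventually_gt_at_top[of 0] unfolding filterlim_iff by blast
   with r(2) have "\<forall>\<^sub>F k in sequentially. v \<bullet> (Y (grid T (r k) (Suc (cell T (r k) t))) p - Y (grid T (r k) (cell T (r k) t)) p) \<le> 1 / real (Suc a)"
    by eventually_elim (use v cell(1)[OF T_pos t] in blast)
   then show ?thesis by (intro tendsto_upperbound[OF lim]) auto
  qed
  have le0: "v \<bullet> (snd (p t) - snd l) \<le> 0" if v: "v \<in> Basis \<union> uminus ` Basis" for v
   by (rule LIMSEQ_le_const[OF LIMSEQ_inverse_real_of_nat]) (use le[OF v] in \<open>auto simp: inverse_eq_divide\<close>)
  have "v \<bullet> (snd (p t) - snd l) = 0" if "v \<in> Basis" for v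
   using le0[of v] le0[of "- v"] that by simp
  then have "snd (p t) - snd l = 0" by (subst euclidean_all_zero_iff[symmetric]) (simp add: inner_commute)
  then have "snd (p t) = snd l" by simp
  then show "((\<lambda>u. snd (p u)) \<longlongrightarrow> snd (p t)) (at_left t)"
   by (rule ssubst[where P="\<lambda>y. ((\<lambda>u. snd (p u)) \<longlongrightarrow> y) (at_left t)"]) (rule tendsto_snd[OF l])
 qed
qed

end

subsection \<open>Approximation of the integrand on grids\<close>

text \<open>Density of continuous functions in L^1: regularity of M encloses a Borel set between a
  closed and an open one, Urysohn's lemma interpolates, and the rest is linearity and dominated
  convergence.\<close>

lemma integrable_approx_continuous:
 fixes h :: "'a::euclidean_space \<Rightarrow> 'b::euclidean_space"
 assumes "finite_measure M" and M: "sets M = sets borel" and "integrable M h"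
 shows "0 < e \<Longrightarrow> \<exists>g. continuous_on UNIV g \<and> integrable M g \<and> (\<integral>x. norm (h x - g x) \<partial>M) < e"
 using assms(3)
proof (induction arbitrary: e rule: integrable_induct)
 interpret finite_measure M by fact
 note [measurable_cong] = M
 have fin: "emeasure M (space M) \<noteq> \<infinity>" by simp
 have sp: "space M = UNIV" using sets_eq_imp_space_eq[OF M] by simp
 {
  case (base A c)
  then have A: "A \<in> sets borel" using M by simp
  \<comment> \<open>The error is at most norm c on U - K, a set of measure less than 2 d; the
    summand 1 in the denominator takes care of c = 0.\<close>
  define d where "d = e / (2 * (1 + norm c))"
  have d: "0 < d" "2 * d * norm c < e" using base(3) by (auto simp: d_def field_simps add_pos_nonneg)
  have reg: "\<exists>U. A \<subseteq> U \<and> open U \<and> measure M U < measure M A + d" if A: "A \<in> sets borel" for A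
  proof -
   have "(INF U\<in>{U. A \<subseteq> U \<and> open U}. emeasure M U) < emeasure M A + ennreal d"
    unfolding outer_regular[OF M fin A, symmetric] using d(1)
    by (simp add: emeasure_eq_measure ennreal_less_iff flip: ennreal_plus)
   then show ?thesis
    unfolding INF_less_iff using d(1) by (auto simp: emeasure_eq_measure ennreal_less_iff simp flip: ennreal_plus)
  qed
  obtain U where U: "A \<subseteq> U" "open U" "measure M U < measure M A + d" using reg[OF A] by blast
  obtain V where V: "- A \<subseteq> V" "open V" "measure M V < measure M (- A) + d" using reg[of "- A"] A by auto
  define K where "K = - V"
  have K: "K \<subseteq> A" "closed K" using V by (auto simp: K_def)
  have Um: "U \<in> sets M" "K \<in> sets M" using U(2) K(2) by (simp_all add: M)
  have "measure M (- A) = measure M (space M) - measure M A" "measure M K = measure M (space M) - measure M V"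
   using base(1) V(2) finite_measure_compl[of A] finite_measure_compl[of V] by (auto simp: K_def sp M Compl_eq_Diff_UNIV)
  then have m: "measure M U < measure M A + d" "measure M A < measure M K + d" using U(3) V(3) by auto
  obtain f :: "'a \<Rightarrow> real" where f: "continuous_on UNIV f" "\<And>x. f x \<in> closed_segment 0 1" "\<And>x. x \<in> - U \<Longrightarrow> f x = 0" "\<And>x. x \<in> K \<Longrightarrow> f x = 1"
   using Urysohn[of "- U" K "0 :: real" 1] U(1,2) K(1,2) by (auto simp: compact_imp_closed)
  have f01: "0 \<le> f x" "f x \<le> 1" for x using f(2)[of x] by (auto simp: closed_segment_eq_real_ivl)
  have [measurable]: "f \<in> borel_measurable M" using borel_measurable_continuous_onI[OF f(1)] by (simp add: M cong: measurable_cong_sets)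
  have ig: "integrable M (\<lambda>x. f x *\<^sub>R c)" by (rule integrable_const_bound[where B="norm c"]) (auto simp: f01 mult_left_le_one_le)
  have "(\<integral>x. norm (indicator A x *\<^sub>R c - f x *\<^sub>R c) \<partial>M) \<le> (\<integral>x. indicator (U - K) x *\<^sub>R norm c \<partial>M)"
  proof (rule integral_mono)
   fix x assume "x \<in> space M"
   have "\<bar>indicator A x - f x\<bar> \<le> (indicator (U - K) x :: real)"
    using f01[of x] f(3,4)[of x] U(1) K(1) by (auto simp: indicator_def)
   from mult_right_mono[OF this norm_ge_zero[of c]]
   show "norm (indicator A x *\<^sub>R c - f x *\<^sub>R c) \<le> indicator (U - K) x *\<^sub>R norm c"
    by (simp flip: scaleR_left_diff_distrib)
  qed (use Um base ig in \<open>auto intro!: Bochner_Integration.integrable_diff integrable_norm integrable_scaleR_left simp: less_top[symmetric]\<close>)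
  also have "\<dots> = (measure M U - measure M K) * norm c"
   using Um U(1) K(1) by (simp add: measure_Diff)
  also have "\<dots> \<le> 2 * d * norm c" using m by (intro mult_right_mono) auto
  also note d(2)
  finally show ?case using f(1) ig by (intro exI[of _ "\<lambda>x. f x *\<^sub>R c"]) (auto intro!: continuous_intros)
 next
  case (add f1 f2)
  obtain g1 g2 where g: "continuous_on UNIV g1" "integrable M g1" "(\<integral>x. norm (f1 x - g1 x) \<partial>M) < e / 2"
   "continuous_on UNIV g2" "integrable M g2" "(\<integral>x. norm (f2 x - g2 x) \<partial>M) < e / 2"
   using add(3,4)[of "e / 2"] add(5) by auto
  have "(\<integral>x. norm (f1 x + f2 x - (g1 x + g2 x)) \<partial>M) \<le> (\<integral>x. norm (f1 x - g1 x) + norm (f2 x - g2 x) \<partial>M)"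
   using add(1,2) g(2,5) norm_triangle_ineq by (intro integral_mono) (auto simp: add_diff_add)
  also have "\<dots> < e" using add(1,2) g by simp
  finally show ?case using g by (intro exI[of _ "\<lambda>x. g1 x + g2 x"]) (auto intro!: continuous_intros)
 next
  case (lim f s)
  have "(\<lambda>i. \<integral>x. norm (f x - s i x) \<partial>M) \<longlonglongrightarrow> (\<integral>x. norm (0 :: 'b) \<partial>M)"
  proof (rule integral_dominated_convergence[where w="\<lambda>x. 3 * norm (f x)"])
   show "AE x in M. (\<lambda>i. norm (f x - s i x)) \<longlonglongrightarrow> norm (0 :: 'b)"
    using tendsto_diff[OF tendsto_const lim.hyps(2), of _ "f _"] by (intro AE_I2 tendsto_norm) (metis diff_self)
   show "AE x in M. norm (norm (f x - s i x)) \<le> 3 * norm (f x)" for i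
   proof (intro AE_I2)
    fix x assume "x \<in> space M"
    then show "norm (norm (f x - s i x)) \<le> 3 * norm (f x)"
     using lim.hyps(3)[of x i] norm_triangle_ineq4[of "f x" "s i x"] by simp
   qed
  qed (use lim.hyps(1,4) in auto)
  then have "\<forall>\<^sub>F i in sequentially. (\<integral>x. norm (f x - s i x) \<partial>M) < e / 2" using lim.prems by (intro order_tendstoD) auto
  then obtain i where i: "(\<integral>x. norm (f x - s i x) \<partial>M) < e / 2" by (auto simp: eventually_sequentially)
  obtain g where g: "continuous_on UNIV g" "integrable M g" "(\<integral>x. norm (s i x - g x) \<partial>M) < e / 2"
   using lim.IH[of "e / 2" i] lim.prems by auto
  have "(\<integral>x. norm (f x - g x) \<partial>M) \<le> (\<integral>x. norm (f x - s i x) + norm (s i x - g x) \<partial>M)"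
   using lim.hyps(1,4) g(2) norm_triangle_ineq[of "f x - s i x" "s i x - g x" for x] by (intro integral_mono) auto
  also have "\<dots> < e" using lim.hyps(1,4) g i by simp
  finally show ?case using g by blast
 }
qed

text \<open>Nearest point projection onto the ball of radius C is 1-Lipschitz and fixes the values
  of h, so it enforces the bound without increasing the error.\<close>

lemma bounded_approx_continuous:
 fixes h :: "'a::euclidean_space \<Rightarrow> 'b::euclidean_space"
 assumes fm: "finite_measure M" and M: "sets M = sets borel" and h: "h \<in> borel_measurable borel" "\<And>x. norm (h x) \<le> C" and "0 < e"
 obtains g where "continuous_on UNIV g" "\<And>x. norm (g x) \<le> C" "(\<integral>x. norm (h x - g x) \<partial>M) < e"
proof -
 interpret finite_measure M by fact
 have hm: "h \<in> borel_measurable M" using h(1) M by (simp cong: measurable_cong_sets)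
 have hi: "integrable M h" by (rule integrable_const_bound[OF _ hm]) (use h(2) in auto)
 obtain g where g: "continuous_on UNIV g" "integrable M g" "(\<integral>x. norm (h x - g x) \<partial>M) < e"
  using integrable_approx_continuous[OF fm M hi \<open>0 < e\<close>] by blast
 have C: "0 \<le> C" using h(2) norm_ge_zero order_trans by blast
 define c where "c = (\<lambda>y :: 'b. closest_point (cball 0 C) y)"
 have c: "continuous_on UNIV c" "norm (c y) \<le> C" "dist (c x) (c y) \<le> dist x y" "norm x \<le> C \<Longrightarrow> c x = x" for x y
  unfolding c_def using C closest_point_in_set[of "cball 0 C" y]
  by (auto intro!: continuous_on_closest_point closest_point_lipschitz closest_point_self)
 show thesis
 proof (rule that[of "\<lambda>x. c (g x)"])
  show cg: "continuous_on UNIV (\<lambda>x. c (g x))" by (rule continuous_on_compose2[OF c(1) g(1)]) simp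
  have cm: "(\<lambda>x. c (g x)) \<in> borel_measurable M"
   using borel_measurable_continuous_onI[OF cg] M by (simp cong: measurable_cong_sets)
  have ci: "integrable M (\<lambda>x. c (g x))" by (rule integrable_const_bound[OF _ cm]) (use c(2) in auto)
  have "(\<integral>x. norm (h x - c (g x)) \<partial>M) \<le> (\<integral>x. norm (h x - g x) \<partial>M)"
   using c(3)[of "h x" "g x" for x] c(4)[OF h(2)] by (intro integral_mono integrable_norm Bochner_Integration.integrable_diff hi ci g(2)) (auto simp: dist_norm)
  then show "(\<integral>x. norm (h x - c (g x)) \<partial>M) < e" using g(3) by simp
 qed (rule c(2))
qed

text \<open>Fubini in this direction asks for a measurable set of convergence; tolerances 1/(k+1)
  exhibit it through countable operations.\<close>

lemma (in pair_sigma_finite) AE_pair_tendsto: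
 fixes f :: "nat \<Rightarrow> _ \<Rightarrow> 'c::{metric_space, second_countable_topology}"
 assumes [measurable]: "\<And>n. f n \<in> borel_measurable (M1 \<Otimes>\<^sub>M M2)" "g \<in> borel_measurable (M1 \<Otimes>\<^sub>M M2)"
  and lim: "AE x in M1. AE y in M2. (\<lambda>n. f n (x, y)) \<longlonglongrightarrow> g (x, y)"
 shows "AE z in M1 \<Otimes>\<^sub>M M2. (\<lambda>n. f n z) \<longlonglongrightarrow> g z"
proof -
 have *: "(X \<longlonglongrightarrow> L) \<longleftrightarrow> (\<forall>k::nat. \<exists>N. \<forall>n\<ge>N. dist (X n) L < inverse (real (Suc k)))" for X and L :: 'c
  unfolding lim_sequentially
  by (meson reals_Archimedean order_less_trans inverse_positive_iff_positive of_nat_0_less_iff zero_less_Suc)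
 have [measurable]: "(\<lambda>z. dist (f n z) (g z)) \<in> borel_measurable (M1 \<Otimes>\<^sub>M M2)" for n
  by (rule borel_measurable_dist[OF assms(1,2)])
 show ?thesis
  unfolding *
 proof (rule AE_pair_measure)
  show "{z \<in> space (M1 \<Otimes>\<^sub>M M2). \<forall>k. \<exists>N. \<forall>n\<ge>N. dist (f n z) (g z) < inverse (real (Suc k))} \<in> sets (M1 \<Otimes>\<^sub>M M2)"
   by (intro sets.sets_Collect_countable_All sets.sets_Collect_countable_Ex sets.sets_Collect_imp sets.sets_Collect_const borel_measurable_less borel_measurable_const) measurable
 qed (rule lim[unfolded *])
qed

section \<open>Sampling a function of the state on grids\<close>

context diffusion begin

abbreviation time where "time \<equiv> restrict_space lborel {0..T}"

definition gstep :: "nat \<Rightarrow> ((real^'k) \<times> (real^'d) \<Rightarrow> 'c::euclidean_space) \<Rightarrow> real \<Rightarrow> ('k, 'd) path \<Rightarrow> 'c" where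
 "gstep n g = stepp (grid T n) n (\<lambda>m p. g (p (grid T n m)))"

lemma gstep:
 fixes g :: "(real^'k) \<times> (real^'d) \<Rightarrow> 'c::euclidean_space"
 assumes g: "g \<in> borel_measurable borel" and n: "0 < n"
 shows "m < n \<Longrightarrow> (\<lambda>p. g (p (grid T n m))) \<in> borel_measurable (F (grid T n m))"
  and "(\<lambda>(w, p). gstep n g w p) \<in> borel_measurable \<P>"
  and "(\<And>z. z \<in> state_space \<Longrightarrow> norm (g z) \<le> C) \<Longrightarrow> 0 \<le> C \<Longrightarrow> p \<in> \<Omega> \<Longrightarrow> norm (gstep n g w p) \<le> C"
  and "0 < w \<Longrightarrow> w \<le> T \<Longrightarrow> gstep n g w p = g (p (grid T n (cell T n w)))"
proof -
 note gp = grid_partition[OF n]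
 have m: "(\<lambda>p. g (p (grid T n m))) \<in> borel_measurable (F (grid T n m))" if "m < n" for m
  using grid_bounds[OF T_pos, of m n] that by (intro measurable_compose[OF filtration_eval g]) auto
 then show "m < n \<Longrightarrow> (\<lambda>p. g (p (grid T n m))) \<in> borel_measurable (F (grid T n m))" .
 show "(\<lambda>(w, p). gstep n g w p) \<in> borel_measurable \<P>"
  unfolding gstep_def by (rule step_props(1)[OF gp m])
 show "norm (gstep n g w p) \<le> C" if b: "\<And>z. z \<in> state_space \<Longrightarrow> norm (g z) \<le> C" "0 \<le> C" and p: "p \<in> \<Omega>"
  unfolding gstep_def
  using grid_bounds[OF T_pos, of _ n] by (intro step_props(3)[OF gp m] b cadlag_in_state_space[OF p]) auto
 show "gstep n g w p = g (p (grid T n (cell T n w)))" if w: "0 < w" "w \<le> T"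
  unfolding gstep_def by (rule stepp_eq[OF gp(3) cell[OF T_pos w n]])
qed

lemma time_pair: "pair_sigma_finite P time" "finite_measure (P \<Otimes>\<^sub>M time)"
proof -
 have *: "finite_measure time" by (rule finite_measureI) (simp add: space_restrict_space emeasure_restrict_space emeasure_lborel_Icc_eq)
 then show "pair_sigma_finite P time"
  by (intro pair_sigma_finite.intro sigma_finite_measure_axioms finite_measure.axioms(1))
 show "finite_measure (P \<Otimes>\<^sub>M time)" by (rule finite_measure_pair_measure[OF * finite_measure_axioms])
qed

lemma space_time: "z \<in> space (P \<Otimes>\<^sub>M time) \<Longrightarrow> fst z \<in> \<Omega> \<and> 0 \<le> snd z \<and> snd z \<le> T"
 by (auto simp: space_pair_measure space_restrict_space)

lemma swap_measurable:
 assumes "(\<lambda>(w, p). X w p) \<in> measurable \<P> R"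
 shows "(\<lambda>z. X (snd z) (fst z)) \<in> measurable (P \<Otimes>\<^sub>M time) R"
proof -
 have "(\<lambda>z. (snd z, fst z)) \<in> measurable (P \<Otimes>\<^sub>M time) \<P>"
  by (intro measurable_Pair measurable_fst measurable_compose[OF measurable_snd] measurable_restrict_space1) simp
 from measurable_compose[OF this assms] show ?thesis by simp
qed

lemma msq_time:
 assumes "joint K"
 shows "msq K = (\<integral>\<^sup>+z. ennreal ((norm (K (snd z) (fst z)))\<^sup>2) \<partial>(P \<Otimes>\<^sub>M time))"
proof -
 interpret pt: pair_sigma_finite P time by (rule time_pair)
 have [measurable]: "(\<lambda>z. K (snd z) (fst z)) \<in> borel_measurable (P \<Otimes>\<^sub>M time)" by (rule swap_measurable[OF assms])
 have "(\<integral>\<^sup>+z. ennreal ((norm (K (snd z) (fst z)))\<^sup>2) \<partial>(P \<Otimes>\<^sub>M time)) = (\<integral>\<^sup>+p. (\<integral>\<^sup>+w. ennreal ((norm (K w p))\<^sup>2) \<partial>time) \<partial>P)"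
  by (subst pt.M2.nn_integral_fst[symmetric]) simp_all
 also have "\<dots> = msq K" unfolding msq_def by (intro nn_integral_cong) (simp add: nn_integral_restrict_space)
 finally show ?thesis by simp
qed

lemma AE_time:
 assumes "AE z in P \<Otimes>\<^sub>M time. R (fst z) (snd z)"
 shows "AE p in P. AE w\<in>{0..T} in lborel. R p w"
proof -
 interpret pt: pair_sigma_finite P time by (rule time_pair)
 show ?thesis using pt.AE_pair[OF assms] by (simp add: AE_restrict_space_iff)
qed

text \<open>The left ends of the cells containing w tend to w from the left, where the path tends to
  its value at w: by \<open>Y_left_continuous\<close> for Y, and outside the finitely many jump
  times for X.\<close>

lemma gstep_tendsto:
 assumes g: "continuous_on UNIV g"
 shows "AE p in P. AE w\<in>{0..T} in lborel. (\<lambda>n. gstep n g w p) \<longlonglongrightarrow> g (p w)"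
proof -
 have gm: "g \<in> borel_measurable borel" by (rule borel_measurable_continuous_onI[OF g])
 show ?thesis
  using Y_left_continuous AE_space
 proof eventually_elim
  fix p assume Yc: "\<forall>t\<in>{0<..T}. ((\<lambda>u. snd (p u)) \<longlongrightarrow> snd (p t)) (at_left t)" and "p \<in> space P"
  then have p: "p \<in> \<Omega>" by simp
  have "insert 0 (jump_times T p) \<in> null_sets lborel"
   by (rule finite_imp_null_set_lborel) (simp add: finite_jump_times[OF p])
  then have "AE w in lborel. w \<notin> insert 0 (jump_times T p)" by (rule AE_not_in)
  then show "AE w\<in>{0..T} in lborel. (\<lambda>n. gstep n g w p) \<longlonglongrightarrow> g (p w)"
  proof (eventually_elim, intro impI)
   fix w assume "w \<notin> insert 0 (jump_times T p)" "w \<in> {0..T}"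
   then have w: "0 < w" "w \<le> T" and fc: "((\<lambda>u. fst (p u)) \<longlongrightarrow> fst (p w)) (at_left w)" by (auto simp: jump_times_def)
   have sc: "((\<lambda>u. snd (p u)) \<longlongrightarrow> snd (p w)) (at_left w)" using Yc w by simp
   have lc: "(p \<longlongrightarrow> p w) (at_left w)" using tendsto_Pair[OF fc sc] by simp
   have "isCont g (p w)" using g by (simp add: continuous_on_eq_continuous_at del: split_paired_All)
   from isCont_tendsto_compose[OF this filterlim_compose[OF lc cell_left[OF T_pos w]]]
   have "(\<lambda>n. g (p (grid T n (cell T n w)))) \<longlonglongrightarrow> g (p w)" .
   \<comment> \<open>The grid with n = 0 has no cells, hence the shift of the index.\<close>
   from LIMSEQ_Suc[OF this] have "(\<lambda>n. gstep (Suc n) g w p) \<longlonglongrightarrow> g (p w)" by (simp add: gstep(4)[OF gm _ w])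
   then show "(\<lambda>n. gstep n g w p) \<longlonglongrightarrow> g (p w)" by (rule LIMSEQ_imp_Suc)
  qed
 qed
qed

lemma gstep_converges:
 assumes g: "continuous_on UNIV g" "\<And>z. norm (g z) \<le> C"
 shows "(\<lambda>n. \<integral>z. norm (gstep n g (snd z) (fst z) - g (fst z (snd z))) \<partial>(P \<Otimes>\<^sub>M time)) \<longlonglongrightarrow> 0"
proof -
 interpret pt: pair_sigma_finite P time by (rule time_pair)
 interpret ft: finite_measure "P \<Otimes>\<^sub>M time" by (rule time_pair)
 have C: "0 \<le> C" using g(2) norm_ge_zero order_trans by blast
 have gm: "g \<in> borel_measurable borel" by (rule borel_measurable_continuous_onI[OF g(1)])
 have km: "(\<lambda>z. gstep (Suc n) g (snd z) (fst z)) \<in> borel_measurable (P \<Otimes>\<^sub>M time)" for n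
  by (rule swap_measurable[OF gstep(2)[OF gm]]) simp
 have hm: "(\<lambda>z. g (fst z (snd z))) \<in> borel_measurable (P \<Otimes>\<^sub>M time)"
  by (rule measurable_compose[OF swap_measurable[OF process_measurable] gm])
 have "AE p in P. AE w in time. (\<lambda>n. gstep (Suc n) g w p) \<longlonglongrightarrow> g (p w)"
  using gstep_tendsto[OF g(1)]
 proof eventually_elim
  fix p assume "AE w\<in>{0..T} in lborel. (\<lambda>n. gstep n g w p) \<longlonglongrightarrow> g (p w)"
  then have "AE w\<in>{0..T} in lborel. (\<lambda>n. gstep (Suc n) g w p) \<longlonglongrightarrow> g (p w)"
   by eventually_elim (use LIMSEQ_Suc in fast)
  then show "AE w in time. (\<lambda>n. gstep (Suc n) g w p) \<longlonglongrightarrow> g (p w)" by (simp add: AE_restrict_space_iff)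
 qed
 then have lim: "AE z in P \<Otimes>\<^sub>M time. (\<lambda>n. gstep (Suc n) g (snd z) (fst z)) \<longlonglongrightarrow> g (fst z (snd z))"
  by (intro pt.AE_pair_tendsto km hm) simp
 have "(\<lambda>n. \<integral>z. norm (gstep (Suc n) g (snd z) (fst z) - g (fst z (snd z))) \<partial>(P \<Otimes>\<^sub>M time)) \<longlonglongrightarrow> (\<integral>z. 0 \<partial>(P \<Otimes>\<^sub>M time))"
 proof (rule integral_dominated_convergence[where w="\<lambda>_. C + C"])
  show "AE z in P \<Otimes>\<^sub>M time. (\<lambda>n. norm (gstep (Suc n) g (snd z) (fst z) - g (fst z (snd z)))) \<longlonglongrightarrow> 0"
   using lim by eventually_elim (rule tendsto_norm_zero[OF LIM_zero])
  show "AE z in P \<Otimes>\<^sub>M time. norm (norm (gstep (Suc n) g (snd z) (fst z) - g (fst z (snd z)))) \<le> C + C" for n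
  proof (rule AE_I2)
   fix z assume "z \<in> space (P \<Otimes>\<^sub>M time)"
   then have "norm (gstep (Suc n) g (snd z) (fst z)) \<le> C" by (intro gstep(3)[OF gm _ g(2) C]) (auto dest: space_time)
   then show "norm (norm (gstep (Suc n) g (snd z) (fst z) - g (fst z (snd z)))) \<le> C + C"
    using norm_triangle_ineq4[of "gstep (Suc n) g (snd z) (fst z)" "g (fst z (snd z))"] g(2)[of "fst z (snd z)"] by simp
  qed
 qed (use km hm in \<open>auto intro!: borel_measurable_norm borel_measurable_diff\<close>)
 then show ?thesis by (subst filterlim_sequentially_Suc[symmetric]) simp
qed

text \<open>The coefficient is only Borel. It is approximated by continuous functions in L^1, each
  of these by its samples on a sufficiently fine grid, and a subsequence converges almost everywhere
  in time and path; the bound C turns this into mean square convergence.\<close>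

lemma grid_approx:
 fixes h :: "'k \<Rightarrow> real^'d \<Rightarrow> real^'d"
 assumes h: "\<And>i. h i \<in> borel_measurable borel" "\<And>i y. norm (h i y) \<le> C"
 obtains N g where "\<And>n. n < N n" "\<And>n. g n \<in> borel_measurable borel" "\<And>n z. norm (g n z) \<le> C"
  "(\<lambda>n. msq (\<lambda>w p. gstep (N n) (g n) w p - lift h (p w))) \<longlonglongrightarrow> 0"
  "AE p in P. AE w\<in>{0..T} in lborel. (\<lambda>n. gstep (N n) (g n) w p) \<longlonglongrightarrow> lift h (p w)"
proof -
 interpret pt: pair_sigma_finite P time by (rule time_pair)
 interpret ft: finite_measure "P \<Otimes>\<^sub>M time" by (rule time_pair)
 let ?N = "P \<Otimes>\<^sub>M time"
 have C: "0 \<le> C" using h(2) norm_ge_zero order_trans by blast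
 \<comment> \<open>\<open>lift h\<close> is bounded by C on the state space only; the projection
   extends the bound to all points without changing values there.\<close>
 define h' where "h' z = closest_point (cball 0 C) (lift h z)" for z :: "(real^'k) \<times> (real^'d)"
 have lm: "lift h \<in> borel_measurable borel" by (rule measurable_lift[OF h(1)])
 have h'm: "h' \<in> borel_measurable borel"
  unfolding h'_def using C
  by (intro measurable_compose[OF lm] borel_measurable_continuous_onI continuous_on_closest_point) auto
 have h'b: "norm (h' z) \<le> C" for z using closest_point_in_set[of "cball 0 C" "lift h z"] C by (simp add: h'_def)
 have lb: "norm (lift h z) \<le> C" if "z \<in> state_space" for z by (rule norm_lift_le[OF that h(2)])
 have h'eq: "h' z = lift h z" if "z \<in> state_space" for z
  using lb[OF that] unfolding h'_def by (intro closest_point_self) simp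
 have em: "(\<lambda>z. fst z (snd z)) \<in> borel_measurable ?N" by (rule swap_measurable[OF process_measurable])
 \<comment> \<open>The occupation measure: L^1 distances under it are mean distances along the
   process over the horizon.\<close>
 define m where "m = distr ?N borel (\<lambda>z. fst z (snd z))"
 have m: "finite_measure m" "sets m = sets borel" unfolding m_def by (rule ft.finite_measure_distr[OF em]) simp
 have e0: "eventually (\<lambda>_. True) F" for F by simp
 have "\<exists>g N. n < N \<and> g \<in> borel_measurable borel \<and> (\<forall>z. norm (g z) \<le> C) \<and>
   (\<integral>z. norm (gstep N g (snd z) (fst z) - h' (fst z (snd z))) \<partial>?N) < 1 / real (Suc n)" for n
 proof -
  obtain g where g: "continuous_on UNIV g" "\<And>z. norm (g z) \<le> C" "(\<integral>x. norm (h' x - g x) \<partial>m) < 1 / real (Suc n) / 2"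
   by (rule bounded_approx_continuous[OF m h'm h'b, of "1 / real (Suc n) / 2"]) auto
  have gm: "g \<in> borel_measurable borel" by (rule borel_measurable_continuous_onI[OF g(1)])
  have "\<forall>\<^sub>F N in sequentially. (\<integral>z. norm (gstep N g (snd z) (fst z) - g (fst z (snd z))) \<partial>?N) < 1 / real (Suc n) / 2"
   by (rule order_tendstoD(2)[OF gstep_converges[OF g(1,2)]]) auto
  then have "\<forall>\<^sub>F N in sequentially. n < N \<and> (\<integral>z. norm (gstep N g (snd z) (fst z) - g (fst z (snd z))) \<partial>?N) < 1 / real (Suc n) / 2"
   using eventually_gt_at_top[of n] by eventually_elim simp
  then obtain N where N: "n < N" "(\<integral>z. norm (gstep N g (snd z) (fst z) - g (fst z (snd z))) \<partial>?N) < 1 / real (Suc n) / 2"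
   unfolding eventually_sequentially by blast
  have N0: "0 < N" using N(1) by simp
  note sm = swap_measurable[OF gstep(2)[OF gm N0]] and gem = measurable_compose[OF em gm] and hem = measurable_compose[OF em h'm]
  have i: "integrable ?N (\<lambda>z. gstep N g (snd z) (fst z))" "integrable ?N (\<lambda>z. g (fst z (snd z)))" "integrable ?N (\<lambda>z. h' (fst z (snd z)))"
   by (rule ft.integrable_const_bound[OF AE_I2[OF gstep(3)[OF gm N0 g(2) C]] sm], simp add: space_time)
    (rule ft.integrable_const_bound[OF AE_I2[OF g(2)] gem] ft.integrable_const_bound[OF AE_I2[OF h'b] hem])+
  have tri: "norm (x - y) \<le> norm (x - z) + norm (y - z)" for x y z :: "real^'d"
   using norm_triangle_ineq4[of "x - z" "y - z"] by simp
  have "(\<integral>z. norm (gstep N g (snd z) (fst z) - h' (fst z (snd z))) \<partial>?N)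
    \<le> (\<integral>z. norm (gstep N g (snd z) (fst z) - g (fst z (snd z))) + norm (h' (fst z (snd z)) - g (fst z (snd z))) \<partial>?N)"
   by (intro integral_mono integrable_norm Bochner_Integration.integrable_diff Bochner_Integration.integrable_add i tri)
  also have "\<dots> = (\<integral>z. norm (gstep N g (snd z) (fst z) - g (fst z (snd z))) \<partial>?N) + (\<integral>x. norm (h' x - g x) \<partial>m)"
   unfolding m_def using i gm h'm
   by (subst integral_distr[OF em]) (auto intro!: Bochner_Integration.integral_add borel_measurable_norm borel_measurable_diff)
  also have "\<dots> < 1 / real (Suc n)" using N(2) g(3) by (simp add: field_simps)
  finally show ?thesis using N(1) gm g(2) by blast
 qed
 then have "\<forall>n. \<exists>(g :: (real^'k) \<times> (real^'d) \<Rightarrow> real^'d) N. n < N \<and> g \<in> borel_measurable borel \<and> (\<forall>z. norm (g z) \<le> C) \<and>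
   (\<integral>z. norm (gstep N g (snd z) (fst z) - h' (fst z (snd z))) \<partial>?N) < 1 / real (Suc n)" ..
 from choice[OF this, THEN exE] obtain g where "\<forall>n. \<exists>N. n < N \<and> g n \<in> borel_measurable borel \<and> (\<forall>z. norm (g n z) \<le> C) \<and>
   (\<integral>z. norm (gstep N (g n) (snd z) (fst z) - h' (fst z (snd z))) \<partial>?N) < 1 / real (Suc n)" .
 from choice[OF this, THEN exE] obtain N where gN: "\<forall>n. n < N n \<and> g n \<in> borel_measurable borel \<and> (\<forall>z. norm (g n z) \<le> C) \<and>
   (\<integral>z. norm (gstep (N n) (g n) (snd z) (fst z) - h' (fst z (snd z))) \<partial>?N) < 1 / real (Suc n)" .
 note gN = gN[THEN spec, THEN conjunct1] gN[THEN spec, THEN conjunct2, THEN conjunct1]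
  gN[THEN spec, THEN conjunct2, THEN conjunct2, THEN conjunct1, THEN spec] gN[THEN spec, THEN conjunct2, THEN conjunct2, THEN conjunct2]
 have N0: "0 < N n" for n using gN(1)[of n] by simp
 define u where "u n z = gstep (N n) (g n) (snd z) (fst z) - lift h (fst z (snd z))" for n and z :: "('k, 'd) path \<times> real"
 have um: "u n \<in> borel_measurable ?N" for n
  unfolding u_def by (intro borel_measurable_diff swap_measurable[OF gstep(2)[OF gN(2) N0]] measurable_compose[OF em lm])
 have ub: "norm (u n z) \<le> C + C" if z: "z \<in> space ?N" for n z
 proof -
  have zs: "fst z (snd z) \<in> state_space" "fst z \<in> \<Omega>" using space_time[OF z] by (auto intro: cadlag_in_state_space)
  show ?thesis unfolding u_def by (rule order_trans[OF norm_triangle_ineq4 add_mono[OF gstep(3)[OF gN(2) N0 gN(3) C zs(2)] lb[OF zs(1)]]])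
 qed
 have ui: "integrable ?N (u n)" for n by (rule ft.integrable_const_bound[OF AE_I2[OF ub] um])
 have "(\<lambda>n. \<integral>z. norm (u n z) \<partial>?N) \<longlonglongrightarrow> 0"
 proof (rule tendsto_sandwich[OF _ _ tendsto_const LIMSEQ_inverse_real_of_nat]; intro always_eventually allI)
  fix n
  have "(\<integral>z. norm (u n z) \<partial>?N) = (\<integral>z. norm (gstep (N n) (g n) (snd z) (fst z) - h' (fst z (snd z))) \<partial>?N)"
  proof (rule Bochner_Integration.integral_cong[OF refl])
   fix z assume "z \<in> space ?N"
   then have "fst z (snd z) \<in> state_space" using space_time by (intro cadlag_in_state_space) blast+
   then show "norm (u n z) = norm (gstep (N n) (g n) (snd z) (fst z) - h' (fst z (snd z)))" by (simp only: u_def h'eq)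
  qed
  then show "(\<integral>z. norm (u n z) \<partial>?N) \<le> inverse (real (Suc n))" using gN(4)[of n] by (simp add: inverse_eq_divide)
 qed simp
 then obtain r where r: "strict_mono r" "AE z in ?N. (\<lambda>n. u (r n) z) \<longlonglongrightarrow> 0" using tendsto_L1_AE_subseq[of ?N u, OF ui] by blast
 show thesis
 proof (rule that[of "\<lambda>n. N (r n)" "\<lambda>n. g (r n)"])
  show "n < N (r n)" for n using gN(1)[of "r n"] seq_suble[OF r(1), of n] by simp
  have m: "(\<lambda>(w, p). gstep (N n) (g n) w p - lift h (p w)) \<in> borel_measurable \<P>" for n
   using gstep(2)[OF gN(2) N0, of n] measurable_compose[OF process_measurable lm] unfolding split_beta' by (rule borel_measurable_diff)
  have "(\<lambda>n. \<integral>\<^sup>+z. ennreal ((norm (u (r n) z))\<^sup>2) \<partial>?N) \<longlonglongrightarrow> (\<integral>\<^sup>+z. ennreal 0 \<partial>?N)"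
  proof (rule nn_integral_dominated_convergence[where w="\<lambda>_. ennreal ((C + C)\<^sup>2)"])
   show "AE z in ?N. (\<lambda>n. ennreal ((norm (u (r n) z))\<^sup>2)) \<longlonglongrightarrow> ennreal 0"
    using r(2)
   proof eventually_elim
    fix z assume "(\<lambda>n. u (r n) z) \<longlonglongrightarrow> 0"
    from tendsto_ennrealI[OF tendsto_power[OF tendsto_norm[OF this], of 2]]
    show "(\<lambda>n. ennreal ((norm (u (r n) z))\<^sup>2)) \<longlonglongrightarrow> ennreal 0" by simp
   qed
   show "AE z in ?N. ennreal ((norm (u (r n) z))\<^sup>2) \<le> ennreal ((C + C)\<^sup>2)" for n
    by (intro AE_I2 ennreal_leI power_mono ub) auto
   show "(\<integral>\<^sup>+z. ennreal ((C + C)\<^sup>2) \<partial>?N) < \<infinity>" by (simp add: ft.emeasure_eq_measure flip: ennreal_mult'')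
  qed (use um in \<open>auto intro!: measurable_compose[OF _ measurable_ennreal] borel_measurable_power borel_measurable_norm\<close>)
  then show "(\<lambda>n. msq (\<lambda>w p. gstep (N (r n)) (g (r n)) w p - lift h (p w))) \<longlonglongrightarrow> 0"
   unfolding msq_time[OF m] u_def by simp
  show "AE p in P. AE w\<in>{0..T} in lborel. (\<lambda>n. gstep (N (r n)) (g (r n)) w p) \<longlonglongrightarrow> lift h (p w)"
  proof (rule AE_time)
   show "AE z in ?N. (\<lambda>n. gstep (N (r n)) (g (r n)) (snd z) (fst z)) \<longlonglongrightarrow> lift h (fst z (snd z))"
    using r(2) unfolding u_def by eventually_elim (rule LIM_zero_cancel)
  qed
 qed (use gN in auto)
qed

end

subsection \<open>Stieltjes integrals against step functions\<close>

text \<open>The difference of the two measures agrees on half-lines with the atoms c t at the points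
  t of J. The pi-lambda argument is run on the difference, so that the measures may share an
  arbitrary common part.\<close>

lemma finite_signed_atoms:
 fixes \<mu>\<^sub>1 \<mu>\<^sub>2 :: "real measure"
 assumes fm: "finite_measure \<mu>\<^sub>1" "finite_measure \<mu>\<^sub>2" and s: "sets \<mu>\<^sub>1 = sets borel" "sets \<mu>\<^sub>2 = sets borel" and J: "finite J"
  and cdf: "\<And>x. measure \<mu>\<^sub>1 {..x} - measure \<mu>\<^sub>2 {..x} = (\<Sum>t\<in>J. c t * indicator {..x} t)"
  and tot: "measure \<mu>\<^sub>1 UNIV - measure \<mu>\<^sub>2 UNIV = (\<Sum>t\<in>J. c t)"
 shows "A \<in> sets borel \<Longrightarrow> measure \<mu>\<^sub>1 A - measure \<mu>\<^sub>2 A = (\<Sum>t\<in>J. c t * indicator A t)"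
  and "integrable \<mu>\<^sub>1 h \<Longrightarrow> integrable \<mu>\<^sub>2 h \<Longrightarrow> (\<integral>x. h x \<partial>\<mu>\<^sub>1) - (\<integral>x. h x \<partial>\<mu>\<^sub>2) = (\<Sum>t\<in>J. c t * h t)"
proof -
 interpret m1: finite_measure \<mu>\<^sub>1 by fact
 interpret m2: finite_measure \<mu>\<^sub>2 by fact
 have sp: "space \<mu>\<^sub>1 = UNIV" "space \<mu>\<^sub>2 = UNIV" using s[THEN sets_eq_imp_space_eq] by simp_all
 have sb: "sets borel = sigma_sets UNIV (range atMost :: real set set)"
  by (subst borel_eq_atMost) (simp add: sets_measure_of)
 show *: "measure \<mu>\<^sub>1 A - measure \<mu>\<^sub>2 A = (\<Sum>t\<in>J. c t * indicator A t)" if "A \<in> sets borel" for A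
 proof -
  have "Int_stable (range atMost :: real set set)" by (auto simp: Int_stable_def)
  moreover have "range atMost \<subseteq> Pow (UNIV :: real set)" by simp
  moreover have "A \<in> sigma_sets UNIV (range atMost)" using that sb by simp
  ultimately show ?thesis
  proof (induction rule: sigma_sets_induct_disjoint)
   case (basic A)
   then show ?case using cdf by auto
  next
   case (compl A)
   then have A: "A \<in> sets \<mu>\<^sub>1" "A \<in> sets \<mu>\<^sub>2" using sb s by simp_all
   have "measure \<mu>\<^sub>1 (UNIV - A) - measure \<mu>\<^sub>2 (UNIV - A) = (\<Sum>t\<in>J. c t) - (\<Sum>t\<in>J. c t * indicator A t)"
    using m1.finite_measure_compl[OF A(1)] m2.finite_measure_compl[OF A(2)] tot compl(2) by (simp add: sp)
   also have "\<dots> = (\<Sum>t\<in>J. c t * indicator (UNIV - A) t)"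
    unfolding sum_subtractf[symmetric] by (intro sum.cong) (auto simp: indicator_def)
   finally show ?case .
  next
   case (union A)
   then have A: "range A \<subseteq> sets \<mu>\<^sub>1" "range A \<subseteq> sets \<mu>\<^sub>2" using sb s by auto
   have "(\<lambda>i. measure \<mu>\<^sub>1 (A i) - measure \<mu>\<^sub>2 (A i)) sums (measure \<mu>\<^sub>1 (\<Union>i. A i) - measure \<mu>\<^sub>2 (\<Union>i. A i))"
    by (intro sums_diff m1.finite_measure_UNION[OF A(1) union(1)] m2.finite_measure_UNION[OF A(2) union(1)])
   moreover have "(\<lambda>i. \<Sum>t\<in>J. c t * indicator (A i) t) sums (\<Sum>t\<in>J. c t * indicator (\<Union>i. A i) t)"
    using indicator_sums[of A] union(1) by (intro sums_sum sums_mult) (auto simp: disjoint_family_on_def)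
   ultimately show ?case using union(3) sums_unique2 by simp
  qed simp
 qed
 have Jb: "J \<in> sets borel" "\<And>t :: real. {t} \<in> sets borel" using J by (simp_all add: finite_imp_closed)
 assume h: "integrable \<mu>\<^sub>1 h" "integrable \<mu>\<^sub>2 h"
 have hm: "h \<in> borel_measurable borel" using h(1) s(1) by (simp cong: measurable_cong_sets)
 have split: "(\<integral>x. h x \<partial>\<mu>) = (\<integral>x. h x \<partial>density \<mu> (indicator (- J))) + (\<Sum>t\<in>J. h t * measure \<mu> {t})"
  if h: "integrable \<mu> h" and s: "sets \<mu> = sets borel" and "finite_measure \<mu>" for \<mu>
 proof -
  interpret finite_measure \<mu> by fact
  have hm': "h \<in> borel_measurable \<mu>" using hm s by (simp cong: measurable_cong_sets)
  have e: "h x = indicator (- J) x * h x + (\<Sum>t\<in>J. h t * indicator {t} x)" for x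
   using J by (auto simp: indicator_def if_distrib[of "\<lambda>y. _ * y"] sum.delta cong: if_cong)
  have i1: "integrable \<mu> (\<lambda>x. indicator (- J) x * h x)"
   using integrable_mult_indicator[of "- J" \<mu> h] Jb s h by simp
  have it: "integrable \<mu> (\<lambda>x. h t * indicator {t} x)" for t
   using Jb(2)[of t] s by (intro integrable_mult_right integrable_real_indicator) (simp_all add: emeasure_eq_measure)
  have i: "integrable \<mu> (\<lambda>x. \<Sum>t\<in>J. h t * indicator {t} x)" by (rule Bochner_Integration.integrable_sum[OF it])
  have "(\<integral>x. h x \<partial>\<mu>) = (\<integral>x. indicator (- J) x * h x + (\<Sum>t\<in>J. h t * indicator {t} x) \<partial>\<mu>)"
   by (rule arg_cong[where f="integral\<^sup>L \<mu>"]) (rule ext, rule e)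
  also have "\<dots> = (\<integral>x. indicator (- J) x * h x \<partial>\<mu>) + (\<Sum>t\<in>J. h t * measure \<mu> {t})"
   using Jb(2) s unfolding Bochner_Integration.integral_add[OF i1 i] Bochner_Integration.integral_sum[OF it] by simp
  also have "(\<integral>x. indicator (- J) x * h x \<partial>\<mu>) = (\<integral>x. h x \<partial>density \<mu> (indicator (- J)))"
   using integral_density[OF hm', of "indicator (- J)"] Jb(1) s by (simp add: ennreal_indicator)
  finally show ?thesis .
 qed
 \<comment> \<open>Off J the two measures coincide, although neither needs to vanish there; the
   integrals therefore differ only through the points of J.\<close>
 have "density \<mu>\<^sub>1 (indicator (- J)) = density \<mu>\<^sub>2 (indicator (- J))"
 proof (rule measure_eqI)
  fix A assume "A \<in> sets (density \<mu>\<^sub>1 (indicator (- J)))"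
  then have A: "A \<in> sets borel" using s(1) by simp
  have "(\<Sum>t\<in>J. c t * indicator (A - J) t) = 0" by (intro sum.neutral) auto
  then have "measure \<mu>\<^sub>1 (A - J) = measure \<mu>\<^sub>2 (A - J)" using *[of "A - J"] A Jb by simp
  then show "emeasure (density \<mu>\<^sub>1 (indicator (- J))) A = emeasure (density \<mu>\<^sub>2 (indicator (- J))) A"
   using A Jb(1) s
   by (subst (1 2) emeasure_restricted) (auto simp: m1.emeasure_eq_measure m2.emeasure_eq_measure Diff_eq Int_commute)
 qed (simp add: s)
 then have "(\<integral>x. h x \<partial>\<mu>\<^sub>1) - (\<integral>x. h x \<partial>\<mu>\<^sub>2) = (\<Sum>t\<in>J. h t * (measure \<mu>\<^sub>1 {t} - measure \<mu>\<^sub>2 {t}))"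
  unfolding split[OF h(1) s(1) fm(1)] split[OF h(2) s(2) fm(2)] by (simp add: right_diff_distrib sum_subtractf)
 also have "\<dots> = (\<Sum>t\<in>J. c t * h t)"
  using J by (intro sum.cong refl) (simp add: *[OF Jb(2)] indicator_def sum.delta if_distrib[of "\<lambda>y. _ * y"] cong: if_cong)
 finally show "(\<integral>x. h x \<partial>\<mu>\<^sub>1) - (\<integral>x. h x \<partial>\<mu>\<^sub>2) = (\<Sum>t\<in>J. c t * h t)" .
qed

lemma interval_measure_restricted:
 assumes F: "mono F" "\<And>s. continuous (at_right s) F" and ab: "a \<le> b"
 defines "\<mu> \<equiv> density (interval_measure F) (indicator {a<..b})"
 shows "finite_measure \<mu>" "sets \<mu> = sets borel" "measure \<mu> {..x} = (if a \<le> x then F (min x b) - F a else 0)" "measure \<mu> UNIV = F b - F a"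
proof -
 have e: "emeasure (interval_measure F) {a<..x} = F x - F a" if "a \<le> x" for x
  using that F by (intro emeasure_interval_measure_Ioc) (auto dest: monoD)
 have m: "emeasure \<mu> A = emeasure (interval_measure F) ({a<..b} \<inter> A)" if "A \<in> sets borel" for A
  unfolding \<mu>_def using that by (intro emeasure_restricted) auto
 show "sets \<mu> = sets borel" by (simp add: \<mu>_def)
 then have "space \<mu> = UNIV" using sets_eq_imp_space_eq by fastforce
 then show "finite_measure \<mu>" using e[OF ab] by (intro finite_measureI) (simp add: m)
 have Fm: "F a \<le> F y" if "a \<le> y" for y using that F(1) by (auto dest: monoD)
 have "{a<..b} \<inter> {..x} = (if a \<le> x then {a<..min x b} else {})" by auto
 then show "measure \<mu> {..x} = (if a \<le> x then F (min x b) - F a else 0)"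
  using e[of "min x b"] ab Fm[of "min x b"] by (simp add: measure_def m split: if_splits)
 show "measure \<mu> UNIV = F b - F a" using e[OF ab] Fm[OF ab] by (simp add: measure_def m)
qed

lemma set_integral_restricted:
 fixes h :: "real \<Rightarrow> real" and a b :: real
 defines "h' \<equiv> \<lambda>s. indicator {a<..b} s * h s"
 assumes m: "h' \<in> borel_measurable borel"
 shows "set_integrable (interval_measure F) {a<..b} h \<longleftrightarrow> integrable (density (interval_measure F) (indicator {a<..b})) h'"
  and "(LINT s:{a<..b}|interval_measure F. h s) = (\<integral>s. h' s \<partial>density (interval_measure F) (indicator {a<..b}))"
proof -
 have hm: "h' \<in> borel_measurable (interval_measure F)" using m by (simp cong: measurable_cong_sets)
 have e: "indicator {a<..b} s * h' s = indicator {a<..b} s * h s" for s by (simp add: h'_def indicator_def)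
 show "set_integrable (interval_measure F) {a<..b} h \<longleftrightarrow> integrable (density (interval_measure F) (indicator {a<..b})) h'"
  using integrable_density[OF hm, of "indicator {a<..b}"] by (simp add: set_integrable_def ennreal_indicator e)
 show "(LINT s:{a<..b}|interval_measure F. h s) = (\<integral>s. h' s \<partial>density (interval_measure F) (indicator {a<..b}))"
  using integral_density[OF hm, of "indicator {a<..b}"] by (simp add: set_lebesgue_integral_def ennreal_indicator e)
qed

text \<open>The integral is a definite description, so every decomposition A - B of F has to give
  the same value; \<open>finite_signed_atoms\<close> shows that it depends on the difference only. A
  decomposition is provided by the step functions with heights max 0 (c t) and max 0 (- c
  t).\<close>

lemma stieltjes_integral_step:
 fixes h F :: "real \<Rightarrow> real"
 assumes ab: "a \<le> b" and J: "finite J" "J \<subseteq> {a<..b}"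
  and F: "\<And>s. a \<le> s \<Longrightarrow> s \<le> b \<Longrightarrow> F s = F a + (\<Sum>t\<in>J. c t * indicator {..s} t)"
  and h: "(\<lambda>s. indicator {a<..b} s * h s) \<in> borel_measurable borel"
 shows "stieltjes_integral h F a b = (\<Sum>t\<in>J. c t * h t)"
 unfolding stieltjes_integral_def
proof (rule the_equality)
 let ?d = "\<lambda>A. density (interval_measure A) (indicator {a<..b})"
 let ?h = "\<lambda>s. indicator {a<..b} s * h s"
 note r = interval_measure_restricted[OF _ _ ab] and si = set_integral_restricted[OF h]
 have hJ: "(\<Sum>t\<in>J. c t * ?h t) = (\<Sum>t\<in>J. c t * h t)" for c using J(2) by (intro sum.cong) auto
 show "I = (\<Sum>t\<in>J. c t * h t)" if H: "has_stieltjes_integral h F a b I" for I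
 proof -
  obtain A B where AB: "mono A" "mono B" "\<And>s. continuous (at_right s) A" "\<And>s. continuous (at_right s) B"
   "\<And>s. s \<in> {a..b} \<Longrightarrow> F s = A s - B s" "set_integrable (interval_measure A) {a<..b} h" "set_integrable (interval_measure B) {a<..b} h"
   "I = (LINT s:{a<..b}|interval_measure A. h s) - (LINT s:{a<..b}|interval_measure B. h s)"
   using H unfolding has_stieltjes_integral_def by blast
  note rA = r[OF AB(1,3)] and rB = r[OF AB(2,4)]
  have d: "A s - A a - (B s - B a) = (\<Sum>t\<in>J. c t * indicator {..s} t)" if "a \<le> s" "s \<le> b" for s
   using F[OF that] AB(5)[of s] AB(5)[of a] that ab by simp
  have "(\<integral>s. ?h s \<partial>?d A) - (\<integral>s. ?h s \<partial>?d B) = (\<Sum>t\<in>J. c t * ?h t)"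
  proof (rule finite_signed_atoms(2)[OF rA(1) rB(1) rA(2) rB(2) J(1)])
   fix x
   show "measure (?d A) {..x} - measure (?d B) {..x} = (\<Sum>t\<in>J. c t * indicator {..x} t)"
   proof (cases "a \<le> x")
    case True
    have "(\<Sum>t\<in>J. c t * indicator {..min x b} t) = (\<Sum>t\<in>J. c t * indicator {..x} t)"
     using J(2) by (intro sum.cong) (auto simp: indicator_def)
    then show ?thesis using d[of "min x b"] True ab by (simp add: rA(3) rB(3))
   next
    case False
    then have "(\<Sum>t\<in>J. c t * indicator {..x} t) = 0" using J(2) by (intro sum.neutral) auto
    then show ?thesis using False by (simp add: rA(3) rB(3))
   qed
   have "(\<Sum>t\<in>J. c t * indicator {..b} t) = (\<Sum>t\<in>J. c t)" using J(2) by (intro sum.cong) (auto simp: indicator_def)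
   then show "measure (?d A) UNIV - measure (?d B) UNIV = (\<Sum>t\<in>J. c t)" using d[of b] ab by (simp add: rA(4) rB(4))
  qed (use AB(6,7) in \<open>simp_all add: si(1)\<close>)
  then show ?thesis unfolding AB(8) si(2) hJ .
 qed note unique = this
 have step: "mono A" "continuous (at_right s) A" "set_integrable (interval_measure A) {a<..b} h"
  if c: "\<And>t. 0 \<le> c t" and A_def: "A = (\<lambda>s. \<Sum>t\<in>J. c t * indicator {..s} t)" for c A s
 proof -
  show mA: "mono A" unfolding A_def by (intro monoI sum_mono mult_left_mono c) (auto simp: indicator_def)
  show cA: "continuous (at_right s) A" for s
  proof -
   have "((\<lambda>u. indicator {..u} t :: real) \<longlongrightarrow> indicator {..s} t) (at_right s)" for t
   proof (rule tendsto_eventually)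
    show "\<forall>\<^sub>F u in at_right s. indicator {..u} t = (indicator {..s} t :: real)"
     unfolding eventually_at_right_field by (intro exI[of _ "if s < t then t else s + 1"]) (auto simp: indicator_def)
   qed
   then show ?thesis unfolding A_def continuous_within by (intro tendsto_intros)
  qed
  note rA = r[OF mA cA]
  interpret finite_measure "?d A" by (rule rA(1))
  \<comment> \<open>Comparison with the zero measure shows that the step measure lives on the finite
    set J. Hence h is bounded almost everywhere and integrable, whatever its size elsewhere.\<close>
  have nm: "finite_measure (null_measure borel :: real measure)" by (rule finite_measureI) simp
  have Jc: "- J \<in> sets borel" using J(1) finite_imp_closed[of J] by (simp add: borel_open open_Compl)
  have nm0: "measure (null_measure borel) S = 0" for S :: "real set" by (simp add: measure_def)
  have "measure (?d A) (- J) - measure (null_measure borel) (- J) = (\<Sum>t\<in>J. c t * indicator (- J) t)"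
  proof (rule finite_signed_atoms(1)[OF rA(1) nm rA(2) _ J(1)])
   have A0: "A a = 0" unfolding A_def using J(2) by (intro sum.neutral) (auto simp: indicator_def)
   fix x
   show "measure (?d A) {..x} - measure (null_measure borel) {..x} = (\<Sum>t\<in>J. c t * indicator {..x} t)"
   proof (cases "a \<le> x")
    case True
    have "A (min x b) = (\<Sum>t\<in>J. c t * indicator {..x} t)"
     unfolding A_def using J(2) by (intro sum.cong) (auto simp: indicator_def)
    then show ?thesis using True unfolding rA(3) by (simp add: A0 nm0)
   next
    case False
    then have "(\<Sum>t\<in>J. c t * indicator {..x} t) = 0" using J(2) by (intro sum.neutral) auto
    then show ?thesis using False unfolding rA(3) by (simp add: nm0)
   qed
   have "A b = (\<Sum>t\<in>J. c t)" unfolding A_def using J(2) by (intro sum.cong) (auto simp: indicator_def)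
   then       show "measure (?d A) UNIV - measure (null_measure borel) UNIV = (\<Sum>t\<in>J. c t)"
    unfolding rA(4) by (simp add: A0 nm0)
  qed (use Jc in simp_all)
  also have "\<dots> = 0" by (intro sum.neutral) auto
  finally have "- J \<in> null_sets (?d A)"
   using Jc by (simp add: null_sets_def nm0 emeasure_eq_measure)
  then have ae: "AE s in ?d A. s \<in> J" using AE_not_in by fastforce
  have "integrable (?d A) ?h"
  proof (rule integrable_const_bound[where B="Max (insert 0 ((\<lambda>s. norm (?h s)) ` J))"])
   show "AE s in ?d A. norm (?h s) \<le> Max (insert 0 ((\<lambda>s. norm (?h s)) ` J))"
    using ae by eventually_elim (use J(1) in \<open>intro Max_ge, auto\<close>)
  qed (use h in \<open>simp cong: measurable_cong_sets\<close>)
  then show "set_integrable (interval_measure A) {a<..b} h" by (simp add: si(1))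
 qed
 define A where "A c s = (\<Sum>t\<in>J. c t * indicator {..s} t)" for c :: "real \<Rightarrow> real" and s :: real
 have Ae: "A c = (\<lambda>s. \<Sum>t\<in>J. c t * indicator {..s} t)" for c by (simp add: A_def fun_eq_iff)
 note sp = step[of "\<lambda>t. max 0 (c t)", OF _ Ae] and sn = step[of "\<lambda>t. max 0 (- c t)", OF _ Ae]
 let ?p = "A (\<lambda>t. max 0 (c t))" and ?n = "A (\<lambda>t. max 0 (- c t))"
 have "?p s - ?n s = A c s" for s
  unfolding A_def sum_subtractf[symmetric] by (intro sum.cong refl) (auto simp: max_def left_diff_distrib)
 then have Fd: "F s = (F a + ?p s) - ?n s" if "a \<le> s" "s \<le> b" for s using F[OF that] by (simp add: A_def)
 show "has_stieltjes_integral h F a b (\<Sum>t\<in>J. c t * h t)"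
 proof -
  \<comment> \<open>The initial value F a goes into the increasing part; adding a constant leaves
    the measure unchanged.\<close>
  have im: "interval_measure (\<lambda>s. F a + ?p s) = interval_measure ?p" unfolding interval_measure_def by simp
  have "has_stieltjes_integral h F a b ((LINT s:{a<..b}|interval_measure (\<lambda>s. F a + ?p s). h s) - (LINT s:{a<..b}|interval_measure ?n. h s))"
   unfolding has_stieltjes_integral_def
  proof (rule exI[of _ "\<lambda>s. F a + ?p s"], rule exI[of _ ?n], intro conjI)
   show "mono (\<lambda>s. F a + ?p s)" using sp(1) by (auto simp: mono_def)
   show "\<forall>s. continuous (at_right s) (\<lambda>s. F a + ?p s)" using sp(2) by (intro allI continuous_intros) auto
   show "set_integrable (interval_measure (\<lambda>s. F a + ?p s)) {a<..b} h" unfolding im by (rule sp(3)) simp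
   show "\<forall>s\<in>{a..b}. F s = (F a + ?p s) - ?n s" by (rule ballI, rule Fd, simp_all only: atLeastAtMost_iff)
   show "mono ?n" "\<forall>s. continuous (at_right s) ?n" "set_integrable (interval_measure ?n) {a<..b} h"
    by (rule sn(1), simp, rule allI, rule sn(2), simp, rule sn(3), simp)
  qed (rule refl)
  \<comment> \<open>The value of this integral is not computed but supplied by the uniqueness
    part.\<close>
  from this[unfolded unique[OF this]] show ?thesis .
 qed
qed

text \<open>Induction on the number of jumps up to s: the path is constant after the last jump, and
  just before that jump it still has the value it took at the preceding one.\<close>

lemma fst_path_eq:
 assumes p: "p \<in> cadlag_paths T" and s: "0 \<le> s" "s \<le> T"
 shows "fst (p s) = fst (p 0) + (\<Sum>t\<in>jump_times T p \<inter> {..s}. fst (p t) - pre p t)"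
 using s
proof (induction "card (jump_times T p \<inter> {..s})" arbitrary: s rule: less_induct)
 case less
 let ?J = "jump_times T p"
 have fin: "finite ?J" by (rule finite_jump_times[OF p])
 have pos: "0 < t" if "t \<in> ?J" for t using that by (simp add: jump_times_def)
 show ?case
 proof (cases "?J \<inter> {..s} = {}")
  case True
  then have "fst (p 0) = fst (p s)" using less.prems by (intro no_jump_const[OF p]) auto
  then show ?thesis using True by simp
 next
  case False
  define u where "u = Max (?J \<inter> {..s})"
  have u: "u \<in> ?J" "u \<le> s" "\<And>t. t \<in> ?J \<Longrightarrow> t \<le> s \<Longrightarrow> t \<le> u"
   using Max_in[of "?J \<inter> {..s}"] False fin by (auto simp: u_def)
  \<comment> \<open>The jump before u, or 0 if u is the first one.\<close>
  define v where "v = Max (insert 0 (?J \<inter> {..<u}))"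
  have v: "v \<in> insert 0 (?J \<inter> {..<u})" "0 \<le> v" "\<And>t. t \<in> ?J \<Longrightarrow> t < u \<Longrightarrow> t \<le> v"
   using Max_in[of "insert 0 (?J \<inter> {..<u})"] fin by (auto simp: v_def)
  have vu: "v < u" using v(1) pos[OF u(1)] by auto
  have e: "?J \<inter> {..s} = insert u (?J \<inter> {..v})" using u v(3) vu by (auto intro: le_less_trans) (metis not_le order_antisym)
  have "u \<notin> ?J \<inter> {..v}" using vu by simp
  then have "card (?J \<inter> {..v}) < card (?J \<inter> {..s})" unfolding e using fin by simp
  from less.hyps[OF this v(2)] vu u(2) less.prems
  have IH: "fst (p v) = fst (p 0) + (\<Sum>t\<in>?J \<inter> {..v}. fst (p t) - pre p t)" by simp
  have "fst (p u) = fst (p s)" using u pos[OF u(1)] less.prems by (intro no_jump_const[OF p]) fastforce+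
  moreover have "pre p u = fst (p v)"
  proof (rule pre_const(1)[OF p v(2) vu])
   show "?J \<inter> {v<..<u} = {}" using v(3) by (fastforce simp: not_le[symmetric])
  qed (use u(2) less.prems in simp)
  ultimately show ?thesis using IH fin \<open>u \<notin> ?J \<inter> {..v}\<close> unfolding e by (simp add: sum.insert)
 qed
qed

lemma pre_tendsto:
 assumes p: "p \<in> cadlag_paths T" and s: "0 < s" "s \<le> T"
 shows "((\<lambda>u. fst (p u)) \<longlongrightarrow> pre p s) (at_left s)" "\<exists>i. pre p s = axis i 1"
proof -
 obtain i r where r: "0 < r" "\<And>u. s - r < u \<Longrightarrow> u < s \<Longrightarrow> fst (p u) = axis i 1"
  by (rule left_state[OF p s]) blast
 have "((\<lambda>u. fst (p u)) \<longlongrightarrow> axis i 1) (at_left s)" by (rule left_state_tendsto[OF r])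
 with pre_eq[OF this] show "((\<lambda>u. fst (p u)) \<longlongrightarrow> pre p s) (at_left s)" "\<exists>i. pre p s = axis i 1" by auto
qed

lemma jumps_eq:
 assumes p: "p \<in> cadlag_paths T" and "j \<noteq> i"
 shows "jumps T p j i = {s \<in> jump_times T p. pre p s = axis i 1 \<and> fst (p s) = axis j 1}"
proof (intro equalityI subsetI)
 fix s assume "s \<in> jumps T p j i"
 moreover from this have "s \<in> jump_times T p" using jumps_union[OF p] assms(2) by blast
 ultimately show "s \<in> {s \<in> jump_times T p. pre p s = axis i 1 \<and> fst (p s) = axis j 1}"
  using pre_eq by (auto simp: jumps_def)
next
 fix s assume "s \<in> {s \<in> jump_times T p. pre p s = axis i 1 \<and> fst (p s) = axis j 1}"
 then show "s \<in> jumps T p j i" using pre_tendsto(1)[OF p, of s] by (auto simp: jumps_def jump_times_def)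
qed

text \<open>The left limit is the pointwise limit of the shifted paths s \<mapsto> p (s -
  1/(n+1)).\<close>

lemma pre_measurable:
 assumes p: "p \<in> cadlag_paths T" and m: "p \<in> borel_measurable borel" and "t \<le> T"
 shows "(\<lambda>s. indicator {0<..t} s * (pre p s \<bullet> v)) \<in> borel_measurable borel"
proof (rule borel_measurable_LIMSEQ_real)
 fix s :: real
 have "(\<lambda>n. fst (p (s - 1 / real (Suc n))) \<bullet> v) \<longlonglongrightarrow> pre p s \<bullet> v" if s: "0 < s" "s \<le> t"
 proof (intro tendsto_inner tendsto_const filterlim_compose[OF pre_tendsto(1)[OF p]])
  have "(\<lambda>n. s - 1 / real (Suc n)) \<longlonglongrightarrow> s - 0" by (intro tendsto_diff tendsto_const LIMSEQ_inverse_real_of_nat[unfolded inverse_eq_divide])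
  then show "filterlim (\<lambda>n. s - 1 / real (Suc n)) (at_left s) sequentially"
   by (intro filterlim_at_withinI) auto
 qed (use s assms(3) in auto)
 then show "(\<lambda>n. indicator {0<..t} s * (fst (p (s - 1 / real (Suc n))) \<bullet> v)) \<longlonglongrightarrow> indicator {0<..t} s * (pre p s \<bullet> v)"
  by (cases "s \<in> {0<..t}") (auto intro!: tendsto_mult)
next
 fix n
 have "(\<lambda>s. p (s - 1 / real (Suc n))) \<in> borel_measurable borel" by (rule measurable_compose[OF _ m]) measurable
 from measurable_compose[OF this fst_snd_measurable(1)]
 show "(\<lambda>s. indicator {0<..t} s * (fst (p (s - 1 / real (Suc n))) \<bullet> v)) \<in> borel_measurable borel" by measurable
qed

text \<open>The coordinate along e_j rises by one on arrival in j and falls by one on departure from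
  j. The integrand selects the jumps out of i, and as j \<noteq> i this removes the
  departures.\<close>

lemma transition_count_eq:
 assumes p: "p \<in> cadlag_paths T" and m: "p \<in> borel_measurable borel" and ij: "j \<noteq> i" and t: "0 \<le> t" "t \<le> T"
 shows "transition_count p j i t = (\<Sum>s\<in>jumps T p j i. indicator {..t} s)"
proof -
 let ?J = "jump_times T p"
 have fin: "finite ?J" by (rule finite_jump_times[OF p])
 have Jp: "0 < s" "s \<le> T" if "s \<in> ?J" for s using that by (auto simp: jump_times_def)
 define c where "c s = axis j 1 \<bullet> (fst (p s) - pre p s)" for s
 have "transition_count p j i t = (\<Sum>s\<in>?J \<inter> {..t}. c s * (pre p s \<bullet> axis i 1))"
  unfolding transition_count_def pre_def[symmetric]
 proof (rule stieltjes_integral_step)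
  fix s assume s: "0 \<le> s" "s \<le> t"
  have "(\<Sum>u\<in>?J \<inter> {..s}. c u) = (\<Sum>u\<in>?J \<inter> {..t}. c u * indicator {..s} u)"
   using fin s by (intro sum.mono_neutral_cong_left) auto
  then show "axis j 1 \<bullet> fst (p s) = axis j 1 \<bullet> fst (p 0) + (\<Sum>u\<in>?J \<inter> {..t}. c u * indicator {..s} u)"
   using fst_path_eq[OF p, of s] s t by (simp add: inner_add_right inner_sum_right c_def)
 qed (use t fin Jp pre_measurable[OF p m t(2)] in auto)
 also have "\<dots> = (\<Sum>s\<in>?J. indicator (jumps T p j i) s * indicator {..t} s)"
 proof (rule sum.mono_neutral_cong_left)
  fix s assume s: "s \<in> ?J \<inter> {..t}"
  obtain i' where i': "pre p s = axis i' 1" using pre_tendsto(2)[OF p, of s] Jp s by auto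
  obtain j' where j': "fst (p s) = axis j' 1" using cadlag_in_state_space[OF p, of s] Jp[of s] s by (auto simp: state_space_def)
  show "c s * (pre p s \<bullet> axis i 1) = indicator (jumps T p j i) s * indicator {..t} s"
   using s ij by (auto simp: c_def i' j' jumps_eq[OF p ij] inner_diff_right inner_axis_axis axis_eq_axis indicator_def)
 qed (use fin in auto)
 also have "\<dots> = (\<Sum>s\<in>jumps T p j i. indicator {..t} s)"
  using fin by (intro sum.mono_neutral_cong_right) (auto simp: jumps_eq[OF p ij])
 finally show ?thesis .
qed

lemma stieltjes_integral_transition_count:
 assumes p: "p \<in> cadlag_paths T" and m: "p \<in> borel_measurable borel" and ij: "j \<noteq> i" and T: "0 \<le> T"
  and h: "(\<lambda>s. indicator {0<..T} s * h s) \<in> borel_measurable borel"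
 shows "stieltjes_integral h (transition_count p j i) 0 T = (\<Sum>s\<in>jumps T p j i. h s)"
proof -
 have sub: "jumps T p j i \<subseteq> {0<..T}" by (auto simp: jumps_def)
 then have z: "transition_count p j i 0 = 0" by (subst transition_count_eq[OF p m ij]) (use T in \<open>auto intro!: sum.neutral\<close>)
 have "stieltjes_integral h (transition_count p j i) 0 T = (\<Sum>s\<in>jumps T p j i. 1 * h s)"
  using finite_jump_times[OF p]
  by (intro stieltjes_integral_step T sub h) (simp_all add: z transition_count_eq[OF p m ij] jumps_eq[OF p ij])
 then show ?thesis by simp
qed

subsection \<open>The limiting density\<close>

context diffusion begin

text \<open>The limit G is known almost everywhere only and is not assumed measurable; the maximum
  of 0 and \<open>lim\<close> of the \<open>D n\<close> is a non-negative measurable version of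
  it.\<close>

lemma good_limit_AE:
 assumes g: "\<And>n. good (D n) (\<beta> n) (\<kappa> n) C" "\<And>n. admissible (\<beta> n) (\<kappa> n) M" "admissible \<beta>' \<kappa>' M" "0 \<le> C"
  and lim: "AE p in P. (\<lambda>n. D n p) \<longlonglongrightarrow> G p"
   "AE p in P. AE w\<in>{0..T} in lborel. (\<lambda>n. \<beta> n w p) \<longlonglongrightarrow> \<beta>' w p"
   "AE p in P. AE w\<in>{0..T} in lborel. (\<lambda>n. \<kappa> n w p) \<longlonglongrightarrow> \<kappa>' w p"
 obtains D' where "good D' \<beta>' \<kappa>' C" "AE p in P. D' p = G p"
proof
 let ?D = "\<lambda>p. max 0 (lim (\<lambda>n. D n p))"
 note Dm = goodD(1)[OF g(1)] and D0 = goodD(2)[OF g(1)]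
 have eq: "AE p in P. ?D p = G p \<and> (\<lambda>n. D n p) \<longlonglongrightarrow> ?D p"
  using lim(1) AE_space
 proof eventually_elim
  fix p assume l: "(\<lambda>n. D n p) \<longlonglongrightarrow> G p" and "p \<in> space P"
  then have "0 \<le> G p" by (intro LIMSEQ_le_const[OF l]) (simp add: D0)
  then show "?D p = G p \<and> (\<lambda>n. D n p) \<longlonglongrightarrow> ?D p" using l by (simp add: limI)
 qed
 then show "AE p in P. ?D p = G p" by eventually_elim simp
 show "good ?D \<beta>' \<kappa>' C"
 proof (rule good_limit[OF g(1-3)])
  show "?D \<in> borel_measurable P" by (intro borel_measurable_max borel_measurable_const borel_measurable_lim_metric Dm)
  show "AE p in P. (\<lambda>n. D n p) \<longlonglongrightarrow> ?D p" using eq by eventually_elim (rule conjunct2)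
 qed (use g(4) lim in auto)
qed

text \<open>The discrete state is taken just before the jump and Y at the jump itself. As Y is
  almost surely left-continuous, sums that sample both at the preceding grid point have this
  limit.\<close>

definition jump_sum :: "('k \<Rightarrow> real^'d \<Rightarrow> real^'k) \<Rightarrow> ('k, 'd) path \<Rightarrow> real" where
 "jump_sum \<rho> p = (\<Sum>s\<in>jump_times T p. lift \<rho> (pre p s, snd (p s)) \<bullet> (fst (p s) - pre p s))"

text \<open>On fine grids the discrete state at the left end of a cell with a jump is exactly the
  state before the jump, so only Y has to converge, through the continuity of \<rho>.\<close>

lemma jump_sum_tendsto:
 assumes \<rho>: "\<And>i. continuous_on UNIV (\<rho> i)"
 shows "AE p in P. (\<lambda>n. \<Sum>m<n. lift \<rho> (p (grid T n m)) \<bullet> (fst (p (grid T n (Suc m))) - fst (p (grid T n m)))) \<longlonglongrightarrow> jump_sum \<rho> p"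
 using Y_left_continuous AE_space
proof eventually_elim
 fix p assume Yc: "\<forall>t\<in>{0<..T}. ((\<lambda>u. snd (p u)) \<longlongrightarrow> snd (p t)) (at_left t)" and "p \<in> space P"
 then have p: "p \<in> \<Omega>" by simp
 let ?S = "\<lambda>n. \<Sum>s\<in>jump_times T p. lift \<rho> (pre p s, snd (p (grid T n (cell T n s)))) \<bullet> (fst (p s) - pre p s)"
 have "?S \<longlonglongrightarrow> jump_sum \<rho> p"
  unfolding jump_sum_def
 proof (intro tendsto_sum tendsto_inner tendsto_const)
  fix s assume "s \<in> jump_times T p"
  then have s: "0 < s" "s \<le> T" by (auto simp: jump_times_def)
  have "isCont (lift \<rho>) (pre p s, snd (p s))"
   using continuous_lift[of \<rho>, OF \<rho>] by (simp add: continuous_on_eq_continuous_at del: split_paired_All)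
  moreover have "(\<lambda>n. snd (p (grid T n (cell T n s)))) \<longlonglongrightarrow> snd (p s)"
   using Yc s by (intro filterlim_compose[OF _ cell_left[OF T_pos s]]) auto
  ultimately show "(\<lambda>n. lift \<rho> (pre p s, snd (p (grid T n (cell T n s))))) \<longlonglongrightarrow> lift \<rho> (pre p s, snd (p s))"
   by (intro isCont_tendsto_compose[of _ "lift \<rho>"] tendsto_Pair tendsto_const)
 qed
 moreover have "\<forall>\<^sub>F n in sequentially. ?S n = (\<Sum>m<n. lift \<rho> (p (grid T n m)) \<bullet> (fst (p (grid T n (Suc m))) - fst (p (grid T n m))))"
  using grid_sum_jumps[OF T_pos p]
 proof eventually_elim
  fix n assume *: "\<forall>h :: nat \<Rightarrow> real^'k \<Rightarrow> real^'k \<Rightarrow> real. (\<forall>m x. h m x x = 0) \<longrightarrow>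
   (\<Sum>m<n. h m (fst (p (grid T n m))) (fst (p (grid T n (Suc m))))) = (\<Sum>s\<in>jump_times T p. h (cell T n s) (pre p s) (fst (p s)))"
  show "?S n = (\<Sum>m<n. lift \<rho> (p (grid T n m)) \<bullet> (fst (p (grid T n (Suc m))) - fst (p (grid T n m))))"
   \<comment> \<open>Y at the left grid point depends on the index m alone and therefore fits into
     the first argument of the summand, which vanishes for x' = x.\<close>
   using *[rule_format, of "\<lambda>m x x'. lift \<rho> (x, snd (p (grid T n m))) \<bullet> (x' - x)"] by simp
 qed
 ultimately show "(\<lambda>n. \<Sum>m<n. lift \<rho> (p (grid T n m)) \<bullet> (fst (p (grid T n (Suc m))) - fst (p (grid T n m)))) \<longlonglongrightarrow> jump_sum \<rho> p"
  by (rule Lim_transform_eventually)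
qed

text \<open>The grid integrands of \<open>grid_approx\<close> converge in mean square, so their
  elementary integrals converge to I in probability; a further subsequence makes this almost
  sure.\<close>

lemma ito_grid:
 assumes h: "\<And>i. h i \<in> borel_measurable borel" "\<And>i y. norm (h i y) \<le> C"
  and I: "has_ito_integral P F T Y (\<lambda>w p. lift h (p w)) I"
 obtains N g where "\<And>n. n < N n" "\<And>n. g n \<in> borel_measurable borel" "\<And>n z. norm (g n z) \<le> C"
  "AE p in P. AE w\<in>{0..T} in lborel. (\<lambda>n. gstep (N n) (g n) w p) \<longlonglongrightarrow> lift h (p w)"
  "AE p in P. (\<lambda>n. ssum (grid T (N n)) (N n) (\<lambda>m p. g n (p (grid T (N n) m))) Y p) \<longlonglongrightarrow> I p"
proof -
 obtain N g where g: "\<And>n. n < N n" "\<And>n. g n \<in> borel_measurable borel" "\<And>n z. norm (g n z) \<le> C"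
  and lim: "(\<lambda>n. msq (\<lambda>w p. gstep (N n) (g n) w p - lift h (p w))) \<longlonglongrightarrow> 0"
  and ae: "AE p in P. AE w\<in>{0..T} in lborel. (\<lambda>n. gstep (N n) (g n) w p) \<longlonglongrightarrow> lift h (p w)"
  by (rule grid_approx[of h, OF h]) blast
 have N0: "0 < N n" for n using g(1)[of n] by simp
 have C: "0 \<le> C" using h(2) norm_ge_zero order_trans by blast
 define J where "J n = ssum (grid T (N n)) (N n) (\<lambda>m p. g n (p (grid T (N n) m))) Y" for n
 have e: "elem (gstep (N n) (g n)) (J n)" for n
  unfolding gstep_def J_def
 proof (rule elemI)
  show "step_data (N n) (grid T (N n)) (\<lambda>m p. g n (p (grid T (N n) m))) (\<lambda>_ _. 0) C"
   unfolding step_data_def using grid_partition[OF N0] gstep(1)[OF g(2) N0] g(3) C by auto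
 qed
 have ms: "mean_square_approx P T (\<lambda>n. gstep (N n) (g n)) (\<lambda>w p. lift h (p w))"
  unfolding mean_square_approx_def using lim unfolding msq_def .
 note I' = I[unfolded has_ito_integral_def]
 have Im: "I \<in> borel_measurable P" by (rule I'[THEN conjunct1])
 have tip: "tends_in_prob P J I"
  by (rule I'[THEN conjunct2, THEN conjunct2, THEN spec, THEN spec, THEN HOL.mp, OF conjI[OF allI[OF e] ms]])
 obtain r where r: "strict_mono r" "AE p in P. (\<lambda>k. J (r k) p) \<longlonglongrightarrow> I p"
  by (rule tends_in_prob_AE_subseq[OF elem_measurable(1)[OF e] Im tip]) blast
 show thesis
 proof (rule that[of "\<lambda>n. N (r n)" "\<lambda>n. g (r n)"])
  show "n < N (r n)" for n using g(1)[of "r n"] seq_suble[OF r(1), of n] by simp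
  show "AE p in P. AE w\<in>{0..T} in lborel. (\<lambda>n. gstep (N (r n)) (g (r n)) w p) \<longlonglongrightarrow> lift h (p w)"
   using ae
  proof eventually_elim
   fix p assume "AE w\<in>{0..T} in lborel. (\<lambda>n. gstep (N n) (g n) w p) \<longlonglongrightarrow> lift h (p w)"
   then show "AE w\<in>{0..T} in lborel. (\<lambda>n. gstep (N (r n)) (g (r n)) w p) \<longlonglongrightarrow> lift h (p w)"
    by eventually_elim (use LIMSEQ_subseq_LIMSEQ[OF _ r(1)] in \<open>fastforce simp: o_def\<close>)
  qed
 qed (use g(2,3) r(2) in \<open>auto simp: J_def\<close>)
qed

end

text \<open>The rates \<open>q\<close> and \<open>q'\<close> vanish together, so that the logarithm of their quotient need not be
 continuous; adding \<open>\<delta> > 0\<close> to both makes it continuous and keeps it bounded by \<open>ln R\<close>. For \<open>\<delta> = 0\<close> the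
 conventions \<open>0/0 = 0\<close> and \<open>ln 0 = 0\<close> agree with \<open>ln 1 = 0\<close>.\<close>

locale girsanov = diffusion T P \<epsilon> b q B
 for T and P :: "(real \<Rightarrow> (real^'k) \<times> (real^'d)) measure" and \<epsilon> b q B +
 fixes h :: "'k \<Rightarrow> real^'d \<Rightarrow> real^'d" and q' :: "'k \<Rightarrow> real^'d \<Rightarrow> real^'k" and C R :: real
  and I :: "(real \<Rightarrow> (real^'k) \<times> (real^'d)) \<Rightarrow> real"
 assumes eps: "0 < \<epsilon>" and h: "\<And>i. h i \<in> borel_measurable borel" "\<And>i y. norm (h i y) \<le> C"
  and qc: "\<And>i. continuous_on UNIV (q i)" "\<And>i. continuous_on UNIV (q' i)"
  and q0: "\<And>i y j. 0 \<le> q i y $ j" "\<And>i y j. 0 \<le> q' i y $ j" and qd: "\<And>i y. q i y $ i = 0" "\<And>i y. q' i y $ i = 0"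
  and R: "1 \<le> R" and ratio: "\<And>i y j. q' i y $ j \<le> R * q i y $ j" "\<And>i y j. q i y $ j \<le> R * q' i y $ j"
  and ito: "has_ito_integral P F T Y (\<lambda>w p. lift h (p w)) I"
begin

definition lrate :: "real \<Rightarrow> 'k \<Rightarrow> real^'d \<Rightarrow> real^'k" where
 "lrate \<delta> i y = (\<chi> j. ln ((q' i y $ j + \<delta>) / (q i y $ j + \<delta>)))"

text \<open>Common bound for \<xi> = h / \<epsilon>^2 and for the vectors of log ratios, whose
  entries are at most ln R in absolute value. It does not involve \<delta>, so the estimates are
  uniform as \<delta> -> 0.\<close>

definition ext_bound :: real where
 "ext_bound = max (C / \<epsilon>\<^sup>2) (real CARD('k) * ln R)"

lemma q'_zero_iff: "q' i y $ j = 0 \<longleftrightarrow> q i y $ j = 0"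
 using ratio[of i y j] q0[of i y j] by (auto intro: antisym)

lemma lrate_diag: "lrate \<delta> i y $ i = 0"
 by (cases "\<delta> = 0") (simp_all add: lrate_def qd)

lemma lrate_continuous: "0 < \<delta> \<Longrightarrow> continuous_on UNIV (lrate \<delta> i)"
 unfolding lrate_def
 by (intro continuous_on_vec_lambda continuous_on_ln continuous_on_divide continuous_intros qc ballI)
  (use q0 in \<open>auto simp: add_nonneg_pos add_nonneg_eq_0_iff\<close>)

lemma lrate_bound:
 assumes "0 \<le> \<delta>" shows "norm (lrate \<delta> i y) \<le> ext_bound"
proof -
 have "\<bar>lrate \<delta> i y $ j\<bar> \<le> ln R" for j
 proof (cases "q i y $ j + \<delta> = 0")
  case True
  then show ?thesis using R by (simp add: lrate_def)
 next
  case False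
  then have pos: "0 < q i y $ j + \<delta>" "0 < q' i y $ j + \<delta>"
   using assms q0[of i y j] q'_zero_iff[of i y j] by (auto simp: less_le add_nonneg_eq_0_iff)
  have "\<delta> \<le> R * \<delta>" using R assms by (simp add: mult_left_le_one_le mult_right_mono[of 1 R \<delta>, simplified])
  then have "q' i y $ j + \<delta> \<le> R * (q i y $ j + \<delta>)" "q i y $ j + \<delta> \<le> R * (q' i y $ j + \<delta>)"
   using ratio[of i y j] by (auto simp: distrib_left)
  then have "ln (q' i y $ j + \<delta>) \<le> ln (R * (q i y $ j + \<delta>))" "ln (q i y $ j + \<delta>) \<le> ln (R * (q' i y $ j + \<delta>))"
   using pos R by (auto intro!: ln_mono)
  then show ?thesis using pos R by (simp add: lrate_def ln_div ln_mult abs_le_iff)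
 qed
 then have "norm (lrate \<delta> i y) \<le> (\<Sum>j\<in>(UNIV :: 'k set). ln R)"
  by (intro order_trans[OF norm_le_l1_cart] sum_mono)
 then show ?thesis by (simp add: ext_bound_def)
qed

lemma lrate_tendsto: "(\<lambda>n. lrate (1 / real (Suc n)) i y) \<longlonglongrightarrow> lrate 0 i y"
proof (rule vec_tendstoI)
 fix j
 show "(\<lambda>n. lrate (1 / real (Suc n)) i y $ j) \<longlonglongrightarrow> lrate 0 i y $ j"
 proof (cases "q i y $ j = 0")
  case True
  moreover from this have "q' i y $ j = 0" by (simp only: q'_zero_iff)
  ultimately show ?thesis by (simp add: lrate_def)
 next
  case False
  then have "(\<lambda>n. ln ((q' i y $ j + 1 / real (Suc n)) / (q i y $ j + 1 / real (Suc n)))) \<longlonglongrightarrow> ln ((q' i y $ j + 0) / (q i y $ j + 0))"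
   by (intro tendsto_ln tendsto_divide tendsto_add tendsto_const LIMSEQ_inverse_real_of_nat[unfolded inverse_eq_divide])
    (use q'_zero_iff in auto)
  then show ?thesis by (simp add: lrate_def)
 qed
qed

lemma lrate_measurable: "0 \<le> \<delta> \<Longrightarrow> lrate \<delta> i \<in> borel_measurable borel"
 using borel_measurable_LIMSEQ_metric[OF borel_measurable_continuous_onI[OF lrate_continuous] lrate_tendsto]
  borel_measurable_continuous_onI[OF lrate_continuous, of \<delta> i] by (cases "\<delta> = 0") auto

lemma lift_lrate:
 assumes "0 \<le> \<delta>"
 shows "lift (lrate \<delta>) \<in> borel_measurable borel" "z \<in> state_space \<Longrightarrow> norm (lift (lrate \<delta>) z) \<le> ext_bound"
  "(\<lambda>n. lift (lrate (1 / real (Suc n))) z) \<longlonglongrightarrow> lift (lrate 0) z"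
proof -
 show "lift (lrate \<delta>) \<in> borel_measurable borel" by (intro measurable_lift lrate_measurable assms)
 show "z \<in> state_space \<Longrightarrow> norm (lift (lrate \<delta>) z) \<le> ext_bound" by (intro norm_lift_le lrate_bound assms)
 show "(\<lambda>n. lift (lrate (1 / real (Suc n))) z) \<longlonglongrightarrow> lift (lrate 0) z"
  unfolding lift_def by (intro tendsto_sum tendsto_scaleR tendsto_const lrate_tendsto)
qed

definition hdrift :: "(real^'k) \<times> (real^'d) \<Rightarrow> real^'d" where
 "hdrift z = (1 / \<epsilon>\<^sup>2) *\<^sub>R lift h z"

lemma hdrift: "hdrift \<in> borel_measurable borel" "z \<in> state_space \<Longrightarrow> norm (hdrift z) \<le> ext_bound"
proof -
 show "hdrift \<in> borel_measurable borel" unfolding hdrift_def by (intro borel_measurable_scaleR measurable_lift[OF h(1)] borel_measurable_const)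
 assume "z \<in> state_space"
 from norm_lift_le[OF this h(2)] show "norm (hdrift z) \<le> ext_bound"
  using eps by (simp add: hdrift_def ext_bound_def max.coboundedI1 divide_right_mono)
qed

lemma ext_bound_nonneg: "0 \<le> ext_bound"
 using R by (simp add: ext_bound_def le_max_iff_disj)

definition new_drift where
 "new_drift w p = (if 0 \<le> w \<and> w \<le> T then drift 0 (hdrift (p w)) (p w) else 0)"

definition new_rates where
 "new_rates \<delta> w p = (if 0 \<le> w \<and> w \<le> T then rates (lift (lrate \<delta>) (p w)) (p w) else 0)"

text \<open>Limit of \<open>log_density 0\<close> along fine grids with \<xi> = h / \<epsilon>^2:
  the increments of X have become a sum over jumps, those of Y the integral I.\<close>

definition log_dens where
 "log_dens \<delta> p = jump_sum (lrate \<delta>) p + I p / \<epsilon>\<^sup>2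
   - (LBINT w:{0..T}. compensator 0 (hdrift (p w)) (lift (lrate \<delta>) (p w)) (p w))"

lemma new_admissible:
 assumes "0 \<le> \<delta>" shows "admissible new_drift (new_rates \<delta>) (coeff_bound ext_bound)"
proof -
 have m1: "(\<lambda>(w, p). f (p w)) \<in> borel_measurable \<P>"
  if "f \<in> borel_measurable borel" for f :: "(real^'k) \<times> (real^'d) \<Rightarrow> 'z::euclidean_space"
  using measurable_compose[OF process_measurable that] by (simp add: split_beta')
 have m2: "(\<lambda>p. f (p w)) \<in> borel_measurable (F w)"
  if "f \<in> borel_measurable borel" "0 \<le> w" for f :: "(real^'k) \<times> (real^'d) \<Rightarrow> 'z::euclidean_space" and w
  using that by (intro measurable_compose[OF filtration_eval]) auto
 show ?thesis
  unfolding new_drift_def new_rates_def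
  by (rule coeff_admissible; (rule m1 m2 hdrift lift_lrate cadlag_in_state_space assms | assumption)+)
qed

text \<open>For \<delta> > 0 the log ratios are continuous and may be sampled on any grids that
  become fine, in particular on those along which the drift is approximated; one sequence of grids
  thus serves both coefficients.\<close>

lemma good_regularised:
 assumes \<delta>: "0 < \<delta>"
 obtains D where "good D new_drift (new_rates \<delta>) (L2_bound (2 * ext_bound))" "AE p in P. D p = exp (log_dens \<delta> p)"
proof -
 obtain N g where g: "\<And>n. n < N n" "\<And>n. g n \<in> borel_measurable borel" "\<And>n z. norm (g n z) \<le> C"
  and ae: "AE p in P. AE w\<in>{0..T} in lborel. (\<lambda>n. gstep (N n) (g n) w p) \<longlonglongrightarrow> lift h (p w)"
  and J: "AE p in P. (\<lambda>n. ssum (grid T (N n)) (N n) (\<lambda>m p. g n (p (grid T (N n) m))) Y p) \<longlonglongrightarrow> I p"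
  by (rule ito_grid[of h, OF h ito]) blast
 have N0: "0 < N n" for n using g(1)[of n] by simp
 \<comment> \<open>From n < N n the grids become fine, so convergence along all uniform grids can be
   used along these.\<close>
 have Nt: "filterlim N sequentially sequentially"
  by (rule filterlim_at_top_mono[OF filterlim_ident]) (intro always_eventually allI less_imp_le g(1))
 let ?\<tau> = "\<lambda>n. grid T (N n)"
 define \<rho> where "\<rho> = lift (lrate \<delta>)"
 have \<rho>c: "continuous_on UNIV \<rho>" unfolding \<rho>_def by (rule continuous_lift lrate_continuous \<delta>)+
 have \<rho>: "\<rho> \<in> borel_measurable borel" "\<And>z. z \<in> state_space \<Longrightarrow> norm (\<rho> z) \<le> ext_bound"
  unfolding \<rho>_def using \<delta> by (intro lift_lrate; simp)+
 define \<xi>s where "\<xi>s n m p = (1 / \<epsilon>\<^sup>2) *\<^sub>R g n (p (?\<tau> n m))" for n m and p :: "('k, 'd) path"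
 define \<rho>s where "\<rho>s n m p = \<rho> (p (?\<tau> n m))" for n m and p :: "('k, 'd) path"
 have sd: "step_data (N n) (?\<tau> n) (\<xi>s n) (\<rho>s n) ext_bound" for n
  unfolding step_data_def
 proof (intro conjI allI impI ballI)
  note gp = grid_partition[OF N0]
  fix m assume m: "m < N n"
  show "\<xi>s n m \<in> borel_measurable (F (?\<tau> n m))" "\<rho>s n m \<in> borel_measurable (F (?\<tau> n m))"
   unfolding \<xi>s_def[abs_def] \<rho>s_def[abs_def]
   by (intro borel_measurable_scaleR borel_measurable_const gstep(1)[OF g(2) N0 m], rule gstep(1)[OF \<rho>(1) N0 m])
  fix p assume p: "p \<in> \<Omega>"
  have "p (?\<tau> n m) \<in> state_space" using grid_bounds[OF T_pos, of m "N n"] m by (intro cadlag_in_state_space[OF p]) auto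
  then show "norm (\<rho>s n m p) \<le> ext_bound" unfolding \<rho>s_def by (rule \<rho>(2))
  show "norm (\<xi>s n m p) \<le> ext_bound"
   using g(3) eps by (simp add: \<xi>s_def ext_bound_def max.coboundedI1 divide_right_mono)
 qed (use grid_partition[OF N0] ext_bound_nonneg in auto)
 have st: "stepp (?\<tau> n) (N n) (\<xi>s n) w p = (1 / \<epsilon>\<^sup>2) *\<^sub>R gstep (N n) (g n) w p" "stepp (?\<tau> n) (N n) (\<rho>s n) w p = gstep (N n) \<rho> w p"
  for n w p
  unfolding gstep_def \<xi>s_def[abs_def] \<rho>s_def[abs_def] stepp_def scaleR_sum_right
  by (intro sum.cong refl scaleR_left_commute, rule refl)
 let ?x = "\<lambda>n w p. stepp (?\<tau> n) (N n) (\<xi>s n) w p" and ?r = "\<lambda>n w p. stepp (?\<tau> n) (N n) (\<rho>s n) w p"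
 have lim: "AE p in P. AE w\<in>{0..T} in lborel. (\<lambda>n. ?x n w p) \<longlonglongrightarrow> hdrift (p w) \<and> (\<lambda>n. ?r n w p) \<longlonglongrightarrow> \<rho> (p w)"
  using ae gstep_tendsto[OF \<rho>c]
 proof eventually_elim
  fix p assume "AE w\<in>{0..T} in lborel. (\<lambda>n. gstep (N n) (g n) w p) \<longlonglongrightarrow> lift h (p w)"
   "AE w\<in>{0..T} in lborel. (\<lambda>n. gstep n \<rho> w p) \<longlonglongrightarrow> \<rho> (p w)"
  then show "AE w\<in>{0..T} in lborel. (\<lambda>n. ?x n w p) \<longlonglongrightarrow> hdrift (p w) \<and> (\<lambda>n. ?r n w p) \<longlonglongrightarrow> \<rho> (p w)"
  proof (eventually_elim, intro impI conjI)
   fix w assume w: "w \<in> {0..T}" and l: "w \<in> {0..T} \<longrightarrow> (\<lambda>n. gstep (N n) (g n) w p) \<longlonglongrightarrow> lift h (p w)"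
    "w \<in> {0..T} \<longrightarrow> (\<lambda>n. gstep n \<rho> w p) \<longlonglongrightarrow> \<rho> (p w)"
   show "(\<lambda>n. ?x n w p) \<longlonglongrightarrow> hdrift (p w)" unfolding st hdrift_def by (intro tendsto_scaleR tendsto_const l(1)[rule_format, OF w])
   show "(\<lambda>n. ?r n w p) \<longlonglongrightarrow> \<rho> (p w)" unfolding st by (rule filterlim_compose[OF l(2)[rule_format, OF w] Nt])
  qed
 qed
 have D: "AE p in P. (\<lambda>n. exp (log_density 0 (N n) (?\<tau> n) (\<xi>s n) (\<rho>s n) p)) \<longlonglongrightarrow> exp (log_dens \<delta> p)"
  using J lim jump_sum_tendsto[of "lrate \<delta>", OF lrate_continuous[OF \<delta>]] AE_space
 proof eventually_elim
  fix p assume J: "(\<lambda>n. ssum (?\<tau> n) (N n) (\<lambda>m p. g n (p (?\<tau> n m))) Y p) \<longlonglongrightarrow> I p"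
   and lim: "AE w\<in>{0..T} in lborel. (\<lambda>n. ?x n w p) \<longlonglongrightarrow> hdrift (p w) \<and> (\<lambda>n. ?r n w p) \<longlonglongrightarrow> \<rho> (p w)"
   and js: "(\<lambda>n. \<Sum>m<n. lift (lrate \<delta>) (p (grid T n m)) \<bullet> (fst (p (grid T n (Suc m))) - fst (p (grid T n m)))) \<longlonglongrightarrow> jump_sum (lrate \<delta>) p"
   and "p \<in> space P"
  then have p: "p \<in> \<Omega>" by simp
  note pm = path_measurable[OF p]
  have "(\<lambda>n. LBINT w:{0..T}. compensator 0 (?x n w p) (?r n w p) (p w)) \<longlonglongrightarrow> (LBINT w:{0..T}. compensator 0 (hdrift (p w)) (\<rho> (p w)) (p w))"
  proof (rule interval_dct[where C="comp_bound ext_bound"])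
   show "(\<lambda>w. compensator 0 (hdrift (p w)) (\<rho> (p w)) (p w)) \<in> borel_measurable borel"
    by (intro coeff_measurable(1) measurable_compose[OF pm] hdrift(1) \<rho>(1) pm)
   fix n
   note d = step_dataD[OF sd[of n]]
   show "(\<lambda>w. compensator 0 (?x n w p) (?r n w p) (p w)) \<in> borel_measurable borel"
    by (intro coeff_measurable(1) path_section_measurable[OF step_props(1)[OF d(1-4)] p] path_section_measurable[OF step_props(1)[OF d(1-3,5)] p] pm)
   show "\<bar>compensator 0 (?x n w p) (?r n w p) (p w)\<bar> \<le> comp_bound ext_bound" if "0 \<le> w" "w \<le> T" for w
    using step_props(3)[OF d(1-4) d(6)[OF _ p] d(8), simplified] step_props(3)[OF d(1-3,5) d(7)[OF _ p] d(8), simplified]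
    by (intro compensator_bound cadlag_in_state_space[OF p that]) auto
  next
   show "AE w\<in>{0..T} in lborel. (\<lambda>n. compensator 0 (?x n w p) (?r n w p) (p w)) \<longlonglongrightarrow> compensator 0 (hdrift (p w)) (\<rho> (p w)) (p w)"
    using lim by eventually_elim (intro impI coeff_tendsto(1) tendsto_const; blast)
  qed
  moreover have "(\<lambda>n. \<Sum>m<N n. \<rho>s n m p \<bullet> (fst (p (?\<tau> n (Suc m))) - fst (p (?\<tau> n m)))) \<longlonglongrightarrow> jump_sum (lrate \<delta>) p"
   using filterlim_compose[OF js Nt] by (simp add: \<rho>s_def \<rho>_def)
  moreover have "(\<lambda>n. \<Sum>m<N n. \<xi>s n m p \<bullet> (snd (p (?\<tau> n (Suc m))) - snd (p (?\<tau> n m)))) \<longlonglongrightarrow> I p / \<epsilon>\<^sup>2"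
   using tendsto_divide[OF J tendsto_const, of "\<epsilon>\<^sup>2"] eps by (simp add: \<xi>s_def ssum_def sum_divide_distrib)
  ultimately show "(\<lambda>n. exp (log_density 0 (N n) (?\<tau> n) (\<xi>s n) (\<rho>s n) p)) \<longlonglongrightarrow> exp (log_dens \<delta> p)"
   unfolding log_density_0[OF sd p] log_dens_def \<rho>_def[symmetric] sum.distrib by (intro tendsto_intros)
 qed
 show thesis
 proof (rule good_limit_AE[OF good_step[OF sd] step_admissible[OF sd] new_admissible[OF less_imp_le[OF \<delta>]] _ D])
  show "AE p in P. AE w\<in>{0..T} in lborel. (\<lambda>n. step_drift 0 (N n) (?\<tau> n) (\<xi>s n) w p) \<longlonglongrightarrow> new_drift w p"
   using lim
  proof eventually_elim
   fix p assume "AE w\<in>{0..T} in lborel. (\<lambda>n. ?x n w p) \<longlonglongrightarrow> hdrift (p w) \<and> (\<lambda>n. ?r n w p) \<longlonglongrightarrow> \<rho> (p w)"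
   then show "AE w\<in>{0..T} in lborel. (\<lambda>n. step_drift 0 (N n) (?\<tau> n) (\<xi>s n) w p) \<longlonglongrightarrow> new_drift w p"
    unfolding step_drift_def new_drift_def
    by eventually_elim (intro impI tendsto_if_const tendsto_const coeff_tendsto(2)[where \<rho>="\<lambda>_. 0"]; blast)
  qed
  show "AE p in P. AE w\<in>{0..T} in lborel. (\<lambda>n. step_rates (N n) (?\<tau> n) (\<rho>s n) w p) \<longlonglongrightarrow> new_rates \<delta> w p"
   using lim
  proof eventually_elim
   fix p assume "AE w\<in>{0..T} in lborel. (\<lambda>n. ?x n w p) \<longlonglongrightarrow> hdrift (p w) \<and> (\<lambda>n. ?r n w p) \<longlonglongrightarrow> \<rho> (p w)"
   then show "AE w\<in>{0..T} in lborel. (\<lambda>n. step_rates (N n) (?\<tau> n) (\<rho>s n) w p) \<longlonglongrightarrow> new_rates \<delta> w p"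
    unfolding step_rates_def new_rates_def \<rho>_def[symmetric]
    by eventually_elim (intro impI tendsto_if_const tendsto_const coeff_tendsto(3)[where \<xi>="\<lambda>_. 0" and s="\<lambda>_. 0"]; blast)
  qed
 qed (use that in \<open>auto simp: L2_bound_def\<close>)
qed

text \<open>The limit \<delta> -> 0 is taken path by path: a path has finitely many jumps, the Ito
  integral does not involve \<delta>, and the compensators are dominated. The second moment bound is
  the same for all \<delta>.\<close>

lemma good_density:
 obtains D where "good D new_drift (new_rates 0) (L2_bound (2 * ext_bound))" "AE p in P. D p = exp (log_dens 0 p)"
proof -
 let ?\<delta> = "\<lambda>n. 1 / real (Suc n)"
 have "\<exists>D. good D new_drift (new_rates (?\<delta> n)) (L2_bound (2 * ext_bound)) \<and> (AE p in P. D p = exp (log_dens (?\<delta> n) p))" for n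
  by (rule good_regularised[of "?\<delta> n"]) auto
 then obtain D where "\<forall>n. good (D n) new_drift (new_rates (?\<delta> n)) (L2_bound (2 * ext_bound)) \<and>
   (AE p in P. D n p = exp (log_dens (?\<delta> n) p))" by (rule choice[OF allI, THEN exE])
 note D = this[THEN spec, THEN conjunct1] this[THEN spec, THEN conjunct2]
 have adm: "admissible new_drift (new_rates (?\<delta> n)) (coeff_bound ext_bound)" for n by (rule new_admissible) simp
 show thesis
 proof (rule good_limit_AE[OF D(1) adm new_admissible[OF order_refl]])
  have "AE p in P. \<forall>n. D n p = exp (log_dens (?\<delta> n) p)" using D(2) by (simp add: AE_all_countable)
  then show "AE p in P. (\<lambda>n. D n p) \<longlonglongrightarrow> exp (log_dens 0 p)"
   using AE_space
  proof eventually_elim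
   fix p assume e: "\<forall>n. D n p = exp (log_dens (?\<delta> n) p)" and "p \<in> space P"
   then have p: "p \<in> \<Omega>" by simp
   note pm = path_measurable[OF p]
   have "(\<lambda>n. LBINT w:{0..T}. compensator 0 (hdrift (p w)) (lift (lrate (?\<delta> n)) (p w)) (p w))
     \<longlonglongrightarrow> (LBINT w:{0..T}. compensator 0 (hdrift (p w)) (lift (lrate 0) (p w)) (p w))"
   proof (rule interval_dct[where C="comp_bound ext_bound"])
    show "AE w\<in>{0..T} in lborel. (\<lambda>n. compensator 0 (hdrift (p w)) (lift (lrate (?\<delta> n)) (p w)) (p w))
      \<longlonglongrightarrow> compensator 0 (hdrift (p w)) (lift (lrate 0) (p w)) (p w)"
     by (intro AE_I2 impI coeff_tendsto(1) tendsto_const lift_lrate(3)[OF order_refl])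
   qed (auto intro!: coeff_measurable(1) measurable_compose[OF pm] hdrift lift_lrate pm compensator_bound cadlag_in_state_space[OF p])
   moreover have "(\<lambda>n. jump_sum (lrate (?\<delta> n)) p) \<longlonglongrightarrow> jump_sum (lrate 0) p"
    unfolding jump_sum_def by (intro tendsto_sum tendsto_inner tendsto_const lift_lrate(3)[OF order_refl])
   ultimately show "(\<lambda>n. D n p) \<longlonglongrightarrow> exp (log_dens 0 p)"
    unfolding e[rule_format] log_dens_def by (intro tendsto_intros)
  qed
  show "AE p in P. AE w\<in>{0..T} in lborel. (\<lambda>n. new_rates (?\<delta> n) w p) \<longlonglongrightarrow> new_rates 0 w p"
   unfolding new_rates_def
   by (intro AE_I2 impI tendsto_if_const tendsto_const coeff_tendsto(3)[OF tendsto_const tendsto_const] lift_lrate(3)[OF order_refl])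
 qed (use that in \<open>auto simp: L2_bound_def\<close>)
qed

section \<open>Identification of the limiting coefficients and of the exponent\<close>

lemma new_drift_eq: "0 \<le> w \<Longrightarrow> w \<le> T \<Longrightarrow> new_drift w p = lift b (p w) + lift h (p w)"
 using eps by (simp add: new_drift_def drift_def hdrift_def)

lemma exp_lrate: "exp (lrate 0 i y $ j) * q i y $ j = q' i y $ j"
proof (cases "q i y $ j = 0")
 case False
 then have "0 < q' i y $ j" "0 < q i y $ j" using q0[of i y j] q'_zero_iff[of i y j] by (auto simp: less_le)
 then show ?thesis by (simp add: lrate_def)
qed (simp add: q'_zero_iff)

lemma new_rates_eq:
 assumes "0 \<le> w" "w \<le> T" "p \<in> \<Omega>" shows "new_rates 0 w p = lift q' (p w)"
proof -
 obtain i where i: "p w = (axis i 1, snd (p w))" by (rule state_spaceE[OF cadlag_in_state_space[OF assms(3,1,2)]])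
 have "rates (lift (lrate 0) (axis i 1, y)) (axis i 1, y) = q' i y" for y
  by (simp add: rates_def vec_eq_iff inner_axis lrate_diag exp_lrate)
 from this[of "snd (p w)"] i assms show ?thesis by (metis lift_axis new_rates_def)
qed

text \<open>With \<xi> = h / \<epsilon>^2 and s = 0 the drift part of the compensator is \<langle>h,
  b\<rangle> / \<epsilon>^2 + |h|^2 / (2 \<epsilon>^2); completing the square gives the difference
  of the squared norms.\<close>

lemma compensator_eq:
 "compensator 0 (hdrift (axis i 1, y)) (lift (lrate 0) (axis i 1, y)) (axis i 1, y)
  = ((norm (b i y + h i y))\<^sup>2 - (norm (b i y))\<^sup>2) / (2 * \<epsilon>\<^sup>2) + (\<Sum>j\<in>UNIV - {i}. q' i y $ j - q i y $ j)"
proof -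
 have "(\<Sum>j\<in>UNIV. (exp (lrate 0 i y $ j) - 1) * q i y $ j) = (\<Sum>j\<in>UNIV - {i}. q' i y $ j - q i y $ j)"
  by (subst sum.remove[of _ i]) (simp_all add: left_diff_distrib exp_lrate qd)
 moreover have "(norm (b i y + h i y))\<^sup>2 - (norm (b i y))\<^sup>2 = 2 * (h i y \<bullet> b i y) + h i y \<bullet> h i y"
  unfolding power2_norm_eq_inner by (simp add: inner_add_left inner_add_right inner_commute[of "b i y" "h i y"])
 ultimately show ?thesis
  using eps by (simp add: compensator_def hdrift_def inner_axis lrate_diag field_simps power2_eq_square)
qed

text \<open>A jump from i to j contributes the entry j minus the entry i of
  \<open>lrate 0 i\<close>, and the latter vanishes by \<open>lrate_diag\<close>; the jumps are then
  sorted by type.\<close>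

lemma jump_sum_eq:
 assumes p: "p \<in> \<Omega>"
 shows "jump_sum (lrate 0) p = (\<Sum>i\<in>UNIV. \<Sum>j\<in>UNIV - {i}. \<Sum>s\<in>jumps T p j i. lrate 0 i (snd (p s)) $ j)"
proof -
 let ?J = "jump_times T p"
 have fin: "finite ?J" by (rule finite_jump_times[OF p])
 \<comment> \<open>Since \<open>lrate 0 i y $ i\<close> is 0, the diagonal terms may be added, and
   sums over all pairs of states can be interchanged with the sum over the jump times.\<close>
 have "(\<Sum>i\<in>UNIV. \<Sum>j\<in>UNIV - {i}. \<Sum>s\<in>jumps T p j i. lrate 0 i (snd (p s)) $ j)
   = (\<Sum>i\<in>UNIV. \<Sum>j\<in>UNIV. \<Sum>s\<in>?J. of_bool (pre p s = axis i 1 \<and> fst (p s) = axis j 1) * lrate 0 i (snd (p s)) $ j)"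
 proof (rule sum.cong[OF refl], rule sum.mono_neutral_cong_left)
  fix i j assume "j \<in> UNIV - {i :: 'k}"
  then show "(\<Sum>s\<in>jumps T p j i. lrate 0 i (snd (p s)) $ j)
   = (\<Sum>s\<in>?J. of_bool (pre p s = axis i 1 \<and> fst (p s) = axis j 1) * lrate 0 i (snd (p s)) $ j)"
   by (intro sum.mono_neutral_cong_left fin) (auto simp: jumps_eq[OF p])
 qed (auto simp: lrate_diag)
 also have "\<dots> = (\<Sum>s\<in>?J. \<Sum>i\<in>UNIV. \<Sum>j\<in>UNIV. of_bool (pre p s = axis i 1 \<and> fst (p s) = axis j 1) * lrate 0 i (snd (p s)) $ j)"
  by (subst sum.swap[of _ ?J]) (intro sum.cong refl sum.swap)
 also have "\<dots> = jump_sum (lrate 0) p"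
  unfolding jump_sum_def
 proof (rule sum.cong[OF refl])
  fix s assume "s \<in> ?J"
  then have s: "0 < s" "s \<le> T" by (auto simp: jump_times_def)
  obtain i where i: "pre p s = axis i 1" using pre_tendsto(2)[OF p s] by blast
  obtain j where j: "fst (p s) = axis j 1" using cadlag_in_state_space[OF p, of s] s by (auto simp: state_space_def)
  have "(\<Sum>i'\<in>UNIV. \<Sum>j'\<in>UNIV. of_bool (i = i' \<and> j = j') * lrate 0 i' (snd (p s)) $ j') = lrate 0 i (snd (p s)) $ j"
   by (simp add: of_bool_conj mult.assoc flip: sum_distrib_left)
  then show "(\<Sum>i\<in>UNIV. \<Sum>j\<in>UNIV. of_bool (pre p s = axis i 1 \<and> fst (p s) = axis j 1) * lrate 0 i (snd (p s)) $ j)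
    = lift (lrate 0) (pre p s, snd (p s)) \<bullet> (fst (p s) - pre p s)"
   by (simp add: i j axis_eq_axis inner_diff_right inner_axis lrate_diag)
 qed
 finally show ?thesis by simp
qed

end

subsection \<open>The density solves the martingale problem\<close>

definition sheets :: "((real^'k) \<times> (real^'d) \<Rightarrow> 'b) \<Rightarrow> 'k \<Rightarrow> real^'d \<Rightarrow> 'b" where
 "sheets f i y = f (axis i 1, y)"

text \<open>Column i of the Q-matrix with its non-positive diagonal entry replaced by 0, so that all
  entries are non-negative and the ratio estimates can be imposed on all of them.\<close>

definition rate_vec :: "(real^'d \<Rightarrow> real^'k^'k) \<Rightarrow> 'k \<Rightarrow> real^'d \<Rightarrow> real^'k" where
 "rate_vec Q i y = (\<chi> j. if j = i then 0 else Q y $ j $ i)"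

lemma lift_sheets: "z \<in> state_space \<Longrightarrow> lift (sheets f) z = f z"
 by (metis lift_axis sheets_def state_spaceE)

lemma sheets_lift: "sheets (lift \<phi>) = \<phi>"
 by (simp add: sheets_def fun_eq_iff)

lemma test_function_iff: "test_function f \<longleftrightarrow> tf (sheets f)"
 by (auto simp: test_function_def tf_def smooth_def compactly_supported_def sheets_def[abs_def])

text \<open>The diagonal entry of the Q-matrix is multiplied by f (x, y) - f (x, y) = 0, so dropping
  it does not change the jump term.\<close>

lemma generator_eq:
 assumes "z \<in> state_space"
 shows "generator \<epsilon> \<mu> Q f z = gen \<epsilon> (sheets f) (lift (sheets \<mu>) z) (lift (rate_vec Q) z) z"
proof -
 obtain i where z: "z = (axis i 1, snd z)" using assms by (rule state_spaceE)
 have "generator \<epsilon> \<mu> Q f (axis i 1, y) = gen \<epsilon> (sheets f) (lift (sheets \<mu>) (axis i 1, y)) (lift (rate_vec Q) (axis i 1, y)) (axis i 1, y)" for y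
  unfolding generator_def gen_def lift_axis
  by (simp add: sheets_def[abs_def] rate_vec_def matrix_vector_mult_basis inner_axis' column_def) (rule sum.cong, auto)
 from this[of "snd z"] z show ?thesis by metis
qed

context path_law begin

lemma sigma_finite_F: "t \<le> T \<Longrightarrow> sigma_finite_subalgebra P (F t)"
 by (intro finite_measure_subalgebra_is_sigma_finite finite_measure_subalgebra.intro
   finite_measure_axioms finite_measure_subalgebra_axioms.intro subalgebra_F)

text \<open>Supplies the assumption \<open>mp\<close> of \<open>diffusion\<close>: a bounded weight
  known at time u passes through the conditional expectation given F_u.\<close>

lemma martingale_increment:
 assumes s: "solves_martingale_problem T \<epsilon> \<nu> \<mu> Q P" and \<phi>: "tf \<phi>" and uv: "0 \<le> u" "u \<le> v" "v \<le> T"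
  and W: "W \<in> borel_measurable (F u)" "\<And>p. p \<in> \<Omega> \<Longrightarrow> \<bar>W p\<bar> \<le> C"
  and m: "\<And>i. sheets \<mu> i \<in> borel_measurable borel" "\<And>i. rate_vec Q i \<in> borel_measurable borel"
  and bd: "\<And>i y. norm (sheets \<mu> i y) \<le> B" "\<And>i y. norm (rate_vec Q i y) \<le> B"
 shows "(\<integral>p. W p * (lift \<phi> (p v) - lift \<phi> (p u)
  - (LBINT w:{u..v}. gen \<epsilon> \<phi> (lift (sheets \<mu>) (p w)) (lift (rate_vec Q) (p w)) (p w))) \<partial>P) = 0"
proof -
 let ?g = "\<lambda>p w. gen \<epsilon> \<phi> (lift (sheets \<mu>) (p w)) (lift (rate_vec Q) (p w)) (p w)"
 obtain K where K: "0 \<le> K" "\<And>\<beta> \<kappa> z. z \<in> state_space \<Longrightarrow> \<bar>gen \<epsilon> \<phi> \<beta> \<kappa> z\<bar> \<le> K * (1 + norm \<beta> + norm \<kappa>)"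
  by (rule gen_bound[OF \<phi>]) blast
 have si: "set_integrable lborel {0..v} (?g p)" if p: "p \<in> \<Omega>" for p
 proof (rule set_integrable_bdd)
  show "?g p \<in> borel_measurable borel"
   by (intro gen_measurable[OF \<phi>] measurable_compose[OF path_measurable[OF p]] measurable_lift m path_measurable[OF p])
  fix w assume w: "0 \<le> w" "w \<le> v"
  have z: "p w \<in> state_space" using w uv by (intro cadlag_in_state_space[OF p]) auto
  have "K * (1 + norm (lift (sheets \<mu>) (p w)) + norm (lift (rate_vec Q) (p w))) \<le> K * (1 + B + B)"
   using norm_lift_le[OF z bd(1)] norm_lift_le[OF z bd(2)] by (intro mult_left_mono add_mono K(1)) auto
  with K(2)[OF z, of "lift (sheets \<mu>) (p w)" "lift (rate_vec Q) (p w)"]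
  show "norm (?g p w) \<le> K * (1 + B + B)" by simp
 qed
 define M where "M = (\<lambda>(t :: real) p. lift \<phi> (p t) - (LBINT s:{0..t}. generator \<epsilon> \<mu> Q (lift \<phi>) (p s)))"
 have "test_function (lift \<phi>)" using \<phi> by (simp add: test_function_iff sheets_lift)
 then have Mart: "martingale_on P F T M" using s unfolding solves_martingale_problem_def M_def by blast
 have Mi: "integrable P (M t)" if "0 \<le> t" "t \<le> T" for t using Mart that unfolding martingale_on_def by auto
 have ce: "AE p in P. real_cond_exp P (F u) (M v) p = M u p" using Mart uv unfolding martingale_on_def by blast
 have M: "M t p = lift \<phi> (p t) - (LBINT s:{0..t}. ?g p s)" if "p \<in> \<Omega>" "t \<le> T" for t p
  using that unfolding M_def
  by (intro arg_cong2[where f="(-)"] refl set_lebesgue_integral_cong) (auto simp: generator_eq sheets_lift cadlag_in_state_space)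
 have inc: "lift \<phi> (p v) - lift \<phi> (p u) - (LBINT w:{u..v}. ?g p w) = M v p - M u p" if "p \<in> \<Omega>" for p
  using M[OF that] uv set_integral_split[OF si[OF that] uv(1,2)] by simp
 have WP: "W \<in> borel_measurable P" using measurable_F_P[OF W(1)] uv by simp
 have Wi: "integrable P (\<lambda>p. W p * M t p)" if t: "0 \<le> t" "t \<le> T" for t
 proof (rule Bochner_Integration.integrable_bound[of _ "\<lambda>p. C * M t p"])
  show "(\<lambda>p. W p * M t p) \<in> borel_measurable P"
   by (intro borel_measurable_times WP borel_measurable_integrable Mi t)
  show "AE p in P. norm (W p * M t p) \<le> norm (C * M t p)"
   unfolding real_norm_def abs_mult using W(2)
   by (intro AE_I2 mult_right_mono[OF order_trans[OF _ abs_ge_self] abs_ge_zero]) simp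
 qed (intro integrable_mult_right Mi t)
 have u: "u \<le> T" "0 \<le> v" using uv by auto
 interpret sf: sigma_finite_subalgebra P "F u" by (rule sigma_finite_F[OF u(1)])
 have "(\<integral>p. W p * M v p \<partial>P) = (\<integral>p. W p * real_cond_exp P (F u) (M v) p \<partial>P)"
  by (rule sf.real_cond_exp_intg(2)[OF Wi[OF u(2) uv(3)] W(1) borel_measurable_integrable[OF Mi[OF u(2) uv(3)]], symmetric])
 also have "\<dots> = (\<integral>p. W p * M u p \<partial>P)"
 proof (rule integral_cong_AE)
  show "AE p in P. W p * real_cond_exp P (F u) (M v) p = W p * M u p" using ce by eventually_elim simp
 qed (intro borel_measurable_times WP borel_measurable_cond_exp2 borel_measurable_integrable Mi uv u)+
 finally have "(\<integral>p. W p * M v p - W p * M u p \<partial>P) = 0"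
  using Bochner_Integration.integral_diff[OF Wi[OF u(2) uv(3)] Wi[OF uv(1) u(1)]] by simp
 moreover have "(\<integral>p. W p * (lift \<phi> (p v) - lift \<phi> (p u) - (LBINT w:{u..v}. ?g p w)) \<partial>P) = (\<integral>p. W p * M v p - W p * M u p \<partial>P)"
  by (intro Bochner_Integration.integral_cong refl) (simp add: inc right_diff_distrib)
 ultimately show ?thesis by simp
qed

end

section \<open>Reweighting by the limiting density\<close>

context girsanov begin

text \<open>Tested with indicators of events in F_u, the property \<open>good\<close> becomes the
  martingale property under the new measure. Adaptedness does not depend on the measure and enters
  as the assumption \<open>meas\<close>, to be taken over from the given law for \<theta>.\<close>

lemma density_solves:
 assumes D: "good D new_drift (new_rates 0) K" and \<nu>: "distr P borel (\<lambda>p. p 0) = \<nu>"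
  and meas: "\<And>f t. test_function f \<Longrightarrow> t \<in> {0..T} \<Longrightarrow>
   (\<lambda>p. f (p t) - (LBINT s:{0..t}. generator \<epsilon> \<mu> Q f (p s))) \<in> borel_measurable (F t)"
  and \<mu>: "\<And>z. z \<in> state_space \<Longrightarrow> lift (sheets \<mu>) z = lift b z + lift h z" and Q: "rate_vec Q = q'"
 shows "solves_martingale_problem T \<epsilon> \<nu> \<mu> Q (density P (\<lambda>p. ennreal (D p)))"
proof -
 let ?P = "density P (\<lambda>p. ennreal (D p))"
 note g = goodD[OF D] and adm = new_admissible[OF order_refl]
 have D0: "AE p in P. 0 \<le> D p" using g(2) by (intro AE_I2) simp
 have D1: "(\<integral>p. D p \<partial>P) = 1" using g(4)[of "\<lambda>_. 1"] by (simp add: bddI[of _ 1] prob_space[simplified])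
 then have Di: "integrable P D" using not_integrable_integral_eq by fastforce
 have bi: "integrable P (\<lambda>p. D p * V p)" if "V \<in> borel_measurable P" "bdd V" for V
 proof -
  obtain L where L: "0 \<le> L" "\<And>p. p \<in> \<Omega> \<Longrightarrow> \<bar>V p\<bar> \<le> L" using bddE[OF \<open>bdd V\<close>] by blast
  show ?thesis
  proof (rule Bochner_Integration.integrable_bound[of _ "\<lambda>p. L * D p"])
   show "AE p in P. norm (D p * V p) \<le> norm (L * D p)"
    unfolding real_norm_def abs_mult mult.commute[of "\<bar>D _\<bar>"] using L
    by (intro AE_I2 mult_right_mono[OF order_trans[OF _ abs_ge_self] abs_ge_zero]) simp
  qed (use Di that(1) g(1) in \<open>auto intro!: borel_measurable_times\<close>)
 qed
 have PD: "emeasure ?P A = ennreal (\<integral>p. indicator A p * D p \<partial>P)" if "A \<in> sets P" for A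
 proof -
  have "emeasure ?P A = (\<integral>\<^sup>+p. ennreal (indicator A p * D p) \<partial>P)"
   using that g(1) by (subst emeasure_density) (auto intro!: nn_integral_cong simp: indicator_def)
  also have "\<dots> = ennreal (\<integral>p. indicator A p * D p \<partial>P)"
   using integrable_mult_indicator[OF that Di] g(2) by (intro nn_integral_eq_integral AE_I2) auto
  finally show ?thesis .
 qed
 have pr: "prob_space ?P"
 proof (rule prob_spaceI)
  have "(\<integral>p. indicator \<Omega> p * D p \<partial>P) = (\<integral>p. D p \<partial>P)" by (intro Bochner_Integration.integral_cong) auto
  then show "emeasure ?P (space ?P) = 1" using PD[of \<Omega>] D1 by simp
 qed
 have sP: "sets ?P = sets (path_space T)" using sets_P by simp
 interpret P': path_law T ?P by (rule path_law.intro[OF T_pos pr sP])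
 have "distr ?P borel (\<lambda>p. p 0) = \<nu>"
  unfolding \<nu>[symmetric]
 proof (rule measure_eqI)
  fix A :: "((real^'k) \<times> (real^'d)) set" assume "A \<in> sets (distr ?P borel (\<lambda>p. p 0))"
  then have A: "A \<in> sets borel" by simp
  let ?A = "(\<lambda>p. p 0) -` A \<inter> \<Omega>"
  have e0: "(\<lambda>p. p 0) \<in> borel_measurable P" using T_pos by (intro eval_measurable) auto
  have AP: "?A \<in> sets P" using measurable_sets[OF e0 A] by simp
  \<comment> \<open>The event is decided at time 0, and D does not change expectations of
    F_0-measurable weights; hence the initial distribution stays \<nu>.\<close>
  have "?A \<in> sets (F 0)" using measurable_sets[OF filtration_eval[of 0 0 T] A] by simp
  then have "(\<integral>p. indicator ?A p * D p \<partial>P) = (\<integral>p. indicator ?A p \<partial>P)"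
   by (intro g(4) borel_measurable_indicator bdd_indicator)
  then have "emeasure ?P ?A = emeasure P ?A" using AP PD[OF AP] by (simp add: emeasure_eq_measure)
  then show "emeasure (distr ?P borel (\<lambda>p. p 0)) A = emeasure (distr P borel (\<lambda>p. p 0)) A"
   using A e0 by (simp add: emeasure_distr)
 qed simp
 moreover have "martingale_on ?P F T (\<lambda>t p. f (p t) - (LBINT s:{0..t}. generator \<epsilon> \<mu> Q f (p s)))" (is "martingale_on _ _ _ ?M")
  if f: "test_function f" for f
 proof -
  let ?\<phi> = "sheets f"
  have \<phi>: "tf ?\<phi>" using f by (simp add: test_function_iff)
  have gen: "generator \<epsilon> \<mu> Q f (p w) = gen \<epsilon> ?\<phi> (new_drift w p) (new_rates 0 w p) (p w)"
   if "p \<in> \<Omega>" "0 \<le> w" "w \<le> T" for w p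
   using that cadlag_in_state_space[of p T w] by (simp add: generator_eq \<mu> Q new_drift_eq new_rates_eq)
  have Mt: "?M t p = lift ?\<phi> (p t) - (LBINT w:{0..t}. gen \<epsilon> ?\<phi> (new_drift w p) (new_rates 0 w p) (p w))"
   if "p \<in> \<Omega>" "0 \<le> t" "t \<le> T" for t p
   using that by (intro arg_cong2[where f="(-)"] set_lebesgue_integral_cong) (auto simp: gen lift_sheets cadlag_in_state_space)
  have Mm: "?M t \<in> borel_measurable P" if "0 \<le> t" "t \<le> T" for t using measurable_F_P[OF meas[OF f]] that by simp
  have Mb: "bdd (?M t)" if t: "0 \<le> t" "t \<le> T" for t
  proof -
   have "bdd (\<lambda>p. lift ?\<phi> (p t) - (LBINT w:{0..t}. gen \<epsilon> ?\<phi> (new_drift w p) (new_rates 0 w p) (p w)))"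
    using bdd_diff[OF bdd_lift[OF \<phi> t] increment_props(4)[OF \<phi> adm order_refl t]] .
   then show ?thesis unfolding bdd_def using Mt[OF _ t] by simp
  qed
  have inc: "?M v p - ?M u p = increment ?\<phi> new_drift (new_rates 0) u v p"
   if p: "p \<in> \<Omega>" and uv: "0 \<le> u" "u \<le> v" "v \<le> T" for u v p
  proof -
   obtain L where L: "\<And>w p. 0 \<le> w \<Longrightarrow> w \<le> T \<Longrightarrow> p \<in> \<Omega> \<Longrightarrow> \<bar>gen \<epsilon> ?\<phi> (new_drift w p) (new_rates 0 w p) (p w)\<bar> \<le> L"
    by (rule admissible_gen[OF \<phi> adm]) blast
   have "set_integrable lborel {0..v} (\<lambda>w. gen \<epsilon> ?\<phi> (new_drift w p) (new_rates 0 w p) (p w))"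
    using uv by (intro set_integrable_bdd[OF gen_section_measurable[OF \<phi> adm p], of _ _ L]) (auto intro: L p)
   from set_integral_split[OF this uv(1,2)] Mt[OF p] uv show ?thesis unfolding increment_def by simp
  qed
  show ?thesis
   unfolding martingale_on_def
  proof (intro conjI ballI allI impI; (elim conjE)?)
   fix t assume "t \<in> {0..T}"
   then have t: "0 \<le> t" "t \<le> T" by auto
   show "?M t \<in> borel_measurable (F t)" using t by (intro meas f) simp
   show "integrable ?P (?M t)"
    using bi[OF Mm[OF t] Mb[OF t]] by (simp add: integrable_density[OF Mm[OF t] g(1) D0])
  next
   fix u v assume uv: "0 \<le> u" "u \<le> v" "v \<le> T"
   then have uT: "u \<le> T" "0 \<le> v" by auto
   note mv = Mm[OF uT(2) uv(3)] Mb[OF uT(2) uv(3)] and mu = Mm[OF uv(1) uT(1)] Mb[OF uv(1) uT(1)]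
   interpret sf: sigma_finite_subalgebra ?P "F u" by (rule P'.sigma_finite_F[OF uT(1)])
   show "AE p in ?P. real_cond_exp ?P (F u) (?M v) p = ?M u p"
   proof (rule sf.real_cond_exp_charact)
    show "integrable ?P (?M v)" "integrable ?P (?M u)"
     using bi[OF mv] bi[OF mu] by (simp_all add: integrable_density[OF mv(1) g(1) D0] integrable_density[OF mu(1) g(1) D0])
    show "?M u \<in> borel_measurable (F u)" using uv by (intro meas f) simp
    fix A :: "('k, 'd) path set" assume A: "A \<in> sets (F u)"
    then have AP: "A \<in> sets P" using subalgebra_F[OF uT(1)] unfolding subalgebra_def by blast
    have *: "(\<integral>p\<in>A. V p \<partial>?P) = (\<integral>p. D p * (indicator A p * V p) \<partial>P)" "integrable P (\<lambda>p. D p * (indicator A p * V p))"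
     if V: "V \<in> borel_measurable P" "bdd V" for V
    proof -
     have m: "(\<lambda>p. indicator A p * V p) \<in> borel_measurable P" by (intro borel_measurable_times borel_measurable_indicator AP V(1))
     show "(\<integral>p\<in>A. V p \<partial>?P) = (\<integral>p. D p * (indicator A p * V p) \<partial>P)"
      unfolding set_lebesgue_integral_def using integral_density[OF m g(1) D0] by simp
     show "integrable P (\<lambda>p. D p * (indicator A p * V p))" by (rule bi[OF m bdd_mult[OF bdd_indicator V(2)]])
    qed
    have "(\<integral>p\<in>A. ?M v p \<partial>?P) - (\<integral>p\<in>A. ?M u p \<partial>?P) = (\<integral>p. D p * (indicator A p * ?M v p) - D p * (indicator A p * ?M u p) \<partial>P)"
     unfolding *(1)[OF mv] *(1)[OF mu] by (rule Bochner_Integration.integral_diff[OF *(2)[OF mv] *(2)[OF mu], symmetric])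
    also have "\<dots> = (\<integral>p. indicator A p * (D p * increment ?\<phi> new_drift (new_rates 0) u v p) \<partial>P)"
     by (intro Bochner_Integration.integral_cong refl) (simp add: inc[OF _ uv, symmetric] algebra_simps)
    also have "\<dots> = 0" by (intro g(5)[OF \<phi> uv] borel_measurable_indicator A bdd_indicator)
    finally show "(\<integral>p\<in>A. ?M v p \<partial>?P) = (\<integral>p\<in>A. ?M u p \<partial>?P)" by simp
   qed
  qed
 qed
 ultimately show ?thesis unfolding solves_martingale_problem_def using pr sP by blast
qed

lemma log_dens_eq:
 assumes p: "p \<in> \<Omega>"
 shows "log_dens 0 p = (\<Sum>i\<in>UNIV. \<Sum>j\<in>UNIV - {i}.
   stieltjes_integral (\<lambda>t. lrate 0 i (snd (p t)) $ j) (transition_count p j i) 0 T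
   - (LBINT t:{0..T}. (q' i (snd (p t)) $ j - q i (snd (p t)) $ j) * (fst (p t) \<bullet> axis i 1)))
  + 1 / \<epsilon>\<^sup>2 * I p - 1 / (2 * \<epsilon>\<^sup>2) * (LBINT t:{0..T}. (norm (lift b (p t) + lift h (p t)))\<^sup>2 - (norm (lift b (p t)))\<^sup>2)"
proof -
 note pm = path_measurable[OF p]
 note fm = measurable_compose[OF pm fst_snd_measurable(1)] and sm = measurable_compose[OF pm fst_snd_measurable(2)]
 have st: "stieltjes_integral (\<lambda>t. lrate 0 i (snd (p t)) $ j) (transition_count p j i) 0 T = (\<Sum>s\<in>jumps T p j i. lrate 0 i (snd (p s)) $ j)"
  if "j \<noteq> i" for i j
 proof (rule stieltjes_integral_transition_count[OF p pm that])
  have "(\<lambda>s. lrate 0 i (snd (p s)) $ j) \<in> borel_measurable borel"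
   by (intro measurable_compose[OF measurable_compose[OF sm lrate_measurable] borel_measurable_vec_nth]) simp
  then show "(\<lambda>s. indicator {0<..T} s * lrate 0 i (snd (p s)) $ j) \<in> borel_measurable borel" by measurable
 qed (use T_pos in simp)
 define f where "f i j t = (q' i (snd (p t)) $ j - q i (snd (p t)) $ j) * (fst (p t) \<bullet> axis i 1)" for i j t
 define d where "d t = (norm (lift b (p t) + lift h (p t)))\<^sup>2 - (norm (lift b (p t)))\<^sup>2" for t
 have fi: "set_integrable lborel {0..T} (f i j)" for i j
 proof (rule set_integrable_bdd[where B="(R * B + B) * 1"])
  have m: "(\<lambda>t. k i (snd (p t)) $ j) \<in> borel_measurable borel" if "continuous_on UNIV (k i)" for k :: "'k \<Rightarrow> real^'d \<Rightarrow> real^'k"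
   by (intro measurable_compose[OF measurable_compose[OF sm borel_measurable_continuous_onI[OF that]] borel_measurable_vec_nth])
  show "f i j \<in> borel_measurable borel"
   unfolding f_def[abs_def] by (intro borel_measurable_times borel_measurable_diff borel_measurable_inner fm borel_measurable_const m[OF qc(1)] m[OF qc(2)])
  fix t assume "0 \<le> t" "t \<le> T"
  then have "p t \<in> state_space" by (intro cadlag_in_state_space[OF p])
  then have 1: "\<bar>fst (p t) \<bullet> axis i 1\<bar> \<le> 1" by (auto simp: state_space_def inner_axis_axis)
  let ?y = "snd (p t)"
  have qB: "q i ?y $ j \<le> B" using component_le_norm_cart[of "q i ?y" j] q_bound[of i ?y] q0(1)[of i ?y j] by simp
  moreover have "q' i ?y $ j \<le> R * B"
   by (rule order_trans[OF ratio(1) mult_left_mono[OF qB]]) (use R in simp)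
  ultimately have "\<bar>q' i ?y $ j - q i ?y $ j\<bar> \<le> R * B + B" using q0[of i ?y j] by linarith
  then show "norm (f i j t) \<le> (R * B + B) * 1" unfolding f_def real_norm_def abs_mult using 1 by (intro mult_mono) auto
 qed
 have di: "set_integrable lborel {0..T} d"
 proof (rule set_integrable_bdd[where B="(B + C)\<^sup>2"])
  have "(\<lambda>z. (norm (lift b z + lift h z))\<^sup>2 - (norm (lift b z))\<^sup>2) \<in> borel_measurable borel"
   by (intro borel_measurable_diff borel_measurable_power measurable_compose[OF _ borel_measurable_norm] borel_measurable_add lift_bq_measurable measurable_lift h)
  from measurable_compose[OF pm this] show "d \<in> borel_measurable borel" unfolding d_def[abs_def] .
  fix t assume "0 \<le> t" "t \<le> T"
  then have z: "p t \<in> state_space" by (intro cadlag_in_state_space[OF p])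
  have "0 \<le> C" using h(2) norm_ge_zero order_trans by blast
  then have "(norm (lift b (p t) + lift h (p t)))\<^sup>2 \<le> (B + C)\<^sup>2" "(norm (lift b (p t)))\<^sup>2 \<le> (B + C)\<^sup>2"
   using norm_triangle_ineq[of "lift b (p t)" "lift h (p t)"] lift_bq_bound(1)[OF z] norm_lift_le[of _ h, OF z h(2)] by (intro power_mono; simp)+
  then show "norm (d t) \<le> (B + C)\<^sup>2"
   unfolding d_def real_norm_def using zero_le_power2[of "norm (lift b (p t) + lift h (p t))"] zero_le_power2[of "norm (lift b (p t))"] by linarith
 qed
 have si: "set_integrable lborel {0..T} (\<lambda>t. \<Sum>i\<in>UNIV. \<Sum>j\<in>UNIV - {i}. f i j t)"
  "(LBINT t:{0..T}. \<Sum>i\<in>UNIV. \<Sum>j\<in>UNIV - {i}. f i j t) = (\<Sum>i\<in>UNIV. \<Sum>j\<in>UNIV - {i}. LBINT t:{0..T}. f i j t)"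
  unfolding set_integrable_def set_lebesgue_integral_def scaleR_sum_right
  by (intro Bochner_Integration.integrable_sum fi[unfolded set_integrable_def])
   (subst Bochner_Integration.integral_sum sum.cong, (intro Bochner_Integration.integrable_sum sum.cong refl Bochner_Integration.integral_sum fi[unfolded set_integrable_def])+)
 have "(LBINT w:{0..T}. compensator 0 (hdrift (p w)) (lift (lrate 0) (p w)) (p w))
   = (LBINT w:{0..T}. 1 / (2 * \<epsilon>\<^sup>2) * d w + (\<Sum>i\<in>UNIV. \<Sum>j\<in>UNIV - {i}. f i j w))"
 proof (rule set_lebesgue_integral_cong)
  show "\<forall>w. w \<in> {0..T} \<longrightarrow> compensator 0 (hdrift (p w)) (lift (lrate 0) (p w)) (p w) = 1 / (2 * \<epsilon>\<^sup>2) * d w + (\<Sum>i\<in>UNIV. \<Sum>j\<in>UNIV - {i}. f i j w)"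
  proof (intro allI impI)
   fix w assume "w \<in> {0..T}"
   then obtain i where i: "p w = (axis i 1, snd (p w))" by (auto intro: state_spaceE[OF cadlag_in_state_space[OF p, of w]])
   have fst_w: "fst (p w) = axis i 1" by (subst i) simp
   \<comment> \<open>The factor \<langle>X_t, e_i'\<rangle> leaves only the summand of the current
     state i, which is the jump part found in \<open>compensator_eq\<close>.\<close>
   have "(\<Sum>i'\<in>UNIV. \<Sum>j\<in>UNIV - {i'}. f i' j w) = (\<Sum>i'\<in>UNIV. if i' = i then \<Sum>j\<in>UNIV - {i}. q' i (snd (p w)) $ j - q i (snd (p w)) $ j else 0)"
    by (intro sum.cong refl) (auto simp: f_def fst_w inner_axis_axis)
   also have "\<dots> = (\<Sum>j\<in>UNIV - {i}. q' i (snd (p w)) $ j - q i (snd (p w)) $ j)" by simp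
   finally have s: "(\<Sum>i'\<in>UNIV. \<Sum>j\<in>UNIV - {i'}. f i' j w) = (\<Sum>j\<in>UNIV - {i}. q' i (snd (p w)) $ j - q i (snd (p w)) $ j)" .
   have l: "lift k (p w) = k i (snd (p w))" for k :: "'k \<Rightarrow> real^'d \<Rightarrow> real^'d" by (subst i) (rule lift_axis)
   show "compensator 0 (hdrift (p w)) (lift (lrate 0) (p w)) (p w) = 1 / (2 * \<epsilon>\<^sup>2) * d w + (\<Sum>i\<in>UNIV. \<Sum>j\<in>UNIV - {i}. f i j w)"
    unfolding s d_def l using compensator_eq[of i "snd (p w)", folded i] by simp
  qed
 qed simp
 also have "\<dots> = 1 / (2 * \<epsilon>\<^sup>2) * (LBINT w:{0..T}. d w) + (\<Sum>i\<in>UNIV. \<Sum>j\<in>UNIV - {i}. LBINT t:{0..T}. f i j t)"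
  using set_integral_add(2)[OF set_integrable_mult_right[OF di, of "1 / (2 * \<epsilon>\<^sup>2)"] si(1)] si(2)
  by (simp only: set_integral_mult_right)
 finally show ?thesis
  unfolding log_dens_def jump_sum_eq[OF p] d_def f_def using st by (simp add: sum_subtractf)
qed

end

subsection \<open>The likelihood ratio\<close>

text \<open>The integrand enters only through \<open>mean_square_approx\<close>, that is through its
  values on {0..T}; there \<open>lift h\<close> agrees with the difference of the drifts, because
  the paths stay in the state space.\<close>

lemma has_ito_integral_cong:
 assumes "\<And>s p. p \<in> space P \<Longrightarrow> 0 \<le> s \<Longrightarrow> s \<le> T \<Longrightarrow> H s p = H' s p"
 shows "has_ito_integral P F T Y H I \<longleftrightarrow> has_ito_integral P F T Y H' I"
proof -
 have "(\<integral>\<^sup>+p. (\<integral>\<^sup>+s\<in>{0..T}. ennreal ((norm (K s p - H s p))\<^sup>2) \<partial>lborel) \<partial>P)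
   = (\<integral>\<^sup>+p. (\<integral>\<^sup>+s\<in>{0..T}. ennreal ((norm (K s p - H' s p))\<^sup>2) \<partial>lborel) \<partial>P)" for K
  using assms by (intro nn_integral_cong) (auto simp: indicator_def)
 then show ?thesis unfolding has_ito_integral_def mean_square_approx_def by simp
qed

lemma (in diffusion) ito_exists_lift:
 assumes h: "\<And>i. h i \<in> borel_measurable borel" "\<And>i y. norm (h i y) \<le> C"
 shows "\<exists>I. has_ito_integral P F T Y (\<lambda>w p. lift h (p w)) I"
proof -
 obtain N g where g: "\<And>n. n < N n" "\<And>n. g n \<in> borel_measurable borel" "\<And>n z. norm (g n z) \<le> C"
  and lim: "(\<lambda>n. msq (\<lambda>w p. gstep (N n) (g n) w p - lift h (p w))) \<longlonglongrightarrow> 0"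
  by (rule grid_approx[of h, OF h]) blast
 have N0: "0 < N n" for n using g(1)[of n] by simp
 have "0 \<le> C" using h(2) norm_ge_zero order_trans by blast
 then have sd: "step_data (N n) (grid T (N n)) (\<lambda>m p. g n (p (grid T (N n) m))) (\<lambda>_ _. 0) C" for n
  unfolding step_data_def using grid_partition[OF N0] gstep(1)[OF g(2) N0] g(3) by auto
 show ?thesis
 proof (rule ito_exists)
  show "(\<lambda>(w, p). lift h (p w)) \<in> borel_measurable (borel \<Otimes>\<^sub>M P)"
   using measurable_compose[OF process_measurable measurable_lift[OF h(1)]] by (simp add: split_beta')
  show "elem (gstep (N n) (g n)) (ssum (grid T (N n)) (N n) (\<lambda>m p. g n (p (grid T (N n) m))) Y)" for n
   unfolding gstep_def by (rule elemI[OF sd])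
  show "mean_square_approx P T (\<lambda>n. gstep (N n) (g n)) (\<lambda>w p. lift h (p w))"
   unfolding mean_square_approx_def using lim unfolding msq_def .
 qed blast
qed

text \<open>A zero denominator forces a zero numerator, since the extended quotient would be
  infinite otherwise; the estimate without quotients thus holds there as well.\<close>

lemma bounded_ratioE:
 assumes "bounded_ratio f g" "\<And>y. 0 \<le> f y" "\<And>y. 0 \<le> g y"
 obtains C where "\<And>y. f y \<le> C * g y"
proof -
 obtain C where C: "\<And>y. \<bar>ratio (f y) (g y)\<bar> \<le> ereal C" using assms(1) unfolding bounded_ratio_def by blast
 have "f y \<le> C * g y" for y
 proof (cases "g y = 0")
  case True
  then show ?thesis using C[of y] assms(2)[of y] by (auto simp: ratio_def split: if_splits)
 next
  case False
  then have "f y / g y \<le> C" using C[of y] assms(2,3)[of y] by (simp add: ratio_def)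
  then show ?thesis using False assms(3)[of y] by (simp add: field_simps)
 qed
 then show thesis by (rule that)
qed

section \<open>Regularity and bounds of the coefficients from the hypotheses\<close>

lemma rate_vec_continuous:
 assumes "continuous_on UNIV Q" shows "continuous_on UNIV (rate_vec Q i)"
 unfolding rate_vec_def[abs_def]
proof (rule continuous_on_vec_lambda)
 show "continuous_on UNIV (\<lambda>y. if j = i then 0 else Q y $ j $ i)" for j
  using assms by (cases "j = i") (auto intro!: continuous_on_component)
qed

lemma rate_vec_bounded:
 fixes Q :: "real^'d \<Rightarrow> real^'k^'k"
 assumes "bounded (range Q)"
 obtains B where "\<And>i y. norm (rate_vec Q i y) \<le> B"
proof -
 obtain B where B: "\<And>y. norm (Q y) \<le> B" using assms by (auto simp: bounded_iff)
 have "norm (rate_vec Q i y) \<le> (\<Sum>j\<in>(UNIV :: 'k set). B)" for i y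
 proof (rule order_trans[OF norm_le_l1_cart sum_mono])
  fix j
  have "\<bar>Q y $ j $ i\<bar> \<le> norm (Q y)" using component_le_norm_cart[of "Q y $ j" i] Finite_Cartesian_Product.norm_nth_le[of "Q y" j] by linarith
  then show "\<bar>rate_vec Q i y $ j\<bar> \<le> B" using B[of y] order_trans[OF norm_ge_zero B[of y]] by (simp add: rate_vec_def)
 qed
 then show thesis by (rule that)
qed

lemma sheets_measurable:
 assumes "\<mu> \<in> borel_measurable (restrict_space borel state_space)"
 shows "sheets \<mu> i \<in> borel_measurable borel"
proof -
 have "(\<lambda>y. (axis i 1, y)) \<in> measurable borel (restrict_space borel state_space)"
  by (intro measurable_restrict_space2 borel_measurable_continuous_onI continuous_intros) (auto simp: state_space_def)
 from measurable_compose[OF this assms] show ?thesis by (simp add: sheets_def[abs_def])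
qed

lemma sheets_bounded:
 assumes "bounded (\<mu> ` state_space)" obtains B where "\<And>i y. norm (sheets \<mu> i y) \<le> B"
 using assms by (force simp: bounded_iff sheets_def state_space_def)

text \<open>Finitely many pairs of states allow a single constant; the summand 1 ensures R \<ge> 1,
  on which \<open>lrate_bound\<close> relies through \<delta> \<le> R \<delta>.\<close>

lemma uniform_bound:
 fixes f g :: "'k::finite \<Rightarrow> 'k \<Rightarrow> 'y \<Rightarrow> real"
 assumes "\<And>i j. \<exists>C. \<forall>y. f i j y \<le> C * g i j y" and g: "\<And>i j y. 0 \<le> g i j y"
 obtains R where "1 \<le> R" "\<And>i j y. f i j y \<le> R * g i j y"
proof -
 obtain C where C: "\<And>i j y. f i j y \<le> C i j * g i j y" using assms(1) by metis
 define R where "R = 1 + (\<Sum>i\<in>UNIV. \<Sum>j\<in>UNIV. \<bar>C i j\<bar>)"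
 have "C i j \<le> R" for i j
 proof -
  have "\<bar>C i j\<bar> \<le> (\<Sum>j\<in>UNIV. \<bar>C i j\<bar>)" by (rule member_le_sum) auto
  also have "\<dots> \<le> (\<Sum>i\<in>UNIV. \<Sum>j\<in>UNIV. \<bar>C i j\<bar>)" by (rule member_le_sum[of i UNIV "\<lambda>i. \<Sum>j\<in>UNIV. \<bar>C i j\<bar>"]) (auto intro: sum_nonneg)
  finally show ?thesis by (simp add: R_def)
 qed
 then have "f i j y \<le> R * g i j y" for i j y
  using C[of i j y] mult_right_mono[OF _ g[of i j y], of "C i j" R] by fastforce
 then show thesis by (intro that[of R]) (simp add: R_def sum_nonneg)
qed

theorem theorem3p1:
  fixes T \<epsilon> :: real
    and \<Theta> :: "'p set"
    and \<mu> :: "'p \<Rightarrow> (real^'k) \<times> (real^'d) \<Rightarrow> real^'d"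
    and Q :: "'p \<Rightarrow> real^'d \<Rightarrow> real^'k^'k"
    and \<nu> :: "((real^'k) \<times> (real^'d)) measure"
    and P :: "'p \<Rightarrow> (real \<Rightarrow> (real^'k) \<times> (real^'d)) measure"
    and \<theta> \<theta>\<^sub>0 :: 'p
  assumes "T > 0" and "\<epsilon> > 0"
    and "\<And>\<eta>. \<eta> \<in> \<Theta> \<Longrightarrow> \<mu> \<eta> \<in> borel_measurable (restrict_space borel state_space)"
    and "\<And>\<eta>. \<eta> \<in> \<Theta> \<Longrightarrow> bounded (\<mu> \<eta> ` state_space)"
    and "\<And>\<eta>. \<eta> \<in> \<Theta> \<Longrightarrow> continuous_on UNIV (Q \<eta>)"
    and "\<And>\<eta>. \<eta> \<in> \<Theta> \<Longrightarrow> bounded (range (Q \<eta>))"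
    and "\<And>\<eta> y. \<eta> \<in> \<Theta> \<Longrightarrow> Q_matrix (Q \<eta> y)"
    and "\<And>\<eta>. \<eta> \<in> \<Theta> \<Longrightarrow> law_with_generator T \<epsilon> \<nu> (\<mu> \<eta>) (Q \<eta>) (P \<eta>)"
    and "\<theta> \<in> \<Theta>" and "\<theta>\<^sub>0 \<in> \<Theta>"
    and "\<And>i j. bounded_ratio (\<lambda>y. Q \<theta> y $ i $ j) (\<lambda>y. Q \<theta>\<^sub>0 y $ i $ j)"
    and "\<And>i j. bounded_ratio (\<lambda>y. Q \<theta>\<^sub>0 y $ i $ j) (\<lambda>y. Q \<theta> y $ i $ j)"
  shows "equivalent_measures (P \<theta>) (P \<theta>\<^sub>0) \<and>
    (\<exists>I. has_ito_integral (P \<theta>\<^sub>0) (canonical_filtration T) T (\<lambda>t \<omega>. snd (\<omega> t))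
           (\<lambda>t \<omega>. \<mu> \<theta> (\<omega> t) - \<mu> \<theta>\<^sub>0 (\<omega> t)) I) \<and>
    (AE \<omega> in P \<theta>\<^sub>0. log_likelihood (P \<theta>) (P \<theta>\<^sub>0) \<omega> =
       (\<Sum>i\<in>UNIV. \<Sum>j\<in>UNIV - {i}.
          stieltjes_integral
            (\<lambda>t. ln (real_of_ereal (ratio (Q \<theta> (snd (\<omega> t)) $ j $ i) (Q \<theta>\<^sub>0 (snd (\<omega> t)) $ j $ i))))
            (transition_count \<omega> j i) 0 T
          - (LBINT t:{0..T}. (Q \<theta> (snd (\<omega> t)) $ j $ i - Q \<theta>\<^sub>0 (snd (\<omega> t)) $ j $ i)
                              * (fst (\<omega> t) \<bullet> axis i 1)))
       + 1 / \<epsilon>\<^sup>2 * ito_integral (P \<theta>\<^sub>0) (canonical_filtration T) T (\<lambda>t \<omega>. snd (\<omega> t))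
                    (\<lambda>t \<omega>. \<mu> \<theta> (\<omega> t) - \<mu> \<theta>\<^sub>0 (\<omega> t)) \<omega>
       - 1 / (2 * \<epsilon>\<^sup>2) * (LBINT t:{0..T}. (norm (\<mu> \<theta> (\<omega> t)))\<^sup>2 - (norm (\<mu> \<theta>\<^sub>0 (\<omega> t)))\<^sup>2))"
proof -
 let ?P = "P \<theta>\<^sub>0" and ?b = "sheets (\<mu> \<theta>\<^sub>0)" and ?q = "rate_vec (Q \<theta>\<^sub>0)" and ?q' = "rate_vec (Q \<theta>)"
 let ?H = "\<lambda>t p. \<mu> \<theta> (p t) - \<mu> \<theta>\<^sub>0 (p t)"
 note \<mu>m = assms(3)[OF assms(9)] assms(3)[OF assms(10)] and \<mu>b = assms(4)[OF assms(9)] assms(4)[OF assms(10)]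
  and Qc = assms(5)[OF assms(9)] assms(5)[OF assms(10)] and Qb = assms(6)[OF assms(9)] assms(6)[OF assms(10)]
  and Qm = assms(7)[OF assms(9)] assms(7)[OF assms(10)] and law = assms(8)[OF assms(9)] assms(8)[OF assms(10)]
 have sm: "solves_martingale_problem T \<epsilon> \<nu> (\<mu> \<theta>) (Q \<theta>) (P \<theta>)" "solves_martingale_problem T \<epsilon> \<nu> (\<mu> \<theta>\<^sub>0) (Q \<theta>\<^sub>0) ?P"
  and uniq: "\<And>P'. solves_martingale_problem T \<epsilon> \<nu> (\<mu> \<theta>) (Q \<theta>) P' \<Longrightarrow> P' = P \<theta>"
  using law unfolding law_with_generator_def by blast+
 have ps: "prob_space ?P" "sets ?P = sets (path_space T)" "distr ?P borel (\<lambda>p. p 0) = \<nu>"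
  using sm(2) unfolding solves_martingale_problem_def by blast+
 interpret path_law T ?P by (rule path_law.intro[OF assms(1) ps(1,2)])
 obtain B1 where B1: "\<And>i y. norm (?b i y) \<le> B1" by (rule sheets_bounded[OF \<mu>b(2)]) blast
 obtain B2 where B2: "\<And>i y. norm (sheets (\<mu> \<theta>) i y) \<le> B2" by (rule sheets_bounded[OF \<mu>b(1)]) blast
 obtain B3 where B3: "\<And>i y. norm (?q i y) \<le> B3" by (rule rate_vec_bounded[OF Qb(2)]) blast
 have bm: "?b i \<in> borel_measurable borel" "sheets (\<mu> \<theta>) i \<in> borel_measurable borel" for i by (rule sheets_measurable[OF \<mu>m(2)], rule sheets_measurable[OF \<mu>m(1)])
 have qm: "?q i \<in> borel_measurable borel" for i by (rule borel_measurable_continuous_onI[OF rate_vec_continuous[OF Qc(2)]])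
 have b1: "norm (?b i y) \<le> max B1 B3" and b3: "norm (?q i y) \<le> max B1 B3" for i y using B1[of i y] B3[of i y] by auto
 interpret diffusion T ?P \<epsilon> ?b ?q "max B1 B3"
  by unfold_locales (rule bm qm b1 b3 martingale_increment[OF sm(2) _ _ _ _ _ _ bm(1) qm b1 b3]; assumption?)+
 define h where "h i y = sheets (\<mu> \<theta>) i y - ?b i y" for i y
 have hm: "h i \<in> borel_measurable borel" for i unfolding h_def[abs_def] by (intro borel_measurable_diff bm)
 have hb: "norm (h i y) \<le> B2 + B1" for i y unfolding h_def by (rule order_trans[OF norm_triangle_ineq4 add_mono[OF B2 B1]])
 have hz: "lift h z = \<mu> \<theta> z - \<mu> \<theta>\<^sub>0 z" if "z \<in> state_space" for z
  using lift_sheets[OF that, of "\<lambda>z. \<mu> \<theta> z - \<mu> \<theta>\<^sub>0 z"] by (simp add: h_def[abs_def] sheets_def[abs_def])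
 have cong: "has_ito_integral ?P F T Y (\<lambda>w p. lift h (p w)) I \<longleftrightarrow> has_ito_integral ?P F T Y ?H I" for I
  by (rule has_ito_integral_cong) (simp add: hz cadlag_in_state_space)
 have ex: "\<exists>I. has_ito_integral ?P F T Y ?H I" using ito_exists_lift[of h, OF hm hb] unfolding cong .
 \<comment> \<open>The integral of the statement is a choice among almost surely equal versions;
   existence guarantees that the chosen one is an Ito integral, and all that follows refers to this
   version.\<close>
 define I where "I = ito_integral ?P F T Y ?H"
 have "has_ito_integral ?P F T Y ?H I" unfolding I_def ito_integral_def by (rule someI_ex[OF ex])
 then have I: "has_ito_integral ?P F T Y (\<lambda>w p. lift h (p w)) I" unfolding cong .
 have nn: "0 \<le> rate_vec (Q \<eta>) i y $ j" if "\<eta> \<in> \<Theta>" for \<eta> i y j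
  using assms(7)[OF that, of y] by (simp add: rate_vec_def Q_matrix_def)
 \<comment> \<open>The indices are transposed: entry j of \<open>rate_vec Q i y\<close> is the entry
   in row j and column i of Q y. On the diagonal both sides are 0.\<close>
 have rat: "\<exists>C. \<forall>y. rate_vec (Q \<eta>) i y $ j \<le> C * rate_vec (Q \<eta>') i y $ j"
  if \<eta>: "\<eta> \<in> \<Theta>" "\<eta>' \<in> \<Theta>" and r: "\<And>i j. bounded_ratio (\<lambda>y. Q \<eta> y $ i $ j) (\<lambda>y. Q \<eta>' y $ i $ j)" for \<eta> \<eta>' i j
 proof (cases "j = i")
  case False
  then have "0 \<le> Q \<eta> y $ j $ i" "0 \<le> Q \<eta>' y $ j $ i" for y using nn[OF \<eta>(1), of i y j] nn[OF \<eta>(2), of i y j] by (simp_all add: rate_vec_def)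
  then obtain C where "\<And>y. Q \<eta> y $ j $ i \<le> C * Q \<eta>' y $ j $ i" by (rule bounded_ratioE[OF r]) blast
  then show ?thesis using False by (auto simp: rate_vec_def)
 qed (simp add: rate_vec_def)
 obtain R1 where R1: "1 \<le> R1" "\<And>i j y. ?q' i y $ j \<le> R1 * ?q i y $ j"
  by (rule uniform_bound[of "\<lambda>i j y. ?q' i y $ j" "\<lambda>i j y. ?q i y $ j", OF rat[OF assms(9,10,11)] nn[OF assms(10)]]) blast
 obtain R2 where R2: "1 \<le> R2" "\<And>i j y. ?q i y $ j \<le> R2 * ?q' i y $ j"
  by (rule uniform_bound[of "\<lambda>i j y. ?q i y $ j" "\<lambda>i j y. ?q' i y $ j", OF rat[OF assms(10,9,12)] nn[OF assms(9)]]) blast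
 define R where "R = max R1 R2"
 have "1 \<le> R" using R1(1) by (simp add: R_def)
 moreover have "?q' i y $ j \<le> R * ?q i y $ j" for i y j
  by (rule order_trans[OF R1(2) mult_right_mono[OF _ nn[OF assms(10)]]]) (simp add: R_def)
 moreover have "?q i y $ j \<le> R * ?q' i y $ j" for i y j
  by (rule order_trans[OF R2(2) mult_right_mono[OF _ nn[OF assms(9)]]]) (simp add: R_def)
 ultimately interpret girsanov T ?P \<epsilon> ?b ?q "max B1 B3" h ?q' "B2 + B1" R I
  using assms(2) hm hb rate_vec_continuous[OF Qc(1)] rate_vec_continuous[OF Qc(2)] nn[OF assms(9)] nn[OF assms(10)] I
  by unfold_locales (assumption | simp add: rate_vec_def)+
 obtain D where D: "good D new_drift (new_rates 0) (L2_bound (2 * ext_bound))" "AE p in ?P. D p = exp (log_dens 0 p)"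
  by (rule good_density) blast
 let ?D = "\<lambda>p. ennreal (D p)"
 have Dm: "?D \<in> borel_measurable ?P" by (rule measurable_compose[OF goodD(1)[OF D(1)] measurable_ennreal])
 have dens: "density ?P ?D = P \<theta>"
 proof (rule uniq, rule density_solves[OF D(1) ps(3)])
  show "(\<lambda>p. f (p t) - (LBINT s:{0..t}. generator \<epsilon> (\<mu> \<theta>) (Q \<theta>) f (p s))) \<in> borel_measurable (F t)" if "test_function f" "t \<in> {0..T}" for f t
   using sm(1) that unfolding solves_martingale_problem_def martingale_on_def by blast
  show "lift (sheets (\<mu> \<theta>)) z = lift ?b z + lift h z" if "z \<in> state_space" for z using that by (simp add: hz lift_sheets)
 qed simp
 \<comment> \<open>Being an exponential almost surely, D is positive; this gives the absolute
   continuity that the existence of a density alone does not.\<close>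
 have pos: "AE p in ?P. ?D p \<noteq> 0" using D(2) by eventually_elim simp
 have "null_sets (density ?P ?D) \<subseteq> null_sets ?P"
 proof
  fix A assume "A \<in> null_sets (density ?P ?D)"
  then have A: "A \<in> sets ?P" "AE p in ?P. p \<in> A \<longrightarrow> ?D p = 0" unfolding null_sets_density_iff[OF Dm] by auto
  from A(2) pos have "AE p in ?P. p \<notin> A" by eventually_elim blast
  then show "A \<in> null_sets ?P" using A(1) by (simp add: AE_iff_null_sets)
 qed
 then have equiv: "equivalent_measures (P \<theta>) ?P"
  using absolutely_continuousI_density[OF Dm] unfolding equivalent_measures_def absolutely_continuous_def dens[symmetric] by simp
 \<comment> \<open>Where the old rate vanishes, so does the new one: the left side is ln (0 / 0) =
   ln 0 = 0 by the conventions for division and logarithm, and the right side is ln 1 = 0 by the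
   convention for the ratio.\<close>
 have lr: "lrate 0 i y $ j = ln (real_of_ereal (ratio (Q \<theta> y $ j $ i) (Q \<theta>\<^sub>0 y $ j $ i)))" if "j \<noteq> i" for i j y
 proof (cases "Q \<theta>\<^sub>0 y $ j $ i = 0")
  case True
  then have "?q' i y $ j = 0" using that q'_zero_iff[of i y j] by (simp add: rate_vec_def)
  then show ?thesis using True that by (simp add: lrate_def rate_vec_def ratio_def)
 next
  case False
  then show ?thesis using that by (simp add: lrate_def rate_vec_def ratio_def)
 qed
 have "AE p in ?P. ?D p = RN_deriv ?P (P \<theta>) p" by (rule RN_deriv_unique[OF Dm dens])
 then have log_eq: "AE p in ?P. log_likelihood (P \<theta>) ?P p = log_dens 0 p"
  using D(2) unfolding log_likelihood_def
 proof eventually_elim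
  fix p assume rn: "?D p = RN_deriv ?P (P \<theta>) p" and "D p = exp (log_dens 0 p)"
  then show "ln (enn2real (RN_deriv ?P (P \<theta>) p)) = log_dens 0 p" by (simp flip: rn)
 qed
 let ?L = "\<lambda>p. (\<Sum>i\<in>UNIV. \<Sum>j\<in>UNIV - {i}.
     stieltjes_integral (\<lambda>t. ln (real_of_ereal (ratio (Q \<theta> (snd (p t)) $ j $ i) (Q \<theta>\<^sub>0 (snd (p t)) $ j $ i)))) (transition_count p j i) 0 T
     - (LBINT t:{0..T}. (Q \<theta> (snd (p t)) $ j $ i - Q \<theta>\<^sub>0 (snd (p t)) $ j $ i) * (fst (p t) \<bullet> axis i 1)))
    + 1 / \<epsilon>\<^sup>2 * I p - 1 / (2 * \<epsilon>\<^sup>2) * (LBINT t:{0..T}. (norm (\<mu> \<theta> (p t)))\<^sup>2 - (norm (\<mu> \<theta>\<^sub>0 (p t)))\<^sup>2)"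
 from log_eq have "AE p in ?P. log_likelihood (P \<theta>) ?P p = ?L p"
  using AE_space
 proof eventually_elim
  fix p assume e: "log_likelihood (P \<theta>) ?P p = log_dens 0 p" and "p \<in> space ?P"
  then have p: "p \<in> \<Omega>" by simp
  have n: "(LBINT t:{0..T}. (norm (lift ?b (p t) + lift h (p t)))\<^sup>2 - (norm (lift ?b (p t)))\<^sup>2)
    = (LBINT t:{0..T}. (norm (\<mu> \<theta> (p t)))\<^sup>2 - (norm (\<mu> \<theta>\<^sub>0 (p t)))\<^sup>2)"
   by (rule set_lebesgue_integral_cong) (auto simp: hz lift_sheets cadlag_in_state_space[OF p])
  show "log_likelihood (P \<theta>) ?P p = ?L p"
   unfolding e log_dens_eq[OF p] n
   by (intro arg_cong2[where f="(-)"] arg_cong2[where f="(+)"] sum.cong refl) (auto simp: lr rate_vec_def)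
 qed
 with equiv ex show ?thesis unfolding I_def by blast
qed

end
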